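(* Let $\gamma>0$, let $2\le p,q<\infty$, let $\alpha\in\mathbb{R}$ satisfy $$-\frac dp<\alpha<(d-1)\left(\frac12-\frac1p\right)-\frac1q ,$$ and let $s\in\mathbb{R}$ satisfy $$s\ge\frac d2-\frac1q-\frac dp-\alpha-\frac1\gamma\left(\frac12-\frac1{\min(p,q)}\right).$$ Let $f\in H^s_{\mathrm{rad}}(\mathbb{R}^d)$ be radial and let $f^\omega$ be its radial randomization with parameter $\gamma$. Then, for all $1\le\sigma<\infty$, $$\big\||x|^\alpha e^{\pm it|\nabla|}f^\omega\big\|_{L^\sigma_\omega L^q_tL^p_x}\lesssim_{p,q,\alpha,s}\sqrt\sigma\,\|f\|_{H^s_x(\mathbb{R}^d)} .$$
   Context: $e^{\pm it|\nabla|}$ is the Fourier multiplier with symbol $e^{\pm it|\xi|}$ on $\mathbb{R}^d$ (either sign). $L^\sigma_\omega L^q_tL^p_x$ is the mixed norm over the probability space, $t\in\mathbb{R}$ and $x\in\mathbb{R}^d$. Radial randomization: for $0\le a_1<a_2\le\infty$ let $A_{[a_1,a_2)}$ be the Fourier multiplier with symbol $\chi_{[a_1,a_2)}(|\xi|)$ (sharp indicator function). Let $\{g_k\}_{k\ge0}$ be independent standard real-valued Gaussians. For radial $f$ (in $L^2$, or by the same formula in $H^s$), $$f^\omega=\sum_{k=0}^\infty g_k(\omega)\,A_{[k^\gamma,(k+1)^\gamma)}f .$$ The implicit constant may also depend on the fixed parameters $d$ and $\gamma$, but not on $f$ or $\sigma$. *)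

theory Defs
  imports "HOL-Probability.Probability"
begin

section \<open>Schwartz functions and tempered distributions\<close>

primrec iter_pderiv :: "'n::finite list \<Rightarrow> (real^'n \<Rightarrow> complex) \<Rightarrow> real^'n \<Rightarrow> complex" where
  "iter_pderiv [] \<phi> = \<phi>"
| "iter_pderiv (i # is) \<phi> = (\<lambda>x. frechet_derivative (iter_pderiv is \<phi>) (at x) (axis i 1))"

text \<open>\<^const>\<open>frechet_derivative\<close> is only meaningful for differentiable functions; requiring
  every iterated partial derivative to be differentiable everywhere is smoothness.\<close>

definition schwartz :: "(real^'n::finite \<Rightarrow> complex) set" where
  "schwartz = {\<phi>. \<forall>is. (\<forall>x. iter_pderiv is \<phi> differentiable (at x)) \<and>
     (\<forall>N::nat. bounded (range (\<lambda>x. (1 + norm x) ^ N *\<^sub>R iter_pderiv is \<phi> x)))}"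

definition schwartz_seminorm :: "nat \<Rightarrow> (real^'n::finite \<Rightarrow> complex) \<Rightarrow> real" where
  "schwartz_seminorm N \<phi> =
     (SUP (is, x) \<in> {is. length is \<le> N} \<times> UNIV. (1 + norm x) ^ N * cmod (iter_pderiv is \<phi> x))"

text \<open>A distribution is a functional on all functions of which only the values on
  \<^const>\<open>schwartz\<close> matter.\<close>

type_synonym 'n distr = "(real^'n \<Rightarrow> complex) \<Rightarrow> complex"

definition tempered :: "'n::finite distr \<Rightarrow> bool" where
  "tempered u \<longleftrightarrow>
     (\<forall>\<phi>\<in>schwartz. \<forall>\<psi>\<in>schwartz. u (\<lambda>x. \<phi> x + \<psi> x) = u \<phi> + u \<psi>) \<and>
     (\<forall>\<phi>\<in>schwartz. \<forall>c. u (\<lambda>x. c * \<phi> x) = c * u \<phi>) \<and>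
     (\<exists>C N. \<forall>\<phi>\<in>schwartz. cmod (u \<phi>) \<le> C * schwartz_seminorm N \<phi>)"

definition represents :: "(real^'n::finite \<Rightarrow> complex) \<Rightarrow> 'n distr \<Rightarrow> bool" where
  "represents F u \<longleftrightarrow> F \<in> borel_measurable lborel \<and>
     (\<forall>\<phi>\<in>schwartz. integrable lborel (\<lambda>x. F x * \<phi> x) \<and>
        u \<phi> = (LINT x|lborel. F x * \<phi> x))"

definition radial :: "'n::finite distr \<Rightarrow> bool" where
  "radial u \<longleftrightarrow> (\<forall>R. \<forall>\<phi>\<in>schwartz. orthogonal_transformation R \<longrightarrow> u (\<phi> \<circ> R) = u \<phi>)"


section \<open>Fourier transform, multipliers and Sobolev spaces\<close>

text \<open>The unitary normalisation with phase \<open>x \<bullet> \<xi>\<close> (no \<open>2\<pi>\<close>) is used, so that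
  \<open>|\<nabla>|\<close> has symbol \<open>|\<xi>|\<close>.\<close>

definition fourier :: "(real^'n::finite \<Rightarrow> complex) \<Rightarrow> real^'n \<Rightarrow> complex" where
  "fourier \<phi> \<xi> = complex_of_real ((2 * pi) powr (- real CARD('n) / 2)) *
     (LINT x|lborel. cis (- (x \<bullet> \<xi>)) * \<phi> x)"

definition inv_fourier :: "(real^'n::finite \<Rightarrow> complex) \<Rightarrow> real^'n \<Rightarrow> complex" where
  "inv_fourier \<phi> x = complex_of_real ((2 * pi) powr (- real CARD('n) / 2)) *
     (LINT \<xi>|lborel. cis (x \<bullet> \<xi>) * \<phi> \<xi>)"

definition fourier_distr :: "'n::finite distr \<Rightarrow> 'n distr" where
  "fourier_distr u = (\<lambda>\<phi>. u (fourier \<phi>))"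

definition inv_fourier_distr :: "'n::finite distr \<Rightarrow> 'n distr" where
  "inv_fourier_distr u = (\<lambda>\<phi>. u (inv_fourier \<phi>))"

text \<open>The Fourier transform of \<open>u\<close> as a function, when it is one (it is then unique up to
  null sets). This is the case for all elements of Sobolev spaces, of any order.\<close>

definition fourier_fun :: "'n::finite distr \<Rightarrow> real^'n \<Rightarrow> complex" where
  "fourier_fun u = (SOME v. represents v (fourier_distr u))"

definition fourier_multiplier :: "(real^'n::finite \<Rightarrow> complex) \<Rightarrow> 'n distr \<Rightarrow> 'n distr" where
  "fourier_multiplier m u =
     inv_fourier_distr (\<lambda>\<phi>. LINT \<xi>|lborel. m \<xi> * fourier_fun u \<xi> * \<phi> \<xi>)"

definition sobolev :: "real \<Rightarrow> 'n::finite distr set" where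
  "sobolev s = {u. tempered u \<and> (\<exists>v. represents v (fourier_distr u) \<and>
     integrable lborel (\<lambda>\<xi>. (1 + (norm \<xi>)\<^sup>2) powr s * (cmod (v \<xi>))\<^sup>2))}"

definition sobolev_norm :: "real \<Rightarrow> 'n::finite distr \<Rightarrow> real" where
  "sobolev_norm s u =
     sqrt (LINT \<xi>|lborel. (1 + (norm \<xi>)\<^sup>2) powr s * (cmod (fourier_fun u \<xi>))\<^sup>2)"

definition annulus_proj :: "real \<Rightarrow> real \<Rightarrow> 'n::finite distr \<Rightarrow> 'n distr" where
  "annulus_proj a b = fourier_multiplier (\<lambda>\<xi>. indicator {a..<b} (norm \<xi>))"

text \<open>\<open>half_wave \<epsilon> t\<close> is \<open>exp (i \<epsilon> t |\<nabla>|)\<close>; the two signs are \<open>\<epsilon> = 1\<close> and \<open>\<epsilon> = -1\<close>.\<close>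

definition half_wave :: "real \<Rightarrow> real \<Rightarrow> 'n::finite distr \<Rightarrow> 'n distr" where
  "half_wave \<epsilon> t = fourier_multiplier (\<lambda>\<xi>. cis (\<epsilon> * t * norm \<xi>))"


section \<open>Radial randomization\<close>

definition iid_std_gaussians :: "'w measure \<Rightarrow> (nat \<Rightarrow> 'w \<Rightarrow> real) \<Rightarrow> bool" where
  "iid_std_gaussians M g \<longleftrightarrow> prob_space M \<and>
     prob_space.indep_vars M (\<lambda>_. borel) g UNIV \<and>
     (\<forall>k. distributed M lborel (g k) std_normal_density)"

text \<open>The series is summed in the sense of distributions, for each \<open>\<omega>\<close>. For \<open>f\<close> in a Sobolev
  space it converges for almost every \<open>\<omega>\<close>.\<close>

definition radial_randomization ::
    "(nat \<Rightarrow> 'w \<Rightarrow> real) \<Rightarrow> real \<Rightarrow> 'n::finite distr \<Rightarrow> 'w \<Rightarrow> 'n distr" where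
  "radial_randomization g \<gamma> f \<omega> = (\<lambda>\<phi>. \<Sum>k. complex_of_real (g k \<omega>) *
     annulus_proj (real k powr \<gamma>) (real (Suc k) powr \<gamma>) f \<phi>)"


section \<open>Mixed norms\<close>

definition ennreal_powr :: "ennreal \<Rightarrow> real \<Rightarrow> ennreal" where
  "ennreal_powr x a = (if x = \<top> then \<top> else ennreal (enn2real x powr a))"

definition Lp_norm :: "real \<Rightarrow> 'a measure \<Rightarrow> ('a \<Rightarrow> ennreal) \<Rightarrow> ennreal" where
  "Lp_norm r M F = ennreal_powr (\<integral>\<^sup>+x. ennreal_powr (F x) r \<partial>M) (1 / r)"

text \<open>The norm of \<open>|x|\<^sup>\<alpha> u\<close> in \<open>L\<^sup>\<sigma>\<^sub>\<omega> L\<^sup>q\<^sub>t L\<^sup>p\<^sub>x\<close> for a random time-dependent distribution \<open>u\<close>.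
  If \<open>u\<close> is given by a jointly measurable function \<open>U\<close>, then \<open>U\<close> is unique up to null sets and
  the infimum is over a single value; otherwise the infimum is over the empty set, so that
  the norm is \<open>\<infinity>\<close>.\<close>

definition weighted_mixed_norm ::
    "'w measure \<Rightarrow> real \<Rightarrow> real \<Rightarrow> real \<Rightarrow> real \<Rightarrow> ('w \<Rightarrow> real \<Rightarrow> 'n::finite distr) \<Rightarrow> ennreal" where
  "weighted_mixed_norm M \<sigma> q p \<alpha> u =
     Inf {Lp_norm \<sigma> M (\<lambda>\<omega>. Lp_norm q lborel (\<lambda>t. Lp_norm p lborel
            (\<lambda>x. ennreal (norm x powr \<alpha> * cmod (U \<omega> t x))))) | U.
        (\<lambda>(\<omega>, t, x). U \<omega> t x) \<in> borel_measurable (M \<Otimes>\<^sub>M lborel \<Otimes>\<^sub>M lborel) \<and>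
        (AE \<omega> in M. AE t in lborel. represents (U \<omega> t) (u \<omega> t))}"

end

theory Submission
  imports Defs
begin

text \<open>The solution is split into the waves emitted by the frequency shells
  \<open>k\<^bsup>\<gamma>\<^esup> \<le> |\<xi>| < (k+1)\<^bsup>\<gamma>\<^esup>\<close>. Khintchine's inequality in \<open>\<omega>\<close> and Minkowski's inequality bound the
  norm of a random sum of these waves by the \<open>\<ell>\<^sup>2\<close> sum of their deterministic norms, at the price of a
  factor \<open>\<surd>\<sigma>\<close>.

  For a single shell everything rests on the pointwise decay \<open>r\<^bsup>-(d-1)/2\<^esup>\<close> of the Fourier transform of the
  sphere, which is read off Bessel's equation: at fixed \<open>x\<close> the wave is a function of time whose frequencies lie
  in the shell, so Bernstein's inequality from \<open>L\<^sup>2\<^sub>t\<close> to \<open>L\<^sup>q\<^sub>t\<close>, together with Plancherel in \<open>x\<close>, gains a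
  power \<open>1/2 - 1/min p q\<close> of the relative width of the shell. That width is of order \<open>1/k\<close>, and \<open>k\<close> is
  \<open>|\<xi>|\<^bsup>1/\<gamma>\<^esup>\<close>, whence the gain of derivatives. The first shell is not thin; it is cut dyadically, and the dyadic
  pieces are summable because the scaling exponent \<open>d/2 - 1/q - d/p - \<alpha>\<close> is positive.

  To identify the sum of the waves with the distribution defined by the randomized series, the
  partial sums are grouped along a lacunary subsequence, which makes the series of groups converge absolutely almost surely.\<close>

section \<open>Mixed norms\<close>

text \<open>The lower bound on \<open>\<alpha>\<close> makes
  \<open>norm x powr (\<alpha> * p)\<close> integrable at the origin; the upper bound, combined with
  the decay of the spherical functions, is exactly integrability at infinity. Both act on a single
  shell, whereas the bound on \<open>s\<close> makes the single-shell constants uniform in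
  \<open>k\<close>. The gain is governed by \<open>min p q\<close> because the sup bound in time
  replaces all but two factors of the wave, counted in the norm with the smaller exponent; the two
  remaining factors are left to the quadratic bounds. Minkowski's inequality forces a probabilistic
  exponent above \<open>p\<close> and \<open>q\<close> even when \<open>\<sigma>\<close> is small;
  an even integer comparable to \<open>\<sigma>\<close> is taken, for which Gaussian moments are
  explicit. Since \<open>weighted_mixed_norm\<close> is infinite unless a jointly measurable
  function represents the random distribution, bounds for partial sums are not enough: a limit
  function has to be constructed and tested against Schwartz functions.\<close>

lemma ennreal_powr_0 [simp]: "ennreal_powr 0 a = 0"
  by (simp add: ennreal_powr_def)

lemma ennreal_powr_top [simp]: "ennreal_powr \<top> a = \<top>"
  by (simp add: ennreal_powr_def)

lemma ennreal_powr_one [simp]: "ennreal_powr x 1 = x"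
  by (cases x) (auto simp: ennreal_powr_def)

lemma ennreal_powr_1 [simp]: "ennreal_powr 1 a = 1"
  by (simp add: ennreal_powr_def)

lemma ennreal_powr_ennreal: "0 \<le> x \<Longrightarrow> ennreal_powr (ennreal x) a = ennreal (x powr a)"
  by (simp add: ennreal_powr_def)

lemma ennreal_powr_mono: "0 \<le> a \<Longrightarrow> x \<le> y \<Longrightarrow> ennreal_powr x a \<le> ennreal_powr y a"
  by (cases x; cases y) (auto simp: ennreal_powr_def top_unique intro!: powr_mono2 ennreal_leI)

lemma ennreal_powr_eq_0_iff [simp]: "ennreal_powr x a = 0 \<longleftrightarrow> x = 0"
  by (cases x) (auto simp: ennreal_powr_def)

lemma ennreal_powr_eq_top_iff [simp]: "ennreal_powr x a = \<top> \<longleftrightarrow> x = \<top>"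
  by (cases x) (auto simp: ennreal_powr_def)

lemma ennreal_powr_mult: "ennreal_powr (x * y) a = ennreal_powr x a * ennreal_powr y a"
proof (cases "x = \<top> \<or> y = \<top>")
  case True
  then show ?thesis
    by (cases "x = 0 \<or> y = 0") (auto simp: ennreal_mult_top ennreal_top_mult)
next
  case False
  then obtain u v where "x = ennreal u" "y = ennreal v" "u \<ge> 0" "v \<ge> 0"
    by (cases x; cases y) auto
  then show ?thesis
    by (simp add: ennreal_powr_ennreal ennreal_mult[symmetric] powr_mult)
qed

lemma ennreal_powr_powr: "ennreal_powr (ennreal_powr x a) b = ennreal_powr x (a * b)"
  by (cases x) (auto simp: ennreal_powr_ennreal powr_powr)

lemma ennreal_powr_add: "ennreal_powr x (a + b) = ennreal_powr x a * ennreal_powr x b"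
  by (cases x) (auto simp: ennreal_powr_ennreal powr_add ennreal_mult)

lemma measurable_ennreal_powr [measurable (raw)]:
  assumes [measurable]: "f \<in> borel_measurable M"
  shows "(\<lambda>x. ennreal_powr (f x) a) \<in> borel_measurable M"
  unfolding ennreal_powr_def by measurable

lemma ennreal_powr_inverse_mult:
  assumes "x \<noteq> 0" "x \<noteq> \<top>" shows "ennreal_powr (y / x) a * ennreal_powr x a = ennreal_powr y a"
proof -
  have "y / x * x = y"
    using assms by (simp add: ennreal_divide_times[symmetric] ennreal_times_divide[symmetric] less_top mult.commute)
  then show ?thesis by (simp add: ennreal_powr_mult[symmetric])
qed

text \<open>The tangent line of the convex function \<open>x powr \<theta>\<close> at
  \<open>m\<close> lies below its graph. This linear form can be integrated against a measure of
  arbitrary mass, which is how Jensen's inequality is derived next.\<close>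

lemma Young_tangent:
  fixes x m \<theta> :: real
  assumes "0 \<le> x" "0 < m" "1 \<le> \<theta>"
  shows "\<theta> * m powr (\<theta> - 1) * x \<le> x powr \<theta> + (\<theta> - 1) * m powr \<theta>"
proof (cases "\<theta> = 1")
  case True then show ?thesis using assms by simp
next
  case False
  then have t: "\<theta> > 1" using assms by simp
  have "x * m powr (\<theta> - 1) \<le> x powr \<theta> / \<theta> + (m powr (\<theta> - 1)) powr (\<theta> / (\<theta> - 1)) / (\<theta> / (\<theta> - 1))"
    by (rule Youngs_inequality) (use t assms in \<open>auto simp: field_simps\<close>)
  also have "(m powr (\<theta> - 1)) powr (\<theta> / (\<theta> - 1)) = m powr \<theta>"
    using t by (simp add: powr_powr)
  finally have "\<theta> * (x * m powr (\<theta> - 1)) \<le> \<theta> * (x powr \<theta> / \<theta> + m powr \<theta> / (\<theta> / (\<theta> - 1)))"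
    using t by (intro mult_left_mono) auto
  also have "\<theta> * (x powr \<theta> / \<theta> + m powr \<theta> / (\<theta> / (\<theta> - 1))) = x powr \<theta> + (\<theta> - 1) * m powr \<theta>"
    using t by (simp add: distrib_left)
  finally show ?thesis by (simp add: mult_ac)
qed

lemma ennreal_Young_tangent:
  fixes x :: ennreal and m \<theta> :: real
  assumes "0 < m" "1 \<le> \<theta>"
  shows "ennreal (\<theta> * m powr (\<theta> - 1)) * x \<le> ennreal_powr x \<theta> + ennreal ((\<theta> - 1) * m powr \<theta>)"
proof (cases x)
  case (real r)
  then show ?thesis
    using Young_tangent[of r m \<theta>] assms
    by (auto simp: ennreal_powr_ennreal ennreal_mult[symmetric] ennreal_plus[symmetric] simp del: ennreal_plus intro!: ennreal_leI)
qed simp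

text \<open>The tangent inequality is integrated without normalising the measure, so the total mass
  appears as a factor. Densities such as \<open>(G t x)^2 * z x\<close>, whose mass is known only
  through an upper bound, can then be used directly.\<close>

lemma nn_integral_powr_Jensen:
  assumes [measurable]: "h \<in> borel_measurable N" and "1 \<le> \<theta>"
  shows "ennreal_powr (\<integral>\<^sup>+x. h x \<partial>N) \<theta>
    \<le> ennreal_powr (emeasure N (space N)) (\<theta> - 1) * (\<integral>\<^sup>+x. ennreal_powr (h x) \<theta> \<partial>N)"
    (is "ennreal_powr ?I \<theta> \<le> ennreal_powr ?T _ * ?J")
proof -
  have *: "ennreal (\<theta> * m powr (\<theta> - 1)) * ?I \<le> ?J + ennreal ((\<theta> - 1) * m powr \<theta>) * ?T" if "m > 0" for m
  proof -
    have "ennreal (\<theta> * m powr (\<theta> - 1)) * ?I = (\<integral>\<^sup>+x. ennreal (\<theta> * m powr (\<theta> - 1)) * h x \<partial>N)"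
      by (simp add: nn_integral_cmult)
    also have "\<dots> \<le> (\<integral>\<^sup>+x. ennreal_powr (h x) \<theta> + ennreal ((\<theta> - 1) * m powr \<theta>) \<partial>N)"
      by (intro nn_integral_mono ennreal_Young_tangent that assms)
    also have "\<dots> = ?J + ennreal ((\<theta> - 1) * m powr \<theta>) * ?T"
      by (simp add: nn_integral_add)
    finally show ?thesis .
  qed
  have J0: "?I = 0" if "?J = 0"
    using that by (simp add: nn_integral_0_iff_AE)
  show ?thesis
  proof (cases "?I = 0 \<or> ?J = \<top> \<or> ?T = \<top> \<or> ?T = 0")
    case True
    have "?I = 0" if "?T = 0"
    proof -
      have "N = N" ..
      have "AE x in N. False" using that by (intro AE_I[of _ _ "space N"]) auto
      then have "AE x in N. h x = 0" by eventually_elim simp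
      then show ?thesis by (simp add: nn_integral_0_iff_AE)
    qed
    with True J0 show ?thesis
      by (cases "?I = 0"; cases "?T = 0") (auto simp: ennreal_mult_top ennreal_top_mult)
  next
    case False
    obtain T where T: "?T = ennreal T" "T > 0"
      using False by (cases ?T) (auto simp: less_le)
    obtain J where J: "?J = ennreal J" "J \<ge> 0" using False by (cases ?J) auto
    have "?I \<noteq> \<top>"
    proof
      assume "?I = \<top>"
      with *[of 1] T J assms show False
        by (auto simp: ennreal_mult_top top_unique ennreal_mult[symmetric] ennreal_plus[symmetric] simp del: ennreal_plus)
    qed
    with False obtain I where I: "?I = ennreal I" "I > 0" by (cases ?I) (auto simp: less_le)
    \<comment> \<open>The mean of \<open>h\<close> is the optimal point of tangency.\<close>
    define m where "m = I / T"
    have m: "m > 0" using I T by (simp add: m_def)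
    have "ennreal (\<theta> * m powr (\<theta> - 1) * I) \<le> ennreal (J + (\<theta> - 1) * m powr \<theta> * T)"
      using *[OF m] I T J assms by (simp add: ennreal_mult[symmetric] ennreal_plus[symmetric] del: ennreal_plus)
    then have "\<theta> * m powr (\<theta> - 1) * I \<le> J + (\<theta> - 1) * m powr \<theta> * T"
      using I T J assms by (subst (asm) ennreal_le_iff) auto
    moreover have "(\<theta> - 1) * m powr \<theta> * T = (\<theta> - 1) * (m powr (\<theta> - 1) * I)"
      using m I T by (simp add: powr_diff m_def)
    ultimately have "\<theta> * (m powr (\<theta> - 1) * I) \<le> J + (\<theta> - 1) * (m powr (\<theta> - 1) * I)"
      by (simp only: mult.assoc)
    then have le: "m powr (\<theta> - 1) * I \<le> J" by (simp add: left_diff_distrib)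
    have "I powr \<theta> = T powr (\<theta> - 1) * (m powr (\<theta> - 1) * I)"
      using I T by (simp add: m_def powr_divide powr_diff)
    also have "\<dots> \<le> T powr (\<theta> - 1) * J" by (intro mult_left_mono le) auto
    finally show ?thesis using I T J
      by (simp add: ennreal_powr_ennreal ennreal_mult[symmetric])
  qed
qed

section \<open>Norms with real exponents and their exchange\<close>

lemma measurable_Lp_norm [measurable (raw)]:
  assumes "sigma_finite_measure N" and [measurable]: "(\<lambda>(x, y). F x y) \<in> borel_measurable (M \<Otimes>\<^sub>M N)"
  shows "(\<lambda>x. Lp_norm r N (F x)) \<in> borel_measurable M"
proof -
  interpret sigma_finite_measure N by fact
  show ?thesis unfolding Lp_norm_def by measurable
qed

lemma Lp_norm_mono_AE:
  "0 < r \<Longrightarrow> AE x in M. F x \<le> G x \<Longrightarrow> Lp_norm r M F \<le> Lp_norm r M G"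
  unfolding Lp_norm_def
  by (intro ennreal_powr_mono nn_integral_mono_AE) (auto elim!: eventually_mono intro: ennreal_powr_mono)

lemma Lp_norm_mono:
  "0 < r \<Longrightarrow> (\<And>x. x \<in> space M \<Longrightarrow> F x \<le> G x) \<Longrightarrow> Lp_norm r M F \<le> Lp_norm r M G"
  by (intro Lp_norm_mono_AE) auto

lemma Lp_norm_cmult:
  assumes [measurable]: "F \<in> borel_measurable M" and "0 < r"
  shows "Lp_norm r M (\<lambda>x. c * F x) = c * Lp_norm r M F"
  using assms by (simp add: Lp_norm_def ennreal_powr_mult nn_integral_cmult ennreal_powr_powr)

lemma Lp_norm_powr:
  "0 < r \<Longrightarrow> ennreal_powr (Lp_norm r M F) r = (\<integral>\<^sup>+x. ennreal_powr (F x) r \<partial>M)"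
  by (simp add: Lp_norm_def ennreal_powr_powr)

lemma Lp_norm_le_iff:
  assumes "0 < r"
  shows "Lp_norm r M F \<le> c \<longleftrightarrow> (\<integral>\<^sup>+x. ennreal_powr (F x) r \<partial>M) \<le> ennreal_powr c r"
proof
  assume "Lp_norm r M F \<le> c"
  then have "ennreal_powr (Lp_norm r M F) r \<le> ennreal_powr c r" using assms by (intro ennreal_powr_mono) auto
  then show "(\<integral>\<^sup>+x. ennreal_powr (F x) r \<partial>M) \<le> ennreal_powr c r" using assms by (simp add: Lp_norm_powr)
next
  assume "(\<integral>\<^sup>+x. ennreal_powr (F x) r \<partial>M) \<le> ennreal_powr c r"
  then have "Lp_norm r M F \<le> ennreal_powr (ennreal_powr c r) (1 / r)"
    unfolding Lp_norm_def using assms by (intro ennreal_powr_mono) auto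
  then show "Lp_norm r M F \<le> c" using assms by (simp add: ennreal_powr_powr)
qed

lemma Lp_norm_finite_AE:
  assumes "Lp_norm r M F \<noteq> \<top>" "0 < r" and [measurable]: "F \<in> borel_measurable M"
  shows "AE x in M. F x \<noteq> \<top>"
proof -
  have "(\<integral>\<^sup>+x. ennreal_powr (F x) r \<partial>M) \<noteq> \<top>" using assms(1) by (simp add: Lp_norm_def)
  then have "AE x in M. ennreal_powr (F x) r \<noteq> \<top>" by (intro nn_integral_noteq_infinite[unfolded infinity_ennreal_def]) auto
  then show ?thesis by simp
qed

text \<open>Jensen's inequality with exponent \<open>r / p\<close>; the factor given by the total
  mass is 1.\<close>

lemma Lp_norm_mono_exponent:
  assumes "prob_space M" and [measurable]: "F \<in> borel_measurable M" and "0 < p" "p \<le> r"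
  shows "Lp_norm p M F \<le> Lp_norm r M F"
proof -
  interpret prob_space M by fact
  have "ennreal_powr (\<integral>\<^sup>+x. ennreal_powr (F x) p \<partial>M) (r / p) \<le> (\<integral>\<^sup>+x. ennreal_powr (F x) r \<partial>M)"
    using nn_integral_powr_Jensen[of "\<lambda>x. ennreal_powr (F x) p" M "r / p"] assms
    by (simp add: ennreal_powr_powr emeasure_space_1)
  then have "ennreal_powr (ennreal_powr (\<integral>\<^sup>+x. ennreal_powr (F x) p \<partial>M) (r / p)) (1 / r)
     \<le> ennreal_powr (\<integral>\<^sup>+x. ennreal_powr (F x) r \<partial>M) (1 / r)"
    using assms by (intro ennreal_powr_mono) auto
  then show ?thesis using assms by (simp add: ennreal_powr_powr Lp_norm_def)
qed

text \<open>Minkowski's integral inequality. With \<open>N x\<close> the inner norm and \<open>T\<close> the integral of \<open>N\<close>,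
  it is Jensen's inequality for the probability measure \<open>N x dx / T\<close> and the function \<open>G / N\<close>.\<close>

lemma nn_integral_Minkowski:
  assumes "sigma_finite_measure M" "sigma_finite_measure N"
    and G [measurable]: "(\<lambda>(x, y). G x y) \<in> borel_measurable (M \<Otimes>\<^sub>M N)" and "1 \<le> \<theta>"
  shows "(\<integral>\<^sup>+x. ennreal_powr (\<integral>\<^sup>+y. G x y \<partial>N) \<theta> \<partial>M)
    \<le> ennreal_powr (\<integral>\<^sup>+y. ennreal_powr (\<integral>\<^sup>+x. ennreal_powr (G x y) \<theta> \<partial>M) (1 / \<theta>) \<partial>N) \<theta>"
proof -
  interpret M: sigma_finite_measure M by fact
  interpret N: sigma_finite_measure N by fact
  interpret pair_sigma_finite M N ..
  define n where "n y = ennreal_powr (\<integral>\<^sup>+x. ennreal_powr (G x y) \<theta> \<partial>M) (1 / \<theta>)" for y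
  have n_meas [measurable]: "n \<in> borel_measurable N" unfolding n_def by measurable
  define T where "T = (\<integral>\<^sup>+y. n y \<partial>N)"
  show ?thesis
  proof (cases "T = \<top>")
    case True
    then show ?thesis by (simp add: T_def n_def)
  next
    case False
    have nfin: "AE y in N. n y \<noteq> \<top>"
      using False unfolding T_def by (intro nn_integral_noteq_infinite[unfolded infinity_ennreal_def]) auto
    define k where "k x y = G x y / n y" for x y
    have k_meas [measurable]: "(\<lambda>(x, y). k x y) \<in> borel_measurable (M \<Otimes>\<^sub>M N)" unfolding k_def by measurable
    have n_powr: "ennreal_powr (n y) \<theta> = (\<integral>\<^sup>+x. ennreal_powr (G x y) \<theta> \<partial>M)" for y
      using assms by (simp add: n_def ennreal_powr_powr)
    \<comment> \<open>Where \<open>n y = 0\<close> the function \<open>G\<close> vanishes for almost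
      every \<open>x\<close>, and \<open>n y = \<top>\<close> occurs only on a null set because
      \<open>T\<close> is finite. So dividing by \<open>n y\<close> loses nothing.\<close>
    have "AE y in N. AE x in M. G x y = n y * k x y"
      using nfin AE_space
    proof eventually_elim
      case (elim y)
      then have [measurable]: "(\<lambda>x. G x y) \<in> borel_measurable M" by simp
      show ?case
      proof (cases "n y = 0")
        case True
        with n_powr[of y] have "(\<integral>\<^sup>+x. ennreal_powr (G x y) \<theta> \<partial>M) = 0" by simp
        then have "AE x in M. ennreal_powr (G x y) \<theta> = 0" by (subst (asm) nn_integral_0_iff_AE) auto
        then show ?thesis using True by simp
      next
        case False
        have "G x y = n y * k x y" for x
          unfolding k_def using elim False
          by (simp add: ennreal_times_divide mult.commute[of "n y"] mult_divide_eq_ennreal)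
        then show ?thesis by simp
      qed
    qed
    then have "AE x in M. AE y in N. G x y = n y * k x y"
      by (subst AE_commute) (auto)
    then have "AE x in M. ennreal_powr (\<integral>\<^sup>+y. G x y \<partial>N) \<theta>
        \<le> ennreal_powr T (\<theta> - 1) * (\<integral>\<^sup>+y. n y * ennreal_powr (k x y) \<theta> \<partial>N)"
      using AE_space
    proof eventually_elim
      case (elim x)
      then have [measurable]: "(\<lambda>y. G x y) \<in> borel_measurable N" "(\<lambda>y. k x y) \<in> borel_measurable N" by auto
      have "(\<integral>\<^sup>+y. G x y \<partial>N) = (\<integral>\<^sup>+y. n y * k x y \<partial>N)"
        using elim(1) by (rule nn_integral_cong_AE)
      also have "\<dots> = (\<integral>\<^sup>+y. k x y \<partial>density N n)" by (simp add: nn_integral_density)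
      finally show ?case
        using nn_integral_powr_Jensen[of "k x" "density N n" \<theta>] assms
        by (simp add: emeasure_density T_def nn_integral_density cong: nn_integral_cong)
    qed
    then have "(\<integral>\<^sup>+x. ennreal_powr (\<integral>\<^sup>+y. G x y \<partial>N) \<theta> \<partial>M)
       \<le> (\<integral>\<^sup>+x. ennreal_powr T (\<theta> - 1) * (\<integral>\<^sup>+y. n y * ennreal_powr (k x y) \<theta> \<partial>N) \<partial>M)"
      by (rule nn_integral_mono_AE)
    also have "\<dots> = ennreal_powr T (\<theta> - 1) * (\<integral>\<^sup>+y. n y * (\<integral>\<^sup>+x. ennreal_powr (k x y) \<theta> \<partial>M) \<partial>N)"
      by (subst nn_integral_cmult, measurable, subst Fubini'[symmetric], measurable)
        (simp add: nn_integral_cmult cong: nn_integral_cong)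
    also have "\<dots> \<le> ennreal_powr T (\<theta> - 1) * (\<integral>\<^sup>+y. n y \<partial>N)"
    proof (intro mult_left_mono nn_integral_mono_AE)
      show "AE y in N. n y * (\<integral>\<^sup>+x. ennreal_powr (k x y) \<theta> \<partial>M) \<le> n y"
        using nfin AE_space
      proof eventually_elim
        case (elim y)
        then have [measurable]: "(\<lambda>x. k x y) \<in> borel_measurable M" by simp
        show ?case
        proof (cases "n y = 0")
          case False
          have "(\<integral>\<^sup>+x. ennreal_powr (k x y) \<theta> \<partial>M) * ennreal_powr (n y) \<theta>
              = (\<integral>\<^sup>+x. ennreal_powr (k x y) \<theta> * ennreal_powr (n y) \<theta> \<partial>M)"
            by (subst nn_integral_multc) auto
          also have "\<dots> = (\<integral>\<^sup>+x. ennreal_powr (G x y) \<theta> \<partial>M)"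
            using False elim unfolding k_def by (simp add: ennreal_powr_inverse_mult)
          also have "\<dots> = ennreal_powr (n y) \<theta>"
            by (simp add: n_powr)
          finally have "(\<integral>\<^sup>+x. ennreal_powr (k x y) \<theta> \<partial>M) * ennreal_powr (n y) \<theta> = 1 * ennreal_powr (n y) \<theta>" by simp
          then have "(\<integral>\<^sup>+x. ennreal_powr (k x y) \<theta> \<partial>M) = 1"
            using False elim by (metis ennreal_powr_eq_0_iff ennreal_powr_eq_top_iff mult_divide_eq_ennreal)
          then show ?thesis by simp
        qed simp
      qed
    qed auto
    also have "\<dots> = ennreal_powr T \<theta>"
      using ennreal_powr_add[of T "\<theta> - 1" 1] by (simp add: T_def)
    finally show ?thesis by (simp add: T_def n_def)
  qed
qed

text \<open>Apply Minkowski's integral inequality with \<open>\<theta> = r / p\<close> to the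
  \<open>p\<close>-th power of \<open>F\<close>. The norm with the larger exponent is the one that
  moves inward.\<close>

lemma Lp_norm_swap:
  assumes "sigma_finite_measure M" "sigma_finite_measure N"
    and F [measurable]: "(\<lambda>(x, y). F x y) \<in> borel_measurable (M \<Otimes>\<^sub>M N)" and "0 < p" "p \<le> r"
  shows "Lp_norm r M (\<lambda>x. Lp_norm p N (F x)) \<le> Lp_norm p N (\<lambda>y. Lp_norm r M (\<lambda>x. F x y))"
proof -
  have "(\<integral>\<^sup>+x. ennreal_powr (\<integral>\<^sup>+y. ennreal_powr (F x y) p \<partial>N) (r / p) \<partial>M)
    \<le> ennreal_powr (\<integral>\<^sup>+y. ennreal_powr (\<integral>\<^sup>+x. ennreal_powr (ennreal_powr (F x y) p) (r / p) \<partial>M) (1 / (r / p)) \<partial>N) (r / p)"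
    by (rule nn_integral_Minkowski) (use assms in auto)
  then have "ennreal_powr (\<integral>\<^sup>+x. ennreal_powr (\<integral>\<^sup>+y. ennreal_powr (F x y) p \<partial>N) (r / p) \<partial>M) (1 / r)
    \<le> ennreal_powr (ennreal_powr (\<integral>\<^sup>+y. ennreal_powr (\<integral>\<^sup>+x. ennreal_powr (ennreal_powr (F x y) p) (r / p) \<partial>M) (1 / (r / p)) \<partial>N) (r / p)) (1 / r)"
    using assms by (intro ennreal_powr_mono) auto
  then show ?thesis using assms by (simp add: Lp_norm_def ennreal_powr_powr)
qed

text \<open>A series of nonnegative terms is a norm of exponent 1 over the counting measure, so the
  countable triangle inequality is a case of the exchange of norms.\<close>

lemma Lp_norm_suminf:
  fixes F :: "nat \<Rightarrow> 'a \<Rightarrow> ennreal"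
  assumes "sigma_finite_measure M" and F [measurable]: "\<And>j. F j \<in> borel_measurable M" and "1 \<le> r"
  shows "Lp_norm r M (\<lambda>x. \<Sum>j. F j x) \<le> (\<Sum>j. Lp_norm r M (F j))"
proof -
  have [simp]: "Lp_norm 1 (count_space UNIV) f = (\<Sum>j. f j)" for f :: "nat \<Rightarrow> ennreal"
    by (simp add: Lp_norm_def nn_integral_count_space_nat)
  have "(\<lambda>(j, x). F j x) \<in> borel_measurable (count_space UNIV \<Otimes>\<^sub>M M)"
    by (rule measurable_pair_measure_countable1) auto
  from measurable_pair_swap[OF this] have [measurable]:
    "(\<lambda>(x, j). F j x) \<in> borel_measurable (M \<Otimes>\<^sub>M count_space UNIV)"
    by (simp add: case_prod_unfold)
  have "Lp_norm r M (\<lambda>x. Lp_norm 1 (count_space (UNIV :: nat set)) (\<lambda>j. F j x))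
     \<le> Lp_norm 1 (count_space UNIV) (\<lambda>j. Lp_norm r M (F j))"
    by (rule Lp_norm_swap)
      (use assms in \<open>auto intro!: sigma_finite_measure_count_space_countable\<close>)
  then show ?thesis by simp
qed

section \<open>Orthogonal invariance and Gaussian integrals\<close>

lemma measurable_cis [measurable (raw)]:
  "f \<in> borel_measurable M \<Longrightarrow> (\<lambda>x. cis (f x)) \<in> borel_measurable M"
  by (rule measurable_compose[of f M borel]) (auto intro!: borel_measurable_continuous_onI continuous_intros)

lemma measurable_cnj [measurable (raw)]:
  "f \<in> borel_measurable M \<Longrightarrow> (\<lambda>x. cnj (f x)) \<in> borel_measurable M"
  by (rule measurable_compose[of f M borel]) (auto intro!: borel_measurable_continuous_onI continuous_intros)

lemma cis_diff: "cis (a - b) = cis a * cnj (cis b)"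
  by (simp add: cis_cnj cis_mult)

lemma integrable_pair_mult:
  fixes f :: "'a \<Rightarrow> complex" and g :: "'b \<Rightarrow> complex"
  assumes "sigma_finite_measure M1" "sigma_finite_measure M2" "integrable M1 f" "integrable M2 g"
  shows "integrable (M1 \<Otimes>\<^sub>M M2) (\<lambda>(x, y). f x * g y)"
proof -
  interpret M1: sigma_finite_measure M1 by fact
  interpret M2: sigma_finite_measure M2 by fact
  interpret pair_sigma_finite M1 M2 ..
  have [measurable]: "f \<in> borel_measurable M1" "g \<in> borel_measurable M2" using assms by auto
  show ?thesis
    by (rule Fubini_integrable) (use assms in \<open>auto simp: norm_mult\<close>)
qed

text \<open>Supplies the integrability that Fubini's theorem asks for with oscillating kernels such
  as \<open>cis (x \<bullet> \<xi>)\<close>: all that counts is that the kernel is bounded by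
  1.\<close>

lemma integrable_pair_mult_bounded:
  fixes f :: "'a \<Rightarrow> complex" and g :: "'b \<Rightarrow> complex"
  assumes "sigma_finite_measure M1" "sigma_finite_measure M2" "integrable M1 f" "integrable M2 g"
    and [measurable]: "(\<lambda>(x, y). h x y) \<in> borel_measurable (M1 \<Otimes>\<^sub>M M2)"
    and "\<And>x y. cmod (h x y) \<le> 1"
  shows "integrable (M1 \<Otimes>\<^sub>M M2) (\<lambda>(x, y). h x y * (f x * g y))"
proof (rule Bochner_Integration.integrable_bound[OF integrable_pair_mult[OF assms(1-4)]])
  have [measurable]: "f \<in> borel_measurable M1" "g \<in> borel_measurable M2" using assms by auto
  show "(\<lambda>(x, y). h x y * (f x * g y)) \<in> borel_measurable (M1 \<Otimes>\<^sub>M M2)" by measurable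
  show "AE x in M1 \<Otimes>\<^sub>M M2. cmod (case x of (x, y) \<Rightarrow> h x y * (f x * g y)) \<le> cmod (case x of (x, y) \<Rightarrow> f x * g y)"
    using assms(6) by (auto simp: norm_mult intro!: AE_I2 mult_left_le_one_le)
qed

section \<open>Translations, dilations and rotations of Lebesgue measure\<close>

lemma nn_integral_translate:
  fixes f :: "'a::euclidean_space \<Rightarrow> ennreal"
  assumes [measurable]: "f \<in> borel_measurable borel"
  shows "(\<integral>\<^sup>+x. f (y + x) \<partial>lborel) = (\<integral>\<^sup>+x. f x \<partial>lborel)"
  by (subst (2) lborel_distr_plus[symmetric, of y]) (simp add: nn_integral_distr)

lemma nn_integral_scale:
  fixes f :: "'a::euclidean_space \<Rightarrow> ennreal"
  assumes [measurable]: "f \<in> borel_measurable borel" and "c \<noteq> 0"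
  shows "(\<integral>\<^sup>+x. f x \<partial>lborel) = ennreal (\<bar>c\<bar> ^ DIM('a)) * (\<integral>\<^sup>+x. f (c *\<^sub>R x) \<partial>lborel)"
  by (subst lborel_affine[OF assms(2), of 0]) (simp add: nn_integral_density nn_integral_distr nn_integral_cmult)

lemma nn_integral_uminus:
  fixes f :: "'a::euclidean_space \<Rightarrow> ennreal"
  assumes [measurable]: "f \<in> borel_measurable borel"
  shows "(\<integral>\<^sup>+x. f (- x) \<partial>lborel) = (\<integral>\<^sup>+x. f x \<partial>lborel)"
  using nn_integral_scale[of f "-1"] by simp

text \<open>Uniqueness of the Haar measure, by the usual exchange of two translation-invariant integrals.\<close>

lemma translation_invariant_eq_lborel:
  fixes \<mu> :: "'a::euclidean_space measure"
  assumes "sigma_finite_measure \<mu>" and [measurable_cong, simp]: "sets \<mu> = sets borel"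
    and inv: "\<And>f y. f \<in> borel_measurable borel \<Longrightarrow> (\<integral>\<^sup>+x. f (y + x) \<partial>\<mu>) = (\<integral>\<^sup>+x. f x \<partial>\<mu>)"
    and [measurable]: "f \<in> borel_measurable borel" "g \<in> borel_measurable borel"
  shows "(\<integral>\<^sup>+x. f x \<partial>\<mu>) * (\<integral>\<^sup>+y. g y \<partial>lborel) = (\<integral>\<^sup>+x. g x \<partial>\<mu>) * (\<integral>\<^sup>+y. f y \<partial>lborel)"
proof -
  interpret sigma_finite_measure \<mu> by fact
  interpret pair_sigma_finite \<mu> "lborel :: 'a measure" ..
  have "(\<integral>\<^sup>+x. f x \<partial>\<mu>) * (\<integral>\<^sup>+y. g y \<partial>lborel) = (\<integral>\<^sup>+x. f x * (\<integral>\<^sup>+y. g (x + y) \<partial>lborel) \<partial>\<mu>)"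
    by (simp add: nn_integral_translate nn_integral_multc)
  also have "\<dots> = (\<integral>\<^sup>+x. \<integral>\<^sup>+y. f x * g (x + y) \<partial>lborel \<partial>\<mu>)"
    by (simp add: nn_integral_cmult)
  also have "\<dots> = (\<integral>\<^sup>+y. \<integral>\<^sup>+x. f x * g (x + y) \<partial>\<mu> \<partial>lborel)"
    by (subst Fubini') auto
  \<comment> \<open>Invariance of \<open>\<mu>\<close> shifts the inner variable by
    \<open>- y\<close>. The dependence on \<open>y\<close> thereby passes from \<open>g\<close> to
    \<open>f\<close>, where Lebesgue measure integrates it out.\<close>
  also have "\<dots> = (\<integral>\<^sup>+y. \<integral>\<^sup>+x. f (- y + x) * g (- y + x + y) \<partial>\<mu> \<partial>lborel)"
  proof (rule nn_integral_cong, goal_cases)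
    case (1 y)
    show ?case using inv[of "\<lambda>x. f x * g (x + y)" "- y"] by simp
  qed
  also have "\<dots> = (\<integral>\<^sup>+y. \<integral>\<^sup>+x. f (- y + x) * g x \<partial>\<mu> \<partial>lborel)" by simp
  also have "\<dots> = (\<integral>\<^sup>+x. \<integral>\<^sup>+y. f (- y + x) * g x \<partial>lborel \<partial>\<mu>)"
    by (subst Fubini') auto
  also have "\<dots> = (\<integral>\<^sup>+x. (\<integral>\<^sup>+y. f (- y + x) \<partial>lborel) * g x \<partial>\<mu>)"
    by (simp add: nn_integral_multc)
  also have "\<dots> = (\<integral>\<^sup>+x. (\<integral>\<^sup>+y. f y \<partial>lborel) * g x \<partial>\<mu>)"
  proof (intro nn_integral_cong, goal_cases)
    case (1 x)
    have "(\<integral>\<^sup>+y. f (- y + x) \<partial>lborel) = (\<integral>\<^sup>+y. f (x + y) \<partial>lborel)"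
      using nn_integral_uminus[of "\<lambda>y. f (x + y)"] by (simp add: add.commute)
    then show ?case by (simp add: nn_integral_translate)
  qed
  also have "\<dots> = (\<integral>\<^sup>+x. g x \<partial>\<mu>) * (\<integral>\<^sup>+y. f y \<partial>lborel)"
    by (subst nn_integral_cmult) (auto simp: mult.commute)
  finally show ?thesis .
qed

text \<open>The image of Lebesgue measure under a linear isometry is again translation invariant,
  hence proportional to Lebesgue measure. The factor is 1 because the unit ball is mapped onto
  itself and has finite positive volume.\<close>

lemma lborel_orthogonal:
  fixes R :: "'a::euclidean_space \<Rightarrow> 'a"
  assumes R: "orthogonal_transformation R"
  shows "distr lborel borel R = lborel"
proof -
  have lin: "linear R" using R by (simp add: orthogonal_transformation_linear)
  have nrm: "norm (R x) = norm x" for x using R by (simp add: orthogonal_transformation_norm)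
  have surj: "surj R" using R lin by (simp add: linear_injective_imp_surjective orthogonal_transformation_inj)
  have [measurable]: "R \<in> borel \<rightarrow>\<^sub>M borel"
    by (intro borel_measurable_continuous_onI linear_continuous_on linear_conv_bounded_linear[THEN iffD1] lin)
  define \<mu> where "\<mu> = distr lborel borel R"
  have sets [measurable_cong, simp]: "sets \<mu> = sets borel" by (simp add: \<mu>_def)
  have ball: "emeasure \<mu> (cball 0 r) = emeasure (lborel :: 'a measure) (cball 0 r)" for r :: real
  proof -
    have "R -` cball 0 r = cball 0 r" by (auto simp: nrm)
    then show ?thesis by (simp add: \<mu>_def emeasure_distr)
  qed
  have "sigma_finite_measure \<mu>"
  proof
    show "\<exists>A. countable A \<and> A \<subseteq> sets \<mu> \<and> \<Union> A = space \<mu> \<and> (\<forall>a\<in>A. emeasure \<mu> a \<noteq> \<infinity>)"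
    proof (intro exI[of _ "range (\<lambda>n::nat. cball 0 (real n))"] conjI ballI)
      show "\<Union> (range (\<lambda>n::nat. cball 0 (real n))) = space \<mu>"
        by (auto simp: \<mu>_def real_arch_simple)
      show "emeasure \<mu> a \<noteq> \<infinity>" if "a \<in> range (\<lambda>n::nat. cball 0 (real n))" for a
        using that emeasure_lborel_cball_finite[where 'a='a] by (auto simp: ball less_top[symmetric])
    qed auto
  qed
  moreover have "(\<integral>\<^sup>+x. f (y + x) \<partial>\<mu>) = (\<integral>\<^sup>+x. f x \<partial>\<mu>)" if [measurable]: "f \<in> borel_measurable borel" for f y
  proof -
    obtain z where z: "y = R z" using surj by auto
    have "(\<integral>\<^sup>+x. f (y + x) \<partial>\<mu>) = (\<integral>\<^sup>+x. f (R (z + x)) \<partial>lborel)"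
      by (simp add: \<mu>_def nn_integral_distr z linear_add[OF lin])
    also have "\<dots> = (\<integral>\<^sup>+x. f x \<partial>\<mu>)"
      by (subst nn_integral_translate) (auto simp: \<mu>_def nn_integral_distr)
    finally show ?thesis .
  qed
  ultimately have *: "(\<integral>\<^sup>+x. f x \<partial>\<mu>) * (\<integral>\<^sup>+y. g y \<partial>lborel) = (\<integral>\<^sup>+x. g x \<partial>\<mu>) * (\<integral>\<^sup>+y. f y \<partial>lborel)"
    if "f \<in> borel_measurable borel" "g \<in> borel_measurable borel" for f g
    using that by (intro translation_invariant_eq_lborel) auto
  define c where "c = emeasure (lborel :: 'a measure) (cball 0 1)"
  have c: "c \<noteq> 0" "c \<noteq> \<top>"
    using emeasure_lborel_cball_finite[of "0::'a" 1] using unit_ball_vol_pos[of "real DIM('a)"] by (auto simp: c_def emeasure_cball simp del: unit_ball_vol_pos)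
  have "\<mu> = lborel"
  proof (rule measure_eqI)
    fix A assume "A \<in> sets \<mu>"
    then have [measurable]: "A \<in> sets borel" by simp
    have "emeasure \<mu> A * c = emeasure \<mu> (cball 0 1) * emeasure lborel A"
      using *[of "indicator A" "indicator (cball 0 1)"] closed_cball[of "0::'a" 1, THEN borel_closed] by (simp add: c_def)
    also have "\<dots> = emeasure lborel A * c" by (simp add: ball c_def mult.commute)
    finally show "emeasure \<mu> A = emeasure lborel A"
      using c by (metis mult_divide_eq_ennreal)
  qed simp
  then show ?thesis by (simp add: \<mu>_def)
qed

section \<open>Gaussian integrals and Bessel's inequality\<close>

lemma gaussian_char_real:
  fixes a x :: real assumes a: "0 < a"
  shows "integrable lborel (\<lambda>y. exp (- (a * y\<^sup>2) / 2))"
    and "(LINT y|lborel. cis (x * y) * complex_of_real (exp (- (a * y\<^sup>2) / 2)))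
      = complex_of_real (sqrt (2 * pi / a) * exp (- x\<^sup>2 / (2 * a)))"
proof -
  have e: "std_normal_density (sqrt a * y) = exp (- (a * y\<^sup>2) / 2) / sqrt (2 * pi)" for y
    using a by (simp add: std_normal_density_def power_mult_distrib)
  have "integrable lborel (\<lambda>y. sqrt (2 * pi) * std_normal_density (0 + sqrt a * y))"
    using a by (intro integrable_mult_right lborel_integrable_real_affine) auto
  then show "integrable lborel (\<lambda>y. exp (- (a * y\<^sup>2) / 2))" by (simp add: e)
  have "complex_of_real (exp (- (x / sqrt a)\<^sup>2 / 2)) = char std_normal_distribution (x / sqrt a)"
    by (simp add: char_std_normal_distribution)
  also have "\<dots> = (LINT z|lborel. std_normal_density z *\<^sub>R cis (x / sqrt a * z))"
    unfolding char_def
    by (subst integral_density) (auto simp: cis_conv_exp normal_density_nonneg)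
  also have "\<dots> = sqrt a *\<^sub>R (LINT y|lborel. std_normal_density (0 + sqrt a * y) *\<^sub>R cis (x / sqrt a * (0 + sqrt a * y)))"
    using a by (subst lborel_integral_real_affine[of "sqrt a" _ 0]) auto
  also have "(LINT y|lborel. std_normal_density (0 + sqrt a * y) *\<^sub>R cis (x / sqrt a * (0 + sqrt a * y)))
     = (LINT y|lborel. (cis (x * y) * complex_of_real (exp (- (a * y\<^sup>2) / 2))) / complex_of_real (sqrt (2 * pi)))"
    using a by (intro Bochner_Integration.integral_cong) (auto simp: e scaleR_conv_of_real)
  finally show "(LINT y|lborel. cis (x * y) * complex_of_real (exp (- (a * y\<^sup>2) / 2)))
      = complex_of_real (sqrt (2 * pi / a) * exp (- x\<^sup>2 / (2 * a)))"
    using a by (simp add: scaleR_conv_of_real field_simps real_sqrt_divide real_sqrt_mult power_divide)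
qed

lemma cis_sum: "finite A \<Longrightarrow> cis (\<Sum>b\<in>A. f b) = (\<Prod>b\<in>A. cis (f b))"
  by (induction A rule: finite_induct) (auto simp: cis_mult[symmetric])

lemma lborel_integral_prod_Basis:
  fixes f :: "'a::euclidean_space \<Rightarrow> real \<Rightarrow> complex"
  assumes "\<And>b. b \<in> Basis \<Longrightarrow> integrable lborel (f b)"
  shows "integrable lborel (\<lambda>x. \<Prod>b\<in>Basis. f b (x \<bullet> b))"
    and "(LINT x|lborel. (\<Prod>b\<in>Basis. f b (x \<bullet> b))) = (\<Prod>b\<in>Basis. LINT y|lborel. f b y)"
proof -
  interpret product_sigma_finite "\<lambda>_. lborel :: real measure" ..
  have [measurable]: "b \<in> Basis \<Longrightarrow> f b \<in> borel_measurable borel" for b using assms[of b] by auto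
  have e: "(\<Prod>b\<in>Basis. f b ((\<Sum>c\<in>Basis. y c *\<^sub>R c) \<bullet> b)) = (\<Prod>b\<in>Basis. f b (y b))" for y :: "'a \<Rightarrow> real"
    by (intro prod.cong) (auto simp: inner_sum_left inner_Basis if_distrib cong: if_cong)
  show "integrable lborel (\<lambda>x. \<Prod>b\<in>Basis. f b (x \<bullet> b))"
    by (subst lborel_eq, subst integrable_distr_eq)
      (auto simp: e intro!: product_integrable_prod assms)
  show "(LINT x|lborel. (\<Prod>b\<in>Basis. f b (x \<bullet> b))) = (\<Prod>b\<in>Basis. LINT y|lborel. f b y)"
    by (subst lborel_eq, subst integral_distr)
      (auto simp: e intro!: product_integral_prod assms)
qed

lemma gaussian_char:
  fixes x :: "'a::euclidean_space" assumes a: "0 < a"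
  shows gaussian_integrable: "integrable lborel (\<lambda>y::'a. exp (- (a * (norm y)\<^sup>2) / 2))"
    and "(LINT y|lborel. cis (x \<bullet> y) * complex_of_real (exp (- (a * (norm y)\<^sup>2) / 2)))
      = complex_of_real (sqrt (2 * pi / a) ^ DIM('a) * exp (- (norm x)\<^sup>2 / (2 * a)))"
proof -
  have n2: "(norm y)\<^sup>2 = (\<Sum>b\<in>Basis. (y \<bullet> b)\<^sup>2)" for y :: 'a
    by (simp add: norm_eq_sqrt_inner euclidean_inner[of y y] power2_eq_square sum_nonneg)
  define f where "f x b y = cis ((x \<bullet> b) * y) * complex_of_real (exp (- (a * y\<^sup>2) / 2))" for x b :: 'a and y
  have fi: "integrable lborel (f x b)" for x b
    unfolding f_def
    by (rule Bochner_Integration.integrable_bound[OF gaussian_char_real(1)[OF a]]) (auto simp: norm_mult)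
  have e: "(\<Prod>b\<in>Basis. f x b (y \<bullet> b)) = cis (x \<bullet> y) * complex_of_real (exp (- (a * (norm y)\<^sup>2) / 2))" for x y
    unfolding f_def prod.distrib cis_sum[symmetric, OF finite_Basis] of_real_prod[symmetric] exp_sum[symmetric, OF finite_Basis]
    by (simp add: euclidean_inner[of x y] n2 sum_negf sum_distrib_left sum_divide_distrib)
  have "integrable lborel (\<lambda>y. \<Prod>b\<in>Basis. f 0 b (y \<bullet> b))"
    by (intro lborel_integral_prod_Basis fi)
  then show "integrable lborel (\<lambda>y::'a. exp (- (a * (norm y)\<^sup>2) / 2))"
    unfolding e by (simp add: complex_of_real_integrable_eq)
  have "(LINT y|lborel. (\<Prod>b\<in>Basis. f x b (y \<bullet> b))) = (\<Prod>b\<in>Basis. LINT y|lborel. f x b y)"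
    by (intro lborel_integral_prod_Basis fi)
  also have "\<dots> = (\<Prod>b\<in>Basis. complex_of_real (sqrt (2 * pi / a) * exp (- (x \<bullet> b)\<^sup>2 / (2 * a))))"
    by (simp only: f_def gaussian_char_real(2)[OF a])
  also have "\<dots> = complex_of_real (sqrt (2 * pi / a) ^ DIM('a) * exp (- (norm x)\<^sup>2 / (2 * a)))"
    unfolding of_real_prod[symmetric] prod.distrib exp_sum[symmetric, OF finite_Basis]
    by (simp add: n2 sum_negf sum_divide_distrib)
  finally show "(LINT y|lborel. cis (x \<bullet> y) * complex_of_real (exp (- (a * (norm y)\<^sup>2) / 2)))
      = complex_of_real (sqrt (2 * pi / a) ^ DIM('a) * exp (- (norm x)\<^sup>2 / (2 * a)))"
    unfolding e .
qed

lemma gaussian_integral: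
  assumes a: "0 < a"
  shows "(LINT y|lborel. exp (- (a * (norm (y::'a::euclidean_space))\<^sup>2) / 2)) = sqrt (2 * pi / a) ^ DIM('a)"
proof -
  have "complex_of_real (LINT y|lborel. exp (- (a * (norm (y::'a))\<^sup>2) / 2)) = complex_of_real (sqrt (2 * pi / a) ^ DIM('a))"
    using gaussian_char(2)[OF a, of "0::'a"] by simp
  then show ?thesis by (simp only: of_real_eq_iff)
qed

lemma gaussian_nn_integral:
  assumes a: "0 < a"
  shows "(\<integral>\<^sup>+y. ennreal (exp (- (a * (norm (y::'a::euclidean_space))\<^sup>2) / 2)) \<partial>lborel) = ennreal (sqrt (2 * pi / a) ^ DIM('a))"
  by (simp only: nn_integral_eq_integral[OF gaussian_integrable[OF a] AE_I2[OF exp_ge_zero]] gaussian_integral[OF a])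

lemma ennreal_add_self_half: "(x + x) / 2 = (x :: ennreal)"
proof (cases x)
  case (real r)
  then have "(x + x) / 2 = ennreal (2 * r) / ennreal 2"
    by (simp add: ennreal_plus[symmetric] del: ennreal_plus)
  also have "\<dots> = x" using real by (simp add: divide_ennreal del: ennreal_numeral)
  finally show ?thesis .
qed (simp add: ennreal_top_divide)

text \<open>Bessel's inequality for the system \<open>cis (y \<bullet> \<theta> \<xi>)\<close>: the \<open>y\<close>-integral is regularised by a
  Gaussian, after which Schur's test applies to the resulting Gaussian kernel.\<close>

lemma Bessel_ineq:
  fixes \<theta> :: "'x \<Rightarrow> 'a::euclidean_space" and H :: "'x \<Rightarrow> complex"
  assumes "sigma_finite_measure N" and Hi: "integrable N H"
    and [measurable]: "\<theta> \<in> borel_measurable N" "S \<in> sets N"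
    and HS: "\<And>\<xi>. \<xi> \<notin> S \<Longrightarrow> H \<xi> = 0"
    and K: "\<And>a \<xi>. 0 < a \<Longrightarrow>
      (\<integral>\<^sup>+\<eta>. ennreal (sqrt (2 * pi / a) ^ DIM('a) * exp (- (norm (\<theta> \<xi> - \<theta> \<eta>))\<^sup>2 / (2 * a))) * indicator S \<eta> \<partial>N) \<le> K"
  shows "(\<integral>\<^sup>+y. ennreal ((cmod (LINT \<xi>|N. cis (y \<bullet> \<theta> \<xi>) * H \<xi>))\<^sup>2) \<partial>lborel)
    \<le> K * (\<integral>\<^sup>+\<xi>. ennreal ((cmod (H \<xi>))\<^sup>2) \<partial>N)"
proof -
  interpret N: sigma_finite_measure N by fact
  interpret NN: pair_sigma_finite N N ..
  have [measurable]: "H \<in> borel_measurable N" using Hi by auto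
  define F where "F y = (LINT \<xi>|N. cis (y \<bullet> \<theta> \<xi>) * H \<xi>)" for y
  have F_meas [measurable]: "F \<in> borel_measurable borel"
    unfolding F_def by measurable
  define P where "P = N \<Otimes>\<^sub>M N"
  have "sigma_finite_measure P" unfolding P_def ..
  interpret P: sigma_finite_measure P by fact
  interpret Q: pair_sigma_finite "lborel :: 'a measure" P ..
  have [measurable]: "fst \<in> P \<rightarrow>\<^sub>M N" "snd \<in> P \<rightarrow>\<^sub>M N" by (simp_all add: P_def)
  define \<Phi> where "\<Phi> z = H (fst z) * cnj (H (snd z))" for z
  define D where "D z = \<theta> (fst z) - \<theta> (snd z)" for z
  have [measurable]: "\<Phi> \<in> borel_measurable P" "D \<in> borel_measurable P"
    unfolding \<Phi>_def D_def P_def by measurable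
  have \<Phi>i: "integrable P \<Phi>"
    using integrable_pair_mult[OF assms(1) assms(1) Hi, of "\<lambda>x. cnj (H x)"] Hi
    by (simp add: \<Phi>_def[abs_def] P_def case_prod_unfold)
  have FF: "(cmod (F y))\<^sup>2 = Re (LINT z|P. cis (y \<bullet> D z) * \<Phi> z)" for y
  proof -
    have i1: "integrable N (\<lambda>\<xi>. cis (y \<bullet> \<theta> \<xi>) * H \<xi>)"
      by (rule Bochner_Integration.integrable_bound[OF Hi]) (auto simp: norm_mult)
    have e: "(case z of (\<xi>, \<eta>) \<Rightarrow> (cis (y \<bullet> \<theta> \<xi>) * H \<xi>) * cnj (cis (y \<bullet> \<theta> \<eta>) * H \<eta>)) = cis (y \<bullet> D z) * \<Phi> z" for z
      by (cases z) (simp add: D_def \<Phi>_def inner_diff_right cis_diff mult_ac)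
    have cF: "cnj (F y) = (LINT \<eta>|N. cnj (cis (y \<bullet> \<theta> \<eta>) * H \<eta>))"
      unfolding F_def by (simp only: Bochner_Integration.integral_cnj)
    have "complex_of_real ((cmod (F y))\<^sup>2) = F y * cnj (F y)"
      using complex_norm_square[of "F y"] by simp
    also have "\<dots> = (LINT \<xi>|N. LINT \<eta>|N. (cis (y \<bullet> \<theta> \<xi>) * H \<xi>) * cnj (cis (y \<bullet> \<theta> \<eta>) * H \<eta>))"
      unfolding cF by (simp only: F_def integral_mult_left_zero integral_mult_right_zero)
    also have "\<dots> = (LINT z|P. cis (y \<bullet> D z) * \<Phi> z)"
      unfolding P_def e[symmetric]
      using NN.integral_fst'[OF integrable_pair_mult[OF assms(1) assms(1) i1 integrable_cnj[OF i1]]] by simp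
    finally show ?thesis by (metis Re_complex_of_real)
  qed
  have main: "(\<integral>\<^sup>+y. ennreal ((cmod (F y))\<^sup>2 * exp (- (a * (norm y)\<^sup>2) / 2)) \<partial>lborel)
    \<le> K * (\<integral>\<^sup>+\<xi>. ennreal ((cmod (H \<xi>))\<^sup>2) \<partial>N)" if a: "a > 0" for a
  proof -
    define g where "g y = exp (- (a * (norm y)\<^sup>2) / 2)" for y :: 'a
    have gi: "integrable lborel g" unfolding g_def by (rule gaussian_integrable[OF a])
    then have gic: "integrable lborel (\<lambda>y. complex_of_real (g y))" by simp
    have [measurable]: "g \<in> borel_measurable borel" unfolding g_def by measurable
    have J: "integrable (lborel \<Otimes>\<^sub>M P) (\<lambda>(y, z). cis (y \<bullet> D z) * (complex_of_real (g y) * \<Phi> z))"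
      by (rule integrable_pair_mult_bounded[OF _ _ gic \<Phi>i]) (auto intro: lborel.sigma_finite_measure_axioms P.sigma_finite_measure_axioms)
    have Ji: "integrable lborel (\<lambda>y. LINT z|P. cis (y \<bullet> D z) * (complex_of_real (g y) * \<Phi> z))"
      using Q.integrable_fst'[OF J] by simp
    have e1: "(LINT z|P. cis (y \<bullet> D z) * (complex_of_real (g y) * \<Phi> z)) = complex_of_real (g y) * (LINT z|P. cis (y \<bullet> D z) * \<Phi> z)" for y
      by (subst integral_mult_right_zero[symmetric]) (simp add: mult_ac)
    have e2: "Re (LINT z|P. cis (y \<bullet> D z) * (complex_of_real (g y) * \<Phi> z)) = (cmod (F y))\<^sup>2 * g y" for y
      unfolding e1 FF by simp
    define k where "k z = sqrt (2 * pi / a) ^ DIM('a) * exp (- (norm (D z))\<^sup>2 / (2 * a))" for z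
    have k0: "k z \<ge> 0" for z using a by (simp add: k_def)
    have [measurable]: "k \<in> borel_measurable P" unfolding k_def by measurable
    have [measurable]: "(\<lambda>\<eta>. k (\<xi>, \<eta>)) \<in> borel_measurable N" "(\<lambda>\<eta>. k (\<eta>, \<xi>)) \<in> borel_measurable N" for \<xi>
      unfolding k_def D_def fst_conv snd_conv by measurable
    have \<Phi>ki: "integrable P (\<lambda>z. \<Phi> z * complex_of_real (k z))"
    proof (rule Bochner_Integration.integrable_bound)
      show "integrable P (\<lambda>z. complex_of_real (sqrt (2 * pi / a) ^ DIM('a)) * \<Phi> z)"
        by (intro integrable_mult_right \<Phi>i)
      have "k z \<le> sqrt (2 * pi / a) ^ DIM('a)" for z
        using a unfolding k_def by (intro mult_left_le) auto
      then have "cmod (\<Phi> z) * k z \<le> cmod (\<Phi> z) * sqrt (2 * pi / a) ^ DIM('a)" for z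
        by (intro mult_left_mono) auto
      moreover have "cmod (\<Phi> z * complex_of_real (k z)) = cmod (\<Phi> z) * k z"
        "cmod (complex_of_real (sqrt (2 * pi / a) ^ DIM('a)) * \<Phi> z) = cmod (\<Phi> z) * sqrt (2 * pi / a) ^ DIM('a)" for z
        using a k0[of z] by (simp_all only: norm_mult norm_of_real abs_of_nonneg mult.commute zero_le_power real_sqrt_ge_zero divide_nonneg_pos) (simp add: mult.commute)
      ultimately show "AE z in P. cmod (\<Phi> z * complex_of_real (k z)) \<le> cmod (complex_of_real (sqrt (2 * pi / a) ^ DIM('a)) * \<Phi> z)"
        by (simp only:) simp
    qed measurable
    have Fi: "integrable lborel (\<lambda>y. (cmod (F y))\<^sup>2 * g y)"
      using integrable_Re[OF Ji] unfolding e2 .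
    have "(LINT y|lborel. (cmod (F y))\<^sup>2 * g y) = Re (LINT y|lborel. LINT z|P. cis (y \<bullet> D z) * (complex_of_real (g y) * \<Phi> z))"
      unfolding e2[symmetric] using Ji by simp
    also have "(LINT y|lborel. LINT z|P. cis (y \<bullet> D z) * (complex_of_real (g y) * \<Phi> z))
       = (LINT z|P. LINT y|lborel. cis (y \<bullet> D z) * (complex_of_real (g y) * \<Phi> z))"
      using Q.Fubini_integral[OF J] by simp
    also have "\<dots> = (LINT z|P. \<Phi> z * complex_of_real (k z))"
    proof (intro Bochner_Integration.integral_cong refl)
      fix z
      have "(LINT y|lborel. cis (y \<bullet> D z) * (complex_of_real (g y) * \<Phi> z))
         = (LINT y|lborel. (cis (D z \<bullet> y) * complex_of_real (g y)) * \<Phi> z)"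
        by (simp add: mult_ac inner_commute)
      also have "\<dots> = complex_of_real (k z) * \<Phi> z"
        using gaussian_char(2)[OF a, of "D z"] by (simp add: g_def k_def)
      finally show "(LINT y|lborel. cis (y \<bullet> D z) * (complex_of_real (g y) * \<Phi> z)) = \<Phi> z * complex_of_real (k z)"
        by (simp add: mult.commute)
    qed
    finally have "ennreal (LINT y|lborel. (cmod (F y))\<^sup>2 * g y) \<le> ennreal (cmod (LINT z|P. \<Phi> z * complex_of_real (k z)))"
      by (intro ennreal_leI) (simp add: complex_Re_le_cmod)
    also have "\<dots> \<le> (\<integral>\<^sup>+z. ennreal (cmod (\<Phi> z * complex_of_real (k z))) \<partial>P)"
      by (rule integral_norm_bound_ennreal[OF \<Phi>ki])
    \<comment> \<open>The inequality between arithmetic and geometric mean separates the two factors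
      of \<open>H\<close>; each half is then integrated against the kernel in the other variable. As
      \<open>H\<close> vanishes outside \<open>S\<close>, the kernel may be restricted to
      \<open>S\<close>.\<close>
    also have "\<dots> \<le> (\<integral>\<^sup>+z. (ennreal ((cmod (H (fst z)))\<^sup>2) * (ennreal (k z) * indicator S (snd z))
        + ennreal ((cmod (H (snd z)))\<^sup>2) * (ennreal (k z) * indicator S (fst z))) / 2 \<partial>P)"
    proof (intro nn_integral_mono)
      fix z
      show "ennreal (cmod (\<Phi> z * complex_of_real (k z))) \<le> (ennreal ((cmod (H (fst z)))\<^sup>2) * (ennreal (k z) * indicator S (snd z))
        + ennreal ((cmod (H (snd z)))\<^sup>2) * (ennreal (k z) * indicator S (fst z))) / 2"
      proof (cases "fst z \<in> S \<and> snd z \<in> S")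
        case True
        have "cmod (H (fst z)) * cmod (H (snd z)) * k z \<le> ((cmod (H (fst z)))\<^sup>2 * k z + (cmod (H (snd z)))\<^sup>2 * k z) / 2"
          using mult_right_mono[OF sum_squares_bound[of "cmod (H (fst z))" "cmod (H (snd z))"] k0[of z]]
          by (simp add: field_simps)
        then have "ennreal (cmod (H (fst z)) * cmod (H (snd z)) * k z) \<le> ennreal (((cmod (H (fst z)))\<^sup>2 * k z + (cmod (H (snd z)))\<^sup>2 * k z) / 2)"
          by (rule ennreal_leI)
        then show ?thesis using True k0[of z]
          by (simp add: \<Phi>_def norm_mult ennreal_mult[symmetric] ennreal_plus[symmetric] divide_ennreal[symmetric] del: ennreal_plus)
      next
        case False
        then have "\<Phi> z = 0" using HS by (auto simp: \<Phi>_def)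
        then show ?thesis by simp
      qed
    qed
    also have "\<dots> = ((\<integral>\<^sup>+z. ennreal ((cmod (H (fst z)))\<^sup>2) * (ennreal (k z) * indicator S (snd z)) \<partial>P)
        + (\<integral>\<^sup>+z. ennreal ((cmod (H (snd z)))\<^sup>2) * (ennreal (k z) * indicator S (fst z)) \<partial>P)) / 2"
      by (simp add: nn_integral_divide nn_integral_add)
    also have "(\<integral>\<^sup>+z. ennreal ((cmod (H (fst z)))\<^sup>2) * (ennreal (k z) * indicator S (snd z)) \<partial>P)
       = (\<integral>\<^sup>+\<xi>. ennreal ((cmod (H \<xi>))\<^sup>2) * (\<integral>\<^sup>+\<eta>. ennreal (k (\<xi>, \<eta>)) * indicator S \<eta> \<partial>N) \<partial>N)"
      unfolding P_def
      by (subst N.nn_integral_fst[symmetric]) (auto simp: P_def[symmetric] nn_integral_cmult intro!: nn_integral_cong nn_integral_cmult)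
    also have "\<dots> \<le> (\<integral>\<^sup>+\<xi>. ennreal ((cmod (H \<xi>))\<^sup>2) * K \<partial>N)"
      using K[OF a] by (intro nn_integral_mono mult_left_mono) (auto simp: k_def D_def)
    also have "(\<integral>\<^sup>+z. ennreal ((cmod (H (snd z)))\<^sup>2) * (ennreal (k z) * indicator S (fst z)) \<partial>P)
       = (\<integral>\<^sup>+\<eta>. ennreal ((cmod (H \<eta>))\<^sup>2) * (\<integral>\<^sup>+\<xi>. ennreal (k (\<xi>, \<eta>)) * indicator S \<xi> \<partial>N) \<partial>N)"
      unfolding P_def
      by (subst NN.nn_integral_snd[symmetric]) (auto simp: P_def[symmetric] nn_integral_cmult intro!: nn_integral_cong nn_integral_cmult)
    also have "\<dots> \<le> (\<integral>\<^sup>+\<xi>. ennreal ((cmod (H \<xi>))\<^sup>2) * K \<partial>N)"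
      using K[OF a] by (intro nn_integral_mono mult_left_mono) (auto simp: k_def D_def norm_minus_commute)
    finally have "ennreal (LINT y|lborel. (cmod (F y))\<^sup>2 * g y) \<le> ((\<integral>\<^sup>+\<xi>. ennreal ((cmod (H \<xi>))\<^sup>2) * K \<partial>N) + (\<integral>\<^sup>+\<xi>. ennreal ((cmod (H \<xi>))\<^sup>2) * K \<partial>N)) / 2"
      by (simp add: divide_right_mono_ennreal add_mono)
    also have "\<dots> = (\<integral>\<^sup>+\<xi>. ennreal ((cmod (H \<xi>))\<^sup>2) * K \<partial>N)"
      by (rule ennreal_add_self_half)
    also have "\<dots> = K * (\<integral>\<^sup>+\<xi>. ennreal ((cmod (H \<xi>))\<^sup>2) \<partial>N)"
      by (subst nn_integral_multc) (auto simp: mult.commute)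
    finally show ?thesis
      using Fi by (subst nn_integral_eq_integral) (auto simp: g_def)
  qed
  \<comment> \<open>The Gaussian weight tends to 1 along \<open>a = 1 / (n + 1)\<close>, and Fatou's
    lemma carries the uniform bound over to the unweighted integral.\<close>
  define h where "h n y = ennreal ((cmod (F y))\<^sup>2 * exp (- (inverse (real (Suc n)) * (norm y)\<^sup>2) / 2))" for n :: nat and y
  have lim: "(\<lambda>n. h n y) \<longlonglongrightarrow> ennreal ((cmod (F y))\<^sup>2)" for y
  proof -
    have "(\<lambda>n. (cmod (F y))\<^sup>2 * exp (- (inverse (real (Suc n)) * (norm y)\<^sup>2) / 2)) \<longlonglongrightarrow> (cmod (F y))\<^sup>2 * exp (- (0 * (norm y)\<^sup>2) / 2)"
      by (intro tendsto_intros LIMSEQ_inverse_real_of_nat) auto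
    then show ?thesis unfolding h_def by (intro tendsto_ennrealI) simp
  qed
  have "(\<integral>\<^sup>+y. ennreal ((cmod (F y))\<^sup>2) \<partial>lborel) = (\<integral>\<^sup>+y. liminf (\<lambda>n. h n y) \<partial>lborel)"
    by (intro nn_integral_cong) (simp add: lim_imp_Liminf[OF _ lim])
  also have "\<dots> \<le> liminf (\<lambda>n. \<integral>\<^sup>+y. h n y \<partial>lborel)"
    by (rule nn_integral_liminf) (simp add: h_def)
  also have "\<dots> \<le> K * (\<integral>\<^sup>+\<xi>. ennreal ((cmod (H \<xi>))\<^sup>2) \<partial>N)"
    using main by (intro Liminf_le) (auto simp: h_def)
  finally show ?thesis by (simp add: F_def)
qed

lemma lborel_integral_affine:
  fixes f :: "'a::euclidean_space \<Rightarrow> 'b::{banach, second_countable_topology}"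
  assumes [measurable]: "f \<in> borel_measurable borel" and "c \<noteq> 0"
  shows "(LINT x|lborel. f x) = \<bar>c\<bar> ^ DIM('a) *\<^sub>R (LINT x|lborel. f (t + c *\<^sub>R x))"
  by (subst lborel_affine[OF assms(2), of t]) (simp add: integral_density integral_distr)

section \<open>Schwartz functions and Fourier inversion\<close>

text \<open>For each coordinate, one factor \<open>(1 + norm x)^2\<close> dominates
  \<open>1 + (x \<bullet> b)^2\<close>. The integral is thus controlled by a product of
  one-dimensional integrals of \<open>inverse (1 + x^2)\<close>, which explains the exponent
  \<open>2 * DIM('a)\<close>.\<close>

lemma poly_decay_integrable:
  "integrable lborel (\<lambda>x::'a::euclidean_space. 1 / (1 + norm x) ^ (2 * DIM('a)))"
proof -
  have "integrable lborel (\<lambda>x::real. inverse (1 + x\<^sup>2))"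
    using integrable_inverse_1_plus_square by (simp add: set_integrable_def)
  then have "integrable lborel (\<lambda>x::real. complex_of_real (inverse (1 + x\<^sup>2)))" by (rule integrable_of_real)
  then have i: "integrable lborel (\<lambda>x::'a. \<Prod>b\<in>Basis. complex_of_real (inverse (1 + (x \<bullet> b)\<^sup>2)))"
    by (intro lborel_integral_prod_Basis(1))
  show ?thesis
  proof (rule Bochner_Integration.integrable_bound[OF i])
    show "AE x::'a in lborel. norm (1 / (1 + norm x) ^ (2 * DIM('a))) \<le> norm (\<Prod>b\<in>Basis. complex_of_real (inverse (1 + (x \<bullet> b)\<^sup>2)))"
    proof (rule AE_I2)
      fix x :: 'a
      have "(\<Prod>b\<in>(Basis::'a set). inverse ((1 + norm x)\<^sup>2)) \<le> (\<Prod>b\<in>Basis. inverse (1 + (x \<bullet> b)\<^sup>2))"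
      proof (intro prod_mono conjI le_imp_inverse_le)
        fix b :: 'a assume "b \<in> Basis"
        then have "(x \<bullet> b)\<^sup>2 \<le> (norm x)\<^sup>2"
          using Basis_le_norm[of b x] by (metis abs_ge_zero power2_abs power_mono)
        then show "1 + (x \<bullet> b)\<^sup>2 \<le> (1 + norm x)\<^sup>2"
          using norm_ge_zero[of x] unfolding power2_sum power_one by linarith
        show "0 < 1 + (x \<bullet> b)\<^sup>2" by (simp add: add_pos_nonneg)
      qed auto
      also have "(\<Prod>b\<in>(Basis::'a set). inverse ((1 + norm x)\<^sup>2)) = 1 / (1 + norm x) ^ (2 * DIM('a))"
        by (simp add: power_mult power_one_over inverse_eq_divide)
      also have "(\<Prod>b\<in>Basis. inverse (1 + (x \<bullet> b)\<^sup>2)) = norm (\<Prod>b\<in>Basis. complex_of_real (inverse (1 + (x \<bullet> b)\<^sup>2)))"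
        unfolding of_real_prod[symmetric] norm_of_real
        by (intro abs_of_nonneg[symmetric] prod_nonneg) (auto simp: add_nonneg_nonneg)
      finally show "norm (1 / (1 + norm x) ^ (2 * DIM('a))) \<le> norm (\<Prod>b\<in>Basis. complex_of_real (inverse (1 + (x \<bullet> b)\<^sup>2)))"
        by (simp add: add_nonneg_nonneg)
    qed
  qed measurable
qed

lemma rapid_integrable:
  fixes f :: "'a::euclidean_space \<Rightarrow> complex"
  assumes [measurable]: "f \<in> borel_measurable borel"
    and "\<And>x. (1 + norm x) ^ (2 * DIM('a)) * cmod (f x) \<le> C"
  shows "integrable lborel f"
proof (rule Bochner_Integration.integrable_bound)
  show "integrable lborel (\<lambda>x::'a. C * (1 / (1 + norm x) ^ (2 * DIM('a))))"
    by (intro integrable_mult_right poly_decay_integrable)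
  show "AE x::'a in lborel. norm (f x) \<le> norm (C * (1 / (1 + norm x) ^ (2 * DIM('a))))"
  proof (rule AE_I2)
    fix x :: 'a
    have "0 < (1 + norm x) ^ (2 * DIM('a))" by (simp add: add_pos_nonneg)
    then have "norm (f x) \<le> C * (1 / (1 + norm x) ^ (2 * DIM('a)))"
      using assms(2)[of x] by (simp add: field_simps)
    then show "norm (f x) \<le> norm (C * (1 / (1 + norm x) ^ (2 * DIM('a))))"
      by (metis abs_ge_self order_trans real_norm_def)
  qed
qed simp

lemma iter_pderiv_append: "iter_pderiv is (iter_pderiv js \<phi>) = iter_pderiv (is @ js) \<phi>"
  by (induction "is") auto

lemma schwartz_pderiv: "\<phi> \<in> schwartz \<Longrightarrow> iter_pderiv js \<phi> \<in> schwartz"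
  unfolding schwartz_def by (auto simp: iter_pderiv_append)

lemma schwartz_differentiable: "\<phi> \<in> schwartz \<Longrightarrow> \<phi> differentiable (at x)"
  unfolding schwartz_def using iter_pderiv.simps(1)[of \<phi>] by (metis (mono_tags, lifting) mem_Collect_eq)

lemma schwartz_bound:
  assumes "\<phi> \<in> schwartz" obtains C where "0 \<le> C" "\<And>x. (1 + norm x) ^ N * cmod (\<phi> x) \<le> C"
proof -
  from assms have "bounded (range (\<lambda>x. (1 + norm x) ^ N *\<^sub>R iter_pderiv [] \<phi> x))"
    unfolding schwartz_def by blast
  then obtain C where C: "\<And>x. norm ((1 + norm x) ^ N *\<^sub>R \<phi> x) \<le> C"
    unfolding bounded_iff by auto
  then have "(1 + norm x) ^ N * cmod (\<phi> x) \<le> C" for x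
    by (metis abs_of_nonneg add_nonneg_nonneg norm_ge_zero norm_scaleR zero_le_one zero_le_power)
  moreover have "0 \<le> C" using C[of 0] norm_ge_zero order_trans by blast
  ultimately show ?thesis using that by blast
qed

lemma schwartz_continuous: "\<phi> \<in> schwartz \<Longrightarrow> isCont \<phi> x"
  by (intro differentiable_imp_continuous_within schwartz_differentiable)

lemma schwartz_measurable: "\<phi> \<in> schwartz \<Longrightarrow> \<phi> \<in> borel_measurable borel"
  by (intro borel_measurable_continuous_onI continuous_at_imp_continuous_on ballI schwartz_continuous)

lemma schwartz_integrable:
  fixes \<phi> :: "real^'n::finite \<Rightarrow> complex"
  assumes "\<phi> \<in> schwartz" shows "integrable lborel \<phi>"
proof -
  obtain C where "\<And>x. (1 + norm x) ^ (2 * DIM(real^'n)) * cmod (\<phi> x) \<le> C"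
    using schwartz_bound[OF assms] by blast
  then show ?thesis by (intro rapid_integrable[of _ C] schwartz_measurable assms)
qed

text \<open>The transform without normalising constant and with positive phase. Both
  \<open>fourier\<close> (at \<open>- \<xi>\<close>) and \<open>inv_fourier\<close> are constant
  multiples of it, so one set of estimates serves both.\<close>

definition ft :: "('a::euclidean_space \<Rightarrow> complex) \<Rightarrow> 'a \<Rightarrow> complex" where
  "ft \<phi> \<xi> = (LINT x|lborel. cis (\<xi> \<bullet> x) * \<phi> x)"

lemma integrable_cis_mult:
  fixes f :: "'a \<Rightarrow> complex"
  assumes "integrable M f" and [measurable]: "g \<in> borel_measurable M"
  shows "integrable M (\<lambda>x. cis (g x) * f x)"
  by (rule Bochner_Integration.integrable_bound[OF assms(1)])
    (use borel_measurable_integrable[OF assms(1)] in \<open>auto simp: norm_mult\<close>)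

lemma ft_measurable [measurable]:
  assumes [measurable]: "\<phi> \<in> borel_measurable borel" shows "ft \<phi> \<in> borel_measurable borel"
  unfolding ft_def by measurable

lemma ft_bounded: "cmod (ft \<phi> \<xi>) \<le> (LINT x|lborel. cmod (\<phi> x))"
  unfolding ft_def by (rule order_trans[OF integral_norm_bound]) (simp add: norm_mult)

lemma ft_isCont:
  fixes \<phi> :: "'a::euclidean_space \<Rightarrow> complex"
  assumes "integrable lborel \<phi>" shows "isCont (ft \<phi>) \<xi>"
proof -
  have [measurable]: "\<phi> \<in> borel_measurable borel" using assms by auto
  show ?thesis
    unfolding continuous_at_sequentially comp_def ft_def
  proof (intro allI impI)
    fix X assume "X \<longlonglongrightarrow> \<xi>"
    then show "(\<lambda>n. LINT x|lborel. cis (X n \<bullet> x) * \<phi> x) \<longlonglongrightarrow> (LINT x|lborel. cis (\<xi> \<bullet> x) * \<phi> x)"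
      by (intro integral_dominated_convergence[where w="\<lambda>x. cmod (\<phi> x)"])
        (use assms in \<open>auto simp: norm_mult intro!: tendsto_intros\<close>)
  qed
qed

text \<open>A majorant for the difference quotients of \<open>\<phi>\<close>, integrable for large
  \<open>N\<close>. It is the mean value inequality on a segment of length at most 1, at each point
  of which \<open>1 + norm x\<close> is at most doubled by passing back to its end point
  \<open>x\<close>.\<close>

lemma pderiv_diff_bound:
  fixes \<phi> :: "real^'n::finite \<Rightarrow> complex"
  assumes "\<phi> \<in> schwartz" and C: "\<And>x. (1 + norm x) ^ N * cmod (iter_pderiv [i] \<phi> x) \<le> C"
    and h: "0 < h" "h \<le> 1"
  shows "cmod (\<phi> (x + h *\<^sub>R axis i 1) - \<phi> x) \<le> h * (C * 2 ^ N / (1 + norm x) ^ N)"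
proof -
  let ?e = "axis i 1 :: real^'n"
  define g where "g s = \<phi> (x + s *\<^sub>R ?e)" for s
  have der: "(\<phi> has_derivative frechet_derivative \<phi> (at y)) (at y)" for y
    using schwartz_differentiable[OF assms(1)] frechet_derivative_works by blast
  have gd: "(g has_derivative (\<lambda>t. t *\<^sub>R iter_pderiv [i] \<phi> (x + s *\<^sub>R ?e))) (at s within {0..h})" for s
  proof -
    have "(g has_derivative (\<lambda>t. frechet_derivative \<phi> (at (x + s *\<^sub>R ?e)) (t *\<^sub>R ?e))) (at s within {0..h})"
      unfolding g_def
      by (rule has_derivative_compose[OF _ der]) (auto intro!: derivative_eq_intros)
    moreover have "frechet_derivative \<phi> (at (x + s *\<^sub>R ?e)) (t *\<^sub>R ?e) = t *\<^sub>R iter_pderiv [i] \<phi> (x + s *\<^sub>R ?e)" for t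
      using linear_frechet_derivative[OF schwartz_differentiable[OF assms(1)]]
      by (simp add: linear_cmul)
    ultimately show ?thesis by simp
  qed
  have "cmod (g h - g 0) \<le> (C * 2 ^ N / (1 + norm x) ^ N) * norm (h - 0)"
  proof (rule differentiable_bound[OF _ gd])
    fix s assume s: "s \<in> {0..h}"
    have "norm x \<le> norm (x + s *\<^sub>R ?e) + norm (s *\<^sub>R ?e)"
      by (metis add_diff_cancel_right' norm_triangle_ineq4)
    then have "1 + norm x \<le> 2 * (1 + norm (x + s *\<^sub>R ?e))"
    proof -
      have "norm (s *\<^sub>R ?e) \<le> 1" using s h by simp
      then show ?thesis
        using \<open>norm x \<le> norm (x + s *\<^sub>R ?e) + norm (s *\<^sub>R ?e)\<close> norm_ge_zero[of "x + s *\<^sub>R ?e"] by argo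
    qed
    then have "(1 + norm x) ^ N \<le> 2 ^ N * (1 + norm (x + s *\<^sub>R ?e)) ^ N"
      unfolding power_mult_distrib[symmetric] by (intro power_mono) auto
    then have "(1 + norm x) ^ N * cmod (iter_pderiv [i] \<phi> (x + s *\<^sub>R ?e))
       \<le> 2 ^ N * (1 + norm (x + s *\<^sub>R ?e)) ^ N * cmod (iter_pderiv [i] \<phi> (x + s *\<^sub>R ?e))"
      by (rule mult_right_mono) auto
    also have "\<dots> \<le> 2 ^ N * C" using C[of "x + s *\<^sub>R ?e"] by (simp add: mult.assoc)
    finally have "cmod (iter_pderiv [i] \<phi> (x + s *\<^sub>R ?e)) \<le> C * 2 ^ N / (1 + norm x) ^ N"
      by (simp add: pos_le_divide_eq add_pos_nonneg mult.commute)
    note le = this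
    show "onorm (\<lambda>t. t *\<^sub>R iter_pderiv [i] \<phi> (x + s *\<^sub>R ?e)) \<le> C * 2 ^ N / (1 + norm x) ^ N"
    proof (rule onorm_le)
      fix t :: real
      show "norm (t *\<^sub>R iter_pderiv [i] \<phi> (x + s *\<^sub>R ?e)) \<le> C * 2 ^ N / (1 + norm x) ^ N * norm t"
        using mult_right_mono[OF le abs_ge_zero[of t]] by (simp only: norm_scaleR real_norm_def mult.commute)
    qed
  qed (use h in auto)
  then show ?thesis using h by (simp add: g_def mult.commute)
qed

text \<open>Integration by parts through difference quotients: translating \<open>\<phi>\<close> by
  \<open>h\<close> multiplies its transform by a phase, whose difference quotient tends to
  \<open>- \<i>\<close> times the frequency. On the other side dominated convergence
  applies.\<close>

lemma ft_pderiv: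
  fixes \<phi> :: "real^'n::finite \<Rightarrow> complex"
  assumes "\<phi> \<in> schwartz"
  shows "ft (iter_pderiv [i] \<phi>) \<xi> = - \<i> * complex_of_real (\<xi> $ i) * ft \<phi> \<xi>"
proof -
  let ?e = "axis i 1 :: real^'n"
  define N where "N = 2 * DIM(real^'n)"
  obtain C where C: "\<And>x. (1 + norm x) ^ N * cmod (iter_pderiv [i] \<phi> x) \<le> C"
    using schwartz_bound[OF schwartz_pderiv[OF assms]] by blast
  define h where "h n = inverse (real (Suc n))" for n
  have h: "0 < h n" "h n \<le> 1" for n by (auto simp: h_def inverse_le_1_iff)
  have h0: "h \<longlonglongrightarrow> 0" unfolding h_def by (rule LIMSEQ_inverse_real_of_nat)
  have [measurable]: "\<phi> \<in> borel_measurable borel" "iter_pderiv [i] \<phi> \<in> borel_measurable borel"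
    using assms schwartz_measurable schwartz_pderiv by blast+
  have \<phi>i: "integrable lborel \<phi>" by (rule schwartz_integrable[OF assms])
  have sh: "integrable lborel (\<lambda>x. \<phi> (x + c))" for c
    using \<phi>i by (subst (asm) lborel_distr_plus[symmetric, of c]) (simp add: integrable_distr_eq add.commute)
  define D where "D n x = (\<phi> (x + h n *\<^sub>R ?e) - \<phi> x) / complex_of_real (h n)" for n x
  have "(\<lambda>n. LINT x|lborel. cis (\<xi> \<bullet> x) * D n x) \<longlonglongrightarrow> (LINT x|lborel. cis (\<xi> \<bullet> x) * iter_pderiv [i] \<phi> x)"
  proof (rule integral_dominated_convergence[where w="\<lambda>x. C * 2 ^ N * (1 / (1 + norm x) ^ N)"])
    show "integrable lborel (\<lambda>x::real^'n. C * 2 ^ N * (1 / (1 + norm x) ^ N))"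
      unfolding N_def by (intro integrable_mult_right poly_decay_integrable)
    show "AE x in lborel. (\<lambda>n. cis (\<xi> \<bullet> x) * D n x) \<longlonglongrightarrow> cis (\<xi> \<bullet> x) * iter_pderiv [i] \<phi> x"
    proof (intro AE_I2 tendsto_intros)
      fix x
      have "((\<lambda>s. \<phi> (x + s *\<^sub>R ?e)) has_derivative (\<lambda>t. frechet_derivative \<phi> (at (x + 0 *\<^sub>R ?e)) (t *\<^sub>R ?e))) (at 0)"
        using schwartz_differentiable[OF assms] frechet_derivative_works
        by (intro has_derivative_compose[of "\<lambda>s. x + s *\<^sub>R ?e" "\<lambda>t. t *\<^sub>R ?e" _ _ \<phi>]) (auto intro!: derivative_eq_intros)
      then have "((\<lambda>s. \<phi> (x + s *\<^sub>R ?e)) has_vector_derivative iter_pderiv [i] \<phi> x) (at 0)"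
        using linear_frechet_derivative[OF schwartz_differentiable[OF assms], of x]
        by (simp add: has_vector_derivative_def linear_cmul)
      then have "((\<lambda>s. norm (\<phi> (x + s *\<^sub>R ?e) - \<phi> x - s *\<^sub>R iter_pderiv [i] \<phi> x) / norm s) \<longlongrightarrow> 0) (at 0)"
        unfolding has_vector_derivative_def has_derivative_at by simp
      then have "(\<lambda>n. norm (\<phi> (x + h n *\<^sub>R ?e) - \<phi> x - h n *\<^sub>R iter_pderiv [i] \<phi> x) / norm (h n)) \<longlonglongrightarrow> 0"
        by (rule filterlim_compose) (use h h0 in \<open>auto simp: filterlim_at less_imp_neq[THEN not_sym]\<close>)
      moreover have "norm (\<phi> (x + h n *\<^sub>R ?e) - \<phi> x - h n *\<^sub>R iter_pderiv [i] \<phi> x) / norm (h n) = norm (D n x - iter_pderiv [i] \<phi> x)" for n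
      proof -
        have "D n x - iter_pderiv [i] \<phi> x = (\<phi> (x + h n *\<^sub>R ?e) - \<phi> x - h n *\<^sub>R iter_pderiv [i] \<phi> x) / complex_of_real (h n)"
          using h[of n] by (simp add: D_def scaleR_conv_of_real diff_divide_distrib)
        then show ?thesis using h[of n] by (simp add: norm_divide)
      qed
      ultimately show "(\<lambda>n. D n x) \<longlonglongrightarrow> iter_pderiv [i] \<phi> x"
        by (simp add: tendsto_norm_zero_iff LIM_zero_iff)
    qed
    show "AE x in lborel. norm (cis (\<xi> \<bullet> x) * D n x) \<le> C * 2 ^ N * (1 / (1 + norm x) ^ N)" for n
    proof (rule AE_I2)
      fix x
      have "norm (D n x) = cmod (\<phi> (x + h n *\<^sub>R ?e) - \<phi> x) / h n"
        using h[of n] by (simp add: D_def norm_divide)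
      also have "\<dots> \<le> C * 2 ^ N / (1 + norm x) ^ N"
        using pderiv_diff_bound[OF assms C h[of n], of x] h[of n] by (simp add: pos_divide_le_eq mult.commute)
      finally show "norm (cis (\<xi> \<bullet> x) * D n x) \<le> C * 2 ^ N * (1 / (1 + norm x) ^ N)"
        by (simp add: norm_mult)
    qed
  qed (auto simp: D_def simp del: iter_pderiv.simps)
  moreover have "(LINT x|lborel. cis (\<xi> \<bullet> x) * D n x) = (cis (0 - h n * (\<xi> $ i)) - cis 0) / complex_of_real (h n) * ft \<phi> \<xi>" for n
  proof -
    have "(LINT x|lborel. cis (\<xi> \<bullet> x) * \<phi> (x + h n *\<^sub>R ?e)) = (LINT x|lborel. cis (\<xi> \<bullet> (x - h n *\<^sub>R ?e)) * \<phi> x)"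
      by (subst (2) lborel_distr_plus[symmetric, of "h n *\<^sub>R ?e"]) (simp add: integral_distr add.commute)
    also have "\<dots> = cis (0 - h n * (\<xi> $ i)) * ft \<phi> \<xi>"
      unfolding ft_def
      by (subst integral_mult_right_zero[symmetric])
        (simp add: inner_diff_right inner_axis cis_mult mult.assoc[symmetric] algebra_simps)
    finally have "(LINT x|lborel. cis (\<xi> \<bullet> x) * \<phi> (x + h n *\<^sub>R ?e)) - ft \<phi> \<xi> = (cis (0 - h n * (\<xi> $ i)) - cis 0) * ft \<phi> \<xi>"
      by (simp add: left_diff_distrib)
    moreover have "(LINT x|lborel. cis (\<xi> \<bullet> x) * \<phi> (x + h n *\<^sub>R ?e)) - ft \<phi> \<xi>
       = (LINT x|lborel. cis (\<xi> \<bullet> x) * \<phi> (x + h n *\<^sub>R ?e) - cis (\<xi> \<bullet> x) * \<phi> x)"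
      unfolding ft_def
      by (subst Bochner_Integration.integral_diff) (auto intro!: integrable_cis_mult sh \<phi>i)
    moreover have "(LINT x|lborel. cis (\<xi> \<bullet> x) * D n x) = (LINT x|lborel. (cis (\<xi> \<bullet> x) * \<phi> (x + h n *\<^sub>R ?e) - cis (\<xi> \<bullet> x) * \<phi> x)) / complex_of_real (h n)"
      by (subst integral_divide_zero[symmetric]) (simp add: D_def right_diff_distrib)
    ultimately show ?thesis by simp
  qed
  moreover have "(\<lambda>n. (cis (0 - h n * (\<xi> $ i)) - cis 0) / complex_of_real (h n) * ft \<phi> \<xi>) \<longlonglongrightarrow> - \<i> * complex_of_real (\<xi> $ i) * ft \<phi> \<xi>"
  proof (intro tendsto_mult tendsto_const)
    have "((\<lambda>s. exp (\<i> * (- complex_of_real (\<xi> $ i)) * s)) has_field_derivative (\<i> * (- complex_of_real (\<xi> $ i)))) (at 0)"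
      by (auto intro!: derivative_eq_intros)
    then have "((\<lambda>s. (exp (\<i> * (- complex_of_real (\<xi> $ i)) * s) - 1) / s) \<longlongrightarrow> \<i> * (- complex_of_real (\<xi> $ i))) (at 0)"
      by (simp add: has_field_derivative_iff)
    then have "(\<lambda>n. (exp (\<i> * (- complex_of_real (\<xi> $ i)) * complex_of_real (h n)) - 1) / complex_of_real (h n)) \<longlonglongrightarrow> \<i> * (- complex_of_real (\<xi> $ i))"
      by (rule filterlim_compose) (use h h0 in \<open>auto simp: filterlim_at less_imp_neq[THEN not_sym] tendsto_of_real_iff[where 'a=complex, of _ 0, simplified]\<close>)
    then show "(\<lambda>n. (cis (0 - h n * (\<xi> $ i)) - cis 0) / complex_of_real (h n)) \<longlonglongrightarrow> - \<i> * complex_of_real (\<xi> $ i)"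
      by (simp add: cis_conv_exp mult_ac)
  qed
  ultimately show ?thesis
    using LIMSEQ_unique by (fastforce simp: ft_def)
qed

text \<open>Each derivative of \<open>\<phi>\<close> buys one power of the frequency, because
  \<open>norm \<xi>\<close> is at most the sum of the moduli of its coordinates.\<close>

lemma ft_schwartz_decay0:
  fixes \<phi> :: "real^'n::finite \<Rightarrow> complex"
  shows "\<phi> \<in> schwartz \<Longrightarrow> \<exists>C. \<forall>\<xi>. norm \<xi> ^ N * cmod (ft \<phi> \<xi>) \<le> C"
proof (induction N arbitrary: \<phi>)
  case 0
  then show ?case using ft_bounded[of \<phi>] by auto
next
  case (Suc N)
  have "\<forall>i. \<exists>C. \<forall>\<xi>. norm \<xi> ^ N * cmod (ft (iter_pderiv [i] \<phi>) \<xi>) \<le> C"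
    using Suc.IH Suc.prems schwartz_pderiv by blast
  then obtain C where C: "\<And>i \<xi>. norm \<xi> ^ N * cmod (ft (iter_pderiv [i] \<phi>) \<xi>) \<le> C i" by metis
  have "norm \<xi> ^ Suc N * cmod (ft \<phi> \<xi>) \<le> (\<Sum>i\<in>UNIV. C i)" for \<xi>
  proof -
    have "norm \<xi> ^ Suc N * cmod (ft \<phi> \<xi>) = norm \<xi> * (norm \<xi> ^ N * cmod (ft \<phi> \<xi>))" by simp
    also have "\<dots> \<le> (\<Sum>i\<in>UNIV. \<bar>\<xi> $ i\<bar>) * (norm \<xi> ^ N * cmod (ft \<phi> \<xi>))"
      by (intro mult_right_mono norm_le_l1_cart) auto
    also have "\<dots> = (\<Sum>i\<in>UNIV. norm \<xi> ^ N * cmod (ft (iter_pderiv [i] \<phi>) \<xi>))"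
      by (simp only: ft_pderiv[OF Suc.prems] norm_mult norm_of_real sum_distrib_right) (simp add: mult_ac)
    also have "\<dots> \<le> (\<Sum>i\<in>UNIV. C i)" by (intro sum_mono C)
    finally show ?thesis .
  qed
  then show ?case by blast
qed

lemma one_plus_power_le: "0 \<le> t \<Longrightarrow> (1 + t) ^ N \<le> 2 ^ N * (1 + t ^ N)" for t :: real
proof -
  assume t: "0 \<le> t"
  have "(1 + t) ^ N \<le> (2 * max 1 t) ^ N" using t by (intro power_mono) auto
  also have "\<dots> = 2 ^ N * (max 1 t) ^ N" by (simp add: power_mult_distrib)
  also have "(max 1 t) ^ N \<le> 1 + t ^ N" using t by (cases "t \<le> 1") (auto simp: max_def)
  finally show ?thesis by simp
qed

lemma ft_schwartz_decay:
  fixes \<phi> :: "real^'n::finite \<Rightarrow> complex"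
  assumes "\<phi> \<in> schwartz"
  obtains C where "\<And>\<xi>. (1 + norm \<xi>) ^ N * cmod (ft \<phi> \<xi>) \<le> C"
proof -
  obtain C0 CN where C: "\<And>\<xi>. cmod (ft \<phi> \<xi>) \<le> C0" "\<And>\<xi>. norm \<xi> ^ N * cmod (ft \<phi> \<xi>) \<le> CN"
    using ft_schwartz_decay0[OF assms, of N] ft_bounded[of \<phi>] by blast
  have "(1 + norm \<xi>) ^ N * cmod (ft \<phi> \<xi>) \<le> 2 ^ N * (C0 + CN)" for \<xi>
  proof -
    have "(1 + norm \<xi>) ^ N * cmod (ft \<phi> \<xi>) \<le> 2 ^ N * (1 + norm \<xi> ^ N) * cmod (ft \<phi> \<xi>)"
      by (intro mult_right_mono one_plus_power_le) auto
    also have "\<dots> = 2 ^ N * (cmod (ft \<phi> \<xi>) + norm \<xi> ^ N * cmod (ft \<phi> \<xi>))" by (simp add: algebra_simps)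
    also have "\<dots> \<le> 2 ^ N * (C0 + CN)" by (intro mult_left_mono add_mono C) auto
    finally show ?thesis .
  qed
  then show ?thesis using that by blast
qed

section \<open>Fourier inversion\<close>

lemma gaussian_approx_identity:
  fixes \<psi> :: "'a::euclidean_space \<Rightarrow> complex"
  assumes [measurable]: "\<psi> \<in> borel_measurable borel" and B: "\<And>x. cmod (\<psi> x) \<le> B" and "isCont \<psi> x"
  shows "(\<lambda>k. LINT y|lborel. \<psi> y * complex_of_real (sqrt (real (Suc k)) ^ DIM('a) * exp (- (real (Suc k) * (norm (x - y))\<^sup>2) / 2)))
    \<longlonglongrightarrow> \<psi> x * complex_of_real (sqrt (2 * pi) ^ DIM('a))"
proof -
  let ?g = "\<lambda>z::'a. exp (- (1 * (norm z)\<^sup>2) / 2)"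
  define r where "r k = inverse (sqrt (real (Suc k)))" for k
  have r: "r k > 0" for k by (simp add: r_def)
  have "r \<longlonglongrightarrow> 0" unfolding r_def
    by (intro tendsto_inverse_0_at_top filterlim_compose[OF sqrt_at_top] filterlim_compose[OF filterlim_real_sequentially] filterlim_Suc)
  have e: "(LINT y|lborel. \<psi> y * complex_of_real (sqrt (real (Suc k)) ^ DIM('a) * exp (- (real (Suc k) * (norm (x - y))\<^sup>2) / 2)))
     = (LINT z|lborel. \<psi> (x + r k *\<^sub>R z) * complex_of_real (?g z))" (is "?L = _") for k
  proof -
    have sq: "real (Suc k) * (norm (r k *\<^sub>R z))\<^sup>2 = (norm z)\<^sup>2" for z :: 'a
      by (simp add: r_def power_mult_distrib power_inverse del: of_nat_Suc)
    have "?L = \<bar>r k\<bar> ^ DIM('a) *\<^sub>R (LINT z|lborel. \<psi> (x + r k *\<^sub>R z) * complex_of_real (sqrt (real (Suc k)) ^ DIM('a) * exp (-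
      (real (Suc k) * (norm (x - (x + r k *\<^sub>R z)))\<^sup>2) / 2)))"
      using r[of k] by (intro lborel_integral_affine) auto
    also have "\<dots> = \<bar>r k\<bar> ^ DIM('a) *\<^sub>R (LINT z|lborel. complex_of_real (sqrt (real (Suc k)) ^ DIM('a)) * (\<psi> (x + r k *\<^sub>R z) * complex_of_real (?g z)))"
      using sq by (intro arg_cong[where f="\<lambda>u. _ *\<^sub>R u"] Bochner_Integration.integral_cong) (auto simp: mult_ac)
    also have "\<dots> = complex_of_real ((r k * sqrt (real (Suc k))) ^ DIM('a)) * (LINT z|lborel. (\<psi> (x + r k *\<^sub>R z) * complex_of_real (?g z)))"
      using r[of k] by (simp add: scaleR_conv_of_real power_mult_distrib del: of_nat_Suc)
    also have "r k * sqrt (real (Suc k)) = 1" by (simp add: r_def)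
    finally show ?thesis by simp
  qed
  have "(\<lambda>k. LINT z|lborel. \<psi> (x + r k *\<^sub>R z) * complex_of_real (?g z)) \<longlonglongrightarrow> (LINT z|lborel. \<psi> x * complex_of_real (?g z))"
  proof (rule integral_dominated_convergence[where w="\<lambda>z. B * ?g z"])
    show "integrable lborel (\<lambda>z. B * ?g z)" by (intro integrable_mult_right gaussian_integrable) simp
    show "AE z in lborel. (\<lambda>k. \<psi> (x + r k *\<^sub>R z) * complex_of_real (?g z)) \<longlonglongrightarrow> \<psi> x * complex_of_real (?g z)"
    proof (intro AE_I2 tendsto_intros)
      fix z
      have "(\<lambda>k. x + r k *\<^sub>R z) \<longlonglongrightarrow> x + 0 *\<^sub>R z" by (intro tendsto_intros \<open>r \<longlonglongrightarrow> 0\<close>)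
      then show "(\<lambda>k. \<psi> (x + r k *\<^sub>R z)) \<longlonglongrightarrow> \<psi> x"
        using isCont_tendsto_compose[OF assms(3)] by simp
    qed
    show "AE z in lborel. norm (\<psi> (x + r k *\<^sub>R z) * complex_of_real (?g z)) \<le> B * ?g z" for k
      by (auto simp: norm_mult intro!: AE_I2 mult_right_mono B)
  qed auto
  moreover have "(LINT z|lborel. \<psi> x * complex_of_real (?g z)) = \<psi> x * complex_of_real (sqrt (2 * pi) ^ DIM('a))"
    using gaussian_integral[of 1, where 'a='a] by simp
  ultimately show ?thesis unfolding e by (simp only:)
qed

lemma fourier_eq_ft: "fourier \<phi> \<xi> = complex_of_real ((2 * pi) powr (- real CARD('n) / 2)) * ft \<phi> (- \<xi>)"
  for \<phi> :: "real^'n::finite \<Rightarrow> complex"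
  unfolding fourier_def ft_def by (simp add: inner_commute)

lemma inv_fourier_eq_ft: "inv_fourier \<phi> x = complex_of_real ((2 * pi) powr (- real CARD('n) / 2)) * ft \<phi> x"
  for \<phi> :: "real^'n::finite \<Rightarrow> complex"
  unfolding inv_fourier_def ft_def ..

lemma two_pi_powr_sq: "sqrt (2 * pi) ^ n * (2 * pi) powr (- real n / 2) = 1"
proof -
  have 1: "sqrt (2 * pi) = (2 * pi) powr (1 / 2)" by (rule powr_half_sqrt[symmetric]) simp
  have "sqrt (2 * pi) ^ n = ((2 * pi) powr (1 / 2)) powr real n"
    unfolding 1 by (rule powr_realpow[symmetric]) simp
  then have "sqrt (2 * pi) ^ n = (2 * pi) powr (real n / 2)" by (simp only: powr_powr) simp
  then have "sqrt (2 * pi) ^ n * (2 * pi) powr (- real n / 2) = (2 * pi) powr (real n / 2 + - real n / 2)"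
    by (simp only: powr_add)
  then show ?thesis by simp
qed

text \<open>A Gaussian factor that widens with \<open>k\<close> is inserted into the inversion
  integral. By dominated convergence the result tends to the inversion integral
  (\<open>lim1\<close>); by Fubini it equals an average of \<open>\<phi>\<close> against a Gaussian
  concentrating at \<open>x\<close> (\<open>eq\<close>, \<open>lim2\<close>).\<close>

lemma inv_fourier_fourier:
  fixes \<phi> :: "real^'n::finite \<Rightarrow> complex"
  assumes \<phi>: "\<phi> \<in> schwartz"
  shows "inv_fourier (fourier \<phi>) = \<phi>"
proof
  fix x :: "real^'n"
  let ?n = "DIM(real^'n)"
  have [measurable]: "\<phi> \<in> borel_measurable borel" by (rule schwartz_measurable[OF \<phi>])
  have \<phi>i: "integrable lborel \<phi>" by (rule schwartz_integrable[OF \<phi>])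
  define F where "F \<xi> = ft \<phi> (- \<xi>)" for \<xi>
  have [measurable]: "F \<in> borel_measurable borel" unfolding F_def by measurable
  obtain C where "\<And>\<xi>. (1 + norm \<xi>) ^ (2 * ?n) * cmod (ft \<phi> \<xi>) \<le> C"
    using ft_schwartz_decay[OF \<phi>] by blast
  then have "(1 + norm \<xi>) ^ (2 * ?n) * cmod (F \<xi>) \<le> C" for \<xi>
    unfolding F_def by (metis norm_minus_cancel)
  then have Fi: "integrable lborel F" by (intro rapid_integrable) auto
  obtain B where B: "\<And>x. cmod (\<phi> x) \<le> B"
    using schwartz_bound[OF \<phi>, of 0] by auto
  define a where "a k = inverse (real (Suc k))" for k
  have a: "a k > 0" for k by (simp add: a_def)
  let ?G = "\<lambda>k y. LINT \<xi>|lborel. cis (x \<bullet> \<xi>) * (F \<xi> * complex_of_real (exp (- (a k * (norm \<xi>)\<^sup>2) / 2)))"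
  have lim1: "(\<lambda>k. LINT \<xi>|lborel. cis (x \<bullet> \<xi>) * (F \<xi> * complex_of_real (exp (- (a k * (norm \<xi>)\<^sup>2) / 2))))
    \<longlonglongrightarrow> (LINT \<xi>|lborel. cis (x \<bullet> \<xi>) * F \<xi>)"
  proof (rule integral_dominated_convergence[where w="\<lambda>\<xi>. cmod (F \<xi>)"])
    show "AE \<xi> in lborel. (\<lambda>k. cis (x \<bullet> \<xi>) * (F \<xi> * complex_of_real (exp (- (a k * (norm \<xi>)\<^sup>2) / 2)))) \<longlonglongrightarrow> cis (x \<bullet> \<xi>) * F \<xi>"
    proof (rule AE_I2)
      fix \<xi>
      have "(\<lambda>k. cis (x \<bullet> \<xi>) * (F \<xi> * complex_of_real (exp (- (a k * (norm \<xi>)\<^sup>2) / 2)))) \<longlonglongrightarrow> cis (x \<bullet> \<xi>) * (F \<xi> * complex_of_real (exp (- (0 * (norm \<xi>)\<^sup>2) / 2)))"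
        unfolding a_def by (intro tendsto_intros LIMSEQ_inverse_real_of_nat) auto
      then show "(\<lambda>k. cis (x \<bullet> \<xi>) * (F \<xi> * complex_of_real (exp (- (a k * (norm \<xi>)\<^sup>2) / 2)))) \<longlonglongrightarrow> cis (x \<bullet> \<xi>) * F \<xi>" by simp
    qed
    show "AE \<xi> in lborel. cmod (cis (x \<bullet> \<xi>) * (F \<xi> * complex_of_real (exp (- (a k * (norm \<xi>)\<^sup>2) / 2)))) \<le> cmod (F \<xi>)" for k
      using a[of k] by (intro AE_I2) (auto simp: norm_mult intro!: mult_left_le)
  qed (use Fi in auto)
  have eq: "(LINT \<xi>|lborel. cis (x \<bullet> \<xi>) * (F \<xi> * complex_of_real (exp (- (a k * (norm \<xi>)\<^sup>2) / 2))))
     = (LINT y|lborel. \<phi> y * complex_of_real (sqrt (real (Suc k)) ^ ?n * exp (- (real (Suc k) * (norm (x - y))\<^sup>2) / 2))) * complex_of_real (sqrt (2 * pi) ^ ?n)" for k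
  proof -
    let ?g = "\<lambda>\<xi>::real^'n. complex_of_real (exp (- (a k * (norm \<xi>)\<^sup>2) / 2))"
    have gi: "integrable lborel ?g" by (intro integrable_of_real gaussian_integrable a)
    have J: "integrable (lborel \<Otimes>\<^sub>M lborel) (\<lambda>(\<xi>, y). cis ((x - y) \<bullet> \<xi>) * (?g \<xi> * \<phi> y))"
      by (rule integrable_pair_mult_bounded[OF _ _ gi \<phi>i]) (auto intro: lborel.sigma_finite_measure_axioms)
    have "(LINT \<xi>|lborel. cis (x \<bullet> \<xi>) * (F \<xi> * ?g \<xi>)) = (LINT \<xi>|lborel. LINT y|lborel. cis ((x - y) \<bullet> \<xi>) * (?g \<xi> * \<phi> y))"
    proof (intro Bochner_Integration.integral_cong refl)
      fix \<xi>
      have "cis (x \<bullet> \<xi>) * (F \<xi> * ?g \<xi>) = (LINT y|lborel. (cis (x \<bullet> \<xi>) * ?g \<xi>) * (cis ((- \<xi>) \<bullet> y) * \<phi> y))"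
        unfolding F_def ft_def by (subst integral_mult_right_zero) (simp add: mult_ac)
      also have "\<dots> = (LINT y|lborel. cis ((x - y) \<bullet> \<xi>) * (?g \<xi> * \<phi> y))"
        by (intro Bochner_Integration.integral_cong refl)
          (simp add: inner_diff_left cis_diff cis_cnj inner_commute[of \<xi>] mult_ac)
      finally show "cis (x \<bullet> \<xi>) * (F \<xi> * ?g \<xi>) = (LINT y|lborel. cis ((x - y) \<bullet> \<xi>) * (?g \<xi> * \<phi> y))" .
    qed
    also have "\<dots> = (LINT y|lborel. LINT \<xi>|lborel. cis ((x - y) \<bullet> \<xi>) * (?g \<xi> * \<phi> y))"
      using lborel_pair.Fubini_integral[OF J] by simp
    also have "\<dots> = (LINT y|lborel. (\<phi> y * complex_of_real (sqrt (real (Suc k)) ^ ?n * exp (- (real (Suc k) * (norm (x - y))\<^sup>2) /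
      2))) * complex_of_real (sqrt (2 * pi) ^ ?n))"
    proof (intro Bochner_Integration.integral_cong refl)
      fix y
      have "(LINT \<xi>|lborel. cis ((x - y) \<bullet> \<xi>) * (?g \<xi> * \<phi> y)) = (LINT \<xi>|lborel. (cis ((x - y) \<bullet> \<xi>) * ?g \<xi>) * \<phi> y)"
        by (simp only: mult.assoc)
      also have "\<dots> = complex_of_real (sqrt (2 * pi / a k) ^ ?n * exp (- (norm (x - y))\<^sup>2 / (2 * a k))) * \<phi> y"
        by (simp only: integral_mult_left_zero gaussian_char(2)[OF a])
      finally have A: "(LINT \<xi>|lborel. cis ((x - y) \<bullet> \<xi>) * (?g \<xi> * \<phi> y))
        = complex_of_real (sqrt (2 * pi / a k) ^ ?n * exp (- (norm (x - y))\<^sup>2 / (2 * a k))) * \<phi> y" .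
      have B: "sqrt (2 * pi / a k) = sqrt (real (Suc k)) * sqrt (2 * pi)"
        unfolding a_def real_sqrt_mult[symmetric] by (simp add: field_simps)
      have C: "- (norm (x - y))\<^sup>2 / (2 * a k) = - (real (Suc k) * (norm (x - y))\<^sup>2) / 2"
        by (simp add: a_def field_simps)
      have D: "complex_of_real ((u * v) ^ m * w) * z = z * complex_of_real (u ^ m * w) * complex_of_real (v ^ m)" for u v w m z
        by (simp add: power_mult_distrib)
      show "(LINT \<xi>|lborel. cis ((x - y) \<bullet> \<xi>) * (?g \<xi> * \<phi> y)) = (\<phi> y * complex_of_real (sqrt (real (Suc k)) ^ ?n * exp (- (real
        (Suc k) * (norm (x - y))\<^sup>2) / 2))) * complex_of_real (sqrt (2 * pi) ^ ?n)"
        unfolding A B C by (rule D)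
    qed
    also have "\<dots> = (LINT y|lborel. (\<phi> y * complex_of_real (sqrt (real (Suc k)) ^ ?n * exp (- (real (Suc k) * (norm (x - y))\<^sup>2) /
      2)))) * complex_of_real (sqrt (2 * pi) ^ ?n)"
      by (rule integral_mult_left_zero)
    finally show ?thesis .
  qed
  have lim2: "(\<lambda>k. LINT \<xi>|lborel. cis (x \<bullet> \<xi>) * (F \<xi> * complex_of_real (exp (- (a k * (norm \<xi>)\<^sup>2) / 2))))
    \<longlonglongrightarrow> (\<phi> x * complex_of_real (sqrt (2 * pi) ^ ?n)) * complex_of_real (sqrt (2 * pi) ^ ?n)"
    unfolding eq by (intro tendsto_mult_right gaussian_approx_identity[OF _ B] schwartz_continuous[OF \<phi>]) measurable
  have I: "(LINT \<xi>|lborel. cis (x \<bullet> \<xi>) * F \<xi>) = (\<phi> x * complex_of_real (sqrt (2 * pi) ^ ?n)) * complex_of_real (sqrt (2 * pi) ^ ?n)"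
    by (rule LIMSEQ_unique[OF lim1 lim2])
  let ?c = "complex_of_real ((2 * pi) powr (- real CARD('n) / 2))"
  have "inv_fourier (fourier \<phi>) x = ?c * (LINT \<xi>|lborel. ?c * (cis (x \<bullet> \<xi>) * F \<xi>))"
    unfolding inv_fourier_def fourier_eq_ft[abs_def] F_def by (simp only: mult_ac)
  also have "\<dots> = ?c * (?c * ((\<phi> x * complex_of_real (sqrt (2 * pi) ^ ?n)) * complex_of_real (sqrt (2 * pi) ^ ?n)))"
    by (simp only: integral_mult_right_zero I)
  also have "\<dots> = \<phi> x * complex_of_real ((sqrt (2 * pi) ^ CARD('n) * (2 * pi) powr (- real CARD('n) / 2)) * (sqrt (2 * pi) ^
    CARD('n) * (2 * pi) powr (- real CARD('n) / 2)))"
    by (simp add: mult_ac)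
  also have "\<dots> = \<phi> x" by (simp only: two_pi_powr_sq) simp
  finally show "inv_fourier (fourier \<phi>) x = \<phi> x" .
qed

section \<open>Functions determined by their Gaussian integrals\<close>

text \<open>\<open>ennreal\<close> sends negative numbers to 0, so \<open>ennreal (h x)\<close> and
  \<open>ennreal (- h x)\<close> are the positive and the negative part of \<open>h\<close>. The
  measures with these densities agree on boxes, hence everywhere; so the two parts coincide almost
  everywhere and both vanish.\<close>

lemma AE_eq_0_of_box_integrals:
  fixes h :: "'a::euclidean_space \<Rightarrow> real"
  assumes hi: "integrable lborel h"
    and box: "\<And>l u. (LINT x|lborel. h x * indicator (box l u) x) = 0"
  shows "AE x in lborel. h x = 0"
proof -
  have [measurable]: "h \<in> borel_measurable borel" using hi by auto
  have "density lborel (\<lambda>x. ennreal (h x)) = density lborel (\<lambda>x. ennreal (- h x))"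
  proof (rule measure_eqI_generator_eq)
    let ?E = "range (\<lambda>(a, b). box a b::'a set)"
    show "Int_stable ?E"
      by (auto simp: Int_stable_def box_Int_box)
    show "?E \<subseteq> Pow UNIV" "sets (density lborel (\<lambda>x. ennreal (h x))) = sigma_sets UNIV ?E" "sets (density lborel (\<lambda>x. ennreal (- h x))) = sigma_sets UNIV ?E"
      by (simp_all add: borel_eq_box)
    let ?A = "\<lambda>n::nat. box (- (real n *\<^sub>R One)) (real n *\<^sub>R One) :: 'a set"
    show "range ?A \<subseteq> ?E" "(\<Union>i. ?A i) = UNIV"
      unfolding UN_box_eq_UNIV by auto
    show "emeasure (density lborel (\<lambda>x. ennreal (h x))) (?A i) \<noteq> \<infinity>" for i
    proof -
      have "emeasure (density lborel (\<lambda>x. ennreal (h x))) (?A i) \<le> (\<integral>\<^sup>+x. ennreal (norm (h x)) \<partial>lborel)"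
        by (subst emeasure_density) (auto intro!: nn_integral_mono simp: indicator_def ennreal_leI)
      also have "\<dots> < \<infinity>" using hi by (simp add: integrable_iff_bounded)
      finally show ?thesis by simp
    qed
    show "emeasure (density lborel (\<lambda>x. ennreal (h x))) X = emeasure (density lborel (\<lambda>x. ennreal (- h x))) X" if X: "X \<in> ?E" for X
    proof -
      obtain l u where [simp]: "X = box l u" using X by auto
      have i: "integrable lborel (\<lambda>x. h x * indicator X x)"
        by (rule Bochner_Integration.integrable_bound[OF hi]) (auto simp: indicator_def)
      have i1: "integrable lborel (\<lambda>x. max 0 (h x * indicator X x))" "integrable lborel (\<lambda>x. max 0 (- (h x * indicator X x)))"
        by (rule Bochner_Integration.integrable_max[OF integrable_zero i],
            rule Bochner_Integration.integrable_max[OF integrable_zero integrable_minus[OF i]])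
      have "emeasure (density lborel (\<lambda>x. ennreal (h x))) X = (\<integral>\<^sup>+x. ennreal (max 0 (h x * indicator X x)) \<partial>lborel)"
        by (subst emeasure_density) (auto intro!: nn_integral_cong simp: indicator_def max_def ennreal_neg)
      then have p: "emeasure (density lborel (\<lambda>x. ennreal (h x))) X = ennreal (LINT x|lborel. max 0 (h x * indicator X x))"
        by (simp only: nn_integral_eq_integral[OF i1(1) AE_I2[OF max.cobounded1]])
      have "emeasure (density lborel (\<lambda>x. ennreal (- h x))) X = (\<integral>\<^sup>+x. ennreal (max 0 (- (h x * indicator X x))) \<partial>lborel)"
        by (subst emeasure_density) (auto intro!: nn_integral_cong simp: indicator_def max_def ennreal_neg)
      then have m: "emeasure (density lborel (\<lambda>x. ennreal (- h x))) X = ennreal (LINT x|lborel. max 0 (- (h x * indicator X x)))"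
        by (simp only: nn_integral_eq_integral[OF i1(2) AE_I2[OF max.cobounded1]])
      have "(LINT x|lborel. max 0 (h x * indicator X x)) - (LINT x|lborel. max 0 (- (h x * indicator X x))) = (LINT x|lborel. h x * indicator X x)"
        unfolding Bochner_Integration.integral_diff[OF i1, symmetric]
        by (intro Bochner_Integration.integral_cong) (auto simp: max_def)
      then show ?thesis unfolding p m using box[of l u] by simp
    qed
  qed
  then have "AE x in lborel. ennreal (h x) = ennreal (- h x)"
    by (intro sigma_finite_measure.density_unique[OF sigma_finite_lborel]) auto
  then show ?thesis
  proof eventually_elim
    case (elim x)
    then show ?case
      by (cases "0 \<le> h x") (auto simp: ennreal_neg ennreal_eq_0_iff eq_commute[of "0::ennreal"])
  qed
qed

text \<open>The indicator of a box is, off its boundary and hence almost everywhere, a limit of its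
  own Gaussian averages \<open>T k\<close>. Pairing these with \<open>h\<close> gives superpositions
  of the vanishing Gaussian integrals, so the integral of \<open>h\<close> over the box
  vanishes.\<close>

lemma AE_eq_0_of_gaussian_integrals:
  fixes h :: "'a::euclidean_space \<Rightarrow> complex"
  assumes hi: "integrable lborel h"
    and g: "\<And>a y. 0 < a \<Longrightarrow> (LINT x|lborel. h x * complex_of_real (exp (- (a * (norm (x - y))\<^sup>2) / 2))) = 0"
  shows "AE x in lborel. h x = 0"
proof -
  let ?n = "DIM('a)"
  have [measurable]: "h \<in> borel_measurable borel" using hi by auto
  have box: "(LINT x|lborel. h x * indicator (box l u) x) = 0" for l u :: 'a
  proof -
    let ?\<psi> = "indicator (box l u) :: 'a \<Rightarrow> complex"
    have \<psi>i: "integrable lborel ?\<psi>"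
    proof -
      have "integrable lborel (\<lambda>x. complex_of_real (indicator (box l u) x))"
        by (intro integrable_of_real integrable_real_indicator) (use emeasure_lborel_box_finite[of l u] in auto)
      then show ?thesis by (simp add: of_real_indicator)
    qed
    define K where "K k x y = sqrt (real (Suc k)) ^ ?n * exp (- (real (Suc k) * (norm (x - y))\<^sup>2) / 2)" for k and x y :: 'a
    define T where "T k x = (LINT y|lborel. ?\<psi> y * complex_of_real (K k x y))" for k x
    have K_meas [measurable]: "(\<lambda>(x, y). K k x y) \<in> borel_measurable (borel \<Otimes>\<^sub>M borel)" for k
      unfolding K_def by measurable
    have [measurable]: "T k \<in> borel_measurable borel" for k
      unfolding T_def K_def by measurable
    have K0: "K k x y \<ge> 0" for k x y by (simp add: K_def)
    have Kint: "integrable lborel (\<lambda>y. K k x y)" "(LINT y|lborel. K k x y) = sqrt (2 * pi) ^ ?n" for k x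
    proof -
      have a: "0 < real (Suc k)" by simp
      have 1: "integrable lborel (\<lambda>y::'a. exp (- (real (Suc k) * (norm (x - y))\<^sup>2) / 2))"
        using gaussian_integrable[OF a, where 'a='a]
        by (subst lborel_distr_plus[symmetric, of x]) (simp add: integrable_distr_eq norm_minus_commute)
      then show "integrable lborel (\<lambda>y. K k x y)" unfolding K_def by (intro integrable_mult_right)
      have "(LINT y|lborel. exp (- (real (Suc k) * (norm (x - y))\<^sup>2) / 2)) = (LINT y|lborel. exp (- (real (Suc k) * (norm (y::'a))\<^sup>2) / 2))"
        by (subst lborel_distr_plus[symmetric, of x]) (simp add: integral_distr norm_minus_commute)
      also have "\<dots> = sqrt (2 * pi / real (Suc k)) ^ ?n" by (rule gaussian_integral[OF a])
      finally show "(LINT y|lborel. K k x y) = sqrt (2 * pi) ^ ?n"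
        unfolding K_def by (simp add: power_mult_distrib[symmetric] real_sqrt_mult[symmetric] del: of_nat_Suc)
    qed
    have TB: "cmod (T k x) \<le> sqrt (2 * pi) ^ ?n" for k x
    proof -
      have "cmod (T k x) \<le> (LINT y|lborel. cmod (?\<psi> y * complex_of_real (K k x y)))"
        unfolding T_def by (rule integral_norm_bound)
      also have "\<dots> \<le> (LINT y|lborel. K k x y)"
        by (rule integral_mono') (auto simp: Kint norm_mult indicator_def K0)
      finally show ?thesis by (simp add: Kint)
    qed
    have lim: "(\<lambda>k. LINT x|lborel. h x * T k x) \<longlonglongrightarrow> (LINT x|lborel. h x * (?\<psi> x * complex_of_real (sqrt (2 * pi) ^ ?n)))"
    proof (rule integral_dominated_convergence[where w="\<lambda>x. cmod (h x) * sqrt (2 * pi) ^ ?n"])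
      show "integrable lborel (\<lambda>x. cmod (h x) * sqrt (2 * pi) ^ ?n)" using hi by (intro integrable_mult_left integrable_norm)
      have "AE x in lborel. x \<notin> cbox l u - box l u" by (intro AE_not_in null_sets_cbox_Diff_box)
      then show "AE x in lborel. (\<lambda>k. h x * T k x) \<longlonglongrightarrow> h x * (?\<psi> x * complex_of_real (sqrt (2 * pi) ^ ?n))"
      proof eventually_elim
        case (elim x)
        have "\<exists>A. open A \<and> x \<in> A \<and> (\<forall>y\<in>A. ?\<psi> y = ?\<psi> x)"
        proof (cases "x \<in> box l u")
          case True then show ?thesis by (intro exI[of _ "box l u"]) (auto simp: open_box)
        next
          case False then show ?thesis using elim box_subset_cbox[of l u]
            by (intro exI[of _ "- cbox l u"]) (auto simp: closed_cbox indicator_def)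
        qed
        then obtain A where A: "open A" "x \<in> A" "\<And>y. y \<in> A \<Longrightarrow> ?\<psi> y = ?\<psi> x" by blast
        have "continuous_on A ?\<psi>"
          by (rule continuous_on_eq[OF continuous_on_const[of A "?\<psi> x"]]) (rule A(3)[symmetric])
        then have "isCont ?\<psi> x"
          using A(1,2) by (simp only: continuous_on_eq_continuous_at)
        moreover have "cmod (?\<psi> y) \<le> 1" for y by (simp add: indicator_def)
        ultimately show ?case unfolding T_def K_def
          by (intro tendsto_mult_left gaussian_approx_identity) measurable
      qed
      show "AE x in lborel. cmod (h x * T k x) \<le> cmod (h x) * sqrt (2 * pi) ^ ?n" for k
        by (auto simp: norm_mult intro!: AE_I2 mult_left_mono TB)
    qed auto
    have "(LINT x|lborel. h x * T k x) = 0" for k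
    proof -
      define k' where "k' x y = complex_of_real (exp (- (real (Suc k) * (norm (x - y))\<^sup>2) / 2))" for x y :: 'a
      define c where "c = complex_of_real (sqrt (real (Suc k)) ^ ?n)"
      have J: "integrable (lborel \<Otimes>\<^sub>M lborel) (\<lambda>(x, y). k' x y * (h x * ?\<psi> y))"
        by (rule integrable_pair_mult_bounded[OF _ _ hi \<psi>i]) (auto intro: lborel.sigma_finite_measure_axioms simp: k'_def)
      have "(LINT x|lborel. h x * T k x) = (LINT x|lborel. LINT y|lborel. c * (k' x y * (h x * ?\<psi> y)))"
        unfolding T_def
        by (subst integral_mult_right_zero[symmetric]) (simp add: c_def K_def k'_def mult_ac)
      also have "\<dots> = c * (LINT x|lborel. LINT y|lborel. k' x y * (h x * ?\<psi> y))"
        by (simp only: integral_mult_right_zero)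
      also have "(LINT x|lborel. LINT y|lborel. k' x y * (h x * ?\<psi> y)) = (LINT y|lborel. LINT x|lborel. k' x y * (h x * ?\<psi> y))"
        using lborel_pair.Fubini_integral[OF J] by simp
      also have "\<dots> = (LINT y|lborel. ?\<psi> y * (LINT x|lborel. h x * k' x y))"
        by (subst integral_mult_right_zero[symmetric]) (simp add: mult_ac)
      also have "\<dots> = 0" unfolding k'_def by (simp only: g[of "real (Suc k)"] of_nat_0_less_iff zero_less_Suc) simp
      finally show ?thesis by simp
    qed
    with lim have "(LINT x|lborel. h x * (?\<psi> x * complex_of_real (sqrt (2 * pi) ^ ?n))) = 0"
      by (simp add: LIMSEQ_const_iff)
    then have "(LINT x|lborel. h x * ?\<psi> x) * complex_of_real (sqrt (2 * pi) ^ ?n) = 0"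
      by (simp only: mult.assoc[symmetric] integral_mult_left_zero)
    then show ?thesis by simp
  qed
  have i: "integrable lborel (\<lambda>x. h x * indicator (box l u) x)" for l u
    by (rule Bochner_Integration.integrable_bound[OF hi]) (auto simp: indicator_def)
  have Rei: "Re (indicator A x) = indicator A x" "Im (indicator A x) = 0" for A and x :: 'a
    by (auto simp: indicator_def)
  have "AE x in lborel. Re (h x) = 0"
    using integral_Re[OF i] by (intro AE_eq_0_of_box_integrals) (auto simp: hi box Rei)
  moreover have "AE x in lborel. Im (h x) = 0"
    using integral_Im[OF i] by (intro AE_eq_0_of_box_integrals) (auto simp: hi box Rei)
  ultimately show ?thesis by eventually_elim (simp add: complex_eq_iff)
qed

lemma gaussian_mult:
  fixes x y :: "'a::real_inner" and a :: real
  assumes "0 < a"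
  shows "exp (- (norm x)\<^sup>2 / 2) * exp (- (a * (norm (x - y))\<^sup>2) / 2)
    = exp (- (a * (norm y)\<^sup>2 - a\<^sup>2 * (norm y)\<^sup>2 / (1 + a)) / 2) * exp (- ((1 + a) * (norm (x - (a / (1 + a)) *\<^sub>R y))\<^sup>2) / 2)"
proof -
  have 1: "(norm (x - c *\<^sub>R y))\<^sup>2 = (norm x)\<^sup>2 - 2 * c * (x \<bullet> y) + c\<^sup>2 * (norm y)\<^sup>2" for c
    unfolding power2_norm_eq_inner
    by (simp add: inner_diff_left inner_diff_right inner_commute[of y x] power2_eq_square algebra_simps)
  define b where "b = a / (1 + a)"
  have b: "(1 + a) * b = a" "a\<^sup>2 * (norm y)\<^sup>2 / (1 + a) = a * b * (norm y)\<^sup>2"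
    using assms by (simp_all add: b_def power2_eq_square)
  have "(1 + a) * (norm (x - b *\<^sub>R y))\<^sup>2 = (1 + a) * (norm x)\<^sup>2 - 2 * ((1 + a) * b) * (x \<bullet> y) + ((1 + a) * b) * b * (norm y)\<^sup>2"
    unfolding 1 by (simp add: algebra_simps power2_eq_square)
  then have "- (norm x)\<^sup>2 / 2 + - (a * (norm (x - y))\<^sup>2) / 2 = - (a * (norm y)\<^sup>2 - a\<^sup>2 * (norm y)\<^sup>2 / (1 + a)) / 2 + - ((1 + a) * (norm (x - b *\<^sub>R y))\<^sup>2) / 2"
    using arg_cong[OF 1[of 1], of "\<lambda>u. a * u"] unfolding b
    by (simp add: algebra_simps diff_divide_distrib add_divide_distrib)
  then show ?thesis unfolding b_def by (simp only: exp_add[symmetric])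
qed

text \<open>The Gaussian weight makes \<open>w\<close> integrable, and products of Gaussians are Gaussians.\<close>

lemma AE_eq_0_of_gaussian_tests:
  fixes w :: "'a::euclidean_space \<Rightarrow> complex"
  assumes [measurable]: "w \<in> borel_measurable borel"
    and wi: "integrable lborel (\<lambda>x. w x * complex_of_real (exp (- (norm x)\<^sup>2 / 2)))"
    and g: "\<And>a y. 0 < a \<Longrightarrow> (LINT x|lborel. w x * complex_of_real (exp (- (a * (norm (x - y))\<^sup>2) / 2))) = 0"
  shows "AE x in lborel. w x = 0"
proof -
  have "AE x in lborel. w x * complex_of_real (exp (- (norm x)\<^sup>2 / 2)) = 0"
  proof (rule AE_eq_0_of_gaussian_integrals[OF wi])
    fix a :: real and y :: 'a assume a: "0 < a"
    let ?c = "complex_of_real (exp (- (a * (norm y)\<^sup>2 - a\<^sup>2 * (norm y)\<^sup>2 / (1 + a)) / 2))"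
    have "(LINT x|lborel. w x * complex_of_real (exp (- (norm x)\<^sup>2 / 2)) * complex_of_real (exp (- (a * (norm (x - y))\<^sup>2) / 2)))
       = (LINT x|lborel. (w x * complex_of_real (exp (- ((1 + a) * (norm (x - (a / (1 + a)) *\<^sub>R y))\<^sup>2) / 2))) * ?c)"
      by (simp only: mult.assoc of_real_mult[symmetric] gaussian_mult[OF a]) (simp only: mult_ac)
    also have "\<dots> = 0" using g[of "1 + a"] a by (simp only: integral_mult_left_zero) simp
    finally show "(LINT x|lborel. w x * complex_of_real (exp (- (norm x)\<^sup>2 / 2)) * complex_of_real (exp (- (a * (norm (x - y))\<^sup>2) / 2))) = 0" .
  qed
  then show ?thesis by eventually_elim simp
qed

section \<open>Distributions given by functions\<close>

text \<open>The coefficients in the iterated derivatives of a Gaussian. What makes the class useful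
  is closure under differentiation together with polynomial growth.\<close>

inductive polyf :: "(real^'n::finite \<Rightarrow> complex) \<Rightarrow> bool" where
  polyf_const: "polyf (\<lambda>x. c)"
| polyf_coord: "polyf (\<lambda>x. complex_of_real (x $ i))"
| polyf_add: "polyf p \<Longrightarrow> polyf q \<Longrightarrow> polyf (\<lambda>x. p x + q x)"
| polyf_mult: "polyf p \<Longrightarrow> polyf q \<Longrightarrow> polyf (\<lambda>x. p x * q x)"

lemma polyf_derivative:
  "polyf p \<Longrightarrow> \<exists>D. (\<forall>x. (p has_derivative D x) (at x)) \<and> (\<forall>i. polyf (\<lambda>x. D x (axis i 1)))"
proof (induction rule: polyf.induct)
  case (polyf_const c)
  show ?case by (intro exI[of _ "\<lambda>x h. 0"]) (auto intro: polyf.intros)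
next
  case (polyf_coord i)
  show ?case
    by (intro exI[of _ "\<lambda>x h. complex_of_real (h $ i)"])
      (auto intro!: polyf.intros bounded_linear_imp_has_derivative bounded_linear_compose[OF bounded_linear_of_real bounded_linear_vec_nth])
next
  case (polyf_add p q)
  then obtain D E where "\<And>x. (p has_derivative D x) (at x)" "\<And>i. polyf (\<lambda>x. D x (axis i 1))"
    "\<And>x. (q has_derivative E x) (at x)" "\<And>i. polyf (\<lambda>x. E x (axis i 1))" by blast
  then show ?case
    by (intro exI[of _ "\<lambda>x h. D x h + E x h"]) (auto intro!: polyf.intros has_derivative_add)
next
  case (polyf_mult p q)
  then obtain D E where "\<And>x. (p has_derivative D x) (at x)" "\<And>i. polyf (\<lambda>x. D x (axis i 1))"
    "\<And>x. (q has_derivative E x) (at x)" "\<And>i. polyf (\<lambda>x. E x (axis i 1))" by blast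
  with polyf_mult.hyps show ?case
    by (intro exI[of _ "\<lambda>x h. p x * E x h + D x h * q x"]) (auto intro!: polyf.intros has_derivative_mult)
qed

lemma polyf_growth: "polyf p \<Longrightarrow> \<exists>C N. 0 \<le> C \<and> (\<forall>x. cmod (p x) \<le> C * (1 + norm x) ^ N)"
proof (induction rule: polyf.induct)
  case (polyf_const c)
  show ?case by (intro exI[of _ "cmod c"] exI[of _ 0]) auto
next
  case (polyf_coord i)
  show ?case
    by (intro exI[of _ 1] exI[of _ 1]) (auto intro!: order_trans[OF component_le_norm_cart])
next
  case (polyf_add p q)
  then obtain C N D M where *: "0 \<le> C" "\<And>x. cmod (p x) \<le> C * (1 + norm x) ^ N" "0 \<le> D" "\<And>x. cmod (q x) \<le> D * (1 + norm x) ^ M" by blast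
  have "cmod (p x + q x) \<le> (C + D) * (1 + norm x) ^ max N M" for x
  proof -
    have "cmod (p x + q x) \<le> C * (1 + norm x) ^ N + D * (1 + norm x) ^ M"
      using *(2)[of x] *(4)[of x] norm_triangle_ineq[of "p x" "q x"] by linarith
    also have "\<dots> \<le> C * (1 + norm x) ^ max N M + D * (1 + norm x) ^ max N M"
      using * by (intro add_mono mult_left_mono power_increasing) auto
    finally show ?thesis by (simp add: algebra_simps)
  qed
  then show ?case using * by (intro exI[of _ "C + D"] exI[of _ "max N M"]) auto
next
  case (polyf_mult p q)
  then obtain C N D M where *: "0 \<le> C" "\<And>x. cmod (p x) \<le> C * (1 + norm x) ^ N" "0 \<le> D" "\<And>x. cmod (q x) \<le> D * (1 + norm x) ^ M" by blast
  have "cmod (p x * q x) \<le> (C * D) * (1 + norm x) ^ (N + M)" for x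
    using mult_mono[OF *(2)[of x] *(4)[of x]] * by (simp add: norm_mult power_add mult_ac)
  then show ?case using * by (intro exI[of _ "C * D"] exI[of _ "N + M"]) auto
qed

text \<open>A real linear exponent \<open>u\<close> translates the Gaussian and an imaginary one
  \<open>w\<close> modulates it. One family thus contains the Gaussian test functions at arbitrary
  centres and their Fourier transforms.\<close>

definition mgauss :: "real \<Rightarrow> real^'n \<Rightarrow> real^'n \<Rightarrow> real^'n::finite \<Rightarrow> complex" where
  "mgauss a u w x = exp (complex_of_real (u \<bullet> x - a / 2 * (x \<bullet> x)) + \<i> * complex_of_real (w \<bullet> x))"

lemma mgauss_derivative:
  "(mgauss a u w has_derivative (\<lambda>h. mgauss a u w x * (complex_of_real (u \<bullet> h - a * (x \<bullet> h)) + \<i> * complex_of_real (w \<bullet> h)))) (at x)"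
proof -
  have 1: "((\<lambda>x. u \<bullet> x - a / 2 * (x \<bullet> x)) has_derivative (\<lambda>h. u \<bullet> h - a * (x \<bullet> h))) (at x)"
    by (auto intro!: derivative_eq_intros simp: inner_commute)
  have 2: "((\<lambda>x. w \<bullet> x) has_derivative (\<lambda>h. w \<bullet> h)) (at x)"
    by (auto intro!: derivative_eq_intros)
  have "((\<lambda>x. complex_of_real (u \<bullet> x - a / 2 * (x \<bullet> x)) + \<i> * complex_of_real (w \<bullet> x)) has_derivative
      (\<lambda>h. complex_of_real (u \<bullet> h - a * (x \<bullet> h)) + \<i> * complex_of_real (w \<bullet> h))) (at x)"
    by (intro has_derivative_add has_derivative_mult_right has_derivative_of_real 1 2)
  from has_derivative_compose[OF this has_field_derivative_imp_has_derivative[OF DERIV_exp]]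
  show ?thesis unfolding mgauss_def[abs_def] .
qed

lemma norm_mgauss: "cmod (mgauss a u w x) = exp (u \<bullet> x - a / 2 * (norm x)\<^sup>2)"
  by (simp add: mgauss_def norm_exp_eq_Re power2_norm_eq_inner)

lemma mgauss_iter_pderiv:
  assumes "polyf p"
  shows "\<exists>q. polyf q \<and> iter_pderiv is (\<lambda>x. p x * mgauss a u w x) = (\<lambda>x. q x * mgauss a u w x)"
proof (induction "is")
  case Nil
  then show ?case using assms by auto
next
  case (Cons i "is")
  then obtain q where q: "polyf q" "iter_pderiv is (\<lambda>x. p x * mgauss a u w x) = (\<lambda>x. q x * mgauss a u w x)" by blast
  obtain D where D: "\<And>x. (q has_derivative D x) (at x)" "\<And>i. polyf (\<lambda>x. D x (axis i 1))"
    using polyf_derivative[OF q(1)] by blast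
  define L where "L x h = complex_of_real (u \<bullet> h - a * (x \<bullet> h)) + \<i> * complex_of_real (w \<bullet> h)" for x h :: "real^'a"
  have "((\<lambda>x. q x * mgauss a u w x) has_derivative (\<lambda>h. q x * (mgauss a u w x * L x h) + D x h * mgauss a u w x)) (at x)" for x
    unfolding L_def by (intro has_derivative_mult D mgauss_derivative)
  then have "frechet_derivative (\<lambda>x. q x * mgauss a u w x) (at x) (axis i 1) = (q x * L x (axis i 1) + D x (axis i 1)) * mgauss a u w x" for x
    by (subst frechet_derivative_at[symmetric], assumption) (simp add: algebra_simps)
  moreover have "polyf (\<lambda>x. q x * L x (axis i 1) + D x (axis i 1))"
  proof -
    have "(\<lambda>x. L x (axis i 1)) = (\<lambda>x. (complex_of_real (u $ i) + \<i> * complex_of_real (w $ i)) + complex_of_real (- a) * complex_of_real (x $ i))"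
      by (auto simp: L_def inner_axis)
    moreover have "polyf (\<lambda>x. (complex_of_real (u $ i) + \<i> * complex_of_real (w $ i)) + complex_of_real (- a) * complex_of_real (x $ i))"
      by (intro polyf.intros)
    ultimately have "polyf (\<lambda>x. L x (axis i 1))" by simp
    then show ?thesis by (intro polyf.intros q D)
  qed
  ultimately show ?case unfolding iter_pderiv.simps q(2) by (intro exI conjI) (assumption, simp)
qed

lemma mgauss_rapid:
  assumes "polyf p" "0 < a"
  shows "bounded (range (\<lambda>x. (1 + norm x) ^ N *\<^sub>R (p x * mgauss a u w x)))"
proof -
  obtain C M where C: "0 \<le> C" "\<And>x. cmod (p x) \<le> C * (1 + norm x) ^ M" using polyf_growth[OF assms(1)] by blast
  \<comment> \<open>Both sources of growth are exponential with linear exponent: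
    \<open>(1 + norm x) ^ (N + M)\<close> is at most \<open>exp ((N + M) * norm x)\<close>, and
    \<open>u \<bullet> x\<close> is at most \<open>norm u * norm x\<close>. The maximum of
    \<open>c * t - a / 2 * t^2\<close> is \<open>c^2 / (2 * a)\<close>.\<close>
  define c where "c = real (N + M) + norm u"
  have "norm ((1 + norm x) ^ N *\<^sub>R (p x * mgauss a u w x)) \<le> C * exp (c\<^sup>2 / (2 * a))" for x
  proof -
    let ?t = "norm x"
    have "u \<bullet> x \<le> norm u * ?t" by (rule norm_cauchy_schwarz)
    moreover have "0 \<le> (a * ?t - c)\<^sup>2 / (2 * a)" using assms(2) by simp
    then have "c * ?t - a / 2 * ?t\<^sup>2 \<le> c\<^sup>2 / (2 * a)"
      using assms(2) by (simp add: power2_diff field_simps power2_eq_square)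
    ultimately have e: "real (N + M) * ?t + (u \<bullet> x - a / 2 * ?t\<^sup>2) \<le> c\<^sup>2 / (2 * a)"
      by (simp add: c_def algebra_simps)
    have "(1 + ?t) ^ (N + M) \<le> exp ?t ^ (N + M)" by (intro power_mono exp_ge_add_one_self) auto
    then have p: "(1 + ?t) ^ (N + M) \<le> exp (real (N + M) * ?t)" by (simp only: exp_of_nat_mult)
    have "norm ((1 + ?t) ^ N *\<^sub>R (p x * mgauss a u w x)) = (1 + ?t) ^ N * (cmod (p x) * exp (u \<bullet> x - a / 2 * ?t\<^sup>2))"
      by (simp add: norm_mult norm_mgauss)
    also have "\<dots> \<le> (1 + ?t) ^ N * (C * (1 + ?t) ^ M * exp (u \<bullet> x - a / 2 * ?t\<^sup>2))"
      by (intro mult_left_mono mult_right_mono C) auto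
    also have "\<dots> = C * ((1 + ?t) ^ (N + M) * exp (u \<bullet> x - a / 2 * ?t\<^sup>2))" by (simp add: power_add mult_ac)
    also have "\<dots> \<le> C * (exp (real (N + M) * ?t) * exp (u \<bullet> x - a / 2 * ?t\<^sup>2))"
      by (intro mult_left_mono mult_right_mono p C) auto
    also have "\<dots> \<le> C * exp (c\<^sup>2 / (2 * a))"
      unfolding exp_add[symmetric] using e by (intro mult_left_mono C) auto
    finally show ?thesis .
  qed
  then show ?thesis unfolding bounded_iff by blast
qed

lemma mgauss_schwartz:
  assumes "0 < a" shows "(\<lambda>x. c * mgauss a u w x) \<in> schwartz"
proof -
  have "iter_pderiv is (\<lambda>x. c * mgauss a u w x) differentiable at x \<and> bounded (range (\<lambda>x. (1 + norm x) ^ N *\<^sub>R iter_pderiv is (\<lambda>x. c * mgauss a u w x) x))" for "is" x N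
  proof -
    obtain q where q: "polyf q" "iter_pderiv is (\<lambda>x. c * mgauss a u w x) = (\<lambda>x. q x * mgauss a u w x)"
      using mgauss_iter_pderiv[OF polyf_const] by blast
    obtain D where Dq: "\<And>x. (q has_derivative D x) (at x)" using polyf_derivative[OF q(1)] by blast
    then have "(\<lambda>x. q x * mgauss a u w x) differentiable at x"
      unfolding differentiable_def using has_derivative_mult[OF Dq mgauss_derivative] by blast
    then show ?thesis unfolding q(2) using mgauss_rapid[OF q(1) assms] by blast
  qed
  then show ?thesis unfolding schwartz_def by blast
qed

lemma cis_gauss_schwartz:
  fixes w :: "real^'n::finite"
  assumes "0 < a" shows "(\<lambda>\<xi>. c * (cis (w \<bullet> \<xi>) * complex_of_real (exp (- (a * (norm \<xi>)\<^sup>2) / 2)))) \<in> schwartz"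
proof -
  have "(\<lambda>\<xi>. c * (cis (w \<bullet> \<xi>) * complex_of_real (exp (- (a * (norm \<xi>)\<^sup>2) / 2)))) = (\<lambda>\<xi>. c * mgauss a 0 w \<xi>)"
    by (simp add: mgauss_def exp_add[symmetric] power2_norm_eq_inner cis_conv_exp exp_of_real[symmetric])
  then show ?thesis using mgauss_schwartz[OF assms] by simp
qed

lemma gauss_schwartz:
  fixes y :: "real^'n::finite"
  assumes "0 < a" shows "(\<lambda>x. complex_of_real (exp (- (a * (norm (x - y))\<^sup>2) / 2))) \<in> schwartz"
proof -
  have "complex_of_real (exp (- (a * (norm (x - y))\<^sup>2) / 2)) = complex_of_real (exp (- (a * (norm y)\<^sup>2) / 2)) * mgauss a (a *\<^sub>R y) 0 x" for x
  proof -
    have "- (a * (norm (x - y))\<^sup>2) / 2 = - (a * (norm y)\<^sup>2) / 2 + ((a *\<^sub>R y) \<bullet> x - a / 2 * (x \<bullet> x))"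
      unfolding power2_norm_eq_inner by (simp add: inner_diff_left inner_diff_right inner_commute[of y x] algebra_simps add_divide_distrib diff_divide_distrib)
    then show ?thesis by (simp only: mgauss_def exp_add of_real_mult exp_of_real) simp
  qed
  then show ?thesis using mgauss_schwartz[OF assms] by simp
qed

text \<open>\<open>radial\<close> speaks of Schwartz functions only. The explicit formula shows that
  the transform of a Gaussian is one, and how rotating its centre acts on it.\<close>

lemma fourier_gauss:
  fixes y :: "real^'n::finite"
  assumes "0 < a"
  shows "fourier (\<lambda>x. complex_of_real (exp (- (a * (norm (x - y))\<^sup>2) / 2)))
    = (\<lambda>\<xi>. complex_of_real ((2 * pi) powr (- real CARD('n) / 2) * sqrt (2 * pi / a) ^ CARD('n)) *
         (cis ((- y) \<bullet> \<xi>) * complex_of_real (exp (- (inverse a * (norm \<xi>)\<^sup>2) / 2))))"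
proof
  fix \<xi> :: "real^'n"
  let ?g = "\<lambda>x::real^'n. complex_of_real (exp (- (a * (norm x)\<^sup>2) / 2))"
  have "ft (\<lambda>x. ?g (x - y)) (- \<xi>) = (LINT x|lborel. cis ((- \<xi>) \<bullet> (x + y)) * ?g x)"
    unfolding ft_def by (subst lborel_distr_plus[symmetric, of y]) (simp add: integral_distr add.commute)
  also have "\<dots> = (LINT x|lborel. cis ((- y) \<bullet> \<xi>) * (cis ((- \<xi>) \<bullet> x) * ?g x))"
    by (simp only: inner_add_right cis_mult[symmetric] inner_minus_left inner_commute[of \<xi> y] mult_ac)
  also have "\<dots> = cis ((- y) \<bullet> \<xi>) * (LINT x|lborel. cis ((- \<xi>) \<bullet> x) * ?g x)"
    by (rule integral_mult_right_zero)
  also have "\<dots> = cis ((- y) \<bullet> \<xi>) * complex_of_real (sqrt (2 * pi / a) ^ CARD('n) * exp (- (norm \<xi>)\<^sup>2 / (2 * a)))"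
    using gaussian_char(2)[OF assms, of "- \<xi>"] by simp
  also have "- (norm \<xi>)\<^sup>2 / (2 * a) = - (inverse a * (norm \<xi>)\<^sup>2) / 2"
    using assms by (simp add: field_simps)
  finally show "fourier (\<lambda>x. ?g (x - y)) \<xi> = complex_of_real ((2 * pi) powr (- real CARD('n) / 2) * sqrt (2 * pi / a) ^ CARD('n)) *
         (cis ((- y) \<bullet> \<xi>) * complex_of_real (exp (- (inverse a * (norm \<xi>)\<^sup>2) / 2)))"
    unfolding fourier_eq_ft by simp
qed

section \<open>Representing functions and radial symbols\<close>

text \<open>Gaussians are Schwartz functions and determine a function up to null sets. This is what
  makes the arbitrary choice in \<open>fourier_fun\<close> harmless.\<close>

lemma represents_unique:
  fixes F G :: "real^'n::finite \<Rightarrow> complex"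
  assumes "represents F u" "represents G u"
  shows "AE x in lborel. F x = G x"
proof -
  have [measurable]: "F \<in> borel_measurable borel" "G \<in> borel_measurable borel"
    using assms by (auto simp: represents_def)
  have *: "integrable lborel (\<lambda>x. (F x - G x) * \<phi> x)" "(LINT x|lborel. (F x - G x) * \<phi> x) = 0" if "\<phi> \<in> schwartz" for \<phi>
    using assms that by (auto simp: represents_def left_diff_distrib)
  have "AE x in lborel. F x - G x = 0"
  proof (rule AE_eq_0_of_gaussian_tests)
    show "integrable lborel (\<lambda>x. (F x - G x) * complex_of_real (exp (- (norm x)\<^sup>2 / 2)))"
      using *(1)[OF gauss_schwartz[of 1 0]] by simp
  qed (use *(2)[OF gauss_schwartz] in auto)
  then show ?thesis by simp
qed

text \<open>By rotation invariance of Lebesgue measure, the rotation moves from \<open>v\<close> to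
  the centre of a Gaussian, and from there, through its transform, to \<open>f\<close>, which is
  invariant. So \<open>v \<circ> R\<close> and \<open>v\<close> have the same Gaussian integrals.
  The null set may depend on \<open>R\<close>.\<close>

lemma radial_symbol:
  fixes f :: "'n::finite distr"
  assumes "radial f" "represents v (fourier_distr f)" "orthogonal_transformation R"
  shows "AE \<xi> in lborel. v (R \<xi>) = v \<xi>"
proof -
  have [measurable]: "v \<in> borel_measurable borel" using assms by (auto simp: represents_def)
  have lin: "linear R" using assms(3) by (simp add: orthogonal_transformation_linear)
  have [measurable]: "R \<in> borel \<rightarrow>\<^sub>M borel"
    by (intro borel_measurable_continuous_onI linear_continuous_on linear_conv_bounded_linear[THEN iffD1] lin)
  let ?g = "\<lambda>a y x. complex_of_real (exp (- (a * (norm (x - y))\<^sup>2) / 2)) :: complex"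
  have v: "integrable lborel (\<lambda>x. v x * ?g a y x)" "(LINT x|lborel. v x * ?g a y x) = f (fourier (?g a y))" if "0 < a" for a and y :: "real^'n"
    using assms(2) gauss_schwartz[OF that, of y] unfolding represents_def fourier_distr_def by auto
  have gR: "?g a y x = ?g a (R y) (R x)" for a x y
    using assms(3) by (metis lin linear_diff orthogonal_transformation_norm)
  have e: "(\<lambda>x. v (R x) * ?g a y x) = (\<lambda>x. (\<lambda>z. v z * ?g a (R y) z) (R x))" for a y
    by (rule ext) (simp only: gR[of a _ y])
  have vR: "integrable lborel (\<lambda>x. v (R x) * ?g a y x)" "(LINT x|lborel. v (R x) * ?g a y x) = f (fourier (?g a (R y)))" if "0 < a" for a y
  proof -
    show "integrable lborel (\<lambda>x. v (R x) * ?g a y x)"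
      unfolding e using v(1)[OF that, of "R y"]
      by (subst (asm) lborel_orthogonal[OF assms(3), symmetric]) (simp add: integrable_distr_eq)
    show "(LINT x|lborel. v (R x) * ?g a y x) = f (fourier (?g a (R y)))"
      unfolding e v(2)[OF that, symmetric]
      by (subst (2) lborel_orthogonal[OF assms(3), symmetric]) (simp add: integral_distr)
  qed
  have fR: "f (fourier (?g a (R y))) = f (fourier (?g a y))" if "0 < a" for a y
  proof -
    have "fourier (?g a (R y)) \<in> schwartz"
      unfolding fourier_gauss[OF that] using that by (intro cis_gauss_schwartz) auto
    moreover have "fourier (?g a (R y)) \<circ> R = fourier (?g a y)"
      unfolding fourier_gauss[OF that] using assms(3)
      by (auto simp: fun_eq_iff orthogonal_transformation_norm orthogonal_transformation_def)
    ultimately show ?thesis using assms(1,3) unfolding radial_def by metis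
  qed
  have "AE x in lborel. v (R x) - v x = 0"
  proof (rule AE_eq_0_of_gaussian_tests)
    show "integrable lborel (\<lambda>x. (v (R x) - v x) * complex_of_real (exp (- (norm x)\<^sup>2 / 2)))"
      using Bochner_Integration.integrable_diff[OF vR(1)[of 1 0] v(1)[of 1 0]] by (simp add: left_diff_distrib)
    fix a :: real and y :: "real^'n" assume a: "0 < a"
    show "(LINT x|lborel. (v (R x) - v x) * ?g a y x) = 0"
      using Bochner_Integration.integral_diff[OF vR(1)[OF a, of y] v(1)[OF a, of y]] vR(2)[OF a, of y] v(2)[OF a, of y] fR[OF a, of y]
      by (simp add: left_diff_distrib)
  qed measurable
  then show ?thesis by simp
qed

section \<open>Fourier transforms of radial functions\<close>

text \<open>The density of the first coordinate of a uniformly distributed point of the unit ball of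
  \<open>\<real>\<^sup>n\<close>, up to normalisation.\<close>

definition slice_density :: "nat \<Rightarrow> real \<Rightarrow> real" where
  "slice_density n \<tau> = unit_ball_vol (real (n - 1)) * sqrt (1 - \<tau>\<^sup>2) ^ (n - 1) * indicator {-1..1} \<tau>"

lemma slice_density_measurable [measurable]: "slice_density n \<in> borel_measurable borel"
  unfolding slice_density_def by measurable

lemma slice_density_nonneg: "0 \<le> slice_density n \<tau>"
  by (auto simp: slice_density_def indicator_def abs_square_le_1 intro!: mult_nonneg_nonneg zero_le_power)

text \<open>Fubini in the coordinate \<open>b\<close>: the section at height \<open>\<tau>\<close>
  is a ball of radius \<open>sqrt (1 - \<tau>^2)\<close> in one dimension less. The heights 1 and
  -1, where the radius is 0, are discarded as a null set.\<close>

lemma nn_integral_ball_slice: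
  fixes b :: "'a::euclidean_space"
  assumes b: "b \<in> Basis" and [measurable]: "h \<in> borel_measurable borel"
  shows "(\<integral>\<^sup>+x. h (x \<bullet> b) * indicator (cball 0 1) x \<partial>lborel)
    = (\<integral>\<^sup>+\<tau>. h \<tau> * ennreal (slice_density DIM('a) \<tau>) \<partial>lborel)"
proof -
  interpret product_sigma_finite "\<lambda>_. lborel :: real measure" ..
  let ?A = "Basis - {b} :: 'a set"
  let ?X = "\<lambda>f. \<Sum>c\<in>Basis. f c *\<^sub>R c :: 'a"
  have card: "card ?A = DIM('a) - 1" using b by simp
  have ins: "insert b ?A = Basis" using b by auto
  have comp: "?X f \<bullet> c = f c" if "c \<in> Basis" for f c
    using that by (simp add: inner_sum_left inner_Basis if_distrib cong: if_cong)
  have nrm: "norm (?X f) = sqrt (\<Sum>c\<in>Basis. (f c)\<^sup>2)" for f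
    by (simp add: norm_eq_sqrt_inner euclidean_inner[of "?X f" "?X f"] comp power2_eq_square)
  have nrmb: "norm (?X f) = sqrt ((f b)\<^sup>2 + (\<Sum>c\<in>?A. (f c)\<^sup>2))" for f
    unfolding nrm by (subst sum.remove[OF finite_Basis b]) simp
  have "(\<integral>\<^sup>+x. h (x \<bullet> b) * indicator (cball 0 1) x \<partial>lborel)
     = (\<integral>\<^sup>+f. h (f b) * indicator {f. sqrt ((f b)\<^sup>2 + (\<Sum>c\<in>?A. (f c)\<^sup>2)) \<le> 1} f \<partial>(\<Pi>\<^sub>M b\<in>insert b ?A. lborel))"
    unfolding ins
    by (subst lborel_eq, subst nn_integral_distr) (auto intro!: nn_integral_cong simp: comp[OF b] nrmb indicator_def)
  also have "\<dots> = (\<integral>\<^sup>+\<tau>. (\<integral>\<^sup>+f. h ((f(b := \<tau>)) b) * indicator {f. sqrt ((f b)\<^sup>2 + (\<Sum>c\<in>?A. (f c)\<^sup>2)) \<le> 1} (f(b := \<tau>)) \<partial>(\<Pi>\<^sub>M b\<in>?A. lborel)) \<partial>lborel)"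
  proof (rule product_nn_integral_insert_rev)
    have 1: "(\<lambda>f. sqrt ((f b)\<^sup>2 + (\<Sum>c\<in>?A. (f c)\<^sup>2))) \<in> borel_measurable (\<Pi>\<^sub>M b\<in>insert b ?A. lborel)"
      by measurable
    have "(\<lambda>f. h (f b) * indicator {t. t \<le> 1} (sqrt ((f b)\<^sup>2 + (\<Sum>c\<in>?A. (f c)\<^sup>2)))) \<in> borel_measurable (\<Pi>\<^sub>M b\<in>insert b ?A. lborel)"
      using 1 by measurable
    then show "(\<lambda>f. h (f b) * indicator {f. sqrt ((f b)\<^sup>2 + (\<Sum>c\<in>?A. (f c)\<^sup>2)) \<le> 1} f) \<in> borel_measurable (\<Pi>\<^sub>M b\<in>insert b ?A. lborel)"
      by (simp add: indicator_def)
  qed auto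
  also have "\<dots> = (\<integral>\<^sup>+\<tau>. h \<tau> * ennreal (slice_density DIM('a) \<tau>) \<partial>lborel)"
  proof (rule nn_integral_cong_AE)
    have "AE \<tau> in lborel. \<tau> \<notin> {-1, 1::real}"
      by (intro AE_not_in countable_imp_null_set_lborel) auto
    then show "AE \<tau> in lborel. (\<integral>\<^sup>+f. h ((f(b := \<tau>)) b) * indicator {f. sqrt ((f b)\<^sup>2 + (\<Sum>c\<in>?A. (f c)\<^sup>2)) \<le> 1} (f(b := \<tau>)) \<partial>(\<Pi>\<^sub>M
      b\<in>?A. lborel)) = h \<tau> * ennreal (slice_density DIM('a) \<tau>)"
    proof eventually_elim
      case (elim \<tau>)
      have S: "(\<Sum>c\<in>?A. ((f(b := \<tau>)) c)\<^sup>2) = (\<Sum>c\<in>?A. (f c)\<^sup>2)" for f :: "'a \<Rightarrow> real"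
        by (intro sum.cong) auto
      show ?case
      proof (cases "\<tau> \<in> {-1<..<1}")
        case True
        then have t: "0 < 1 - \<tau>\<^sup>2" by (auto simp: abs_square_less_1)
        let ?S = "{f. sqrt (\<Sum>c\<in>?A. (f c)\<^sup>2) \<le> sqrt (1 - \<tau>\<^sup>2)} \<inter> space (\<Pi>\<^sub>M b\<in>?A. lborel :: real measure)"
        have "(\<integral>\<^sup>+f. h ((f(b := \<tau>)) b) * indicator {f. sqrt ((f b)\<^sup>2 + (\<Sum>c\<in>?A. (f c)\<^sup>2)) \<le> 1} (f(b := \<tau>)) \<partial>(\<Pi>\<^sub>M b\<in>?A. lborel))
          = (\<integral>\<^sup>+f. h \<tau> * indicator ?S f \<partial>(\<Pi>\<^sub>M b\<in>?A. lborel))"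
          using S by (intro nn_integral_cong) (auto simp: indicator_def algebra_simps)
        also have "\<dots> = h \<tau> * emeasure (\<Pi>\<^sub>M b\<in>?A. lborel) ?S"
          by (subst nn_integral_cmult_indicator) auto
        also have "emeasure (\<Pi>\<^sub>M b\<in>?A. lborel) ?S = ennreal (unit_ball_vol (real (card ?A)) * sqrt (1 - \<tau>\<^sup>2) ^ card ?A)"
          using t by (intro emeasure_cball_aux) auto
        also have "\<dots> = ennreal (slice_density DIM('a) \<tau>)"
          using True unfolding card by (simp add: slice_density_def)
        finally show ?thesis .
      next
        case False
        with elim have "1 < \<bar>\<tau>\<bar>" by auto
        then have "1 < \<tau>\<^sup>2" using power_strict_mono[of 1 "\<bar>\<tau>\<bar>" 2] by simp
        then have "\<not> sqrt (\<tau>\<^sup>2 + (\<Sum>c\<in>?A. (f c)\<^sup>2)) \<le> 1" for f :: "'a \<Rightarrow> real"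
          using sum_nonneg[of ?A "\<lambda>c. (f c)\<^sup>2"] by (auto simp: not_le)
        moreover have "\<tau> \<notin> {-1..1}" using False elim by auto
        then have "slice_density DIM('a) \<tau> = 0" by (auto simp: slice_density_def indicator_def)
        ultimately show ?thesis using S by (simp add: indicator_def)
      qed
    qed
  qed
  finally show ?thesis .
qed

definition slice_measure :: "nat \<Rightarrow> real measure" where
  "slice_measure n = density lborel (\<lambda>\<tau>. ennreal (slice_density n \<tau>))"

lemma sets_slice_measure [measurable_cong, simp]: "sets (slice_measure n) = sets borel"
  by (simp add: slice_measure_def)

lemma space_slice_measure [simp]: "space (slice_measure n) = UNIV"
  by (simp add: slice_measure_def)

lemma distr_ball_slice:
  fixes b :: "'a::euclidean_space"
  assumes b: "b \<in> Basis"
  shows "distr (density lborel (indicator (cball 0 1))) borel (\<lambda>x. x \<bullet> b) = slice_measure DIM('a)"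
proof (rule measure_eqI)
  fix A assume "A \<in> sets (distr (density lborel (indicator (cball 0 1 :: 'a set))) borel (\<lambda>x. x \<bullet> b))"
  then have [measurable]: "A \<in> sets borel" by simp
  have [measurable, simp]: "cball (0::'a) 1 \<in> sets borel" by simp
  have [simp]: "(\<lambda>x::'a. x \<bullet> b) -` A \<in> sets borel"
    using measurable_sets[of "\<lambda>x::'a. x \<bullet> b" borel borel A] by simp
  have "emeasure (distr (density lborel (indicator (cball 0 1))) borel (\<lambda>x. x \<bullet> b)) A
      = (\<integral>\<^sup>+x. indicator A (x \<bullet> b) * indicator (cball 0 1) x \<partial>lborel)"
    by (subst emeasure_distr, simp, simp, subst emeasure_density)
      (auto intro!: nn_integral_cong simp: indicator_def)
  then show "emeasure (distr (density lborel (indicator (cball 0 1))) borel (\<lambda>x. x \<bullet> b)) A = emeasure (slice_measure DIM('a)) A"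
    unfolding slice_measure_def
    using nn_integral_ball_slice[OF b, of "indicator A"] by (simp add: emeasure_density mult.commute)
qed simp

lemma slice_measure_space:
  "emeasure (slice_measure DIM('a::euclidean_space)) UNIV = ennreal (unit_ball_vol (real DIM('a)))"
proof -
  obtain b :: 'a where b: "b \<in> Basis" using nonempty_Basis by blast
  show ?thesis
    unfolding distr_ball_slice[OF b, symmetric]
    using closed_cball[of "0::'a" 1, THEN borel_closed]
    by (subst emeasure_distr, simp, simp, subst emeasure_density) (auto simp: emeasure_cball intro!: borel_measurable_indicator)
qed

section \<open>Bessel's equation and decay\<close>

text \<open>The Fourier transform of the unit ball of dimension \<open>n\<close> at a frequency of
  length \<open>r\<close>, integrated slice by slice orthogonally to the frequency. Up to a constant
  it is \<open>r powr (- n / 2)\<close> times the Bessel function of order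
  \<open>n / 2\<close>.\<close>

definition ball_ft :: "nat \<Rightarrow> real \<Rightarrow> real" where
  "ball_ft n r = (LINT \<tau>|slice_measure n. cos (r * \<tau>))"

definition ball_ft' :: "nat \<Rightarrow> real \<Rightarrow> real" where
  "ball_ft' n r = (LINT \<tau>|slice_measure n. - (\<tau> * sin (r * \<tau>)))"

lemma AE_slice_measure: "AE \<tau> in slice_measure n. \<bar>\<tau>\<bar> \<le> 1"
  unfolding slice_measure_def
  by (subst AE_density) (auto simp: slice_density_def indicator_def intro!: AE_I2)

lemma has_real_derivative_integral_bounded:
  fixes g g' :: "real \<Rightarrow> 'x \<Rightarrow> real"
  assumes "finite_measure \<mu>"
    and [measurable]: "\<And>r. g r \<in> borel_measurable \<mu>" "\<And>r. g' r \<in> borel_measurable \<mu>"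
    and d: "\<And>r \<tau>. ((\<lambda>r. g r \<tau>) has_real_derivative g' r \<tau>) (at r)"
    and K: "AE \<tau> in \<mu>. \<forall>r. \<bar>g' r \<tau>\<bar> \<le> K" and B: "\<And>r. integrable \<mu> (g r)"
  shows "((\<lambda>r. LINT \<tau>|\<mu>. g r \<tau>) has_real_derivative (LINT \<tau>|\<mu>. g' r \<tau>)) (at r)"
proof -
  interpret finite_measure \<mu> by fact
  have "((\<lambda>h. ((LINT \<tau>|\<mu>. g (r + h) \<tau>) - (LINT \<tau>|\<mu>. g r \<tau>)) / h) \<longlongrightarrow> (LINT \<tau>|\<mu>. g' r \<tau>)) (at 0)"
    unfolding tendsto_at_iff_sequentially comp_def
  proof (intro allI impI)
    fix X :: "nat \<Rightarrow> real" assume X: "\<forall>i. X i \<in> UNIV - {0}" "X \<longlonglongrightarrow> 0"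
    have e: "((LINT \<tau>|\<mu>. g (r + X k) \<tau>) - (LINT \<tau>|\<mu>. g r \<tau>)) / X k = (LINT \<tau>|\<mu>. (g (r + X k) \<tau> - g r \<tau>) / X k)" for k
      using B by simp
    show "(\<lambda>k. ((LINT \<tau>|\<mu>. g (r + X k) \<tau>) - (LINT \<tau>|\<mu>. g r \<tau>)) / X k) \<longlonglongrightarrow> (LINT \<tau>|\<mu>. g' r \<tau>)"
      unfolding e
    proof (rule integral_dominated_convergence[where w="\<lambda>_. K"])
      show "AE \<tau> in \<mu>. (\<lambda>k. (g (r + X k) \<tau> - g r \<tau>) / X k) \<longlonglongrightarrow> g' r \<tau>"
      proof (rule AE_I2)
        fix \<tau>
        have "((\<lambda>h. (g (r + h) \<tau> - g r \<tau>) / h) \<longlongrightarrow> g' r \<tau>) (at 0)"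
          using d[of \<tau> r] by (simp add: DERIV_def)
        then show "(\<lambda>k. (g (r + X k) \<tau> - g r \<tau>) / X k) \<longlonglongrightarrow> g' r \<tau>"
          by (rule filterlim_compose) (use X in \<open>auto simp: filterlim_at\<close>)
      qed
      show "AE \<tau> in \<mu>. norm ((g (r + X k) \<tau> - g r \<tau>) / X k) \<le> K" for k
        using K
      proof eventually_elim
        case (elim \<tau>)
        have "norm (g (r + X k) \<tau> - g r \<tau>) \<le> K * norm (r + X k - r)"
        proof (rule field_differentiable_bound[of UNIV "\<lambda>r. g r \<tau>" "\<lambda>r. g' r \<tau>"])
          show "((\<lambda>r. g r \<tau>) has_field_derivative g' z \<tau>) (at z within UNIV)" for z using d[of \<tau> z] by simp
        qed (use elim in auto)
        then show ?case using X by (simp add: pos_divide_le_eq)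
      qed
    qed auto
  qed
  then show ?thesis by (simp add: DERIV_def)
qed

lemma integrable_slice:
  assumes "finite_measure (slice_measure n)" and [measurable]: "g \<in> borel_measurable borel" and "\<And>\<tau>. \<bar>\<tau>\<bar> \<le> 1 \<Longrightarrow> \<bar>g \<tau>\<bar> \<le> (K::real)"
  shows "integrable (slice_measure n) g"
proof -
  interpret finite_measure "slice_measure n" by fact
  show ?thesis
    by (rule integrable_const_bound[of _ K]) (use AE_slice_measure[of n] assms(3) in \<open>auto elim!: eventually_mono\<close>)
qed

lemma integral_lincomb3:
  fixes f g h :: "'x \<Rightarrow> real"
  assumes "integrable M f" "integrable M g" "integrable M h"
  shows "(LINT x|M. a * f x + b * g x + c * h x) = a * (LINT x|M. f x) + b * (LINT x|M. g x) + c * (LINT x|M. h x)"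
  using assms by simp

locale slice =
  fixes n :: nat
  assumes n: "0 < n" and fin: "finite_measure (slice_measure n)"
begin

abbreviation "B \<equiv> ball_ft n"
abbreviation "B' \<equiv> ball_ft' n"
definition "B2 r = (LINT \<tau>|slice_measure n. - (\<tau>\<^sup>2 * cos (r * \<tau>)))"

lemma abs_bounds: "\<bar>\<tau>\<bar> \<le> 1 \<Longrightarrow> \<bar>\<tau> * sin x\<bar> \<le> 1" "\<bar>\<tau>\<bar> \<le> 1 \<Longrightarrow> \<bar>\<tau>\<^sup>2 * cos x\<bar> \<le> 1" for \<tau> x :: real
  by (simp_all add: abs_mult mult_le_one abs_square_le_1)

lemma abs_bound_square: "\<bar>\<tau>\<bar> \<le> 1 \<Longrightarrow> \<bar>\<tau> * \<tau> * cos x\<bar> \<le> 1" for \<tau> x :: real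
  using abs_bounds(2)[of \<tau> x] by (simp only: power2_eq_square)

lemma B_deriv: "(B has_real_derivative B' r) (at r)"
  unfolding ball_ft_def[abs_def] ball_ft'_def
  by (rule has_real_derivative_integral_bounded[where K=1, OF fin])
    (use AE_slice_measure[of n] in \<open>auto intro!: derivative_eq_intros integrable_slice[OF fin, where K=1] elim!: eventually_mono simp: abs_bounds\<close>)

lemma B'_deriv: "(B' has_real_derivative B2 r) (at r)"
  unfolding ball_ft'_def[abs_def] B2_def
  by (rule has_real_derivative_integral_bounded[where K=1, OF fin])
    (use AE_slice_measure[of n] in \<open>auto intro!: derivative_eq_intros integrable_slice[OF fin, where K=1] elim!: eventually_mono
      simp: abs_bounds abs_bound_square power2_eq_square\<close>)

definition "\<kappa> = ball_ft n 0"

lemma B_bounded: "\<bar>B r\<bar> \<le> \<kappa>"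
proof -
  interpret finite_measure "slice_measure n" by (rule fin)
  have "\<bar>B r\<bar> \<le> (LINT \<tau>|slice_measure n. \<bar>cos (r * \<tau>)\<bar>)" unfolding ball_ft_def by (rule integral_abs_bound)
  also have "\<dots> \<le> (LINT \<tau>|slice_measure n. cos (0 * \<tau>))"
    by (intro integral_mono integrable_slice[OF fin, where K=1]) auto
  finally show ?thesis by (simp add: \<kappa>_def ball_ft_def)
qed

lemma B'_bounded: "\<bar>B' r\<bar> \<le> \<kappa>"
proof -
  interpret finite_measure "slice_measure n" by (rule fin)
  have "\<bar>B' r\<bar> \<le> (LINT \<tau>|slice_measure n. \<bar>- (\<tau> * sin (r * \<tau>))\<bar>)" unfolding ball_ft'_def by (rule integral_abs_bound)
  also have "\<dots> \<le> (LINT \<tau>|slice_measure n. cos (0 * \<tau>))"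
    by (intro integral_mono_AE integrable_slice[OF fin, where K=1]) (use AE_slice_measure[of n] in \<open>auto elim!: eventually_mono simp: abs_bounds\<close>)
  finally show ?thesis by (simp add: \<kappa>_def ball_ft_def)
qed

text \<open>Bessel's equation, obtained by integrating the derivative of
  \<open>(1 - \<tau>\<^sup>2)\<^bsup>(n+1)/2\<^esup> sin (r \<tau>)\<close> over \<open>[-1, 1]\<close>.\<close>

lemma B_ode: "r * B2 r + (real n + 1) * B' r + r * B r = 0"
proof -
  define c where "c = unit_ball_vol (real (n - 1))"
  define \<Phi> where "\<Phi> \<tau> = c * (sqrt (1 - \<tau>\<^sup>2) ^ (n + 1) * sin (r * \<tau>))" for \<tau>
  define \<phi> where "\<phi> \<tau> = c * sqrt (1 - \<tau>\<^sup>2) ^ (n - 1) * (r * (1 - \<tau>\<^sup>2) * cos (r * \<tau>) - (real n + 1) * \<tau> * sin (r * \<tau>))" for \<tau>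
  have cont: "continuous_on {-1..1} \<phi>" unfolding \<phi>_def by (intro continuous_intros)
  \<comment> \<open>The square root is not differentiable at the end points, so the fundamental
    theorem is used with differentiability in the interior only. As \<open>\<Phi>\<close> vanishes
    at both ends, the integral is 0.\<close>
  have "(\<phi> has_integral (\<Phi> 1 - \<Phi> (- 1))) {-1..1}"
  proof (rule fundamental_theorem_of_calculus_interior)
    show "continuous_on {-1..1} \<Phi>" unfolding \<Phi>_def by (intro continuous_intros)
    fix \<tau> :: real assume "\<tau> \<in> {-1<..<1}"
    then have t: "0 < 1 - \<tau>\<^sup>2" by (auto simp: abs_square_less_1)
    obtain m where m: "n = Suc m" using n by (cases n) auto
    let ?s = "sqrt (1 - \<tau>\<^sup>2)"
    have ds: "((\<lambda>\<tau>. sqrt (1 - \<tau>\<^sup>2)) has_real_derivative - \<tau> / ?s) (at \<tau>)"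
      using t by (auto intro!: derivative_eq_intros simp: field_simps)
    have "((\<lambda>\<tau>. sqrt (1 - \<tau>\<^sup>2) ^ (n + 1)) has_real_derivative real (n + 1) * ?s ^ n * (- \<tau> / ?s)) (at \<tau>)"
      using DERIV_power[OF ds, of "n + 1"] by (simp add: mult_ac)
    also have "real (n + 1) * ?s ^ n * (- \<tau> / ?s) = - (real n + 1) * \<tau> * ?s ^ (n - 1)"
      using t by (simp add: m algebra_simps)
    finally have "(\<Phi> has_real_derivative c * ((- (real n + 1) * \<tau> * ?s ^ (n - 1)) * sin (r * \<tau>) + (r * cos (r * \<tau>)) * ?s ^ (n + 1))) (at \<tau>)"
      unfolding \<Phi>_def by (intro DERIV_cmult DERIV_mult) (auto intro!: derivative_eq_intros)
    also have "?s ^ (n + 1) = ?s ^ (n - 1) * (1 - \<tau>\<^sup>2)"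
    proof -
      have "?s ^ (n + 1) = (?s * ?s) * ?s ^ (n - 1)" by (simp add: m mult.assoc)
      also have "?s * ?s = 1 - \<tau>\<^sup>2" using t by simp
      finally show ?thesis by (simp only: mult.commute)
    qed
    also have "c * ((- (real n + 1) * \<tau> * ?s ^ (n - 1)) * sin (r * \<tau>) + (r * cos (r * \<tau>)) * (?s ^ (n - 1) * (1 - \<tau>\<^sup>2))) = \<phi> \<tau>"
      unfolding \<phi>_def by (simp add: algebra_simps)
    finally show "(\<Phi> has_vector_derivative \<phi> \<tau>) (at \<tau>)" by (simp add: has_real_derivative_iff_has_vector_derivative)
  qed simp
  then have "(\<phi> has_integral 0) {-1..1}" by (simp add: \<Phi>_def)
  moreover have si: "set_integrable lborel {-1..1} \<phi>"
    by (rule borel_integrable_atLeastAtMost') (rule cont)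
  ultimately have "(LINT \<tau>:{-1..1}|lborel. \<phi> \<tau>) = 0"
    using set_borel_integral_eq_integral(2)[OF si] by (simp add: integral_unique)
  then have 0: "(LINT \<tau>|lborel. indicator {-1..1} \<tau> * \<phi> \<tau>) = 0" by (simp add: set_lebesgue_integral_def)
  define k where "k \<tau> = r * (- (\<tau>\<^sup>2 * cos (r * \<tau>))) + (real n + 1) * (- (\<tau> * sin (r * \<tau>))) + r * cos (r * \<tau>)" for \<tau>
  have [measurable]: "k \<in> borel_measurable borel" unfolding k_def by measurable
  have i1: "integrable (slice_measure n) (\<lambda>\<tau>. - (\<tau>\<^sup>2 * cos (r * \<tau>)))" "integrable (slice_measure n) (\<lambda>\<tau>. - (\<tau> * sin (r * \<tau>)))"
    "integrable (slice_measure n) (\<lambda>\<tau>. cos (r * \<tau>))"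
    by (auto intro!: integrable_slice[OF fin, where K=1] simp: abs_bounds)
  have "r * B2 r + (real n + 1) * B' r + r * B r = (LINT \<tau>|slice_measure n. k \<tau>)"
    unfolding B2_def ball_ft'_def ball_ft_def k_def by (rule integral_lincomb3[OF i1, symmetric])
  also have "\<dots> = (LINT \<tau>|lborel. slice_density n \<tau> * k \<tau>)"
    unfolding slice_measure_def
    by (subst integral_density) (auto simp: slice_density_nonneg)
  also have "\<dots> = (LINT \<tau>|lborel. indicator {-1..1} \<tau> * \<phi> \<tau>)"
    by (intro Bochner_Integration.integral_cong) (auto simp: slice_density_def \<phi>_def k_def c_def algebra_simps indicator_def)
  finally show ?thesis using 0 by simp
qed

text \<open>With \<open>\<nu> = (n + 1) / 2\<close>, the function
  \<open>h = r powr \<nu> * B\<close> solves \<open>h'' = (k / r^2 - 1) * h\<close>, an oscillator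
  with an integrable perturbation at infinity. Its energy, corrected by a bounded factor, does not
  increase on \<open>{1..}\<close>, so \<open>h\<close> and its derivative stay bounded
  there.\<close>

lemma B_decay:
  obtains M where "0 \<le> M" "\<And>r. 1 \<le> r \<Longrightarrow> \<bar>B r\<bar> \<le> M * r powr (- (real n + 1) / 2)"
    "\<And>r. 1 \<le> r \<Longrightarrow> \<bar>B' r\<bar> \<le> M * r powr (- (real n + 1) / 2)"
proof -
  define \<nu> where "\<nu> = (real n + 1) / 2"
  define k where "k = \<nu> * (\<nu> - 1)"
  have \<nu>: "1 \<le> \<nu>" using n by (simp add: \<nu>_def)
  then have k: "0 \<le> k" by (simp add: k_def)
  define h where "h r = r powr \<nu> * B r" for r
  define h1 where "h1 r = r powr \<nu> * (B' r + \<nu> / r * B r)" for r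
  have dh: "(h has_real_derivative h1 r) (at r)" if "0 < r" for r
  proof -
    have "(h has_real_derivative \<nu> * r powr (\<nu> - 1) * B r + B' r * r powr \<nu>) (at r)"
      unfolding h_def using that by (intro DERIV_mult B_deriv has_real_derivative_powr)
    also have "r powr (\<nu> - 1) = r powr \<nu> / r" using that by (simp add: powr_diff)
    also have "\<nu> * (r powr \<nu> / r) * B r + B' r * r powr \<nu> = h1 r" by (simp add: h1_def algebra_simps)
    finally show ?thesis .
  qed
  have dh1: "(h1 has_real_derivative (k / r\<^sup>2 - 1) * h r) (at r)" if r: "0 < r" for r
  proof -
    have 1: "((\<lambda>r. \<nu> / r * B r) has_real_derivative - \<nu> / r\<^sup>2 * B r + B' r * (\<nu> / r)) (at r)"
      using r by (intro DERIV_mult B_deriv) (auto intro!: derivative_eq_intros simp: power2_eq_square)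
    have "(h1 has_real_derivative \<nu> * r powr (\<nu> - 1) * (B' r + \<nu> / r * B r) + (B2 r + (- \<nu> / r\<^sup>2 * B r + B' r * (\<nu> / r))) * r powr \<nu>) (at r)"
      unfolding h1_def using r by (intro DERIV_mult DERIV_add B'_deriv 1 has_real_derivative_powr)
    also have "r powr (\<nu> - 1) = r powr \<nu> / r" using r by (simp add: powr_diff)
    also have "\<nu> * (r powr \<nu> / r) * (B' r + \<nu> / r * B r) + (B2 r + (- \<nu> / r\<^sup>2 * B r + B' r * (\<nu> / r))) * r powr \<nu>
       = r powr \<nu> * ((B2 r + 2 * \<nu> / r * B' r) + k / r\<^sup>2 * B r)"
      by (simp add: k_def algebra_simps power2_eq_square add_divide_distrib diff_divide_distrib)
    also have "B2 r + 2 * \<nu> / r * B' r = - B r"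
      using B_ode[of r] r by (simp add: \<nu>_def field_simps)
    finally show ?thesis by (simp add: h_def algebra_simps)
  qed
  \<comment> \<open>The derivative of \<open>exp (k / r)\<close> compensates the cross term
    \<open>2 * k / r^2 * h * h1\<close> caused by the perturbation: together they are a nonpositive
    multiple of the square of \<open>h1 - h\<close>, as \<open>k \<ge> 0\<close>.\<close>
  define E where "E r = ((h1 r)\<^sup>2 + (h r)\<^sup>2) * exp (k / r)" for r
  have dE: "(E has_real_derivative (2 * h1 r * ((k / r\<^sup>2 - 1) * h r) + 2 * h r * h1 r) * exp (k / r) + exp (k / r) * (- k / r\<^sup>2) *
    ((h1 r)\<^sup>2 + (h r)\<^sup>2)) (at r)" if r: "0 < r" for r
  proof -
    have a: "((\<lambda>r. (h1 r)\<^sup>2 + (h r)\<^sup>2) has_real_derivative 2 * h1 r * ((k / r\<^sup>2 - 1) * h r) + 2 * h r * h1 r) (at r)"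
      using DERIV_add[OF DERIV_power[OF dh1[OF r], of 2] DERIV_power[OF dh[OF r], of 2]] by (simp add: mult_ac)
    have b: "((\<lambda>r. exp (k / r)) has_real_derivative exp (k / r) * (- k / r\<^sup>2)) (at r)"
      using r by (auto intro!: derivative_eq_intros simp: power2_eq_square)
    show ?thesis unfolding E_def by (rule DERIV_mult[OF a b])
  qed
  have le0: "(2 * h1 r * ((k / r\<^sup>2 - 1) * h r) + 2 * h r * h1 r) * exp (k / r) + exp (k / r) * (- k / r\<^sup>2) * ((h1 r)\<^sup>2 + (h r)\<^sup>2) \<le> 0" for r
  proof -
    have "(2 * h1 r * ((k / r\<^sup>2 - 1) * h r) + 2 * h r * h1 r) * exp (k / r) + exp (k / r) * (- k / r\<^sup>2) * ((h1 r)\<^sup>2 + (h r)\<^sup>2)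
       = - (k / r\<^sup>2 * exp (k / r) * (h1 r - h r)\<^sup>2)"
      by (simp add: power2_diff algebra_simps)
    then show ?thesis using k by simp
  qed
  define M0 where "M0 = sqrt (E 1)"
  have E1: "E r \<le> E 1" if "1 \<le> r" for r
  proof (rule DERIV_nonpos_imp_nonincreasing[OF that])
    fix x :: real assume "1 \<le> x"
    then have "0 < x" by simp
    from dE[OF this] le0[of x] show "\<exists>y. DERIV E x :> y \<and> y \<le> 0" by (intro exI conjI)
  qed
  have hh: "\<bar>h r\<bar> \<le> M0" "\<bar>h1 r\<bar> \<le> M0" if "1 \<le> r" for r
  proof -
    have "(h1 r)\<^sup>2 + (h r)\<^sup>2 \<le> E r" unfolding E_def
      using mult_left_mono[of 1 "exp (k / r)" "(h1 r)\<^sup>2 + (h r)\<^sup>2"] k that by simp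
    then have "(h r)\<^sup>2 \<le> E 1" "(h1 r)\<^sup>2 \<le> E 1" using E1[OF that] zero_le_power2[of "h r"] zero_le_power2[of "h1 r"] by linarith+
    then show "\<bar>h r\<bar> \<le> M0" "\<bar>h1 r\<bar> \<le> M0" unfolding M0_def
      using real_sqrt_le_mono[of "(h r)\<^sup>2" "E 1"] real_sqrt_le_mono[of "(h1 r)\<^sup>2" "E 1"] by simp_all
  qed
  have M0: "0 \<le> M0" using hh(1)[of 1] by simp
  have Bb: "\<bar>B r\<bar> \<le> M0 * r powr (- \<nu>)" if "1 \<le> r" for r
  proof -
    have "B r = h r * r powr (- \<nu>)" using that by (simp add: h_def powr_minus)
    then show ?thesis using mult_right_mono[OF hh(1)[OF that], of "r powr (- \<nu>)"] by (simp add: abs_mult)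
  qed
  have B'b: "\<bar>B' r\<bar> \<le> (1 + \<nu>) * M0 * r powr (- \<nu>)" if r: "1 \<le> r" for r
  proof -
    have "h1 r * r powr (- \<nu>) = (B' r + \<nu> / r * B r) * (r powr \<nu> * r powr (- \<nu>))" by (simp add: h1_def)
    also have "r powr \<nu> * r powr (- \<nu>) = 1" using r by (simp add: powr_minus)
    finally have "B' r = h1 r * r powr (- \<nu>) - \<nu> / r * B r" by simp
    then have "\<bar>B' r\<bar> \<le> \<bar>h1 r\<bar> * r powr (- \<nu>) + \<nu> / r * \<bar>B r\<bar>"
      using abs_triangle_ineq4[of "h1 r * r powr (- \<nu>)" "\<nu> / r * B r"] r \<nu> by (simp add: abs_mult)
    also have "\<dots> \<le> M0 * r powr (- \<nu>) + \<nu> * (M0 * r powr (- \<nu>))"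
    proof (intro add_mono mult_mono Bb hh r)
      show "\<nu> / r \<le> \<nu>" using r \<nu> mult_left_mono[of 1 r \<nu>] by (simp add: pos_divide_le_eq)
    qed (use r \<nu> M0 in auto)
    finally show ?thesis by (simp add: algebra_simps)
  qed
  show ?thesis
  proof (rule that[of "(1 + \<nu>) * M0"])
    show "0 \<le> (1 + \<nu>) * M0" using M0 \<nu> by simp
    have "M0 * r powr - \<nu> \<le> (1 + \<nu>) * M0 * r powr - \<nu>" for r
      using M0 \<nu> by (intro mult_right_mono) (auto simp: algebra_simps)
    then show "\<bar>B r\<bar> \<le> (1 + \<nu>) * M0 * r powr (- (real n + 1) / 2)" if "1 \<le> r" for r
      using Bb[OF that] order_trans by (fastforce simp: \<nu>_def minus_divide_left)
    show "\<bar>B' r\<bar> \<le> (1 + \<nu>) * M0 * r powr (- (real n + 1) / 2)" if "1 \<le> r" for r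
      using B'b[OF that] by (simp add: \<nu>_def minus_divide_left)
  qed
qed

end

lemma slice_DIM: "slice DIM('a::euclidean_space)"
  unfolding slice_def by (auto intro!: finite_measureI simp: slice_measure_space)

lemma integral_sin_slice: "(LINT \<tau>|slice_measure n. sin (r * \<tau>)) = 0"
proof -
  have "(LINT \<tau>|slice_measure n. sin (r * \<tau>)) = (LINT \<tau>|lborel. slice_density n \<tau> * sin (r * \<tau>))" (is "_ = ?I")
    unfolding slice_measure_def
    by (subst integral_density) (auto simp: slice_density_nonneg)
  moreover have "?I = - ?I"
  proof -
    have e: "slice_density n (0 + (-1) * \<tau>) * sin (r * (0 + (-1) * \<tau>)) = - (slice_density n \<tau> * sin (r * \<tau>))" for \<tau>
      by (auto simp: slice_density_def indicator_def)
    have "?I = \<bar>-1\<bar> *\<^sub>R (LINT \<tau>|lborel. slice_density n (0 + (-1) * \<tau>) * sin (r * (0 + (-1) * \<tau>)))"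
      by (rule lborel_integral_real_affine) simp
    then show ?thesis unfolding e by (simp only: Bochner_Integration.integral_minus) simp
  qed
  ultimately show ?thesis by linarith
qed

lemma integral_cis_slice:
  "(LINT \<tau>|slice_measure DIM('a::euclidean_space). cis (r * \<tau>)) = complex_of_real (ball_ft DIM('a) r)"
proof -
  interpret slice "DIM('a)" by (rule slice_DIM)
  have i: "integrable (slice_measure DIM('a)) (\<lambda>\<tau>. cos (r * \<tau>))" "integrable (slice_measure DIM('a)) (\<lambda>\<tau>. sin (r * \<tau>))"
    by (auto intro!: integrable_slice[OF fin, where K=1])
  have "(LINT \<tau>|slice_measure DIM('a). cis (r * \<tau>)) = (LINT \<tau>|slice_measure DIM('a). complex_of_real (cos (r * \<tau>)) + \<i> * complex_of_real (sin (r * \<tau>)))"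
    by (intro Bochner_Integration.integral_cong) (auto simp: complex_eq_iff)
  also have "\<dots> = (LINT \<tau>|slice_measure DIM('a). complex_of_real (cos (r * \<tau>))) + (LINT \<tau>|slice_measure DIM('a). \<i> * complex_of_real (sin (r * \<tau>)))"
    by (intro Bochner_Integration.integral_add integrable_mult_right integrable_of_real i)
  also have "\<dots> = complex_of_real (ball_ft DIM('a) r)"
    by (simp add: integral_sin_slice ball_ft_def)
  finally show ?thesis .
qed

lemma sets_cball_borel [measurable, simp]: "cball (x::'a::euclidean_space) r \<in> sets borel"
  by (simp add: borel_closed)

lemma integral_unit_ball_cis_Basis:
  assumes "b \<in> (Basis :: 'a::euclidean_space set)"
  shows "(LINT x|lborel. indicator (cball 0 1) x *\<^sub>R cis (\<rho> * (x \<bullet> b))) = complex_of_real (ball_ft DIM('a) \<rho>)"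
proof -
  have "(LINT x|lborel. indicator (cball 0 1) x *\<^sub>R cis (\<rho> * (x \<bullet> b))) = (LINT x|density lborel (\<lambda>x. ennreal (indicator (cball 0 1) x)). cis (\<rho> * (x \<bullet> b)))"
    by (subst integral_density) (auto intro!: borel_measurable_indicator)
  also have "(\<lambda>x::'a. ennreal (indicator (cball 0 1) x)) = indicator (cball 0 1)" by (auto simp: indicator_def)
  also have "(LINT x|density lborel (indicator (cball 0 1)). cis (\<rho> * (x \<bullet> b))) = (LINT \<tau>|distr (density lborel (indicator (cball 0 1))) borel (\<lambda>x. x \<bullet> b). cis (\<rho> * \<tau>))"
    by (subst integral_distr) auto
  also have "\<dots> = complex_of_real (ball_ft DIM('a) \<rho>)"
    unfolding distr_ball_slice[OF assms] by (rule integral_cis_slice)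
  finally show ?thesis .
qed

lemma orthogonal_measurable:
  fixes T :: "'a::euclidean_space \<Rightarrow> 'a"
  assumes "orthogonal_transformation T" shows "T \<in> borel \<rightarrow>\<^sub>M borel"
  using assms
  by (intro borel_measurable_continuous_onI linear_continuous_on linear_conv_bounded_linear[THEN iffD1] orthogonal_transformation_linear)

lemma integral_orthogonal:
  fixes f :: "'a::euclidean_space \<Rightarrow> 'b::{banach, second_countable_topology}" and T :: "'a \<Rightarrow> 'a"
  assumes T: "orthogonal_transformation T" and [measurable]: "f \<in> borel_measurable borel"
  shows "(LINT x|lborel. f (T x)) = (LINT x|lborel. f x)"
proof -
  have [measurable]: "T \<in> borel \<rightarrow>\<^sub>M borel" by (rule orthogonal_measurable[OF T])
  show ?thesis by (subst (2) lborel_orthogonal[OF T, symmetric]) (simp add: integral_distr)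
qed

text \<open>Dilation reduces to the unit ball, and a rotation taking a coordinate axis to the
  direction of \<open>\<xi>\<close> reduces to the slices.\<close>

lemma integral_ball_cis:
  fixes \<xi> :: "real^'n::finite"
  assumes "0 < R"
  shows "(LINT y|lborel. indicator (cball 0 R) y *\<^sub>R cis (y \<bullet> \<xi>)) = complex_of_real (R ^ CARD('n) * ball_ft CARD('n) (R * norm \<xi>))"
proof -
  obtain b :: "real^'n" where b: "b \<in> Basis" using nonempty_Basis by blast
  have "norm (norm (R *\<^sub>R \<xi>) *\<^sub>R b) = norm (R *\<^sub>R \<xi>)" using b by simp
  then obtain T where T: "orthogonal_transformation T" "T (norm (R *\<^sub>R \<xi>) *\<^sub>R b) = R *\<^sub>R \<xi>"
    using orthogonal_transformation_exists by metis
  have "(LINT y|lborel. indicator (cball 0 R) y *\<^sub>R cis (y \<bullet> \<xi>)) = \<bar>R\<bar> ^ DIM(real^'n) *\<^sub>R (LINT y|lborel. indicator (cball 0 R) (0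
    + R *\<^sub>R y) *\<^sub>R cis ((0 + R *\<^sub>R y) \<bullet> \<xi>))"
    using assms by (intro lborel_integral_affine) auto
  also have "(LINT y|lborel. indicator (cball 0 R) (0 + R *\<^sub>R y) *\<^sub>R cis ((0 + R *\<^sub>R y) \<bullet> \<xi>)) = (LINT y|lborel. indicator (cball 0 1) y *\<^sub>R cis (y \<bullet> R *\<^sub>R \<xi>))"
    using assms by (intro Bochner_Integration.integral_cong) (auto simp: indicator_def)
  also have "\<dots> = (LINT y|lborel. indicator (cball 0 1) (T y) *\<^sub>R cis (T y \<bullet> R *\<^sub>R \<xi>))"
    by (rule integral_orthogonal[OF T(1), symmetric]) auto
  also have "\<dots> = (LINT y|lborel. indicator (cball 0 1) y *\<^sub>R cis ((R * norm \<xi>) * (y \<bullet> b)))"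
  proof (intro Bochner_Integration.integral_cong refl arg_cong2[where f=scaleR])
    fix y
    show "indicator (cball 0 1) (T y) = indicator (cball 0 1) y"
      using T(1) by (simp add: indicator_def orthogonal_transformation_norm)
    have "T y \<bullet> R *\<^sub>R \<xi> = T y \<bullet> T (norm (R *\<^sub>R \<xi>) *\<^sub>R b)" by (simp only: T(2))
    also have "\<dots> = y \<bullet> (norm (R *\<^sub>R \<xi>) *\<^sub>R b)" using T(1) by (simp only: orthogonal_transformation_def)
    finally show "cis (T y \<bullet> R *\<^sub>R \<xi>) = cis ((R * norm \<xi>) * (y \<bullet> b))" using assms by (simp add: mult.assoc)
  qed
  also have "\<dots> = complex_of_real (ball_ft DIM(real^'n) (R * norm \<xi>))"
    by (rule integral_unit_ball_cis_Basis[OF b])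
  finally show ?thesis using assms by (simp add: scaleR_conv_of_real)
qed

section \<open>Spherical functions\<close>

text \<open>The Fourier transform of the normalised surface measure of the unit sphere: the
  derivative at \<open>R = 1\<close> of \<open>R ^ n * ball_ft n (R * r)\<close>, the transform of
  the ball of radius \<open>R\<close>, divided by the area
  \<open>n * unit_ball_vol n\<close>.\<close>

definition sph :: "nat \<Rightarrow> real \<Rightarrow> real" where
  "sph n r = (ball_ft n r + r * ball_ft' n r / real n) / unit_ball_vol (real n)"

text \<open>The derivative of \<open>sph\<close>; Bessel's equation has eliminated the second
  derivative of \<open>ball_ft\<close>.\<close>

definition sph' :: "nat \<Rightarrow> real \<Rightarrow> real" where
  "sph' n r = - (r * ball_ft n r) / (real n * unit_ball_vol (real n))"

lemma sph_deriv:
  "(sph DIM('a::euclidean_space) has_real_derivative sph' DIM('a) r) (at r)"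
proof -
  interpret slice "DIM('a)" by (rule slice_DIM)
  let ?n = "DIM('a)"
  have "(sph ?n has_real_derivative (B' r + (1 * B' r + B2 r * r) / real ?n) / unit_ball_vol (real ?n)) (at r)"
    unfolding sph_def by (intro DERIV_cdivide DERIV_add DERIV_mult B_deriv B'_deriv DERIV_ident)
  also have "B' r + (1 * B' r + B2 r * r) / real ?n = - (r * B r) / real ?n"
  proof -
    have "1 * B' r + B2 r * r = - (real ?n * B' r) - r * B r"
      using B_ode[of r] by (simp add: algebra_simps)
    then show ?thesis by (simp only: diff_divide_distrib minus_divide_left[symmetric]) simp
  qed
  finally show ?thesis by (simp add: sph'_def)
qed

lemma ball_ft_continuous: "continuous_on UNIV (ball_ft DIM('a::euclidean_space))"
proof -
  interpret slice "DIM('a)" by (rule slice_DIM)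
  show ?thesis using B_deriv DERIV_isCont by (blast intro: continuous_at_imp_continuous_on)
qed

lemma sph'_continuous: "continuous_on UNIV (sph' DIM('a::euclidean_space))"
  unfolding sph'_def[abs_def] by (intro continuous_intros ball_ft_continuous) (use unit_ball_vol_pos[of "real DIM('a)"] in \<open>auto simp del: unit_ball_vol_pos\<close>)

lemma sph_continuous: "continuous_on UNIV (sph DIM('a::euclidean_space))"
  using sph_deriv DERIV_isCont by (blast intro: continuous_at_imp_continuous_on)

lemma sph_measurable [measurable]: "sph DIM('a::euclidean_space) \<in> borel_measurable borel" "sph' DIM('a) \<in> borel_measurable borel"
  by (intro borel_measurable_continuous_onI sph_continuous sph'_continuous)+

text \<open>\<open>ball_ft\<close> and its derivative decay with exponent
  \<open>(n + 1) / 2\<close>, and the factor \<open>r\<close> in both formulas costs one power. For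
  \<open>r < 1\<close> boundedness suffices, since \<open>1 + r\<close> is then between 1 and
  2.\<close>

lemma sph_decay:
  obtains C where "0 < C" "\<And>r. 0 \<le> r \<Longrightarrow> \<bar>sph DIM('a::euclidean_space) r\<bar> \<le> C * (1 + r) powr (- (real DIM('a) - 1) / 2)"
    "\<And>r. 0 \<le> r \<Longrightarrow> \<bar>sph' DIM('a) r\<bar> \<le> C * (1 + r) powr (- (real DIM('a) - 1) / 2)"
proof -
  interpret slice "DIM('a)" by (rule slice_DIM)
  let ?n = "DIM('a)"
  define V where "V = unit_ball_vol (real ?n)"
  have V: "0 < V" by (simp add: V_def)
  have n1: "1 \<le> real ?n" using n by linarith
  obtain M where M: "0 \<le> M" "\<And>r. 1 \<le> r \<Longrightarrow> \<bar>B r\<bar> \<le> M * r powr (- (real ?n + 1) / 2)"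
    "\<And>r. 1 \<le> r \<Longrightarrow> \<bar>B' r\<bar> \<le> M * r powr (- (real ?n + 1) / 2)" using B_decay by blast
  define \<mu> where "\<mu> = (real ?n - 1) / 2"
  have \<mu>: "0 \<le> \<mu>" using n1 by (simp add: \<mu>_def)
  define K where "K = 2 * (M + \<kappa>) / V"
  have \<kappa>: "0 \<le> \<kappa>" using B_bounded[of 0] by simp
  have K: "0 \<le> K" using M(1) V \<kappa> by (simp add: K_def)
  have main: "\<bar>B r\<bar> + r * \<bar>B' r\<bar> \<le> 2 * (M + \<kappa>) * (2 powr \<mu> * (1 + r) powr (- \<mu>))" "r * \<bar>B r\<bar> \<le> 2 * (M + \<kappa>) * (2 powr \<mu> * (1 + r) powr (- \<mu>))" if r: "0 \<le> r" for r
  proof -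
    have *: "\<bar>B r\<bar> + r * \<bar>B' r\<bar> \<le> 2 * (M + \<kappa>) * (2 powr \<mu> * (1 + r) powr (- \<mu>)) \<and> r * \<bar>B r\<bar> \<le> 2 * (M + \<kappa>) * (2 powr \<mu> * (1 + r) powr (- \<mu>))"
    proof (cases "1 \<le> r")
      case True
      have e: "- (real ?n + 1) / 2 = - \<mu> - 1" by (simp add: \<mu>_def field_simps)
      have rp: "r powr (- \<mu>) \<le> 2 powr \<mu> * (1 + r) powr (- \<mu>)"
      proof -
        have "(1 + r) powr \<mu> \<le> (2 * r) powr \<mu>" using True \<mu> by (intro powr_mono2) auto
        then show ?thesis using True by (simp add: powr_minus powr_mult field_simps)
      qed
      have rr: "r powr (- \<mu> - 1) * r = r powr (- \<mu>)" "r powr (- \<mu> - 1) \<le> r powr (- \<mu>)"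
        using True by (simp_all add: powr_diff)  (simp add: divide_le_eq)
      have b1: "\<bar>B r\<bar> \<le> M * r powr (- \<mu>)"
        using M(2)[OF True] mult_left_mono[OF rr(2) M(1)] unfolding e by linarith
      have b2: "r * \<bar>B' r\<bar> \<le> M * r powr (- \<mu>)" "r * \<bar>B r\<bar> \<le> M * r powr (- \<mu>)"
        using mult_left_mono[OF M(3)[OF True], of r] mult_left_mono[OF M(2)[OF True], of r] r rr(1)
        unfolding e by (simp_all add: mult_ac)
      have "M * r powr (- \<mu>) \<le> (M + \<kappa>) * (2 powr \<mu> * (1 + r) powr (- \<mu>))"
        using \<kappa> M(1) by (intro mult_mono rp) auto
      then show ?thesis using b1 b2 M(1) \<kappa> by (auto simp: algebra_simps)
    next
      case False
      have "(1 + r) powr \<mu> \<le> 2 powr \<mu>" using False r \<mu> by (intro powr_mono2) auto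
      then have one: "1 \<le> 2 powr \<mu> * (1 + r) powr (- \<mu>)" using r by (simp add: powr_minus field_simps)
      have b: "r * \<bar>B' r\<bar> \<le> \<kappa>" "r * \<bar>B r\<bar> \<le> \<kappa>"
        using mult_mono[of r 1 "\<bar>B' r\<bar>" \<kappa>] mult_mono[of r 1 "\<bar>B r\<bar>" \<kappa>] B_bounded[of r] B'_bounded[of r] False r by auto
      have "2 * \<kappa> \<le> 2 * (M + \<kappa>) * 1" using M(1) by simp
      also have "\<dots> \<le> 2 * (M + \<kappa>) * (2 powr \<mu> * (1 + r) powr (- \<mu>))" using M(1) \<kappa> by (intro mult_left_mono one) auto
      finally show ?thesis using b B_bounded[of r] \<kappa> by linarith
    qed
    then show "\<bar>B r\<bar> + r * \<bar>B' r\<bar> \<le> 2 * (M + \<kappa>) * (2 powr \<mu> * (1 + r) powr (- \<mu>))" "r * \<bar>B r\<bar> \<le> 2 * (M + \<kappa>) * (2 powr \<mu> * (1 + r) powr (- \<mu>))" by blast+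
  qed
  show ?thesis
  proof (rule that[of "K * 2 powr \<mu> + 1"])
    show "0 < K * 2 powr \<mu> + 1" using K by (simp add: add_nonneg_pos)
    fix r :: real assume r: "0 \<le> r"
    have e: "- (real ?n - 1) / 2 = - \<mu>" unfolding \<mu>_def by (simp only: minus_divide_left)
    have Kp: "K * 2 powr \<mu> * (1 + r) powr (- \<mu>) \<le> (K * 2 powr \<mu> + 1) * (1 + r) powr (- \<mu>)"
      by (intro mult_right_mono) auto
    have "\<bar>sph ?n r\<bar> \<le> (\<bar>B r\<bar> + r * \<bar>B' r\<bar>) / V"
    proof -
      have "\<bar>r * B' r / real ?n\<bar> \<le> r * \<bar>B' r\<bar>"
        using n1 r mult_left_mono[of 1 "real ?n" "r * \<bar>B' r\<bar>"] by (simp add: abs_mult pos_divide_le_eq)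
      then have "\<bar>B r + r * B' r / real ?n\<bar> \<le> \<bar>B r\<bar> + r * \<bar>B' r\<bar>" by linarith
      then show ?thesis using V by (simp add: sph_def V_def[symmetric] divide_right_mono)
    qed
    also have "\<dots> \<le> 2 * (M + \<kappa>) * (2 powr \<mu> * (1 + r) powr (- \<mu>)) / V"
      using V main(1)[OF r] by (intro divide_right_mono) auto
    also have "\<dots> = K * 2 powr \<mu> * (1 + r) powr (- \<mu>)" by (simp add: K_def)
    finally show "\<bar>sph ?n r\<bar> \<le> (K * 2 powr \<mu> + 1) * (1 + r) powr (- (real ?n - 1) / 2)"
      unfolding e using Kp by linarith
    have "\<bar>sph' ?n r\<bar> \<le> (r * \<bar>B r\<bar>) / V"
    proof -
      have "r * \<bar>B r\<bar> / (real ?n * V) \<le> r * \<bar>B r\<bar> / V"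
        using n1 r V by (intro divide_left_mono) (auto intro!: mult_pos_pos)
      then show ?thesis using V r by (simp add: sph'_def V_def[symmetric] abs_mult)
    qed
    also have "\<dots> \<le> 2 * (M + \<kappa>) * (2 powr \<mu> * (1 + r) powr (- \<mu>)) / V"
      using V main(2)[OF r] by (intro divide_right_mono) auto
    also have "\<dots> = K * 2 powr \<mu> * (1 + r) powr (- \<mu>)" by (simp add: K_def)
    finally show "\<bar>sph' ?n r\<bar> \<le> (K * 2 powr \<mu> + 1) * (1 + r) powr (- (real ?n - 1) / 2)"
      unfolding e using Kp by linarith
  qed
qed

section \<open>Polar coordinates and averages over shells\<close>

lemma emeasure_cball0: "0 \<le> r \<Longrightarrow> emeasure lborel (cball (0::'a::euclidean_space) r) = ennreal (unit_ball_vol (real DIM('a)) * r ^ DIM('a))"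
  by (simp add: emeasure_cball)

text \<open>Polar coordinates for functions of the norm alone. On a half-line \<open>{..r}\<close>
  the left side is the volume of a ball and the right side the integral of the derivative of that
  volume; half-lines generate the Borel sets.\<close>

lemma distr_norm_lborel:
  "distr lborel borel (norm :: 'a::euclidean_space \<Rightarrow> real)
    = density lborel (\<lambda>\<rho>. ennreal (indicator {0..} \<rho> * (real DIM('a) * unit_ball_vol (real DIM('a)) * \<rho> ^ (DIM('a) - 1))))"
    (is "?L = ?R")
proof (rule measure_eqI_generator_eq)
  let ?V = "unit_ball_vol (real DIM('a))"
  let ?E = "range (\<lambda>r. {..r :: real})"
  show "Int_stable ?E" by (auto simp: Int_stable_def)
  show "?E \<subseteq> Pow UNIV" "sets ?L = sigma_sets UNIV ?E" "sets ?R = sigma_sets UNIV ?E"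
    by (simp_all add: borel_eq_atMost)
  have L: "emeasure ?L {..r} = ennreal (?V * (max 0 r) ^ DIM('a))" for r :: real
  proof (cases "0 \<le> r")
    case True
    have "norm -` {..r} = cball (0::'a) r" by (auto simp: dist_norm)
    then show ?thesis using True by (simp add: emeasure_distr emeasure_cball0)
  next
    case False
    have "norm -` {..r} = ({} :: 'a set)"
    proof (rule equals0I)
      fix x :: 'a assume "x \<in> norm -` {..r}"
      then show "False" using False norm_ge_zero[of x] by simp
    qed
    then show ?thesis using False by (simp add: emeasure_distr max_def)
  qed
  show "range (\<lambda>n::nat. {..real n}) \<subseteq> ?E" by auto
  show "(\<Union>n::nat. {..real n}) = UNIV" by (auto simp: real_arch_simple)
  show "emeasure ?L {..real i} \<noteq> \<infinity>" for i unfolding L by simp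
  show "emeasure ?L X = emeasure ?R X" if XE: "X \<in> ?E" for X
  proof -
    obtain r where X: "X = {..r}" using XE by auto
    have "emeasure ?R X = (\<integral>\<^sup>+\<rho>. ennreal (real DIM('a) * ?V * \<rho> ^ (DIM('a) - 1)) * indicator {0..max 0 r} \<rho> \<partial>lborel)"
      unfolding X by (subst emeasure_density, simp, simp, rule nn_integral_cong_AE, rule AE_I[where N="{0}"])
        (auto simp: indicator_def max_def)
    also have "\<dots> = ennreal (?V * (max 0 r) ^ DIM('a) - ?V * 0 ^ DIM('a))"
      by (rule nn_integral_FTC_Icc) (auto intro!: derivative_eq_intros simp: max_def)
    finally show ?thesis unfolding X L by simp
  qed
qed

lemma nn_integral_radial:
  fixes F :: "real \<Rightarrow> ennreal"
  assumes [measurable]: "F \<in> borel_measurable borel"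
  shows "(\<integral>\<^sup>+x. F (norm (x::'a::euclidean_space)) \<partial>lborel)
    = (\<integral>\<^sup>+\<rho>. ennreal (indicator {0..} \<rho> * (real DIM('a) * unit_ball_vol (real DIM('a)) * \<rho> ^ (DIM('a) - 1))) * F \<rho> \<partial>lborel)"
proof -
  have "(\<integral>\<^sup>+x. F (norm (x::'a)) \<partial>lborel) = (\<integral>\<^sup>+\<rho>. F \<rho> \<partial>distr lborel borel (norm :: 'a \<Rightarrow> real))"
    by (simp add: nn_integral_distr)
  then show ?thesis unfolding distr_norm_lborel by (subst (asm) nn_integral_density) auto
qed

text \<open>Radiality for symbols known only up to null sets: the exceptional set may vary with the
  rotation. This is the form in which \<open>radial_symbol\<close> provides it.\<close>

definition radial_ae :: "('a::euclidean_space \<Rightarrow> complex) \<Rightarrow> bool" where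
  "radial_ae H \<longleftrightarrow> (\<forall>T. orthogonal_transformation T \<longrightarrow> (AE \<xi> in lborel. H (T \<xi>) = H \<xi>))"

lemma ft_radial:
  fixes H :: "'a::euclidean_space \<Rightarrow> complex" and T :: "'a \<Rightarrow> 'a"
  assumes [measurable]: "H \<in> borel_measurable borel" and "radial_ae H" and T: "orthogonal_transformation T"
  shows "ft H (T x) = ft H x"
proof -
  have [measurable]: "T \<in> borel \<rightarrow>\<^sub>M borel" by (rule orthogonal_measurable[OF T])
  have "ft H (T x) = (LINT \<xi>|lborel. cis (T x \<bullet> T \<xi>) * H (T \<xi>))"
    unfolding ft_def by (rule integral_orthogonal[OF T, symmetric]) measurable
  also have "\<dots> = (LINT \<xi>|lborel. cis (x \<bullet> \<xi>) * H \<xi>)"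
  proof (rule integral_cong_AE)
    have "AE \<xi> in lborel. H (T \<xi>) = H \<xi>" using assms by (simp add: radial_ae_def)
    then show "AE \<xi> in lborel. cis (T x \<bullet> T \<xi>) * H (T \<xi>) = cis (x \<bullet> \<xi>) * H \<xi>"
      using T by (auto elim!: eventually_mono simp: orthogonal_transformation_def)
  qed measurable
  finally show ?thesis by (simp add: ft_def)
qed

text \<open>Averaging the radial function \<open>ft H\<close> over the shell \<open>R < norm y \<le> R + h\<close> and letting
  \<open>h \<rightarrow> 0\<close> replaces the plane waves by spherical functions.\<close>

lemma ft_radial_eq_sph:
  fixes H :: "real^'n::finite \<Rightarrow> complex"
  assumes Hi: "integrable lborel H" and rad: "radial_ae H" and x: "x \<noteq> 0"
  shows "ft H x = (LINT \<xi>|lborel. complex_of_real (sph CARD('n) (norm \<xi> * norm x)) * H \<xi>)"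
proof -
  let ?n = "CARD('n)"
  let ?V = "unit_ball_vol (real ?n)"
  interpret slice ?n using slice_DIM[where 'a="real^'n"] by simp
  have [measurable]: "H \<in> borel_measurable borel" using Hi by auto
  have V: "0 < ?V" by simp
  have V0: "?V \<noteq> 0" using V by (metis less_irrefl)
  define R where "R = norm x"
  have R: "0 < R" using x by (simp add: R_def)
  define h where "h k = inverse (real (Suc k))" for k
  have h: "0 < h k" for k by (simp add: h_def)
  have h0: "h \<longlonglongrightarrow> 0" unfolding h_def by (rule LIMSEQ_inverse_real_of_nat)
  define S where "S k = cball 0 (R + h k) - cball (0::real^'n) R" for k
  have [measurable]: "S k \<in> sets borel" for k by (simp add: S_def)
  define vol where "vol k = ?V * (R + h k) ^ ?n - ?V * R ^ ?n" for k
  have vol: "0 < vol k" for k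
    using h[of k] R V by (simp add: vol_def power_strict_mono)
  have sub: "cball 0 R \<subseteq> cball (0::real^'n) (R + h k)" for k using h[of k] by auto
  have emS: "emeasure lborel (S k) = ennreal (vol k)" for k
    unfolding S_def using R h[of k] V
    by (subst emeasure_Diff) (auto simp: emeasure_cball0 vol_def ennreal_minus sub)
  have msS: "measure lborel (S k) = vol k" for k
    using emS[of k] vol[of k] by (simp add: measure_def)
  have iS: "integrable lborel (\<lambda>y. indicator (S k) y *\<^sub>R (1::complex))" for k
    by (rule integrable_scaleR_left) (auto intro!: integrable_real_indicator simp: emS)
  have iB: "integrable lborel (\<lambda>y. indicator (cball 0 r) y *\<^sub>R cis (y \<bullet> \<xi>))" for r and \<xi> :: "real^'n"
  proof (rule Bochner_Integration.integrable_bound)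
    show "integrable lborel (indicator (cball (0::real^'n) r) :: _ \<Rightarrow> real)"
      using emeasure_lborel_cball_finite[of "0::real^'n" r] by (intro integrable_real_indicator) auto
  qed (auto simp: indicator_def)
  \<comment> \<open>The average over the shell \<open>S k\<close> of the plane wave with frequency
    \<open>\<xi>\<close>; as an average of numbers of modulus 1 it is bounded by 1, which gives the
    majorant below.\<close>
  define b where "b k \<xi> = ((R + h k) ^ ?n * B ((R + h k) * norm \<xi>) - R ^ ?n * B (R * norm \<xi>)) / vol k" for k and \<xi> :: "real^'n"
  have shell: "(LINT y|lborel. indicator (S k) y *\<^sub>R cis (y \<bullet> \<xi>)) = complex_of_real (vol k * b k \<xi>)" for k \<xi>
  proof -
    have "indicator (S k) y *\<^sub>R cis (y \<bullet> \<xi>) = indicator (cball 0 (R + h k)) y *\<^sub>R cis (y \<bullet> \<xi>) - indicator (cball 0 R) y *\<^sub>R cis (y \<bullet> \<xi>)" for y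
      using sub[of k] by (auto simp: S_def indicator_def)
    then have "(LINT y|lborel. indicator (S k) y *\<^sub>R cis (y \<bullet> \<xi>)) = (LINT y|lborel. indicator (cball 0 (R + h k)) y *\<^sub>R cis (y \<bullet>
      \<xi>)) - (LINT y|lborel. indicator (cball 0 R) y *\<^sub>R cis (y \<bullet> \<xi>))"
      using iB by simp
    also have "\<dots> = complex_of_real (vol k * b k \<xi>)"
      using R h[of k] vol[of k] by (subst (1 2) integral_ball_cis) (auto simp: b_def)
    finally show ?thesis .
  qed
  have b1: "\<bar>b k \<xi>\<bar> \<le> 1" for k \<xi>
  proof -
    have "cmod (complex_of_real (vol k * b k \<xi>)) \<le> (LINT y|lborel. norm (indicator (S k) y *\<^sub>R cis (y \<bullet> \<xi>)))"
      unfolding shell[symmetric] by (rule integral_norm_bound)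
    also have "\<dots> = vol k" by (simp add: msS)
    finally have "vol k * \<bar>b k \<xi>\<bar> \<le> vol k * 1" using vol[of k] by (simp only: norm_of_real abs_mult)
    then show ?thesis using vol[of k] by (simp only: mult_le_cancel_left_pos)
  qed
  have blim: "(\<lambda>k. b k \<xi>) \<longlonglongrightarrow> sph ?n (norm \<xi> * R)" for \<xi>
  proof -
    let ?\<rho> = "norm \<xi>"
    obtain m where m: "?n = Suc m" by (cases ?n) auto
    have d1: "((\<lambda>s. s ^ ?n) has_real_derivative real ?n * R ^ m) (at R)"
      using DERIV_pow[of ?n R UNIV] by (simp add: m)
    have "((\<lambda>s. B (s * ?\<rho>)) has_real_derivative B' (R * ?\<rho>) * ?\<rho>) (at R)"
      by (rule DERIV_chain2[OF B_deriv]) (auto intro!: derivative_eq_intros)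
    from DERIV_mult[OF d1 this]
    have d2: "((\<lambda>s. s ^ ?n * B (s * ?\<rho>)) has_real_derivative real ?n * R ^ m * B (R * ?\<rho>) + B' (R * ?\<rho>) * ?\<rho> * R ^ ?n) (at R)" .
    have seq: "(\<lambda>k. (F (R + h k) - F R) / h k) \<longlonglongrightarrow> D" if "(F has_real_derivative D) (at R)" for F D
    proof -
      have "((\<lambda>s. (F (R + s) - F R) / s) \<longlongrightarrow> D) (at 0)" using that by (simp add: DERIV_def)
      then show ?thesis
        by (rule filterlim_compose) (use h h0 in \<open>auto simp: filterlim_at less_imp_neq[THEN not_sym]\<close>)
    qed
    \<comment> \<open>Numerator and denominator of \<open>b\<close> are increments over the same
      step \<open>h k\<close>, so the limit is the quotient of the derivatives at
      \<open>R\<close>.\<close>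
    have "(\<lambda>k. (((R + h k) ^ ?n * B ((R + h k) * ?\<rho>) - R ^ ?n * B (R * ?\<rho>)) / h k) / (?V * (((R + h k) ^ ?n - R ^ ?n) / h k)))
      \<longlonglongrightarrow> (real ?n * R ^ m * B (R * ?\<rho>) + B' (R * ?\<rho>) * ?\<rho> * R ^ ?n) / (?V * (real ?n * R ^ m))"
      using R V0 by (intro tendsto_divide tendsto_mult tendsto_const seq[OF d1] seq[OF d2]) auto
    also have "(\<lambda>k. (((R + h k) ^ ?n * B ((R + h k) * ?\<rho>) - R ^ ?n * B (R * ?\<rho>)) / h k) / (?V * (((R + h k) ^ ?n - R ^ ?n) / h k))) = (\<lambda>k. b k \<xi>)"
    proof
      fix k
      have "(A / h k) / (?V * (C / h k)) = A / (?V * C)" for A C using h[of k] by simp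
      then show "(((R + h k) ^ ?n * B ((R + h k) * ?\<rho>) - R ^ ?n * B (R * ?\<rho>)) / h k) / (?V * (((R + h k) ^ ?n - R ^ ?n) / h k)) = b k \<xi>"
        by (simp only: b_def vol_def right_diff_distrib)
    qed
    also have "(real ?n * R ^ m * B (R * ?\<rho>) + B' (R * ?\<rho>) * ?\<rho> * R ^ ?n) / (?V * (real ?n * R ^ m)) = sph ?n (?\<rho> * R)"
    proof -
      have Rn: "R ^ ?n = R * R ^ m" by (simp add: m)
      have "real ?n * R ^ m * B (R * ?\<rho>) + B' (R * ?\<rho>) * ?\<rho> * R ^ ?n = (real ?n * R ^ m) * (B (R * ?\<rho>) + (R * ?\<rho>) * B' (R * ?\<rho>) / real ?n)"
        unfolding Rn by (simp add: distrib_left)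
      moreover have "(real ?n * R ^ m) * X / (?V * (real ?n * R ^ m)) = X / ?V" for X
        using R by simp
      ultimately show ?thesis by (simp only: sph_def mult.commute[of ?\<rho> R])
    qed
    finally show ?thesis .
  qed
  have [measurable]: "b k \<in> borel_measurable borel" for k
    unfolding b_def using borel_measurable_continuous_onI[OF ball_ft_continuous[where 'a="real^'n"]] by simp
  define A where "A k = (LINT y|lborel. indicator (S k) y *\<^sub>R ft H y) / complex_of_real (vol k)" for k
  have A1: "A k = (LINT \<xi>|lborel. complex_of_real (b k \<xi>) * H \<xi>)" for k
  proof -
    have J: "integrable (lborel \<Otimes>\<^sub>M lborel) (\<lambda>(y, \<xi>). cis (y \<bullet> \<xi>) * ((indicator (S k) y *\<^sub>R (1::complex)) * H \<xi>))"
      by (rule integrable_pair_mult_bounded[OF _ _ iS Hi]) (auto intro: lborel.sigma_finite_measure_axioms)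
    have "(LINT y|lborel. indicator (S k) y *\<^sub>R ft H y) = (LINT y|lborel. LINT \<xi>|lborel. cis (y \<bullet> \<xi>) * ((indicator (S k) y *\<^sub>R (1::complex)) * H \<xi>))"
      unfolding ft_def
      by (intro Bochner_Integration.integral_cong refl, subst integral_scaleR_right[symmetric])
        (auto intro!: Bochner_Integration.integral_cong simp: indicator_def)
    also have "\<dots> = (LINT \<xi>|lborel. LINT y|lborel. cis (y \<bullet> \<xi>) * ((indicator (S k) y *\<^sub>R (1::complex)) * H \<xi>))"
      using lborel_pair.Fubini_integral[OF J] by simp
    also have "\<dots> = (LINT \<xi>|lborel. (LINT y|lborel. indicator (S k) y *\<^sub>R cis (y \<bullet> \<xi>)) * H \<xi>)"
      by (intro Bochner_Integration.integral_cong refl, subst integral_mult_left_zero[symmetric])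
        (auto intro!: Bochner_Integration.integral_cong simp: indicator_def)
    also have "\<dots> = (LINT \<xi>|lborel. complex_of_real (vol k) * (complex_of_real (b k \<xi>) * H \<xi>))"
      unfolding shell by (simp only: of_real_mult mult.assoc)
    also have "\<dots> = complex_of_real (vol k) * (LINT \<xi>|lborel. complex_of_real (b k \<xi>) * H \<xi>)"
      by (rule integral_mult_right_zero)
    finally show ?thesis using vol[of k] by (simp add: A_def)
  qed
  have lim1: "A \<longlonglongrightarrow> (LINT \<xi>|lborel. complex_of_real (sph ?n (norm \<xi> * R)) * H \<xi>)"
    unfolding A1[abs_def]
  proof (rule integral_dominated_convergence[where w="\<lambda>\<xi>. cmod (H \<xi>)"])
    show "AE \<xi> in lborel. (\<lambda>k. complex_of_real (b k \<xi>) * H \<xi>) \<longlonglongrightarrow> complex_of_real (sph ?n (norm \<xi> * R)) * H \<xi>"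
      by (intro AE_I2 tendsto_mult tendsto_of_real blim tendsto_const)
    show "AE \<xi> in lborel. norm (complex_of_real (b k \<xi>) * H \<xi>) \<le> cmod (H \<xi>)" for k
      using b1 by (intro AE_I2) (simp add: norm_mult mult_left_le_one_le)
  qed (use Hi sph_measurable(1)[where 'a="real^'n"] in auto)
  have lim2: "A \<longlonglongrightarrow> ft H x"
  proof (rule LIMSEQ_I)
    fix e :: real assume e: "0 < e"
    obtain d where d: "0 < d" "\<And>y. dist y x < d \<Longrightarrow> dist (ft H y) (ft H x) < e / 2"
      using ft_isCont[OF Hi, of x] e unfolding continuous_at_eps_delta by (metis half_gt_zero)
    obtain k0 where k0: "\<And>k. k0 \<le> k \<Longrightarrow> h k < d"
      using LIMSEQ_D[OF h0 d(1)] h by (metis abs_of_pos diff_zero real_norm_def)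
    have "norm (A k - ft H x) < e" if k: "k0 \<le> k" for k
    proof -
      \<comment> \<open>\<open>ft H\<close> is exactly radial, so its value at \<open>y\<close> is
        the value at the point of the same norm on the ray through \<open>x\<close>, whose distance
        from \<open>x\<close> is at most \<open>h k\<close>.\<close>
      have near: "cmod (ft H y - ft H x) \<le> e / 2" if y: "y \<in> S k" for y
      proof -
        have ny: "R < norm y" "norm y \<le> R + h k" using y by (auto simp: S_def dist_norm)
        have "norm y = norm ((norm y / R) *\<^sub>R x)" using R by (simp add: R_def)
        then obtain T where T: "orthogonal_transformation T" "T ((norm y / R) *\<^sub>R x) = y"
          using orthogonal_transformation_exists by metis
        have eq: "ft H y = ft H ((norm y / R) *\<^sub>R x)"
          using ft_radial[OF _ rad T(1)] T(2) by (metis \<open>H \<in> borel_measurable borel\<close>)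
        have "dist ((norm y / R) *\<^sub>R x) x = norm ((norm y / R - 1) *\<^sub>R x)"
          by (simp add: dist_norm scaleR_diff_left)
        also have "\<dots> = norm y - R" using R ny by (simp add: R_def[symmetric] field_simps)
        also have "\<dots> < d" using ny k0[OF k] by simp
        finally show ?thesis using d(2) unfolding eq by (simp add: dist_norm less_imp_le)
      qed
      have iSf: "integrable lborel (\<lambda>y. indicator (S k) y *\<^sub>R ft H y)"
        using ft_bounded[of H]
        by (intro integrableI_bounded_set_indicator[where B="LINT x|lborel. cmod (H x)"]) (auto simp: emS)
      have "A k - ft H x = (LINT y|lborel. indicator (S k) y *\<^sub>R (ft H y - ft H x)) / complex_of_real (vol k)"
      proof -
        have "(LINT y|lborel. indicator (S k) y *\<^sub>R (ft H y - ft H x)) = (LINT y|lborel. indicator (S k) y *\<^sub>R ft H y) - (LINT y|lborel. indicator (S k) y *\<^sub>R ft H x)"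
          unfolding scaleR_diff_right using iSf emS[of k] by (intro Bochner_Integration.integral_diff) (auto intro!: integrable_scaleR_left integrable_real_indicator)
        also have "(LINT y|lborel. indicator (S k) y *\<^sub>R ft H x) = complex_of_real (vol k) * ft H x"
          using emS[of k] by (subst integral_scaleR_left) (auto intro!: integrable_real_indicator simp: msS scaleR_conv_of_real)
        finally show ?thesis using vol[of k] by (simp add: A_def diff_divide_distrib)
      qed
      then have "norm (A k - ft H x) \<le> (LINT y|lborel. norm (indicator (S k) y *\<^sub>R (ft H y - ft H x))) / vol k"
        using vol[of k] by (simp only: norm_divide norm_of_real abs_of_pos) (intro divide_right_mono integral_norm_bound, simp)
      also have "\<dots> \<le> (LINT y|lborel. indicator (S k) y * (e / 2)) / vol k"
      proof (intro divide_right_mono integral_mono')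
        show "integrable lborel (\<lambda>y. indicator (S k) y * (e / 2))"
          by (intro integrable_mult_left integrable_real_indicator) (auto simp: emS)
      qed (use near vol[of k] e in \<open>auto simp: indicator_def\<close>)
      also have "\<dots> = e / 2" using vol[of k] by (simp add: msS)
      finally show ?thesis using e by simp
    qed
    then show "\<exists>k0. \<forall>k\<ge>k0. norm (A k - ft H x) < e" by blast
  qed
  show ?thesis using LIMSEQ_unique[OF lim2 lim1] by (simp add: R_def)
qed

section \<open>Waves with frequencies in a shell\<close>

lemma ennreal_powr_le_cancel:
  assumes "ennreal_powr x a \<le> ennreal_powr y a" "0 < a" shows "x \<le> y"
proof -
  have "ennreal_powr (ennreal_powr x a) (1 / a) \<le> ennreal_powr (ennreal_powr y a) (1 / a)"
    by (rule ennreal_powr_mono) (use assms in auto)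
  then show ?thesis using assms(2) by (simp add: ennreal_powr_powr)
qed

text \<open>Up to the normalising constant, \<open>wave H t\<close> is \<open>exp (i t |\<nabla>|)\<close> applied to the inverse Fourier transform of \<open>H\<close>.\<close>

definition wave :: "('a::euclidean_space \<Rightarrow> complex) \<Rightarrow> real \<Rightarrow> 'a \<Rightarrow> complex" where
  "wave H t = ft (\<lambda>\<xi>. cis (t * norm \<xi>) * H \<xi>)"

lemma wave_measurable [measurable]:
  assumes [measurable]: "H \<in> borel_measurable borel"
  shows "(\<lambda>(t, x). wave H t x) \<in> borel_measurable (borel \<Otimes>\<^sub>M borel)"
  unfolding wave_def ft_def by measurable

definition annulus :: "real \<Rightarrow> real \<Rightarrow> 'a::euclidean_space set" where
  "annulus a b = {\<xi>. a \<le> norm \<xi> \<and> norm \<xi> < b}"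

lemma sqrt_two_pi_mult:
  assumes "0 < a" shows "sqrt (2 * pi / a) * sqrt (2 * pi / inverse a) = 2 * pi"
proof -
  have "(2 * pi / a) * (2 * pi / inverse a) = (2 * pi)\<^sup>2"
    using assms by (simp add: field_simps power2_eq_square)
  then have "sqrt (2 * pi / a) * sqrt (2 * pi / inverse a) = sqrt ((2 * pi)\<^sup>2)"
    by (simp only: real_sqrt_mult[symmetric])
  then show ?thesis by (simp only: real_sqrt_abs) simp
qed

lemma sets_annulus [measurable]: "annulus a b \<in> sets borel"
  unfolding annulus_def by measurable

lemma emeasure_annulus_le:
  assumes "0 \<le> a" "a \<le> b"
  shows "emeasure lborel (annulus a b :: 'a::euclidean_space set) \<le> ennreal (unit_ball_vol (real DIM('a)) * (b ^ DIM('a) - a ^ DIM('a)))"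
proof -
  have "emeasure lborel (annulus a b :: 'a set) \<le> emeasure lborel (cball 0 b - ball (0::'a) a)"
    by (rule emeasure_mono) (auto simp: annulus_def dist_norm)
  also have "\<dots> = ennreal (unit_ball_vol (real DIM('a)) * b ^ DIM('a)) - ennreal (unit_ball_vol (real DIM('a)) * a ^ DIM('a))"
    using assms by (subst emeasure_Diff) (auto simp: emeasure_cball0 emeasure_ball)
  also have "\<dots> = ennreal (unit_ball_vol (real DIM('a)) * (b ^ DIM('a) - a ^ DIM('a)))"
    using assms by (simp add: ennreal_minus right_diff_distrib)
  finally show ?thesis .
qed

lemma power_diff_le:
  fixes a b :: real
  assumes "0 \<le> a" "a \<le> b"
  shows "b ^ n - a ^ n \<le> real n * b ^ (n - 1) * (b - a)"
proof (induction n)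
  case (Suc n)
  have "b ^ Suc n - a ^ Suc n = b * (b ^ n - a ^ n) + (b - a) * a ^ n" by (simp add: algebra_simps)
  also have "\<dots> \<le> b * (real n * b ^ (n - 1) * (b - a)) + (b - a) * b ^ n"
    using assms by (intro add_mono mult_left_mono Suc power_mono) auto
  also have "b * (real n * b ^ (n - 1) * (b - a)) = real n * b ^ n * (b - a)" by (cases n) auto
  finally show ?case by (simp add: algebra_simps)
qed simp

section \<open>Time and space bounds for one normalised shell\<close>

text \<open>The inner radius is normalised to 1; other shells follow by dilation. \<open>A\<close>
  is any upper bound for the L^2 norm, so it can be taken positive even when \<open>H\<close>
  vanishes.\<close>

locale annulus_data =
  fixes H :: "real^'n::finite \<Rightarrow> complex" and b A :: real
  assumes H_meas [measurable]: "H \<in> borel_measurable borel"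
    and H_rad: "radial_ae H"
    and H_supp: "\<And>\<xi>. \<xi> \<notin> annulus 1 b \<Longrightarrow> H \<xi> = 0"
    and H_L2: "(\<integral>\<^sup>+\<xi>. ennreal ((cmod (H \<xi>))\<^sup>2) \<partial>lborel) \<le> ennreal (A\<^sup>2)"
    and A: "0 \<le> A" and b: "1 < b"
begin

text \<open>A bound for the volume of the shell that is linear in the width \<open>b - 1\<close>:
  this is where thinness is exploited.\<close>

definition "Vol = unit_ball_vol (real CARD('n)) * (real CARD('n) * b ^ (CARD('n) - 1) * (b - 1))"

lemma Vol: "0 \<le> Vol" using b by (simp add: Vol_def)

lemma emeasure_annulus: "emeasure lborel (annulus 1 b :: (real^'n) set) \<le> ennreal Vol"
proof -
  have "emeasure lborel (annulus 1 b :: (real^'n) set) \<le> ennreal (unit_ball_vol (real CARD('n)) * (b ^ CARD('n) - 1 ^ CARD('n)))"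
    using emeasure_annulus_le[of 1 b, where 'a="real^'n"] b by simp
  also have "\<dots> \<le> ennreal Vol"
    unfolding Vol_def using b power_diff_le[of 1 b "CARD('n)"] by (intro ennreal_leI mult_left_mono) auto
  finally show ?thesis .
qed

text \<open>Cauchy-Schwarz on the shell, as Jensen's inequality with exponent 2 for Lebesgue measure
  restricted to it.\<close>

lemma nn_integral_H: "(\<integral>\<^sup>+\<xi>. ennreal (cmod (H \<xi>)) \<partial>lborel) \<le> ennreal (sqrt Vol * A)"
proof -
  have "ennreal_powr (\<integral>\<^sup>+\<xi>. ennreal (cmod (H \<xi>)) * indicator (annulus 1 b) \<xi> \<partial>lborel) 2
      = ennreal_powr (\<integral>\<^sup>+\<xi>. ennreal (cmod (H \<xi>)) \<partial>density lborel (indicator (annulus 1 b))) 2"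
    by (simp add: nn_integral_density mult.commute)
  also have "\<dots> \<le> ennreal_powr (emeasure (density lborel (indicator (annulus 1 b :: (real^'n) set))) UNIV) (2 - 1) * (\<integral>\<^sup>+\<xi>.
    ennreal_powr (ennreal (cmod (H \<xi>))) 2 \<partial>density lborel (indicator (annulus 1 b)))"
    using nn_integral_powr_Jensen[of "\<lambda>\<xi>. ennreal (cmod (H \<xi>))" "density lborel (indicator (annulus 1 b))" 2] by simp
  also have "\<dots> = emeasure lborel (annulus 1 b :: (real^'n) set) * (\<integral>\<^sup>+\<xi>. ennreal ((cmod (H \<xi>))\<^sup>2) * indicator (annulus 1 b) \<xi> \<partial>lborel)"
    by (simp add: emeasure_density nn_integral_density mult.commute ennreal_powr_ennreal)
  also have "\<dots> \<le> ennreal Vol * ennreal (A\<^sup>2)"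
  proof (intro mult_mono emeasure_annulus order_trans[OF nn_integral_mono H_L2])
    show "ennreal ((cmod (H \<xi>))\<^sup>2) * indicator (annulus 1 b) \<xi> \<le> ennreal ((cmod (H \<xi>))\<^sup>2)" for \<xi>
      by (auto simp: indicator_def)
  qed auto
  also have "\<dots> = ennreal_powr (ennreal (sqrt Vol * A)) 2"
    using Vol A by (simp add: ennreal_powr_ennreal ennreal_mult[symmetric] power_mult_distrib)
  finally have "(\<integral>\<^sup>+\<xi>. ennreal (cmod (H \<xi>)) * indicator (annulus 1 b) \<xi> \<partial>lborel) \<le> ennreal (sqrt Vol * A)"
    by (rule ennreal_powr_le_cancel) simp
  moreover have "(\<integral>\<^sup>+\<xi>. ennreal (cmod (H \<xi>)) * indicator (annulus 1 b) \<xi> \<partial>lborel) = (\<integral>\<^sup>+\<xi>. ennreal (cmod (H \<xi>)) \<partial>lborel)"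
    by (intro nn_integral_cong) (use H_supp in \<open>auto simp: indicator_def\<close>)
  ultimately show ?thesis by simp
qed

lemma H_integrable: "integrable lborel H"
  using nn_integral_H by (intro integrableI_bounded) (auto intro: le_less_trans)

text \<open>A radial wave at fixed \<open>x\<close> has this form, with \<open>m\<close> the
  spherical function sampled at \<open>norm x\<close> (\<open>wave_eq_W\<close>), and so has its
  radial derivative. As a function of time its frequencies lie in \<open>{1..<b}\<close>.\<close>

definition W :: "(real \<Rightarrow> real) \<Rightarrow> real \<Rightarrow> complex" where
  "W m t = (LINT \<xi>|lborel. cis (t * norm \<xi>) * (complex_of_real (m (norm \<xi>)) * H \<xi>))"

context
  fixes m :: "real \<Rightarrow> real" and \<mu> :: real
  assumes m_meas [measurable]: "m \<in> borel_measurable borel" and m: "\<And>\<rho>. 1 \<le> \<rho> \<Longrightarrow> \<rho> < b \<Longrightarrow> \<bar>m \<rho>\<bar> \<le> \<mu>"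
begin

lemma mu: "0 \<le> \<mu>" using m[of 1] b by auto

lemma mH_le: "cmod (complex_of_real (m (norm \<xi>)) * H \<xi>) \<le> \<mu> * cmod (H \<xi>)"
proof (cases "\<xi> \<in> annulus 1 b")
  case True
  then show ?thesis using m[of "norm \<xi>"] by (auto simp: norm_mult annulus_def intro!: mult_right_mono)
qed (simp add: H_supp)

lemma mH_integrable: "integrable lborel (\<lambda>\<xi>. complex_of_real (m (norm \<xi>)) * H \<xi>)"
proof (rule Bochner_Integration.integrable_bound)
  show "integrable lborel (\<lambda>\<xi>. \<mu> * cmod (H \<xi>))" by (intro integrable_mult_right integrable_norm H_integrable)
  show "AE \<xi> in lborel. cmod (complex_of_real (m (norm \<xi>)) * H \<xi>) \<le> norm (\<mu> * cmod (H \<xi>))"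
    using mH_le mu by (intro AE_I2) auto
qed measurable

lemma W_sup: "cmod (W m t) \<le> \<mu> * (sqrt Vol * A)"
proof -
  have "ennreal (cmod (W m t)) \<le> (\<integral>\<^sup>+\<xi>. ennreal (cmod (cis (t * norm \<xi>) * (complex_of_real (m (norm \<xi>)) * H \<xi>))) \<partial>lborel)"
    unfolding W_def by (intro integral_norm_bound_ennreal integrable_cis_mult mH_integrable) measurable
  also have "\<dots> \<le> (\<integral>\<^sup>+\<xi>. ennreal \<mu> * ennreal (cmod (H \<xi>)) \<partial>lborel)"
    using mH_le mu by (intro nn_integral_mono) (simp only: norm_mult norm_cis mult_1 ennreal_mult[symmetric] norm_ge_zero ennreal_leI)
  also have "\<dots> = ennreal \<mu> * (\<integral>\<^sup>+\<xi>. ennreal (cmod (H \<xi>)) \<partial>lborel)" by (simp add: nn_integral_cmult)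
  also have "\<dots> \<le> ennreal \<mu> * ennreal (sqrt Vol * A)" by (intro mult_left_mono nn_integral_H) auto
  finally show ?thesis using mu Vol A by (simp add: ennreal_mult[symmetric])
qed

lemma W_measurable [measurable]: "W m \<in> borel_measurable borel"
  unfolding W_def by measurable

text \<open>Bessel's inequality in time, for the system \<open>cis (t * norm \<xi>)\<close>. In
  polar coordinates the kernel becomes a one-dimensional Gaussian with integral
  \<open>2 * pi\<close>, times at most the polar density at the outer radius; the width of the shell
  does not enter.\<close>

lemma W_L2: "(\<integral>\<^sup>+t. ennreal ((cmod (W m t))\<^sup>2) \<partial>lborel) \<le> ennreal (2 * pi * (real CARD('n) * unit_ball_vol (real CARD('n)) * b ^ (CARD('n) - 1)) * (\<mu> * A)\<^sup>2)"
proof -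
  let ?K = "real CARD('n) * unit_ball_vol (real CARD('n)) * b ^ (CARD('n) - 1)"
  have K: "0 \<le> ?K" using b by simp
  have "(\<integral>\<^sup>+t. ennreal ((cmod (LINT \<xi>|lborel. cis (t \<bullet> norm \<xi>) * (complex_of_real (m (norm \<xi>)) * H \<xi>)))\<^sup>2) \<partial>lborel)
     \<le> ennreal (2 * pi * ?K) * (\<integral>\<^sup>+\<xi>. ennreal ((cmod (complex_of_real (m (norm \<xi>)) * H \<xi>))\<^sup>2) \<partial>lborel)"
  proof (rule Bessel_ineq[where S="annulus 1 b"])
    show "integrable lborel (\<lambda>\<xi>. complex_of_real (m (norm \<xi>)) * H \<xi>)" by (rule mH_integrable)
    show "complex_of_real (m (norm \<xi>)) * H \<xi> = 0" if "\<xi> \<notin> annulus 1 b" for \<xi> using H_supp[OF that] by simp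
    fix a :: real and \<xi> :: "real^'n" assume a: "0 < a"
    define g where "g \<rho> = sqrt (2 * pi / a) ^ DIM(real) * exp (- (norm (norm \<xi> - \<rho>))\<^sup>2 / (2 * a))" for \<rho>
    have g0: "0 \<le> g \<rho>" for \<rho> using a by (simp add: g_def)
    have [measurable]: "g \<in> borel_measurable borel" unfolding g_def by measurable
    have "(\<integral>\<^sup>+\<eta>. ennreal (g (norm \<eta>)) * indicator (annulus 1 b) (\<eta>::real^'n) \<partial>lborel)
      = (\<integral>\<^sup>+\<eta>. (\<lambda>\<rho>. ennreal (g \<rho>) * indicator {1..<b} \<rho>) (norm (\<eta>::real^'n)) \<partial>lborel)"
      by (intro nn_integral_cong) (auto simp: annulus_def indicator_def)
    also have "\<dots> = (\<integral>\<^sup>+\<rho>. ennreal (indicator {0..} \<rho> * (real CARD('n) * unit_ball_vol (real CARD('n)) * \<rho> ^ (CARD('n) - 1))) *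
      (ennreal (g \<rho>) * indicator {1..<b} \<rho>) \<partial>lborel)"
      by (subst nn_integral_radial) auto
    also have "\<dots> \<le> (\<integral>\<^sup>+\<rho>. ennreal ?K * ennreal (g \<rho>) \<partial>lborel)"
    proof (intro nn_integral_mono)
      fix \<rho> :: real
      show "ennreal (indicator {0..} \<rho> * (real CARD('n) * unit_ball_vol (real CARD('n)) * \<rho> ^ (CARD('n) - 1))) * (ennreal (g \<rho>) *
        indicator {1..<b} \<rho>) \<le> ennreal ?K * ennreal (g \<rho>)"
      proof (cases "1 \<le> \<rho> \<and> \<rho> < b")
        case True
        then have "real CARD('n) * unit_ball_vol (real CARD('n)) * \<rho> ^ (CARD('n) - 1) \<le> ?K" by (intro mult_left_mono power_mono) auto
        then show ?thesis using True by (auto intro!: mult_right_mono ennreal_leI)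
      qed auto
    qed
    also have "\<dots> = ennreal ?K * (\<integral>\<^sup>+\<rho>. ennreal (g \<rho>) \<partial>lborel)" by (simp add: nn_integral_cmult)
    also have "(\<integral>\<^sup>+\<rho>. ennreal (g \<rho>) \<partial>lborel) = (\<integral>\<^sup>+\<rho>. ennreal (g (norm \<xi> + \<rho>)) \<partial>lborel)"
      by (rule nn_integral_translate[symmetric]) measurable
    also have "\<dots> = (\<integral>\<^sup>+\<rho>. ennreal (sqrt (2 * pi / a)) * ennreal (exp (- (inverse a * (norm (\<rho>::real))\<^sup>2) / 2)) \<partial>lborel)"
      using a by (intro nn_integral_cong) (simp add: g_def ennreal_mult[symmetric] field_simps)
    also have "\<dots> = ennreal (sqrt (2 * pi / a)) * ennreal (sqrt (2 * pi / inverse a) ^ DIM(real))"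
      using a gaussian_nn_integral[of "inverse a", where 'a=real] by (subst nn_integral_cmult) auto
    also have "\<dots> = ennreal (2 * pi)"
    proof -
      have "0 \<le> sqrt (2 * pi / a)" "0 \<le> sqrt (2 * pi / inverse a)" using a by auto
      then show ?thesis by (simp only: DIM_real power_one_right ennreal_mult[symmetric] sqrt_two_pi_mult[OF a])
    qed
    finally show "(\<integral>\<^sup>+\<eta>. ennreal (sqrt (2 * pi / a) ^ DIM(real) * exp (- (norm (norm \<xi> - norm \<eta>))\<^sup>2 / (2 * a))) * indicator
      (annulus 1 b) (\<eta>::real^'n) \<partial>lborel) \<le> ennreal (2 * pi * ?K)"
      using K by (simp add: g_def ennreal_mult[symmetric] mult.commute)
  qed (auto intro: lborel.sigma_finite_measure_axioms)
  also have "\<dots> \<le> ennreal (2 * pi * ?K) * (ennreal (\<mu>\<^sup>2) * ennreal (A\<^sup>2))"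
  proof (intro mult_left_mono)
    have "(\<integral>\<^sup>+\<xi>. ennreal ((cmod (complex_of_real (m (norm \<xi>)) * H \<xi>))\<^sup>2) \<partial>lborel) \<le> (\<integral>\<^sup>+\<xi>. ennreal (\<mu>\<^sup>2) * ennreal ((cmod (H \<xi>))\<^sup>2) \<partial>lborel)"
    proof (intro nn_integral_mono)
      fix \<xi>
      have "(cmod (complex_of_real (m (norm \<xi>)) * H \<xi>))\<^sup>2 \<le> (\<mu> * cmod (H \<xi>))\<^sup>2" by (intro power_mono mH_le) auto
      then show "ennreal ((cmod (complex_of_real (m (norm \<xi>)) * H \<xi>))\<^sup>2) \<le> ennreal (\<mu>\<^sup>2) * ennreal ((cmod (H \<xi>))\<^sup>2)"
        by (simp only: ennreal_mult[symmetric] zero_le_power2 power_mult_distrib ennreal_leI)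
    qed
    also have "\<dots> = ennreal (\<mu>\<^sup>2) * (\<integral>\<^sup>+\<xi>. ennreal ((cmod (H \<xi>))\<^sup>2) \<partial>lborel)" by (simp add: nn_integral_cmult)
    also have "\<dots> \<le> ennreal (\<mu>\<^sup>2) * ennreal (A\<^sup>2)" by (intro mult_left_mono H_L2) auto
    finally show "(\<integral>\<^sup>+\<xi>. ennreal ((cmod (complex_of_real (m (norm \<xi>)) * H \<xi>))\<^sup>2) \<partial>lborel) \<le> ennreal (\<mu>\<^sup>2) * ennreal (A\<^sup>2)" .
  qed auto
  also have "\<dots> = ennreal (2 * pi * ?K * (\<mu> * A)\<^sup>2)"
    using K by (simp add: ennreal_mult[symmetric] power_mult_distrib mult.assoc)
  finally show ?thesis by (simp add: W_def)
qed

text \<open>Bernstein's inequality in time, by interpolation between the last two bounds.\<close>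

lemma W_Lq:
  assumes q: "2 \<le> q" and A0: "0 < A"
  shows "(\<integral>\<^sup>+t. ennreal (cmod (W m t) powr q) \<partial>lborel)
    \<le> ennreal ((\<mu> * (sqrt Vol * A)) powr (q - 2) * (2 * pi * (real CARD('n) * unit_ball_vol (real CARD('n)) * b ^ (CARD('n) - 1)) * (\<mu> * A)\<^sup>2))"
proof -
  let ?S = "\<mu> * (sqrt Vol * A)"
  have "(\<integral>\<^sup>+t. ennreal (cmod (W m t) powr q) \<partial>lborel) \<le> (\<integral>\<^sup>+t. ennreal (?S powr (q - 2)) * ennreal ((cmod (W m t))\<^sup>2) \<partial>lborel)"
  proof (intro nn_integral_mono)
    fix t
    show "ennreal (cmod (W m t) powr q) \<le> ennreal (?S powr (q - 2)) * ennreal ((cmod (W m t))\<^sup>2)"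
    proof (cases "W m t = 0")
      case False
      then have "cmod (W m t) powr q = cmod (W m t) powr (q - 2) * (cmod (W m t))\<^sup>2"
        using powr_add[of "cmod (W m t)" "q - 2" 2] by simp
      also have "\<dots> \<le> ?S powr (q - 2) * (cmod (W m t))\<^sup>2"
        using q by (intro mult_right_mono powr_mono2 W_sup) auto
      finally show ?thesis by (simp only: ennreal_mult[symmetric] powr_ge_zero zero_le_power2 ennreal_leI)
    qed simp
  qed
  also have "\<dots> = ennreal (?S powr (q - 2)) * (\<integral>\<^sup>+t. ennreal ((cmod (W m t))\<^sup>2) \<partial>lborel)" by (simp add: nn_integral_cmult)
  also have "\<dots> \<le> ennreal (?S powr (q - 2)) * ennreal (2 * pi * (real CARD('n) * unit_ball_vol (real CARD('n)) * b ^ (CARD('n) - 1)) * (\<mu> * A)\<^sup>2)"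
    by (intro mult_left_mono W_L2) auto
  finally show ?thesis using b by (simp add: ennreal_mult[symmetric])
qed

end

lemma wave_eq_W:
  assumes "x \<noteq> 0"
  shows "wave H t x = W (\<lambda>\<rho>. sph CARD('n) (\<rho> * norm x)) t"
proof -
  have "radial_ae (\<lambda>\<xi>. cis (t * norm \<xi>) * H \<xi>)"
    unfolding radial_ae_def
  proof (intro allI impI)
    fix T :: "real^'n \<Rightarrow> real^'n" assume T: "orthogonal_transformation T"
    then have "AE \<xi> in lborel. H (T \<xi>) = H \<xi>" using H_rad by (simp add: radial_ae_def)
    then show "AE \<xi> in lborel. cis (t * norm (T \<xi>)) * H (T \<xi>) = cis (t * norm \<xi>) * H \<xi>"
      using T by (auto elim!: eventually_mono simp: orthogonal_transformation_norm)
  qed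
  then show ?thesis
    unfolding wave_def W_def
    by (subst ft_radial_eq_sph[OF integrable_cis_mult[OF H_integrable] _ assms]) (auto simp: mult_ac)
qed

text \<open>The upper half of Plancherel's identity at fixed time: Bessel's inequality with all
  plane waves, where the Gaussian kernel has total mass \<open>(2 * pi) ^ CARD('n)\<close>.\<close>

lemma wave_L2: "(\<integral>\<^sup>+x. ennreal ((cmod (wave H t x))\<^sup>2) \<partial>lborel) \<le> ennreal ((2 * pi) ^ CARD('n) * A\<^sup>2)"
proof -
  have "(\<integral>\<^sup>+x. ennreal ((cmod (LINT \<xi>|lborel. cis (x \<bullet> id \<xi>) * (cis (t * norm \<xi>) * H \<xi>)))\<^sup>2) \<partial>lborel)
     \<le> ennreal ((2 * pi) ^ CARD('n)) * (\<integral>\<^sup>+\<xi>. ennreal ((cmod (cis (t * norm \<xi>) * H \<xi>))\<^sup>2) \<partial>lborel)"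
  proof (rule Bessel_ineq[where S=UNIV])
    show "integrable lborel (\<lambda>\<xi>. cis (t * norm \<xi>) * H \<xi>)" by (intro integrable_cis_mult H_integrable) measurable
    fix a :: real and \<xi> :: "real^'n" assume a: "0 < a"
    let ?g = "\<lambda>\<eta>::real^'n. ennreal (sqrt (2 * pi / a) ^ CARD('n) * exp (- (norm (\<xi> - \<eta>))\<^sup>2 / (2 * a)))"
    have "(\<integral>\<^sup>+\<eta>. ?g \<eta> \<partial>lborel) = (\<integral>\<^sup>+\<eta>. ?g (\<xi> + \<eta>) \<partial>lborel)"
      by (rule nn_integral_translate[symmetric]) measurable
    also have "\<dots> = (\<integral>\<^sup>+\<eta>. ennreal (sqrt (2 * pi / a) ^ CARD('n)) * ennreal (exp (- (inverse a * (norm (\<eta>::real^'n))\<^sup>2) / 2)) \<partial>lborel)"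
      using a by (intro nn_integral_cong) (simp add: ennreal_mult[symmetric] field_simps)
    also have "\<dots> = ennreal (sqrt (2 * pi / a) ^ CARD('n)) * ennreal (sqrt (2 * pi / inverse a) ^ CARD('n))"
      using a gaussian_nn_integral[of "inverse a", where 'a="real^'n"] by (subst nn_integral_cmult) auto
    also have "\<dots> = ennreal ((2 * pi) ^ CARD('n))"
    proof -
      have "sqrt (2 * pi / a) ^ CARD('n) * sqrt (2 * pi / inverse a) ^ CARD('n) = (2 * pi) ^ CARD('n)"
        unfolding power_mult_distrib[symmetric] sqrt_two_pi_mult[OF a] ..
      moreover have "0 \<le> sqrt (2 * pi / a) ^ CARD('n)" "0 \<le> sqrt (2 * pi / inverse a) ^ CARD('n)" using a by auto
      ultimately show ?thesis by (simp only: ennreal_mult[symmetric])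
    qed
    finally show "(\<integral>\<^sup>+\<eta>. ennreal (sqrt (2 * pi / a) ^ DIM(real^'n) * exp (- (norm (id \<xi> - id \<eta>))\<^sup>2 / (2 * a))) * indicator UNIV
      (\<eta>::real^'n) \<partial>lborel) \<le> ennreal ((2 * pi) ^ CARD('n))"
      by simp
  qed (auto intro: lborel.sigma_finite_measure_axioms)
  also have "\<dots> \<le> ennreal ((2 * pi) ^ CARD('n)) * ennreal (A\<^sup>2)"
    using H_L2 by (intro mult_left_mono) (auto simp: norm_mult)
  finally show ?thesis unfolding wave_def ft_def by (simp add: ennreal_mult[symmetric])
qed

end

section \<open>Power weights and powers of series\<close>

lemma sets_ball_borel [measurable, simp]: "ball (x::'a::euclidean_space) r \<in> sets borel"
  by (simp add: borel_open)

lemma nn_integral_radial_powr_near: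
  fixes \<beta> :: real
  assumes "- real DIM('a::euclidean_space) < \<beta>"
  shows "(\<integral>\<^sup>+x. ennreal (norm (x::'a) powr \<beta>) * indicator (ball 0 1) x \<partial>lborel) < \<top>"
proof -
  let ?n = "DIM('a)"
  let ?c = "real ?n * unit_ball_vol (real ?n)"
  let ?e = "\<beta> + real ?n - 1"
  have e: "- 1 < ?e" using assms by simp
  have "(\<integral>\<^sup>+x. ennreal (norm (x::'a) powr \<beta>) * indicator (ball 0 1) x \<partial>lborel) = (\<integral>\<^sup>+x. (\<lambda>\<rho>. ennreal (\<rho> powr \<beta>) * indicator {..<1} \<rho>) (norm (x::'a)) \<partial>lborel)"
    by (intro nn_integral_cong) (auto simp: indicator_def dist_norm)
  also have "\<dots> = (\<integral>\<^sup>+\<rho>. ennreal (indicator {0..} \<rho> * (?c * \<rho> ^ (?n - 1))) * (ennreal (\<rho> powr \<beta>) * indicator {..<1} \<rho>) \<partial>lborel)"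
    by (rule nn_integral_radial) measurable
  also have "\<dots> \<le> (\<integral>\<^sup>+\<rho>. ennreal ?c * (ennreal (\<rho> powr ?e) * indicator {0..1} \<rho>) \<partial>lborel)"
  proof (intro nn_integral_mono)
    fix \<rho> :: real
    show "ennreal (indicator {0..} \<rho> * (?c * \<rho> ^ (?n - 1))) * (ennreal (\<rho> powr \<beta>) * indicator {..<1} \<rho>) \<le> ennreal ?c * (ennreal (\<rho> powr ?e) * indicator {0..1} \<rho>)"
    proof (cases "0 < \<rho> \<and> \<rho> < 1")
      case True
      then have "\<rho> ^ (?n - 1) * \<rho> powr \<beta> = \<rho> powr ?e"
        by (simp add: powr_realpow[symmetric] powr_add[symmetric] of_nat_diff Suc_leI algebra_simps)
      then show ?thesis using True by (simp add: ennreal_mult[symmetric] mult.assoc)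
    next
      case False
      then show ?thesis by (cases "\<rho> = 0") (auto simp: indicator_def)
    qed
  qed
  also have "\<dots> = ennreal ?c * (\<integral>\<^sup>+\<rho>. ennreal (\<rho> powr ?e) * indicator {0..1} \<rho> \<partial>lborel)"
    by (simp add: nn_integral_cmult)
  also have "(\<integral>\<^sup>+\<rho>. ennreal (\<rho> powr ?e) * indicator {0..1} \<rho> \<partial>lborel) = ennreal (1 powr (?e + 1) / (?e + 1))"
    using nn_integral_has_integral_lebesgue'[OF _ has_integral_powr_from_0[OF e, of 1]]
    by simp
  finally show ?thesis by (rule order.strict_trans1) (simp add: ennreal_mult[symmetric] ennreal_mult_less_top)
qed

lemma nn_integral_radial_powr_far:
  fixes \<beta> :: real
  assumes "\<beta> < - real DIM('a::euclidean_space)"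
  shows "(\<integral>\<^sup>+x. ennreal (norm (x::'a) powr \<beta>) * indicator (- ball 0 1) x \<partial>lborel) < \<top>"
proof -
  let ?n = "DIM('a)"
  let ?c = "real ?n * unit_ball_vol (real ?n)"
  let ?e = "\<beta> + real ?n - 1"
  have e: "?e < - 1" using assms by simp
  have "(\<integral>\<^sup>+x. ennreal (norm (x::'a) powr \<beta>) * indicator (- ball 0 1) x \<partial>lborel) = (\<integral>\<^sup>+x. (\<lambda>\<rho>. ennreal (\<rho> powr \<beta>) * indicator {1..} \<rho>) (norm (x::'a)) \<partial>lborel)"
    by (intro nn_integral_cong) (auto simp: indicator_def dist_norm)
  also have "\<dots> = (\<integral>\<^sup>+\<rho>. ennreal (indicator {0..} \<rho> * (?c * \<rho> ^ (?n - 1))) * (ennreal (\<rho> powr \<beta>) * indicator {1..} \<rho>) \<partial>lborel)"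
    by (rule nn_integral_radial) measurable
  also have "\<dots> \<le> (\<integral>\<^sup>+\<rho>. ennreal ?c * (ennreal (\<rho> powr ?e) * indicator {1..} \<rho>) \<partial>lborel)"
  proof (intro nn_integral_mono)
    fix \<rho> :: real
    show "ennreal (indicator {0..} \<rho> * (?c * \<rho> ^ (?n - 1))) * (ennreal (\<rho> powr \<beta>) * indicator {1..} \<rho>) \<le> ennreal ?c * (ennreal (\<rho> powr ?e) * indicator {1..} \<rho>)"
    proof (cases "1 \<le> \<rho>")
      case True
      then have "\<rho> ^ (?n - 1) * \<rho> powr \<beta> = \<rho> powr ?e"
        by (simp add: powr_realpow[symmetric] powr_add[symmetric] of_nat_diff Suc_leI algebra_simps)
      then show ?thesis using True by (simp add: ennreal_mult[symmetric] mult.assoc)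
    qed auto
  qed
  also have "\<dots> = ennreal ?c * (\<integral>\<^sup>+\<rho>. ennreal (\<rho> powr ?e) * indicator {1..} \<rho> \<partial>lborel)"
    by (simp add: nn_integral_cmult)
  also have "(\<integral>\<^sup>+\<rho>. ennreal (\<rho> powr ?e) * indicator {1..} \<rho> \<partial>lborel) = ennreal (- (1 powr (?e + 1)) / (?e + 1))"
    using nn_integral_has_integral_lebesgue'[OF _ has_integral_powr_to_inf[OF e, of 1]]
    by simp
  finally show ?thesis by (rule order.strict_trans1) (simp add: ennreal_mult_less_top)
qed

text \<open>Subadditivity of a concave power, by splitting \<open>a m\<close> into its powers
  \<open>r\<close> and \<open>1 - r\<close>. With \<open>R\<close> the right-hand side, the second
  is at most \<open>R\<close> to the power \<open>(1 - r) / r\<close>, and the first ones sum to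
  \<open>R\<close>.\<close>

lemma ennreal_powr_suminf_le:
  fixes a :: "nat \<Rightarrow> ennreal"
  assumes "0 < r" "r \<le> 1"
  shows "ennreal_powr (\<Sum>m. a m) r \<le> (\<Sum>m. ennreal_powr (a m) r)"
proof -
  define R where "R = (\<Sum>m. ennreal_powr (a m) r)"
  have le: "ennreal_powr (a m) r \<le> R" for m
    unfolding R_def using sum_le_suminf[of "\<lambda>m. ennreal_powr (a m) r" "{m}"] by simp
  have "(\<Sum>m. a m) \<le> (\<Sum>m. ennreal_powr (a m) r * ennreal_powr R ((1 - r) / r))"
  proof (intro suminf_le summableI)
    fix m
    have "a m = ennreal_powr (a m) r * ennreal_powr (a m) (1 - r)"
      unfolding ennreal_powr_add[symmetric] by simp
    also have "ennreal_powr (a m) (1 - r) = ennreal_powr (ennreal_powr (a m) r) ((1 - r) / r)"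
      using assms by (simp add: ennreal_powr_powr)
    also have "\<dots> \<le> ennreal_powr R ((1 - r) / r)"
      using assms by (intro ennreal_powr_mono[OF _ le]) auto
    finally show "a m \<le> ennreal_powr (a m) r * ennreal_powr R ((1 - r) / r)"
      by (simp add: mult_left_mono)
  qed
  also have "\<dots> = R * ennreal_powr R ((1 - r) / r)"
    by (simp add: R_def)
  also have "\<dots> = ennreal_powr R (1 / r)"
    using ennreal_powr_add[of R 1 "(1 - r) / r"] assms by (simp add: field_simps)
  finally have "ennreal_powr (\<Sum>m. a m) r \<le> ennreal_powr (ennreal_powr R (1 / r)) r"
    using assms by (intro ennreal_powr_mono) auto
  then show ?thesis using assms by (simp add: ennreal_powr_powr R_def)
qed

text \<open>The area of the sphere of radius \<open>1 + \<Lambda>\<close>, which bounds the polar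
  density on shells with \<open>b \<le> 1 + \<Lambda>\<close>. It makes the constants independent of
  \<open>b\<close>.\<close>

definition ring_const :: "'n::finite itself \<Rightarrow> real \<Rightarrow> real" where
  "ring_const _ \<Lambda> = real CARD('n) * unit_ball_vol (real CARD('n)) * (1 + \<Lambda>) ^ (CARD('n) - 1)"

context annulus_data
begin

lemma W_bounds:
  assumes \<Lambda>: "b \<le> 1 + \<Lambda>" and [measurable]: "m \<in> borel_measurable borel" and m: "\<And>\<rho>. 1 \<le> \<rho> \<Longrightarrow> \<rho> < b \<Longrightarrow> \<bar>m \<rho>\<bar> \<le> \<mu>"
  defines "c \<equiv> ring_const TYPE('n) \<Lambda>"
  shows "cmod (W m t) \<le> \<mu> * (sqrt (c * (b - 1)) * A)"
    and "(\<integral>\<^sup>+t. ennreal ((cmod (W m t))\<^sup>2) \<partial>lborel) \<le> ennreal (2 * pi * c * (\<mu> * A)\<^sup>2)"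
    and "2 \<le> q \<Longrightarrow> 0 < A \<Longrightarrow> (\<integral>\<^sup>+t. ennreal (cmod (W m t) powr q) \<partial>lborel) \<le> ennreal (2 * pi * c * sqrt (c * (b - 1)) powr (q - 2) * (\<mu> * A) powr q)"
proof -
  have mu: "0 \<le> \<mu>" using mu[OF assms(2)] m by blast
  have kc: "real CARD('n) * unit_ball_vol (real CARD('n)) * b ^ (CARD('n) - 1) \<le> c"
    unfolding c_def ring_const_def using b \<Lambda> by (intro mult_left_mono power_mono) auto
  have Vc: "Vol \<le> c * (b - 1)"
    using mult_right_mono[OF kc, of "b - 1"] b by (simp add: Vol_def mult_ac)
  have c0: "0 \<le> c" using kc b by (intro order_trans[OF _ kc]) auto
  have sq: "sqrt Vol \<le> sqrt (c * (b - 1))" using Vc by simp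
  have W1: "cmod (W m t) \<le> \<mu> * (sqrt Vol * A)" for t by (rule W_sup[OF assms(2) m])
  also have "\<mu> * (sqrt Vol * A) \<le> \<mu> * (sqrt (c * (b - 1)) * A)"
    using mu A by (intro mult_left_mono mult_right_mono sq) auto
  finally show "cmod (W m t) \<le> \<mu> * (sqrt (c * (b - 1)) * A)" .
  have "(\<integral>\<^sup>+t. ennreal ((cmod (W m t))\<^sup>2) \<partial>lborel) \<le> ennreal (2 * pi * (real CARD('n) * unit_ball_vol (real CARD('n)) * b ^ (CARD('n) - 1)) * (\<mu> * A)\<^sup>2)"
    by (rule W_L2[OF assms(2) m])
  also have "\<dots> \<le> ennreal (2 * pi * c * (\<mu> * A)\<^sup>2)"
    by (intro ennreal_leI mult_right_mono mult_left_mono kc) auto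
  finally show "(\<integral>\<^sup>+t. ennreal ((cmod (W m t))\<^sup>2) \<partial>lborel) \<le> ennreal (2 * pi * c * (\<mu> * A)\<^sup>2)" .
  assume q: "2 \<le> q" and A0: "0 < A"
  have "(\<integral>\<^sup>+t. ennreal (cmod (W m t) powr q) \<partial>lborel)
    \<le> ennreal ((\<mu> * (sqrt Vol * A)) powr (q - 2) * (2 * pi * (real CARD('n) * unit_ball_vol (real CARD('n)) * b ^ (CARD('n) - 1)) * (\<mu> * A)\<^sup>2))"
    by (rule W_Lq[OF assms(2) m q A0])
  also have "\<dots> \<le> ennreal (2 * pi * c * sqrt (c * (b - 1)) powr (q - 2) * (\<mu> * A) powr q)"
  proof (rule ennreal_leI)
    have "(\<mu> * (sqrt Vol * A)) powr (q - 2) * (2 * pi * (real CARD('n) * unit_ball_vol (real CARD('n)) * b ^ (CARD('n) - 1)) * (\<mu> * A)\<^sup>2)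
      \<le> (\<mu> * (sqrt (c * (b - 1)) * A)) powr (q - 2) * (2 * pi * c * (\<mu> * A)\<^sup>2)"
      using mu A q b Vol by (intro mult_mono powr_mono2 mult_left_mono mult_right_mono kc sq mult_nonneg_nonneg) auto
    also have "\<dots> = 2 * pi * c * sqrt (c * (b - 1)) powr (q - 2) * ((\<mu> * A) powr (q - 2) * (\<mu> * A)\<^sup>2)"
    proof -
      have "(\<mu> * (sqrt (c * (b - 1)) * A)) powr (q - 2) = sqrt (c * (b - 1)) powr (q - 2) * (\<mu> * A) powr (q - 2)"
        using mu A c0 b by (subst powr_mult[symmetric]) (auto simp: mult_ac)
      then show ?thesis by (simp only: mult_ac)
    qed
    also have "(\<mu> * A) powr (q - 2) * (\<mu> * A)\<^sup>2 = (\<mu> * A) powr q"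
    proof (cases "\<mu> * A = 0")
      case False
      then have "0 < \<mu> * A" using mu A by (simp add: less_le)
      then show ?thesis using powr_add[of "\<mu> * A" "q - 2" 2] by simp
    next
      case True
      show ?thesis unfolding True by simp
    qed
    finally show "(\<mu> * (sqrt Vol * A)) powr (q - 2) * (2 * pi * (real CARD('n) * unit_ball_vol (real CARD('n)) * b ^ (CARD('n) - 1)) * (\<mu> * A)\<^sup>2)
      \<le> 2 * pi * c * sqrt (c * (b - 1)) powr (q - 2) * (\<mu> * A) powr q" .
  qed
  finally show "(\<integral>\<^sup>+t. ennreal (cmod (W m t) powr q) \<partial>lborel) \<le> ennreal (2 * pi * c * sqrt (c * (b - 1)) powr (q - 2) * (\<mu> * A) powr q)" .
qed

end

lemma ring_const_pos: "0 \<le> \<Lambda> \<Longrightarrow> 0 < ring_const TYPE('n::finite) \<Lambda>"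
  unfolding ring_const_def by (intro mult_pos_pos) auto

lemma sph_measurable_CARD [measurable]:
  "sph CARD('n::finite) \<in> borel_measurable borel" "sph' CARD('n) \<in> borel_measurable borel"
  using sph_measurable[where 'a="real^'n"] by simp_all

lemma sph_decay_CARD:
  obtains S where "0 < S" "\<And>r. 0 \<le> r \<Longrightarrow> \<bar>sph CARD('n::finite) r\<bar> \<le> S * (1 + r) powr (- (real CARD('n) - 1) / 2)"
    "\<And>r. 0 \<le> r \<Longrightarrow> \<bar>sph' CARD('n) r\<bar> \<le> S * (1 + r) powr (- (real CARD('n) - 1) / 2)"
  using sph_decay[where 'a="real^'n"] by auto

section \<open>The mixed norm of the wave of one shell\<close>

definition det_norm :: "real \<Rightarrow> real \<Rightarrow> real \<Rightarrow> (real^'n::finite \<Rightarrow> complex) \<Rightarrow> ennreal" where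
  "det_norm q p \<alpha> H = Lp_norm q lborel (\<lambda>t. Lp_norm p lborel (\<lambda>x. ennreal (norm x powr \<alpha> * cmod (wave H t x))))"

text \<open>For \<open>p \<le> q\<close> the spatial integral is estimated by Jensen's inequality with respect to the
  measure \<open>|u|\<^sup>2 z dx\<close>, whose mass is controlled by Plancherel. The weight \<open>z\<close> is chosen to make
  the resulting integral converge at the origin.\<close>

lemma det_norm_p_le_q:
  fixes p q \<alpha> \<Lambda> :: real
  assumes p: "2 \<le> p" "p \<le> q" and \<alpha>: "- real CARD('n::finite) / p < \<alpha>" "\<alpha> < (real CARD('n) - 1) * (1 / 2 - 1 / p) - 1 / q"
    and \<Lambda>: "0 \<le> \<Lambda>"
  shows "\<exists>C>0. \<forall>(H::real^'n \<Rightarrow> complex) b A. annulus_data H b A \<longrightarrow> b \<le> 1 + \<Lambda> \<longrightarrow> 0 < A \<longrightarrow>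
    det_norm q p \<alpha> H \<le> ennreal (C * (b - 1) powr (1 / 2 - 1 / p) * A)"
proof -
  let ?n = "CARD('n)"
  define \<mu> where "\<mu> = (real ?n - 1) / 2"
  define \<theta> where "\<theta> = q / p"
  define c where "c = ring_const TYPE('n) \<Lambda>"
  have c: "0 < c" unfolding c_def by (rule ring_const_pos[OF \<Lambda>])
  have n1: "1 \<le> real ?n" by (simp add: Suc_leI)
  have \<mu>: "0 \<le> \<mu>" using n1 by (simp add: \<mu>_def)
  have pq: "0 < p" "0 < q" "1 \<le> \<theta>" "0 < \<theta>" using p by (auto simp: \<theta>_def)
  obtain S where S: "0 < S" "\<And>r. 0 \<le> r \<Longrightarrow> \<bar>sph ?n r\<bar> \<le> S * (1 + r) powr (- (real ?n - 1) / 2)"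
    by (rule sph_decay_CARD[where 'n='n]) (rule that; assumption)
  have S2: "\<bar>sph ?n r\<bar> \<le> S * (1 + r) powr (- \<mu>)" if "0 \<le> r" for r
    using S(2)[OF that] unfolding \<mu>_def minus_divide_left .
  define g where "g x = S * (1 + norm x) powr (- \<mu>)" for x :: "real^'n"
  define w where "w x = norm x powr (\<alpha> * p)" for x :: "real^'n"
  define z where "z x = 1 + w x * indicator (ball 0 1) x" for x :: "real^'n"
  define k where "k x = w x * g x powr (p - 2) / z x" for x
  have g_meas [measurable]: "g \<in> borel_measurable borel" unfolding g_def by measurable
  have w_meas [measurable]: "w \<in> borel_measurable borel" unfolding w_def by measurable
  have z_meas [measurable]: "z \<in> borel_measurable borel" unfolding z_def by measurable
  have k_meas [measurable]: "k \<in> borel_measurable borel" unfolding k_def by measurable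
  have g: "0 < g x" "g x \<le> S" for x
  proof -
    have "1 + norm x > 0" by (simp add: add_pos_nonneg)
    then show "0 < g x" using S(1) by (simp add: g_def)
    have "(1 + norm x) powr (- \<mu>) \<le> (1 + norm x) powr 0" using \<mu> by (intro powr_mono) auto
    then show "g x \<le> S" using S(1) by (simp add: g_def add_nonneg_eq_0_iff)
  qed
  have w0: "0 \<le> w x" for x by (simp add: w_def)
  have z1: "1 \<le> z x" for x using w0[of x] by (simp add: z_def)
  have k0: "0 \<le> k x" for x unfolding k_def using w0[of x] z1[of x] by (intro divide_nonneg_nonneg mult_nonneg_nonneg) auto
  define I0 where "I0 = enn2real (\<integral>\<^sup>+x. ennreal (w x) * indicator (ball 0 1) x \<partial>lborel)"
  have "- real ?n < \<alpha> * p" using \<alpha>(1) pq(1) by (simp only: pos_divide_less_eq)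
  then have I0fin: "(\<integral>\<^sup>+x. ennreal (w x) * indicator (ball 0 1) x \<partial>lborel) < \<top>"
    unfolding w_def using nn_integral_radial_powr_near[where 'a="real^'n" and \<beta>="\<alpha> * p"] by simp
  then have I0: "(\<integral>\<^sup>+x. ennreal (w x) * indicator (ball 0 1) x \<partial>lborel) = ennreal I0" "0 \<le> I0"
    by (simp_all add: I0_def)
  define m where "m = (p - 2) * \<theta> + 2"
  have m: "0 \<le> m" using p pq by (simp add: m_def)
  define I1 where "I1 = enn2real (\<integral>\<^sup>+x. ennreal (k x powr \<theta> * z x * (g x)\<^sup>2) \<partial>lborel)"
  have "(\<integral>\<^sup>+x. ennreal (k x powr \<theta> * z x * (g x)\<^sup>2) \<partial>lborel) < \<top>"
  proof -
    let ?e = "\<alpha> * q - \<mu> * m"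
    \<comment> \<open>This is equivalent to the assumed upper bound on
      \<open>\<alpha>\<close>.\<close>
    have "?e < - real ?n"
    proof -
      have "\<mu> * m = (real ?n - 1) * (q / 2 - q / p + 1)"
        using pq by (simp add: \<mu>_def m_def \<theta>_def field_simps)
      moreover have "\<alpha> * q < ((real ?n - 1) * (1 / 2 - 1 / p) - 1 / q) * q" using \<alpha>(2) pq by simp
      moreover have "((real ?n - 1) * (1 / 2 - 1 / p) - 1 / q) * q = (real ?n - 1) * (q / 2 - q / p) - 1"
        using pq by (simp add: field_simps)
      ultimately show ?thesis by (simp add: algebra_simps)
    qed
    then have far: "(\<integral>\<^sup>+x. ennreal (norm (x::real^'n) powr ?e) * indicator (- ball 0 1) x \<partial>lborel) < \<top>"
      using nn_integral_radial_powr_far[where 'a="real^'n" and \<beta>="?e"] by simp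
    have "(\<integral>\<^sup>+x. ennreal (k x powr \<theta> * z x * (g x)\<^sup>2) \<partial>lborel)
      \<le> (\<integral>\<^sup>+x. ennreal (S powr m) * (indicator (ball 0 1) x + ennreal (w x) * indicator (ball 0 1) x + ennreal (norm x powr ?e) * indicator (- ball 0 1) x) \<partial>lborel)"
    proof (intro nn_integral_mono_AE)
      have "AE x in lborel. x \<noteq> (0::real^'n)" by (rule AE_lborel_singleton)
      then show "AE x in lborel. ennreal (k x powr \<theta> * z x * (g x)\<^sup>2) \<le> ennreal (S powr m) * (indicator (ball 0 1) x + ennreal (w
        x) * indicator (ball 0 1) x + ennreal (norm x powr ?e) * indicator (- ball 0 1) x)"
      proof eventually_elim
        case (elim x)
        have gm: "(g x powr (p - 2)) powr \<theta> * (g x)\<^sup>2 = g x powr m"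
          using g(1)[of x] powr_add[of "g x" "(p - 2) * \<theta>" 2] by (simp add: m_def powr_powr)
        show ?case
        proof (cases "x \<in> ball 0 1")
          case True
          then have zx: "z x = 1 + w x" by (simp add: z_def)
          have "k x \<le> g x powr (p - 2)"
          proof -
            have "w x / z x \<le> 1" using w0[of x] by (simp add: zx)
            then show ?thesis unfolding k_def using mult_right_mono[of "w x / z x" 1 "g x powr (p - 2)"] by simp
          qed
          then have "k x powr \<theta> \<le> (g x powr (p - 2)) powr \<theta>" using k0 pq by (intro powr_mono2) auto
          then have "k x powr \<theta> * (g x)\<^sup>2 \<le> g x powr m" unfolding gm[symmetric] by (intro mult_right_mono) auto
          also have "\<dots> \<le> S powr m" using g[of x] m by (intro powr_mono2) auto
          finally have "k x powr \<theta> * z x * (g x)\<^sup>2 \<le> S powr m * (1 + w x)"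
            using mult_right_mono[of "k x powr \<theta> * (g x)\<^sup>2" "S powr m" "1 + w x"] w0[of x] by (simp add: zx mult_ac)
          then show ?thesis using True w0[of x]
            by (simp add: ennreal_mult[symmetric] ennreal_plus[symmetric] ennreal_leI del: ennreal_plus flip: ennreal_1)
        next
          case False
          have xn: "1 \<le> norm x" using False by (simp add: dist_norm)
          have zx: "z x = 1" using False by (simp add: z_def)
          have wq: "w x powr \<theta> = norm x powr (\<alpha> * q)" using pq by (simp add: w_def powr_powr \<theta>_def)
          have "g x powr m = S powr m * (1 + norm x) powr (- (\<mu> * m))"
            using S(1) by (simp add: g_def powr_mult powr_powr)
          also have "\<dots> \<le> S powr m * norm x powr (- (\<mu> * m))"
            using xn \<mu> m by (intro mult_left_mono powr_mono2') auto
          finally have gS: "g x powr m \<le> S powr m * norm x powr (- (\<mu> * m))" .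
          have "k x powr \<theta> * z x * (g x)\<^sup>2 = w x powr \<theta> * g x powr m"
            using w0[of x] by (simp add: k_def zx powr_mult gm[symmetric])
          also have "\<dots> \<le> norm x powr (\<alpha> * q) * (S powr m * norm x powr (- (\<mu> * m)))"
            unfolding wq by (intro mult_left_mono gS) auto
          also have "\<dots> = S powr m * norm x powr ?e" by (simp add: powr_add[symmetric] mult_ac)
          finally show ?thesis using False by (simp add: ennreal_mult[symmetric] ennreal_leI)
        qed
      qed
    qed
    also have "\<dots> = ennreal (S powr m) * (emeasure lborel (ball (0::real^'n) 1) + (\<integral>\<^sup>+x. ennreal (w x) * indicator (ball 0 1) x
      \<partial>lborel) + (\<integral>\<^sup>+x. ennreal (norm (x::real^'n) powr ?e) * indicator (- ball 0 1) x \<partial>lborel))"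
      by (simp add: nn_integral_cmult nn_integral_add)
    also have "\<dots> < \<top>"
      using far I0fin emeasure_lborel_ball_finite[of "0::real^'n" 1] by (simp add: ennreal_mult_less_top)
    finally show ?thesis .
  qed
  then have I1: "(\<integral>\<^sup>+x. ennreal (k x powr \<theta> * z x * (g x)\<^sup>2) \<partial>lborel) = ennreal I1" "0 \<le> I1"
    by (simp_all add: I1_def)
  define c2 where "c2 = (2 * pi) ^ ?n + S\<^sup>2 * (c * \<Lambda>) * I0"
  have c2: "0 < c2" using c \<Lambda> I0 by (simp add: c2_def add_pos_nonneg)
  define c3 where "c3 = sqrt c powr ((p - 2) * \<theta>) * c2 powr (\<theta> - 1) * (2 * pi * c) * I1"
  have c3: "0 \<le> c3" using c I1 by (simp add: c3_def)
  show ?thesis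
  \<comment> \<open>\<open>c3\<close> may be 0; adding 1 keeps the constant positive.\<close>
  proof (intro exI[of _ "(c3 + 1) powr (1 / q)"] conjI allI impI)
    show "0 < (c3 + 1) powr (1 / q)" using c3 by simp
    fix H :: "real^'n \<Rightarrow> complex" and b A
    assume "annulus_data H b A" and b\<Lambda>: "b \<le> 1 + \<Lambda>" and A0: "0 < A"
    then interpret annulus_data H b A by simp
    define D where "D = b - 1"
    have D: "0 < D" "D \<le> \<Lambda>" using b b\<Lambda> by (auto simp: D_def)
    \<comment> \<open>Up to the decay \<open>g x\<close>, the bound for the wave uniformly in time.
      The square root of the width \<open>D\<close> inside \<open>K\<close> is the whole source of
      the gain.\<close>
    define K where "K = sqrt (c * D) * A"
    have K: "0 < K" using c D A0 by (simp add: K_def)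
    define G where "G t x = cmod (wave H t x)" for t x
    have G_meas [measurable]: "(\<lambda>(t, x). G t x) \<in> borel_measurable (borel \<Otimes>\<^sub>M borel)"
      unfolding G_def by measurable
    have G0: "0 \<le> G t x" for t x by (simp add: G_def)
    have sphb: "\<bar>sph ?n (\<rho> * norm x)\<bar> \<le> g x" if "1 \<le> \<rho>" for \<rho> and x :: "real^'n"
    proof -
      have "\<bar>sph ?n (\<rho> * norm x)\<bar> \<le> S * (1 + \<rho> * norm x) powr (- \<mu>)"
        using S2[of "\<rho> * norm x"] that by simp
      also have "\<dots> \<le> S * (1 + norm x) powr (- \<mu>)"
        using S(1) \<mu> that mult_right_mono[of 1 \<rho> "norm x"] by (intro mult_left_mono powr_mono2') (auto simp: add_pos_nonneg)
      finally show ?thesis by (simp add: g_def)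
    qed
    have Wb: "cmod (W (\<lambda>\<rho>. sph ?n (\<rho> * norm x)) t) \<le> g x * K"
      "(\<integral>\<^sup>+t. ennreal ((cmod (W (\<lambda>\<rho>. sph ?n (\<rho> * norm x)) t))\<^sup>2) \<partial>lborel) \<le> ennreal (2 * pi * c * (g x * A)\<^sup>2)" for x t
      unfolding K_def c_def D_def using sphb by (intro W_bounds[OF b\<Lambda>]; measurable)+
    have Gs: "G t x \<le> g x * K" if "x \<noteq> 0" for t x
      using Wb(1)[of x t] wave_eq_W[OF that] by (simp add: G_def)
    have GT: "(\<integral>\<^sup>+t. ennreal ((G t x)\<^sup>2) \<partial>lborel) \<le> ennreal (2 * pi * c * (g x * A)\<^sup>2)" if "x \<noteq> 0" for x
      using Wb(2)[of x] wave_eq_W[OF that] by (simp add: G_def)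
    have x0: "AE x in lborel. x \<noteq> (0::real^'n)" by (rule AE_lborel_singleton)
    define I where "I t = (\<integral>\<^sup>+x. ennreal_powr (ennreal (norm x powr \<alpha> * G t x)) p \<partial>lborel)" for t
    \<comment> \<open>Of the \<open>p\<close> factors of the wave, \<open>p - 2\<close> are replaced
      by the bound \<open>g x * K\<close>; the square that remains becomes the density of a
      measure.\<close>
    have step1: "I t \<le> ennreal (K powr (p - 2)) * (\<integral>\<^sup>+x. ennreal (k x) \<partial>density lborel (\<lambda>x. ennreal ((G t x)\<^sup>2 * z x)))" for t
    proof -
      have "I t \<le> (\<integral>\<^sup>+x. ennreal (K powr (p - 2)) * (ennreal ((G t x)\<^sup>2 * z x) * ennreal (k x)) \<partial>lborel)"
        unfolding I_def
      proof (intro nn_integral_mono_AE)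
        from x0 show "AE x in lborel. ennreal_powr (ennreal (norm x powr \<alpha> * G t x)) p \<le> ennreal (K powr (p - 2)) * (ennreal ((G t x)\<^sup>2 * z x) * ennreal (k x))"
        proof eventually_elim
          case (elim x)
          have "(norm x powr \<alpha> * G t x) powr p = w x * G t x powr p"
            using G0[of t x] by (simp add: powr_mult powr_powr w_def)
          also have "G t x powr p \<le> (g x * K) powr (p - 2) * (G t x)\<^sup>2"
          proof (cases "G t x = 0")
            case False
            then have "G t x powr p = G t x powr (p - 2) * (G t x)\<^sup>2"
              using G0[of t x] powr_add[of "G t x" "p - 2" 2] by simp
            also have "\<dots> \<le> (g x * K) powr (p - 2) * (G t x)\<^sup>2"
              using p G0[of t x] by (intro mult_right_mono powr_mono2 Gs elim) auto
            finally show ?thesis .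
          qed (use p in simp)
          also have "w x * ((g x * K) powr (p - 2) * (G t x)\<^sup>2) = K powr (p - 2) * ((G t x)\<^sup>2 * z x * k x)"
            using z1[of x] K g(1)[of x] by (simp add: k_def powr_mult)
          finally have "(norm x powr \<alpha> * G t x) powr p \<le> K powr (p - 2) * ((G t x)\<^sup>2 * z x * k x)"
            using w0[of x] by (simp add: mult_left_mono)
          then show ?case using G0[of t x] z1[of x] k0[of x]
            by (simp add: ennreal_powr_ennreal ennreal_mult[symmetric] ennreal_leI)
        qed
      qed
      then show ?thesis by (simp add: nn_integral_cmult nn_integral_density)
    qed
    \<comment> \<open>The square of the wave is controlled by Plancherel. The part of
      \<open>z\<close> beyond 1 lives in the unit ball, where the uniform bound and the local
      integrability of the weight \<open>w\<close> suffice.\<close>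
    have mass: "emeasure (density lborel (\<lambda>x. ennreal ((G t x)\<^sup>2 * z x))) UNIV \<le> ennreal (c2 * A\<^sup>2)" for t
    proof -
      have "emeasure (density lborel (\<lambda>x. ennreal ((G t x)\<^sup>2 * z x))) UNIV = (\<integral>\<^sup>+x. ennreal ((G t x)\<^sup>2 * z x) \<partial>lborel)"
        by (simp add: emeasure_density)
      also have "\<dots> \<le> (\<integral>\<^sup>+x. ennreal ((G t x)\<^sup>2) + ennreal ((S * K)\<^sup>2) * (ennreal (w x) * indicator (ball 0 1) x) \<partial>lborel)"
      proof (intro nn_integral_mono_AE)
        from x0 show "AE x in lborel. ennreal ((G t x)\<^sup>2 * z x) \<le> ennreal ((G t x)\<^sup>2) + ennreal ((S * K)\<^sup>2) * (ennreal (w x) * indicator (ball 0 1) x)"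
        proof eventually_elim
          case (elim x)
          have "G t x \<le> S * K"
            by (rule order_trans[OF Gs[OF elim] mult_right_mono[OF g(2) less_imp_le[OF K]]])
          then have "(G t x)\<^sup>2 \<le> (S * K)\<^sup>2" using G0 by (intro power_mono) auto
          then have "(G t x)\<^sup>2 * w x \<le> (S * K)\<^sup>2 * w x" using w0 by (intro mult_right_mono) auto
          then show ?case using w0[of x]
            by (auto simp: z_def indicator_def distrib_left ennreal_mult[symmetric] ennreal_plus[symmetric] ennreal_leI simp del: ennreal_plus)
        qed
      qed
      also have "\<dots> = (\<integral>\<^sup>+x. ennreal ((G t x)\<^sup>2) \<partial>lborel) + ennreal ((S * K)\<^sup>2) * ennreal I0"
        by (simp add: nn_integral_add nn_integral_cmult I0)
      also have "\<dots> \<le> ennreal ((2 * pi) ^ ?n * A\<^sup>2) + ennreal ((S * K)\<^sup>2) * ennreal I0"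
        unfolding G_def by (intro add_mono wave_L2) auto
      also have "\<dots> = ennreal ((2 * pi) ^ ?n * A\<^sup>2 + (S * K)\<^sup>2 * I0)"
        using I0 by (simp add: ennreal_mult[symmetric] ennreal_plus[symmetric] del: ennreal_plus)
      also have "\<dots> \<le> ennreal (c2 * A\<^sup>2)"
      proof (rule ennreal_leI)
        have SK: "(S * K)\<^sup>2 = S\<^sup>2 * (c * D) * A\<^sup>2" using c D by (simp add: K_def power_mult_distrib)
        have "S\<^sup>2 * (c * D) * A\<^sup>2 * I0 \<le> S\<^sup>2 * (c * \<Lambda>) * A\<^sup>2 * I0"
          using c D I0 by (intro mult_right_mono mult_left_mono) auto
        moreover have "(2 * pi) ^ ?n * A\<^sup>2 + S\<^sup>2 * (c * \<Lambda>) * A\<^sup>2 * I0 = c2 * A\<^sup>2"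
          by (simp add: c2_def algebra_simps)
        ultimately show "(2 * pi) ^ ?n * A\<^sup>2 + (S * K)\<^sup>2 * I0 \<le> c2 * A\<^sup>2"
          unfolding SK by linarith
      qed
      finally show ?thesis .
    qed
    have step2: "ennreal_powr (I t) \<theta> \<le> ennreal (K powr ((p - 2) * \<theta>) * (c2 * A\<^sup>2) powr (\<theta> - 1)) * (\<integral>\<^sup>+x. ennreal (k x powr \<theta> * z x * (G t x)\<^sup>2) \<partial>lborel)" for t
    proof -
      let ?\<nu> = "density lborel (\<lambda>x. ennreal ((G t x)\<^sup>2 * z x))"
      have "ennreal_powr (I t) \<theta> \<le> ennreal_powr (ennreal (K powr (p - 2)) * (\<integral>\<^sup>+x. ennreal (k x) \<partial>?\<nu>)) \<theta>"
        using pq by (intro ennreal_powr_mono step1) auto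
      also have "\<dots> = ennreal (K powr ((p - 2) * \<theta>)) * ennreal_powr (\<integral>\<^sup>+x. ennreal (k x) \<partial>?\<nu>) \<theta>"
        by (simp add: ennreal_powr_mult ennreal_powr_ennreal powr_powr)
      also have "ennreal_powr (\<integral>\<^sup>+x. ennreal (k x) \<partial>?\<nu>) \<theta> \<le> ennreal_powr (emeasure ?\<nu> UNIV) (\<theta> - 1) * (\<integral>\<^sup>+x. ennreal_powr (ennreal (k x)) \<theta> \<partial>?\<nu>)"
        using nn_integral_powr_Jensen[of "\<lambda>x. ennreal (k x)" ?\<nu> \<theta>] pq by simp
      also have "ennreal_powr (emeasure ?\<nu> UNIV) (\<theta> - 1) \<le> ennreal_powr (ennreal (c2 * A\<^sup>2)) (\<theta> - 1)"
        using pq by (intro ennreal_powr_mono mass) auto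
      also have "\<dots> = ennreal ((c2 * A\<^sup>2) powr (\<theta> - 1))" using c2 by (simp add: ennreal_powr_ennreal)
      also have "(\<integral>\<^sup>+x. ennreal_powr (ennreal (k x)) \<theta> \<partial>?\<nu>) = (\<integral>\<^sup>+x. ennreal (k x powr \<theta> * z x * (G t x)\<^sup>2) \<partial>lborel)"
      proof -
        have "ennreal ((G t x)\<^sup>2 * z x) * ennreal (k x powr \<theta>) = ennreal (k x powr \<theta> * z x * (G t x)\<^sup>2)" for x
          using z1[of x] by (simp add: ennreal_mult[symmetric] mult_ac)
        then show ?thesis using k0 by (simp add: nn_integral_density ennreal_powr_ennreal)
      qed
      finally show ?thesis by (simp add: ennreal_mult mult.assoc mult_left_mono mult_right_mono)
    qed
    have "(\<integral>\<^sup>+t. ennreal_powr (I t) \<theta> \<partial>lborel) \<le> (\<integral>\<^sup>+t. ennreal (K powr ((p - 2) * \<theta>) * (c2 * A\<^sup>2) powr (\<theta> - 1)) * (\<integral>\<^sup>+x. ennreal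
      (k x powr \<theta> * z x * (G t x)\<^sup>2) \<partial>lborel) \<partial>lborel)"
      by (intro nn_integral_mono step2)
    \<comment> \<open>After the exchange the square is integrated in time first, at fixed
      \<open>x\<close>, where the bound in time carries the decay \<open>(g x)^2\<close>.\<close>
    also have "\<dots> = ennreal (K powr ((p - 2) * \<theta>) * (c2 * A\<^sup>2) powr (\<theta> - 1)) * (\<integral>\<^sup>+x. \<integral>\<^sup>+t. ennreal (k x powr \<theta> * z x * (G t x)\<^sup>2) \<partial>lborel \<partial>lborel)"
      by (subst nn_integral_cmult, measurable, subst lborel_pair.Fubini', measurable)
    also have "(\<integral>\<^sup>+x. \<integral>\<^sup>+t. ennreal (k x powr \<theta> * z x * (G t x)\<^sup>2) \<partial>lborel \<partial>lborel) \<le> (\<integral>\<^sup>+x. ennreal (2 * pi * c * A\<^sup>2) * ennreal (k x powr \<theta> * z x * (g x)\<^sup>2) \<partial>lborel)"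
    proof (intro nn_integral_mono_AE)
      from x0 show "AE x in lborel. (\<integral>\<^sup>+t. ennreal (k x powr \<theta> * z x * (G t x)\<^sup>2) \<partial>lborel) \<le> ennreal (2 * pi * c * A\<^sup>2) * ennreal (k x powr \<theta> * z x * (g x)\<^sup>2)"
      proof eventually_elim
        case (elim x)
        have kz: "0 \<le> k x powr \<theta> * z x" using z1[of x] by simp
        have "(\<integral>\<^sup>+t. ennreal (k x powr \<theta> * z x * (G t x)\<^sup>2) \<partial>lborel) = ennreal (k x powr \<theta> * z x) * (\<integral>\<^sup>+t. ennreal ((G t x)\<^sup>2) \<partial>lborel)"
          using kz by (subst nn_integral_cmult[symmetric]) (auto simp: ennreal_mult)
        also have "\<dots> \<le> ennreal (k x powr \<theta> * z x) * ennreal (2 * pi * c * (g x * A)\<^sup>2)"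
          by (intro mult_left_mono GT elim) auto
        also have "\<dots> = ennreal (2 * pi * c * A\<^sup>2) * ennreal (k x powr \<theta> * z x * (g x)\<^sup>2)"
        proof -
          have n1: "0 \<le> k x powr \<theta> * z x * (g x)\<^sup>2" by (rule mult_nonneg_nonneg[OF kz]) simp
          have n2: "0 \<le> 2 * pi * c * A\<^sup>2" "0 \<le> 2 * pi * c * (g x * A)\<^sup>2" using c by auto
          show ?thesis
            unfolding ennreal_mult[OF kz n2(2), symmetric] ennreal_mult[OF n2(1) n1, symmetric]
            by (simp only: power_mult_distrib mult_ac)
        qed
        finally show ?case .
      qed
    qed
    also have "\<dots> = ennreal (2 * pi * c * A\<^sup>2) * ennreal I1" by (simp add: nn_integral_cmult I1)
    finally have "(\<integral>\<^sup>+t. ennreal_powr (I t) \<theta> \<partial>lborel) \<le> ennreal (K powr ((p - 2) * \<theta>) * (c2 * A\<^sup>2) powr (\<theta> - 1)) * (ennreal (2 * pi * c * A\<^sup>2) * ennreal I1)"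
      by (simp add: mult_left_mono)
    also have "\<dots> = ennreal (K powr ((p - 2) * \<theta>) * (c2 * A\<^sup>2) powr (\<theta> - 1) * (2 * pi * c * A\<^sup>2) * I1)"
      using c I1 by (simp add: ennreal_mult[symmetric] mult.assoc)
    also have "K powr ((p - 2) * \<theta>) * (c2 * A\<^sup>2) powr (\<theta> - 1) * (2 * pi * c * A\<^sup>2) * I1 = c3 * (D powr (1 / 2 - 1 / p) * A) powr q"
    proof -
      have e1: "(p - 2) * \<theta> / 2 = (1 / 2 - 1 / p) * q" using pq by (simp add: \<theta>_def field_simps)
      have K1: "K powr ((p - 2) * \<theta>) = sqrt c powr ((p - 2) * \<theta>) * D powr ((1 / 2 - 1 / p) * q) * A powr ((p - 2) * \<theta>)"
      proof -
        have "sqrt D powr ((p - 2) * \<theta>) = D powr ((p - 2) * \<theta> / 2)"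
          using D by (simp add: powr_half_sqrt[symmetric] powr_powr)
        then show ?thesis using c D A0 unfolding K_def real_sqrt_mult by (simp add: powr_mult e1)
      qed
      have A2: "(A\<^sup>2) powr (\<theta> - 1) = A powr (2 * (\<theta> - 1))" using A0 by (simp add: powr_powr flip: powr_numeral)
      have "A\<^sup>2 = A powr 2" using A0 by simp
      then have "A powr ((p - 2) * \<theta>) * A powr (2 * (\<theta> - 1)) * A\<^sup>2 = A powr ((p - 2) * \<theta> + 2 * (\<theta> - 1) + 2)"
        by (simp only: powr_add)
      also have "(p - 2) * \<theta> + 2 * (\<theta> - 1) + 2 = q" using pq by (simp add: \<theta>_def field_simps)
      finally have Aq: "A powr ((p - 2) * \<theta>) * A powr (2 * (\<theta> - 1)) * A\<^sup>2 = A powr q" .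
      have "K powr ((p - 2) * \<theta>) * (c2 * A\<^sup>2) powr (\<theta> - 1) * (2 * pi * c * A\<^sup>2) * I1
        = c3 * D powr ((1 / 2 - 1 / p) * q) * (A powr ((p - 2) * \<theta>) * A powr (2 * (\<theta> - 1)) * A\<^sup>2)"
        using c2 unfolding K1 c3_def by (simp add: powr_mult A2 mult_ac)
      then show ?thesis unfolding Aq using D A0 by (simp add: powr_mult powr_powr mult_ac)
    qed
    also have "ennreal (c3 * (D powr (1 / 2 - 1 / p) * A) powr q) \<le> ennreal ((c3 + 1) * (D powr (1 / 2 - 1 / p) * A) powr q)"
      by (intro ennreal_leI mult_right_mono) auto
    also have "\<dots> = ennreal_powr (ennreal ((c3 + 1) powr (1 / q) * D powr (1 / 2 - 1 / p) * A)) q"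
      using c3 A0 pq by (simp add: ennreal_powr_ennreal powr_mult powr_powr mult.assoc)
    finally have "(\<integral>\<^sup>+t. ennreal_powr (I t) \<theta> \<partial>lborel) \<le> ennreal_powr (ennreal ((c3 + 1) powr (1 / q) * D powr (1 / 2 - 1 / p) * A)) q" .
    moreover have "ennreal_powr (I t) \<theta> = ennreal_powr (Lp_norm p lborel (\<lambda>x. ennreal (norm x powr \<alpha> * cmod (wave H t x)))) q" for t
      using pq by (simp add: Lp_norm_def I_def G_def ennreal_powr_powr \<theta>_def)
    ultimately show "det_norm q p \<alpha> H \<le> ennreal ((c3 + 1) powr (1 / q) * (b - 1) powr (1 / 2 - 1 / p) * A)"
      unfolding det_norm_def D_def[symmetric] Lp_norm_le_iff[OF pq(2)] by simp
  qed
qed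

text \<open>For \<open>q < p\<close> the solution on the shell \<open>j \<le> |x| \<le> j + 1\<close> is bounded by
  \<open>shell_sup j\<close>, by the fundamental theorem of calculus in the radial variable.\<close>

context annulus_data
begin

abbreviation "W0 s \<equiv> W (\<lambda>\<rho>. sph CARD('n) (\<rho> * s))"
abbreviation "W1 s \<equiv> W (\<lambda>\<rho>. \<rho> * sph' CARD('n) (\<rho> * s))"

definition shell_sup :: "real \<Rightarrow> real \<Rightarrow> ennreal" where
  "shell_sup j t = (\<integral>\<^sup>+s. (ennreal (cmod (W0 s t)) + ennreal (cmod (W1 s t))) * indicator {j..j+1} s \<partial>lborel)"

lemma W01_measurable [measurable]:
  "(\<lambda>(s, t). W0 s t) \<in> borel_measurable (borel \<Otimes>\<^sub>M borel)"
  "(\<lambda>(s, t). W1 s t) \<in> borel_measurable (borel \<Otimes>\<^sub>M borel)"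
  unfolding W_def by measurable

lemma sph_FTC:
  assumes "s \<le> r"
  shows "(LINT \<sigma>|lborel. (\<rho> * sph' CARD('n) (\<rho> * \<sigma>)) * indicator {s..r} \<sigma>) = sph CARD('n) (\<rho> * r) - sph CARD('n) (\<rho> * s)"
proof (rule integral_FTC_Icc_real[OF assms])
  fix x
  have "((\<lambda>\<sigma>. sph CARD('n) (\<rho> * \<sigma>)) has_real_derivative sph' CARD('n) (\<rho> * x) * \<rho>) (at x)"
    using sph_deriv[where 'a="real^'n"] by (intro DERIV_chain2) (auto intro!: derivative_eq_intros)
  then show "((\<lambda>\<sigma>. sph CARD('n) (\<rho> * \<sigma>)) has_real_derivative \<rho> * sph' CARD('n) (\<rho> * x)) (at x)"
    by (simp add: mult.commute)
  have "isCont (sph' CARD('n)) (\<rho> * x)"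
    using sph'_continuous[where 'a="real^'n"] by (simp add: continuous_on_eq_continuous_at)
  then have "isCont (\<lambda>\<sigma>. sph' CARD('n) (\<rho> * \<sigma>)) x"
    by (rule isCont_o2[rotated]) simp
  then show "isCont (\<lambda>\<sigma>. \<rho> * sph' CARD('n) (\<rho> * \<sigma>)) x"
    by (rule isCont_mult[OF continuous_const])
qed

lemma W0_diff:
  assumes sr: "0 \<le> s" "s \<le> r"
  shows "W0 r t - W0 s t = (LINT \<sigma>|lborel. indicator {s..r} \<sigma> *\<^sub>R W1 \<sigma> t)"
proof -
  obtain S where S: "0 < S" "\<And>r. 0 \<le> r \<Longrightarrow> \<bar>sph CARD('n) r\<bar> \<le> S * (1 + r) powr (- (real CARD('n) - 1) / 2)"
      "\<And>r. 0 \<le> r \<Longrightarrow> \<bar>sph' CARD('n) r\<bar> \<le> S * (1 + r) powr (- (real CARD('n) - 1) / 2)"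
    by (rule sph_decay_CARD[where 'n='n]) (rule that; assumption)
  have pw: "S * (1 + r) powr (- (real CARD('n) - 1) / 2) \<le> S" if "0 \<le> r" for r
  proof -
    have "(1 + r) powr (- (real CARD('n) - 1) / 2) \<le> (1 + r) powr 0"
      using that by (intro powr_mono) (auto simp: Suc_leI)
    then show ?thesis using S(1) that by simp
  qed
  have S0: "\<bar>sph CARD('n) r\<bar> \<le> S" "\<bar>sph' CARD('n) r\<bar> \<le> S" if "0 \<le> r" for r
    using S(2,3)[OF that] pw[OF that] by linarith+
  define M where "M = b * S"
  have M: "0 < M" using b S(1) by (simp add: M_def)
  \<comment> \<open>The Fubini criterion asks for a kernel bounded by 1: hence the division by
    \<open>M\<close>, compensated in the other factor, and the cutoffs to the range in which the
    bound on \<open>sph'\<close> holds.\<close>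
  define h where "h \<sigma> \<xi> = cis (t * norm \<xi>) * complex_of_real (indicator (annulus 1 b) \<xi> * indicator {0..} \<sigma> * (norm \<xi> * sph'
    CARD('n) (norm \<xi> * \<sigma>)) / M)" for \<sigma> and \<xi> :: "real^'n"
  have h1: "cmod (h \<sigma> \<xi>) \<le> 1" for \<sigma> \<xi>
  proof (cases "\<xi> \<in> annulus 1 b \<and> 0 \<le> \<sigma>")
    case True
    then have "\<bar>norm \<xi> * sph' CARD('n) (norm \<xi> * \<sigma>)\<bar> \<le> b * S"
      using S0(2)[of "norm \<xi> * \<sigma>"] b by (simp add: abs_mult annulus_def mult_mono)
    then have "\<bar>norm \<xi> * sph' CARD('n) (norm \<xi> * \<sigma>) / M\<bar> \<le> 1" using M by (simp add: M_def)
    moreover have "cmod (h \<sigma> \<xi>) = \<bar>norm \<xi> * sph' CARD('n) (norm \<xi> * \<sigma>) / M\<bar>"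
      unfolding h_def norm_mult norm_of_real norm_cis using True by simp
    ultimately show ?thesis by simp
  qed (auto simp: h_def)
  have [measurable]: "(\<lambda>(\<sigma>, \<xi>). h \<sigma> \<xi>) \<in> borel_measurable (lborel \<Otimes>\<^sub>M lborel)"
    unfolding h_def by measurable
  have f1: "integrable lborel (\<lambda>\<sigma>. complex_of_real (indicator {s..r} \<sigma>))"
    by (intro integrable_of_real integrable_real_indicator) (use sr(2) in \<open>simp_all add: emeasure_lborel_Icc\<close>)
  have J: "integrable (lborel \<Otimes>\<^sub>M lborel) (\<lambda>(\<sigma>, \<xi>). h \<sigma> \<xi> * (complex_of_real (indicator {s..r} \<sigma>) * (complex_of_real M * H \<xi>)))"
    by (rule integrable_pair_mult_bounded[OF _ _ f1 integrable_mult_right[OF H_integrable]])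
      (auto intro: lborel.sigma_finite_measure_axioms h1)
  have hE: "h \<sigma> \<xi> * (complex_of_real (indicator {s..r} \<sigma>) * (complex_of_real M * H \<xi>))
     = complex_of_real (indicator {s..r} \<sigma>) * (cis (t * norm \<xi>) * (complex_of_real (norm \<xi> * sph' CARD('n) (norm \<xi> * \<sigma>)) * H \<xi>))" for \<sigma> \<xi>
  proof (cases "\<xi> \<in> annulus 1 b \<and> \<sigma> \<in> {s..r}")
    case True
    then show ?thesis using M sr by (simp add: h_def)
  next
    case False
    then show ?thesis using H_supp[of \<xi>] by auto
  qed
  have i0: "integrable lborel (\<lambda>\<xi>. cis (t * norm \<xi>) * (complex_of_real (sph CARD('n) (norm \<xi> * u)) * H \<xi>))" if "0 \<le> u" for u
    by (intro integrable_cis_mult mH_integrable[where \<mu>=S]) (use that in \<open>auto intro!: S0\<close>)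
  have "(LINT \<sigma>|lborel. indicator {s..r} \<sigma> *\<^sub>R W1 \<sigma> t)
     = (LINT \<sigma>|lborel. LINT \<xi>|lborel. h \<sigma> \<xi> * (complex_of_real (indicator {s..r} \<sigma>) * (complex_of_real M * H \<xi>)))"
    unfolding W_def hE integral_mult_right_zero by (simp add: scaleR_conv_of_real)
  also have "\<dots> = (LINT \<xi>|lborel. LINT \<sigma>|lborel. h \<sigma> \<xi> * (complex_of_real (indicator {s..r} \<sigma>) * (complex_of_real M * H \<xi>)))"
    using lborel_pair.Fubini_integral[OF J] by simp
  also have "\<dots> = (LINT \<xi>|lborel. cis (t * norm \<xi>) * (complex_of_real (sph CARD('n) (norm \<xi> * r)) * H \<xi>) - cis (t * norm \<xi>) *
    (complex_of_real (sph CARD('n) (norm \<xi> * s)) * H \<xi>))"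
  proof (intro Bochner_Integration.integral_cong refl)
    fix \<xi>
    have "(LINT \<sigma>|lborel. h \<sigma> \<xi> * (complex_of_real (indicator {s..r} \<sigma>) * (complex_of_real M * H \<xi>)))
      = (LINT \<sigma>|lborel. complex_of_real ((norm \<xi> * sph' CARD('n) (norm \<xi> * \<sigma>)) * indicator {s..r} \<sigma>) * (cis (t * norm \<xi>) * H \<xi>))"
      unfolding hE by (intro Bochner_Integration.integral_cong) auto
    also have "\<dots> = complex_of_real (sph CARD('n) (norm \<xi> * r) - sph CARD('n) (norm \<xi> * s)) * (cis (t * norm \<xi>) * H \<xi>)"
      by (simp only: integral_mult_left_zero integral_complex_of_real sph_FTC[OF sr(2)])
    finally show "(LINT \<sigma>|lborel. h \<sigma> \<xi> * (complex_of_real (indicator {s..r} \<sigma>) * (complex_of_real M * H \<xi>)))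
      = cis (t * norm \<xi>) * (complex_of_real (sph CARD('n) (norm \<xi> * r)) * H \<xi>) - cis (t * norm \<xi>) * (complex_of_real (sph CARD('n) (norm \<xi> * s)) * H \<xi>)"
      by (simp add: algebra_simps)
  qed
  also have "\<dots> = W0 r t - W0 s t"
    unfolding W_def using sr by (intro Bochner_Integration.integral_diff i0) auto
  finally show ?thesis by simp
qed

text \<open>For every \<open>s\<close> in the unit interval, \<open>W0 r t\<close> differs from
  \<open>W0 s t\<close> by at most the integral of the modulus of \<open>W1\<close> over that
  interval. Averaging over \<open>s\<close> removes the choice of a base point.\<close>

lemma W0_le_shell_sup:
  assumes j: "0 \<le> j" and r: "j \<le> r" "r \<le> j + 1"
  shows "ennreal (cmod (W0 r t)) \<le> shell_sup j t"
proof -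
  define X where "X = (\<integral>\<^sup>+\<sigma>. ennreal (cmod (W1 \<sigma> t)) * indicator {j..j+1} \<sigma> \<partial>lborel)"
  have diff: "ennreal (cmod (W0 r' t - W0 s t)) \<le> X" if "j \<le> s" "s \<le> r'" "r' \<le> j + 1" for s r'
  proof -
    have "ennreal (cmod (W0 r' t - W0 s t)) \<le> (\<integral>\<^sup>+\<sigma>. ennreal (norm (indicator {s..r'} \<sigma> *\<^sub>R W1 \<sigma> t)) \<partial>lborel)"
    proof (cases "integrable lborel (\<lambda>\<sigma>. indicator {s..r'} \<sigma> *\<^sub>R W1 \<sigma> t)")
      case True
      have sr: "0 \<le> s" "s \<le> r'" using that j by auto
      show ?thesis unfolding W0_diff[OF sr] by (rule integral_norm_bound_ennreal[OF True])
    next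
      \<comment> \<open>The integral of a non-integrable function is 0 by convention, so the left
        side is then 0.\<close>
      case False
      then show ?thesis using that j by (subst W0_diff) (auto simp: not_integrable_integral_eq)
    qed
    also have "\<dots> \<le> X" unfolding X_def
      by (intro nn_integral_mono) (use that in \<open>auto simp: indicator_def\<close>)
    finally show ?thesis .
  qed
  have pt: "ennreal (cmod (W0 r t)) \<le> ennreal (cmod (W0 s t)) + X" if s: "j \<le> s" "s \<le> j + 1" for s
  proof -
    have "ennreal (cmod (W0 r t - W0 s t)) \<le> X"
      using diff[of s r] diff[of r s] r s by (cases "s \<le> r") (auto simp: norm_minus_commute)
    moreover have "ennreal (cmod (W0 r t)) \<le> ennreal (cmod (W0 s t)) + ennreal (cmod (W0 r t - W0 s t))"
      using norm_triangle_sub[of "W0 r t" "W0 s t"] by (simp add: ennreal_plus[symmetric] ennreal_leI del: ennreal_plus)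
    ultimately show ?thesis by (meson add_left_mono order_trans)
  qed
  have em: "emeasure lborel {j..j+1} = 1" by simp
  have "ennreal (cmod (W0 r t)) = (\<integral>\<^sup>+s. ennreal (cmod (W0 r t)) * indicator {j..j+1} s \<partial>lborel)"
    by (subst nn_integral_cmult_indicator) (auto simp: em)
  also have "\<dots> \<le> (\<integral>\<^sup>+s. ennreal (cmod (W0 s t)) * indicator {j..j+1} s + X * indicator {j..j+1} s \<partial>lborel)"
    using pt by (intro nn_integral_mono) (auto simp: indicator_def)
  also have "\<dots> = (\<integral>\<^sup>+s. ennreal (cmod (W0 s t)) * indicator {j..j+1} s \<partial>lborel) + X"
    by (subst nn_integral_add) (auto simp: nn_integral_cmult_indicator em)
  also have "\<dots> = shell_sup j t"
    unfolding shell_sup_def X_def distrib_right by (subst nn_integral_add) auto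
  finally show ?thesis .
qed

lemma ennreal_powr_add_le:
  fixes x y :: ennreal assumes "0 < q" shows "ennreal_powr (x + y) q \<le> ennreal (2 powr q) * (ennreal_powr x q + ennreal_powr y q)"
proof -
  have "x + y \<le> ennreal 2 * max x y" by (simp add: mult_2 add_mono)
  then have "ennreal_powr (x + y) q \<le> ennreal_powr (ennreal 2 * max x y) q" by (rule ennreal_powr_mono[rotated]) (use assms in simp)
  also have "\<dots> = ennreal (2 powr q) * ennreal_powr (max x y) q"
    by (simp only: ennreal_powr_mult ennreal_powr_ennreal zero_le_numeral)
  also have "ennreal_powr (max x y) q \<le> ennreal_powr x q + ennreal_powr y q"
    by (cases "x \<le> y") (auto simp: max_def add_increasing add_increasing2)
  finally show ?thesis by (simp add: mult_left_mono)
qed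

text \<open>Jensen's inequality on the unit interval takes the power \<open>q\<close> inside the
  radial integral; Bernstein's inequality in time then applies at each radius, with the decay
  evaluated at the inner radius \<open>j\<close>. The factor \<open>1 + \<Lambda>\<close> dominates
  the frequency \<open>\<rho>\<close> produced by the radial derivative, and \<open>2 powr q\<close>
  splits the power of a sum.\<close>

lemma shell_sup_Lq:
  assumes \<Lambda>: "b \<le> 1 + \<Lambda>" and q: "2 \<le> q" and A0: "0 < A" and j: "0 \<le> j"
    and S: "0 < S" "\<And>r. 0 \<le> r \<Longrightarrow> \<bar>sph CARD('n) r\<bar> \<le> S * (1 + r) powr (- (real CARD('n) - 1) / 2)"
      "\<And>r. 0 \<le> r \<Longrightarrow> \<bar>sph' CARD('n) r\<bar> \<le> S * (1 + r) powr (- (real CARD('n) - 1) / 2)"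
  defines "c \<equiv> ring_const TYPE('n) \<Lambda>" and "\<mu> \<equiv> (real CARD('n) - 1) / 2"
  shows "(\<integral>\<^sup>+t. ennreal_powr (shell_sup j t) q \<partial>lborel)
    \<le> ennreal (2 * 2 powr q * (2 * pi * c * sqrt (c * (b - 1)) powr (q - 2) * ((1 + \<Lambda>) * S * (1 + j) powr (- \<mu>) * A) powr q))"
proof -
  define B where "B = 2 * pi * c * sqrt (c * (b - 1)) powr (q - 2) * ((1 + \<Lambda>) * S * (1 + j) powr (- \<mu>) * A) powr q"
  have \<Lambda>0: "0 < \<Lambda>" using \<Lambda> b by simp
  have c: "0 < c" unfolding c_def by (rule ring_const_pos) (use \<Lambda>0 in simp)
  have B0: "0 \<le> B" using c by (simp add: B_def)
  have \<mu>: "0 \<le> \<mu>" by (simp add: \<mu>_def Suc_leI)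
  define m where "m = (1 + \<Lambda>) * S * (1 + j) powr (- \<mu>)"
  have dec: "S * (1 + \<rho> * s) powr (- (real CARD('n) - 1) / 2) \<le> S * (1 + j) powr (- \<mu>)" if "1 \<le> \<rho>" "j \<le> s" for \<rho> s
  proof -
    have "j \<le> \<rho> * s" using that j mult_right_mono[of 1 \<rho> s] by simp
    then have "(1 + \<rho> * s) powr (- \<mu>) \<le> (1 + j) powr (- \<mu>)" using \<mu> j by (intro powr_mono2') auto
    moreover have "- (real CARD('n) - 1) / 2 = - \<mu>" unfolding \<mu>_def by (simp only: minus_divide_left)
    ultimately show ?thesis using S(1) by simp
  qed
  have mS: "S * (1 + j) powr (- \<mu>) \<le> m"
    using mult_right_mono[of 1 "1 + \<Lambda>" "S * (1 + j) powr (- \<mu>)"] S(1) \<Lambda>0 by (simp add: m_def mult.assoc)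
  have b0: "\<bar>sph CARD('n) (\<rho> * s)\<bar> \<le> m" if "1 \<le> \<rho>" "\<rho> < b" "j \<le> s" for \<rho> s
    using S(2)[of "\<rho> * s"] dec[OF that(1,3)] mS that j by (simp add: mult_nonneg_nonneg)
  have b1: "\<bar>\<rho> * sph' CARD('n) (\<rho> * s)\<bar> \<le> m" if "1 \<le> \<rho>" "\<rho> < b" "j \<le> s" for \<rho> s
  proof -
    have "\<bar>sph' CARD('n) (\<rho> * s)\<bar> \<le> S * (1 + j) powr (- \<mu>)"
      using S(3)[of "\<rho> * s"] dec[OF that(1,3)] that j by (simp add: mult_nonneg_nonneg)
    then have "\<rho> * \<bar>sph' CARD('n) (\<rho> * s)\<bar> \<le> (1 + \<Lambda>) * (S * (1 + j) powr (- \<mu>))"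
      using that \<Lambda> by (intro mult_mono) auto
    then show ?thesis using that by (simp add: abs_mult m_def mult.assoc)
  qed
  have Wq: "(\<integral>\<^sup>+t. ennreal_powr (ennreal (cmod (W0 s t))) q \<partial>lborel) \<le> ennreal B"
       "(\<integral>\<^sup>+t. ennreal_powr (ennreal (cmod (W1 s t))) q \<partial>lborel) \<le> ennreal B" if "j \<le> s" for s
    unfolding B_def c_def m_def[symmetric] using that
    by (simp_all only: ennreal_powr_ennreal norm_ge_zero)
      (rule W_bounds(3)[OF \<Lambda> _ _ q A0]; use b0 b1 that in \<open>auto\<close>)+
  have "(\<integral>\<^sup>+t. ennreal_powr (shell_sup j t) q \<partial>lborel) \<le> (\<integral>\<^sup>+t. \<integral>\<^sup>+s. ennreal (2 powr q) * (ennreal_powr (ennreal (cmod (W0 s t)))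
    q + ennreal_powr (ennreal (cmod (W1 s t))) q) * indicator {j..j+1} s \<partial>lborel \<partial>lborel)"
  proof (intro nn_integral_mono)
    fix t
    let ?N = "density lborel (indicator {j..j+1} :: real \<Rightarrow> ennreal)"
    let ?f = "\<lambda>s. ennreal (cmod (W0 s t)) + ennreal (cmod (W1 s t))"
    have [measurable]: "(\<lambda>s. W0 s t) \<in> borel_measurable borel" "(\<lambda>s. W1 s t) \<in> borel_measurable borel"
      by measurable
    have "shell_sup j t = (\<integral>\<^sup>+s. ?f s \<partial>?N)"
      unfolding shell_sup_def by (subst nn_integral_density, measurable) (simp only: mult.commute)
    moreover have "emeasure ?N (space ?N) = 1" by (simp add: emeasure_density)
    ultimately have "ennreal_powr (shell_sup j t) q \<le> (\<integral>\<^sup>+s. ennreal_powr (?f s) q \<partial>?N)"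
      using nn_integral_powr_Jensen[of ?f ?N q] q by simp
    also have "\<dots> = (\<integral>\<^sup>+s. ennreal_powr (?f s) q * indicator {j..j+1} s \<partial>lborel)"
      by (subst nn_integral_density, measurable) (simp only: mult.commute)
    also have "\<dots> \<le> (\<integral>\<^sup>+s. ennreal (2 powr q) * (ennreal_powr (ennreal (cmod (W0 s t))) q + ennreal_powr (ennreal (cmod (W1 s t))) q) * indicator {j..j+1} s \<partial>lborel)"
      using q by (intro nn_integral_mono mult_right_mono ennreal_powr_add_le) auto
    finally show "ennreal_powr (shell_sup j t) q \<le> (\<integral>\<^sup>+s. ennreal (2 powr q) * (ennreal_powr (ennreal (cmod (W0 s t))) q +
      ennreal_powr (ennreal (cmod (W1 s t))) q) * indicator {j..j+1} s \<partial>lborel)" .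
  qed
  also have "\<dots> = (\<integral>\<^sup>+s. \<integral>\<^sup>+t. ennreal (2 powr q) * (ennreal_powr (ennreal (cmod (W0 s t))) q + ennreal_powr (ennreal (cmod (W1 s
    t))) q) * indicator {j..j+1} s \<partial>lborel \<partial>lborel)"
    by (rule lborel_pair.Fubini') measurable
  also have "\<dots> = (\<integral>\<^sup>+s. ennreal (2 powr q) * ((\<integral>\<^sup>+t. ennreal_powr (ennreal (cmod (W0 s t))) q \<partial>lborel) + (\<integral>\<^sup>+t. ennreal_powr
    (ennreal (cmod (W1 s t))) q \<partial>lborel)) * indicator {j..j+1} s \<partial>lborel)"
    by (intro nn_integral_cong) (simp add: nn_integral_cmult nn_integral_multc nn_integral_add)
  also have "\<dots> \<le> (\<integral>\<^sup>+s. ennreal (2 powr q) * (ennreal B + ennreal B) * indicator {j..j+1} s \<partial>lborel)"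
  proof (intro nn_integral_mono)
    fix s
    show "ennreal (2 powr q) * ((\<integral>\<^sup>+t. ennreal_powr (ennreal (cmod (W0 s t))) q \<partial>lborel) + (\<integral>\<^sup>+t. ennreal_powr (ennreal (cmod (W1
      s t))) q \<partial>lborel)) * indicator {j..j+1} s \<le> ennreal (2 powr q) * (ennreal B + ennreal B) * indicator {j..j+1} s"
    proof (cases "s \<in> {j..j+1}")
      case True
      then show ?thesis using Wq[of s] by (auto intro!: mult_left_mono add_mono)
    qed simp
  qed
  also have "\<dots> = ennreal (2 powr q) * (ennreal B + ennreal B)"
    by (subst nn_integral_cmult_indicator) auto
  also have "\<dots> = ennreal (2 * 2 powr q * B)"
    using B0 by (simp add: ennreal_mult[symmetric] ennreal_plus[symmetric] del: ennreal_plus)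
  finally show ?thesis unfolding B_def .
qed

end

text \<open>For \<open>j = 0\<close> this is integrability at the origin. For
  \<open>j \<ge> 1\<close> the norm lies between half of \<open>1 + j\<close> and
  \<open>1 + j\<close>, so the weight is constant up to \<open>2 powr \<bar>\<beta>\<bar>\<close>,
  and the volume of the shell is of order \<open>(1 + j) ^ (CARD('n) - 1)\<close>.\<close>

lemma shell_weight:
  fixes \<beta> :: real
  assumes "- real CARD('n::finite) < \<beta>"
  shows "\<exists>C>0. \<forall>j::nat. (\<integral>\<^sup>+x. ennreal (norm (x::real^'n) powr \<beta>) * indicator (annulus (real j) (real j + 1)) x \<partial>lborel)
    \<le> ennreal (C * (1 + real j) powr (\<beta> + real CARD('n) - 1))"
proof -
  let ?n = "CARD('n)"
  have fin0: "(\<integral>\<^sup>+x. ennreal (norm (x::real^'n) powr \<beta>) * indicator (ball 0 1) x \<partial>lborel) < \<top>"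
    using nn_integral_radial_powr_near[where 'a="real^'n" and \<beta>=\<beta>] assms by simp
  define I0 where "I0 = enn2real (\<integral>\<^sup>+x. ennreal (norm (x::real^'n) powr \<beta>) * indicator (ball 0 1) x \<partial>lborel)"
  have I0: "(\<integral>\<^sup>+x. ennreal (norm (x::real^'n) powr \<beta>) * indicator (ball 0 1) x \<partial>lborel) = ennreal I0" "0 \<le> I0"
    using fin0 by (simp_all add: I0_def)
  define C where "C = I0 + 2 powr \<bar>\<beta>\<bar> * (unit_ball_vol (real ?n) * real ?n)"
  have V: "0 \<le> unit_ball_vol (real ?n)" by simp
  have "(\<integral>\<^sup>+x. ennreal (norm (x::real^'n) powr \<beta>) * indicator (annulus (real j) (real j + 1)) x \<partial>lborel)
    \<le> ennreal (C * (1 + real j) powr (\<beta> + real CARD('n) - 1))" for j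
  proof (cases "j = 0")
    case True
    have "annulus 0 1 = (ball 0 1 :: (real^'n) set)" by (auto simp: annulus_def dist_norm)
    then show ?thesis using True I0 V by (simp add: C_def ennreal_leI)
  next
    case False
    then have j: "1 \<le> real j" by simp
    have wt: "norm x powr \<beta> \<le> 2 powr \<bar>\<beta>\<bar> * (1 + real j) powr \<beta>" if "real j \<le> norm x" "norm x < real j + 1" for x :: "real^'n"
    proof (cases "0 \<le> \<beta>")
      case True
      have "norm x powr \<beta> \<le> 1 * (1 + real j) powr \<beta>" using that True by (simp, intro powr_mono2) auto
      also have "\<dots> \<le> 2 powr \<bar>\<beta>\<bar> * (1 + real j) powr \<beta>" by (intro mult_right_mono) (auto simp: ge_one_powr_ge_zero)
      finally show ?thesis .
    next
      case False
      have "norm x powr \<beta> \<le> ((1 + real j) / 2) powr \<beta>" using that False j by (intro powr_mono2') auto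
      also have "\<dots> = 2 powr \<bar>\<beta>\<bar> * (1 + real j) powr \<beta>" using False j by (simp add: powr_divide powr_minus_divide)
      finally show ?thesis .
    qed
    have "(\<integral>\<^sup>+x. ennreal (norm (x::real^'n) powr \<beta>) * indicator (annulus (real j) (real j + 1)) x \<partial>lborel)
      \<le> (\<integral>\<^sup>+x. ennreal (2 powr \<bar>\<beta>\<bar> * (1 + real j) powr \<beta>) * indicator (annulus (real j) (real j + 1) :: (real^'n) set) x \<partial>lborel)"
      using wt by (intro nn_integral_mono) (auto simp: indicator_def annulus_def intro!: ennreal_leI)
    also have "\<dots> = ennreal (2 powr \<bar>\<beta>\<bar> * (1 + real j) powr \<beta>) * emeasure lborel (annulus (real j) (real j + 1) :: (real^'n) set)"
      by (subst nn_integral_cmult_indicator) auto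
    also have "\<dots> \<le> ennreal (2 powr \<bar>\<beta>\<bar> * (1 + real j) powr \<beta>) * ennreal (unit_ball_vol (real ?n) * (real ?n * (1 + real j) ^ (?n - 1)))"
    proof (intro mult_left_mono)
      have "emeasure lborel (annulus (real j) (real j + 1) :: (real^'n) set) \<le> ennreal (unit_ball_vol (real ?n) * ((real j + 1) ^ ?n - real j ^ ?n))"
        using emeasure_annulus_le[of "real j" "real j + 1", where 'a="real^'n"] by simp
      also have "\<dots> \<le> ennreal (unit_ball_vol (real ?n) * (real ?n * (1 + real j) ^ (?n - 1)))"
        using power_diff_le[of "real j" "real j + 1" ?n] V by (intro ennreal_leI mult_left_mono) (auto simp: add.commute)
      finally show "emeasure lborel (annulus (real j) (real j + 1) :: (real^'n) set) \<le> ennreal (unit_ball_vol (real ?n) * (real ?n * (1 + real j) ^ (?n - 1)))" .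
    qed auto
    also have "\<dots> = ennreal (2 powr \<bar>\<beta>\<bar> * (unit_ball_vol (real ?n) * real ?n) * (1 + real j) powr (\<beta> + real ?n - 1))"
    proof -
      have "(1 + real j) ^ (?n - 1) = (1 + real j) powr (real ?n - 1)"
        by (simp add: powr_realpow[symmetric] of_nat_diff Suc_leI)
      then have "(1 + real j) powr \<beta> * (1 + real j) ^ (?n - 1) = (1 + real j) powr (\<beta> + real ?n - 1)"
        by (simp add: powr_add[symmetric] add_diff_eq)
      then show ?thesis using V by (simp add: ennreal_mult[symmetric] mult_ac)
    qed
    also have "\<dots> \<le> ennreal (C * (1 + real j) powr (\<beta> + real ?n - 1))"
      using I0 by (intro ennreal_leI mult_right_mono) (auto simp: C_def)
    finally show ?thesis .
  qed
  moreover have "0 < C"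
    using I0 unfolding C_def by (intro add_nonneg_pos mult_pos_pos) auto
  ultimately show ?thesis by blast
qed

text \<open>Now \<open>\<theta> = q / p\<close> is at most 1 and Jensen's inequality points the
  wrong way. Instead, the concave power of the sum over unit shells in space is at most the sum of
  the powers, so time is integrated shell by shell. The resulting series in \<open>j\<close> has
  exponent \<open>e\<close>, and \<open>e < - 1\<close> is equivalent to the upper bound on
  \<open>\<alpha>\<close>.\<close>

lemma det_norm_q_less_p:
  fixes p q \<alpha> \<Lambda> :: real
  assumes p: "2 \<le> q" "q < p" and \<alpha>: "- real CARD('n::finite) / p < \<alpha>" "\<alpha> < (real CARD('n) - 1) * (1 / 2 - 1 / p) - 1 / q"
    and \<Lambda>: "0 \<le> \<Lambda>"
  shows "\<exists>C>0. \<forall>(H::real^'n \<Rightarrow> complex) b A. annulus_data H b A \<longrightarrow> b \<le> 1 + \<Lambda> \<longrightarrow> 0 < A \<longrightarrow>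
    det_norm q p \<alpha> H \<le> ennreal (C * (b - 1) powr (1 / 2 - 1 / q) * A)"
proof -
  let ?n = "CARD('n)"
  define \<mu> where "\<mu> = (real ?n - 1) / 2"
  define \<theta> where "\<theta> = q / p"
  define c where "c = ring_const TYPE('n) \<Lambda>"
  have c: "0 < c" unfolding c_def by (rule ring_const_pos[OF \<Lambda>])
  have pq: "0 < p" "0 < q" "\<theta> \<le> 1" "0 < \<theta>" using p by (auto simp: \<theta>_def)
  obtain S where S: "0 < S" "\<And>r. 0 \<le> r \<Longrightarrow> \<bar>sph ?n r\<bar> \<le> S * (1 + r) powr (- (real ?n - 1) / 2)"
      "\<And>r. 0 \<le> r \<Longrightarrow> \<bar>sph' ?n r\<bar> \<le> S * (1 + r) powr (- (real ?n - 1) / 2)"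
    by (rule sph_decay_CARD[where 'n='n]) (rule that; assumption)
  have "- real ?n < \<alpha> * p" using \<alpha>(1) pq(1) by (simp only: pos_divide_less_eq)
  from shell_weight[OF this] obtain C0 where C0: "0 < C0"
    "\<And>j::nat. (\<integral>\<^sup>+x. ennreal (norm (x::real^'n) powr (\<alpha> * p)) * indicator (annulus (real j) (real j + 1)) x \<partial>lborel)
      \<le> ennreal (C0 * (1 + real j) powr (\<alpha> * p + real ?n - 1))" by blast
  define e where "e = (\<alpha> * p + real ?n - 1) * \<theta> - \<mu> * q"
  have e: "e < - 1"
  proof -
    have "e = (\<alpha> - (real ?n - 1) * (1 / 2 - 1 / p)) * q"
      using pq by (simp add: e_def \<theta>_def \<mu>_def field_simps)
    also have "\<dots> < (- 1 / q) * q" using \<alpha>(2) pq by (intro mult_strict_right_mono) auto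
    finally show ?thesis using pq by simp
  qed
  define \<Sigma> where "\<Sigma> = (\<Sum>j. (1 + real j) powr e)"
  have sm: "summable (\<lambda>j. (1 + real j) powr e)"
  proof -
    have "summable (\<lambda>j. real (Suc j) powr e)"
      using e summable_real_powr_iff[of e] by (subst summable_Suc_iff) simp
    then show ?thesis by simp
  qed
  have \<Sigma>0: "0 \<le> \<Sigma>" unfolding \<Sigma>_def by (intro suminf_nonneg sm) auto
  define c3 where "c3 = C0 powr \<theta> * (2 * 2 powr q * (2 * pi * c * sqrt c powr (q - 2) * ((1 + \<Lambda>) * S) powr q)) * \<Sigma>"
  have c3: "0 \<le> c3" using \<Sigma>0 c by (simp add: c3_def)
  show ?thesis
  proof (intro exI[of _ "(c3 + 1) powr (1 / q)"] conjI allI impI)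
    show "0 < (c3 + 1) powr (1 / q)" using c3 by simp
    fix H :: "real^'n \<Rightarrow> complex" and b A
    assume "annulus_data H b A" and b\<Lambda>: "b \<le> 1 + \<Lambda>" and A0: "0 < A"
    then interpret annulus_data H b A by simp
    define D where "D = b - 1"
    have D: "0 < D" using b by (simp add: D_def)
    define c4 where "c4 = 2 * 2 powr q * (2 * pi * c * sqrt (c * D) powr (q - 2) * ((1 + \<Lambda>) * S * A) powr q)"
    have c4: "0 \<le> c4" using c by (simp add: c4_def)
    have x0: "AE x in lborel. x \<noteq> (0::real^'n)" by (rule AE_lborel_singleton)
    have KL: "(\<integral>\<^sup>+t. ennreal_powr (shell_sup (real j) t) q \<partial>lborel) \<le> ennreal (c4 * (1 + real j) powr (- (\<mu> * q)))" for j
    proof -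
      have "(\<integral>\<^sup>+t. ennreal_powr (shell_sup (real j) t) q \<partial>lborel)
         \<le> ennreal (2 * 2 powr q * (2 * pi * c * sqrt (c * D) powr (q - 2) * ((1 + \<Lambda>) * S * (1 + real j) powr (- \<mu>) * A) powr q))"
        unfolding c_def D_def \<mu>_def by (rule shell_sup_Lq[OF b\<Lambda> p(1) A0 _ S]) auto
      also have "((1 + \<Lambda>) * S * (1 + real j) powr (- \<mu>) * A) powr q = ((1 + \<Lambda>) * S * A) powr q * (1 + real j) powr (- (\<mu> * q))"
        using \<Lambda> S(1) A0 by (simp add: powr_mult powr_powr)
      finally show ?thesis by (simp add: c4_def mult_ac)
    qed
    define I where "I t = (\<integral>\<^sup>+x. ennreal_powr (ennreal (norm x powr \<alpha> * cmod (wave H t x))) p \<partial>lborel)" for t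
    have I_le: "I t \<le> (\<Sum>j. ennreal_powr (shell_sup (real j) t) p * ennreal (C0 * (1 + real j) powr (\<alpha> * p + real ?n - 1)))" for t
    proof -
      have "I t \<le> (\<integral>\<^sup>+(x::real^'n). (\<Sum>j. ennreal_powr (shell_sup (real j) t) p * (ennreal (norm x powr (\<alpha> * p)) * indicator (annulus (real j) (real j + 1)) x)) \<partial>lborel)"
        unfolding I_def
      proof (intro nn_integral_mono_AE)
        from x0 show "AE x in lborel. ennreal_powr (ennreal (norm x powr \<alpha> * cmod (wave H t x))) p
          \<le> (\<Sum>j. ennreal_powr (shell_sup (real j) t) p * (ennreal (norm x powr (\<alpha> * p)) * indicator (annulus (real j) (real j + 1)) x))"
        proof eventually_elim
          case (elim x)
          define j where "j = nat \<lfloor>norm x\<rfloor>"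
          have j: "real j \<le> norm x" "norm x < real j + 1" unfolding j_def by (simp_all add: of_nat_nat)
          have "ennreal (cmod (wave H t x)) \<le> shell_sup (real j) t"
            unfolding wave_eq_W[OF elim] using j by (intro W0_le_shell_sup) auto
          then have "ennreal_powr (ennreal (cmod (wave H t x))) p \<le> ennreal_powr (shell_sup (real j) t) p"
            using pq by (intro ennreal_powr_mono) auto
          moreover have "ennreal_powr (ennreal (norm x powr \<alpha> * cmod (wave H t x))) p = ennreal_powr (ennreal (cmod (wave H t x))) p * ennreal (norm x powr (\<alpha> * p))"
            by (simp add: ennreal_mult ennreal_powr_mult ennreal_powr_ennreal powr_powr mult.commute)
          ultimately have "ennreal_powr (ennreal (norm x powr \<alpha> * cmod (wave H t x))) p \<le> ennreal_powr (shell_sup (real j) t) p *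
            (ennreal (norm x powr (\<alpha> * p)) * indicator (annulus (real j) (real j + 1)) x)"
            using j by (simp add: annulus_def mult_right_mono)
          also have "\<dots> \<le> (\<Sum>j. ennreal_powr (shell_sup (real j) t) p * (ennreal (norm x powr (\<alpha> * p)) * indicator (annulus (real j) (real j + 1)) x))"
            using sum_le_suminf[of "\<lambda>j. ennreal_powr (shell_sup (real j) t) p * (ennreal (norm x powr (\<alpha> * p)) * indicator
              (annulus (real j) (real j + 1)) x)" "{j}"] by simp
          finally show ?case .
        qed
      qed
      also have "\<dots> = (\<Sum>j. ennreal_powr (shell_sup (real j) t) p * (\<integral>\<^sup>+x. ennreal (norm x powr (\<alpha> * p)) * indicator (annulus (real
        j) (real j + 1) :: (real^'n) set) x \<partial>lborel))"
        by (subst nn_integral_suminf) (auto simp: nn_integral_cmult)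
      also have "\<dots> \<le> (\<Sum>j. ennreal_powr (shell_sup (real j) t) p * ennreal (C0 * (1 + real j) powr (\<alpha> * p + real ?n - 1)))"
        by (intro suminf_le mult_left_mono C0 summableI) auto
      finally show ?thesis .
    qed
    have I_powr: "ennreal_powr (I t) \<theta> \<le> (\<Sum>j. ennreal_powr (shell_sup (real j) t) q * ennreal (C0 powr \<theta> * (1 + real j) powr ((\<alpha> * p + real ?n - 1) * \<theta>)))" for t
    proof -
      have "ennreal_powr (I t) \<theta> \<le> ennreal_powr (\<Sum>j. ennreal_powr (shell_sup (real j) t) p * ennreal (C0 * (1 + real j) powr (\<alpha> * p + real ?n - 1))) \<theta>"
        using pq by (intro ennreal_powr_mono I_le) auto
      also have "\<dots> \<le> (\<Sum>j. ennreal_powr (ennreal_powr (shell_sup (real j) t) p * ennreal (C0 * (1 + real j) powr (\<alpha> * p + real ?n - 1))) \<theta>)"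
        using pq by (intro ennreal_powr_suminf_le) auto
      also have "\<dots> = (\<Sum>j. ennreal_powr (shell_sup (real j) t) q * ennreal (C0 powr \<theta> * (1 + real j) powr ((\<alpha> * p + real ?n - 1) * \<theta>)))"
        using pq C0(1) by (intro suminf_cong) (simp add: ennreal_powr_mult ennreal_powr_powr ennreal_powr_ennreal powr_mult powr_powr \<theta>_def)
      finally show ?thesis .
    qed
    have [measurable]: "(\<lambda>t. shell_sup j t) \<in> borel_measurable borel" for j
      unfolding shell_sup_def by measurable
    have "(\<integral>\<^sup>+t. ennreal_powr (I t) \<theta> \<partial>lborel) \<le> (\<integral>\<^sup>+t. (\<Sum>j. ennreal_powr (shell_sup (real j) t) q * ennreal (C0 powr \<theta> * (1 +
      real j) powr ((\<alpha> * p + real ?n - 1) * \<theta>))) \<partial>lborel)"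
      by (intro nn_integral_mono I_powr)
    also have "\<dots> = (\<Sum>j. (\<integral>\<^sup>+t. ennreal_powr (shell_sup (real j) t) q \<partial>lborel) * ennreal (C0 powr \<theta> * (1 + real j) powr ((\<alpha> * p + real ?n - 1) * \<theta>)))"
      by (subst nn_integral_suminf) (auto simp: nn_integral_multc)
    also have "\<dots> \<le> (\<Sum>j. ennreal (C0 powr \<theta> * c4) * ennreal ((1 + real j) powr e))"
    proof (intro suminf_le summableI)
      fix j
      have "(\<integral>\<^sup>+t. ennreal_powr (shell_sup (real j) t) q \<partial>lborel) * ennreal (C0 powr \<theta> * (1 + real j) powr ((\<alpha> * p + real ?n - 1) * \<theta>))
        \<le> ennreal (c4 * (1 + real j) powr (- (\<mu> * q))) * ennreal (C0 powr \<theta> * (1 + real j) powr ((\<alpha> * p + real ?n - 1) * \<theta>))"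
        by (intro mult_right_mono KL) auto
      also have "\<dots> = ennreal (C0 powr \<theta> * c4 * ((1 + real j) powr (- (\<mu> * q)) * (1 + real j) powr ((\<alpha> * p + real ?n - 1) * \<theta>)))"
        using c4 by (simp add: ennreal_mult[symmetric] mult_ac)
      also have "(1 + real j) powr (- (\<mu> * q)) * (1 + real j) powr ((\<alpha> * p + real ?n - 1) * \<theta>) = (1 + real j) powr e"
        by (simp add: powr_add[symmetric] e_def)
      finally show "(\<integral>\<^sup>+t. ennreal_powr (shell_sup (real j) t) q \<partial>lborel) * ennreal (C0 powr \<theta> * (1 + real j) powr ((\<alpha> * p + real
        ?n - 1) * \<theta>)) \<le> ennreal (C0 powr \<theta> * c4) * ennreal ((1 + real j) powr e)"
        using c4 by (simp add: ennreal_mult)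
    qed
    also have "\<dots> = ennreal (C0 powr \<theta> * c4) * ennreal \<Sigma>"
      unfolding \<Sigma>_def by (subst ennreal_suminf_cmult, subst suminf_ennreal2) (auto intro: sm)
    also have "\<dots> = ennreal (c3 * (D powr (1 / 2 - 1 / q) * A) powr q)"
    proof -
      have e1: "(q - 2) / 2 = (1 / 2 - 1 / q) * q" using pq by (simp add: field_simps)
      have "sqrt D powr (q - 2) = D powr ((q - 2) / 2)"
        using D by (simp add: powr_half_sqrt[symmetric] powr_powr)
      then have "sqrt (c * D) powr (q - 2) = sqrt c powr (q - 2) * D powr ((1 / 2 - 1 / q) * q)"
        using c D unfolding real_sqrt_mult by (simp add: powr_mult e1)
      then have "C0 powr \<theta> * c4 * \<Sigma> = c3 * (D powr (1 / 2 - 1 / q) * A) powr q"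
        using \<Lambda> S(1) A0 D unfolding c3_def c4_def by (simp add: powr_mult powr_powr mult_ac)
      then show ?thesis using c4 \<Sigma>0 by (simp add: ennreal_mult[symmetric])
    qed
    also have "\<dots> \<le> ennreal ((c3 + 1) * (D powr (1 / 2 - 1 / q) * A) powr q)"
      by (intro ennreal_leI mult_right_mono) auto
    also have "\<dots> = ennreal_powr (ennreal ((c3 + 1) powr (1 / q) * D powr (1 / 2 - 1 / q) * A)) q"
      using c3 A0 pq by (simp add: ennreal_powr_ennreal powr_mult powr_powr mult.assoc)
    finally have "(\<integral>\<^sup>+t. ennreal_powr (I t) \<theta> \<partial>lborel) \<le> ennreal_powr (ennreal ((c3 + 1) powr (1 / q) * D powr (1 / 2 - 1 / q) * A)) q" .
    moreover have "ennreal_powr (I t) \<theta> = ennreal_powr (Lp_norm p lborel (\<lambda>x. ennreal (norm x powr \<alpha> * cmod (wave H t x)))) q" for t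
      using pq by (simp add: Lp_norm_def I_def ennreal_powr_powr \<theta>_def)
    ultimately show "det_norm q p \<alpha> H \<le> ennreal ((c3 + 1) powr (1 / q) * (b - 1) powr (1 / 2 - 1 / q) * A)"
      unfolding det_norm_def D_def[symmetric] Lp_norm_le_iff[OF pq(2)] by simp
  qed
qed

section \<open>Scaling and low frequencies\<close>

lemma wave_scale:
  fixes H :: "'a::euclidean_space \<Rightarrow> complex"
  assumes [measurable]: "H \<in> borel_measurable borel" and a: "0 < a"
  shows "wave H t x = complex_of_real (a ^ DIM('a)) * wave (\<lambda>\<eta>. H (a *\<^sub>R \<eta>)) (a * t) (a *\<^sub>R x)"
proof -
  have "wave H t x = \<bar>a\<bar> ^ DIM('a) *\<^sub>R (LINT \<eta>|lborel. cis (x \<bullet> (0 + a *\<^sub>R \<eta>)) * (cis (t * norm (0 + a *\<^sub>R \<eta>)) * H (0 + a *\<^sub>R \<eta>)))"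
    unfolding wave_def ft_def by (rule lborel_integral_affine) (use a in auto)
  then show ?thesis using a by (simp add: wave_def ft_def scaleR_conv_of_real mult_ac)
qed

lemma Lp_norm_scale:
  fixes F :: "'a::euclidean_space \<Rightarrow> ennreal"
  assumes [measurable]: "F \<in> borel_measurable borel" and c: "c \<noteq> 0" and p: "0 < p"
  shows "Lp_norm p lborel (\<lambda>x. F (c *\<^sub>R x)) = ennreal (\<bar>c\<bar> powr (- real DIM('a) / p)) * Lp_norm p lborel F"
proof -
  let ?J = "\<integral>\<^sup>+x. ennreal_powr (F (c *\<^sub>R x)) p \<partial>lborel"
  have "(\<integral>\<^sup>+x. ennreal_powr (F x) p \<partial>lborel) = ennreal (\<bar>c\<bar> ^ DIM('a)) * ?J"
    by (rule nn_integral_scale[OF _ c]) measurable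
  then have "ennreal (\<bar>c\<bar> powr (- real DIM('a))) * (\<integral>\<^sup>+x. ennreal_powr (F x) p \<partial>lborel) = ennreal (\<bar>c\<bar> powr (- real DIM('a)) * \<bar>c\<bar> ^ DIM('a)) * ?J"
    by (simp add: ennreal_mult mult.assoc)
  also have "\<bar>c\<bar> powr (- real DIM('a)) * \<bar>c\<bar> ^ DIM('a) = 1"
    using c by (simp add: powr_minus powr_realpow)
  finally have "?J = ennreal (\<bar>c\<bar> powr (- real DIM('a))) * (\<integral>\<^sup>+x. ennreal_powr (F x) p \<partial>lborel)" by simp
  then show ?thesis
    by (simp add: Lp_norm_def ennreal_powr_mult ennreal_powr_ennreal powr_powr)
qed

lemma wave_measurable_x [measurable]:
  assumes [measurable]: "H \<in> borel_measurable borel" shows "wave H t \<in> borel_measurable borel"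
  unfolding wave_def by measurable

lemma Lp_wave_measurable [measurable]:
  fixes H :: "real^'n::finite \<Rightarrow> complex"
  assumes [measurable]: "H \<in> borel_measurable borel"
  shows "(\<lambda>t. Lp_norm p lborel (\<lambda>x. ennreal (norm x powr \<alpha> * cmod (wave H t x)))) \<in> borel_measurable borel"
  by (rule measurable_Lp_norm[OF sigma_finite_lborel]) measurable

text \<open>The exponent collects the Jacobian in frequency, the homogeneity of the weight, and the
  dilations of \<open>x\<close> and \<open>t\<close> inside their norms.\<close>

lemma det_norm_scale:
  fixes H :: "real^'n::finite \<Rightarrow> complex"
  assumes [measurable]: "H \<in> borel_measurable borel" and a: "0 < a" and pq: "0 < p" "0 < q"
  shows "det_norm q p \<alpha> H = ennreal (a powr (real CARD('n) - \<alpha> - real CARD('n) / p - 1 / q)) * det_norm q p \<alpha> (\<lambda>\<eta>. H (a *\<^sub>R \<eta>))"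
proof -
  let ?n = "CARD('n)"
  define H1 where "H1 = (\<lambda>\<eta>. H (a *\<^sub>R \<eta>))"
  have [measurable]: "H1 \<in> borel_measurable borel" unfolding H1_def by measurable
  define N where "N t = Lp_norm p lborel (\<lambda>x. ennreal (norm x powr \<alpha> * cmod (wave H1 t x)))" for t
  have [measurable]: "N \<in> borel_measurable borel" unfolding N_def by measurable
  have "Lp_norm p lborel (\<lambda>x. ennreal (norm x powr \<alpha> * cmod (wave H t x))) = ennreal (a powr (real ?n - \<alpha> - real ?n / p)) * N (a *\<^sub>R t)" for t
  proof -
    have e: "ennreal (norm x powr \<alpha> * cmod (wave H t x)) = ennreal (a powr (real ?n - \<alpha>)) * ennreal (norm (a *\<^sub>R x) powr \<alpha> * cmod (wave H1 (a * t) (a *\<^sub>R x)))" for x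
    proof -
      have "cmod (wave H t x) = a powr real ?n * cmod (wave H1 (a * t) (a *\<^sub>R x))"
        using a wave_scale[OF assms(1) a, of t x] by (simp add: H1_def norm_mult norm_power powr_realpow)
      moreover have "norm x powr \<alpha> = a powr (- \<alpha>) * norm (a *\<^sub>R x) powr \<alpha>"
        using a by (simp add: powr_mult powr_minus)
      ultimately have "norm x powr \<alpha> * cmod (wave H t x) = (a powr (- \<alpha>) * a powr real ?n) * (norm (a *\<^sub>R x) powr \<alpha> * cmod (wave H1 (a * t) (a *\<^sub>R x)))"
        by (simp only: mult_ac)
      also have "a powr (- \<alpha>) * a powr real ?n = a powr (real ?n - \<alpha>)" by (simp add: powr_add[symmetric])
      finally show ?thesis by (simp only: ennreal_mult powr_ge_zero mult_nonneg_nonneg norm_ge_zero)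
    qed
    have "Lp_norm p lborel (\<lambda>x. ennreal (norm x powr \<alpha> * cmod (wave H t x))) = ennreal (a powr (real ?n - \<alpha>)) * Lp_norm p lborel
      (\<lambda>x. (\<lambda>y. ennreal (norm y powr \<alpha> * cmod (wave H1 (a * t) y))) (a *\<^sub>R x))"
      unfolding e by (rule Lp_norm_cmult[OF _ pq(1)]) measurable
    also have "\<dots> = ennreal (a powr (real ?n - \<alpha>)) * (ennreal (\<bar>a\<bar> powr (- real DIM(real^'n) / p)) * N (a * t))"
      unfolding N_def using a pq by (subst Lp_norm_scale) auto
    also have "\<dots> = ennreal (a powr (real ?n - \<alpha> - real ?n / p)) * N (a *\<^sub>R t)"
      using a by (simp add: mult.assoc[symmetric] ennreal_mult[symmetric] powr_add[symmetric])
    finally show ?thesis .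
  qed
  then have "det_norm q p \<alpha> H = Lp_norm q lborel (\<lambda>t. ennreal (a powr (real ?n - \<alpha> - real ?n / p)) * N (a *\<^sub>R t))"
    by (simp add: det_norm_def)
  also have "\<dots> = ennreal (a powr (real ?n - \<alpha> - real ?n / p)) * Lp_norm q lborel (\<lambda>t. N (a *\<^sub>R t))"
    by (rule Lp_norm_cmult[OF _ pq(2)]) measurable
  also have "Lp_norm q lborel (\<lambda>t. N (a *\<^sub>R t)) = ennreal (\<bar>a\<bar> powr (- real DIM(real) / q)) * Lp_norm q lborel N"
    using a pq by (intro Lp_norm_scale) auto
  also have "ennreal (a powr (real ?n - \<alpha> - real ?n / p)) * (ennreal (\<bar>a\<bar> powr (- real DIM(real) / q)) * Lp_norm q lborel N) =
    ennreal (a powr (real ?n - \<alpha> - real ?n / p - 1 / q)) * Lp_norm q lborel N"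
    using a by (simp add: mult.assoc[symmetric] ennreal_mult[symmetric] powr_add[symmetric])
  finally show ?thesis by (simp add: det_norm_def N_def[abs_def] H1_def)
qed

lemma AE_scale:
  fixes P :: "'a::euclidean_space \<Rightarrow> bool"
  assumes "AE x in lborel. P x" and [measurable]: "Measurable.pred borel P" and "c \<noteq> 0"
  shows "AE x in lborel. P (c *\<^sub>R x)"
proof -
  have "AE x in density (distr lborel borel (\<lambda>x::'a. 0 + c *\<^sub>R x)) (\<lambda>_. \<bar>c\<bar>^DIM('a)). P x"
    using assms(1) by (simp only: lborel_affine[OF assms(3), of "0::'a", symmetric])
  then have "AE x in distr lborel borel (\<lambda>x::'a. 0 + c *\<^sub>R x). P x"
    using assms(3) by (subst (asm) AE_density) auto
  then show ?thesis by (subst (asm) AE_distr_iff) auto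
qed

lemma ennreal_le_0_of_mult:
  assumes "\<And>A. 0 < A \<Longrightarrow> X \<le> ennreal (K * A)" "0 \<le> K" shows "X = 0"
proof (rule ccontr)
  assume "X \<noteq> 0"
  have "X \<noteq> \<top>" using assms(1)[of 1] by (auto simp: top_unique)
  then obtain x where x: "X = ennreal x" "0 < x" using \<open>X \<noteq> 0\<close> by (cases X) (auto simp: less_le)
  have "0 < x / (2 * K + 1)" using x assms(2) by simp
  from assms(1)[OF this] have "x \<le> K * (x / (2 * K + 1))" using x assms(2) by simp
  then have "x * (2 * K + 1) \<le> K * x" using assms(2) by (simp add: field_simps)
  then have "x * (K + 1) \<le> 0" by (simp add: algebra_simps)
  then show False using x assms(2) mult_pos_pos[of x "K + 1"] by linarith
qed

text \<open>Dilation by \<open>a\<close> reduces to a shell of inner radius 1 and width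
  \<open>(b - a) / a\<close>. The L^2 norm of the dilated symbol is
  \<open>a powr (- CARD('n) / 2)\<close> times the original one, which turns the exponent of
  \<open>det_norm_scale\<close> into the one stated. \<open>\<Lambda>\<close> bounds the relative
  width, so that the constant is uniform.\<close>

lemma det_norm_annulus:
  fixes p q \<alpha> \<Lambda> :: real
  assumes p: "2 \<le> p" "2 \<le> q" and \<alpha>: "- real CARD('n::finite) / p < \<alpha>" "\<alpha> < (real CARD('n) - 1) * (1 / 2 - 1 / p) - 1 / q"
    and \<Lambda>: "0 \<le> \<Lambda>"
  shows "\<exists>C>0. \<forall>(H::real^'n \<Rightarrow> complex) a b A. H \<in> borel_measurable borel \<longrightarrow> radial_ae H \<longrightarrow> 0 < a \<longrightarrow> a < b \<longrightarrow> b \<le> (1 + \<Lambda>) * a \<longrightarrow> 0 \<le> A \<longrightarrow>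
    (\<forall>\<xi>. \<xi> \<notin> annulus a b \<longrightarrow> H \<xi> = 0) \<longrightarrow> (\<integral>\<^sup>+\<xi>. ennreal ((cmod (H \<xi>))\<^sup>2) \<partial>lborel) \<le> ennreal (A\<^sup>2) \<longrightarrow>
    det_norm q p \<alpha> H \<le> ennreal (C * a powr (real CARD('n) / 2 - 1 / q - real CARD('n) / p - \<alpha>) * ((b - a) / a) powr (1 / 2 - 1 / min p q) * A)"
proof -
  let ?n = "CARD('n)"
  let ?\<kappa> = "1 / 2 - 1 / min p q"
  have "\<exists>C>0. \<forall>(H::real^'n \<Rightarrow> complex) b A. annulus_data H b A \<longrightarrow> b \<le> 1 + \<Lambda> \<longrightarrow> 0 < A \<longrightarrow>
    det_norm q p \<alpha> H \<le> ennreal (C * (b - 1) powr ?\<kappa> * A)"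
  proof (cases "p \<le> q")
    case True
    then show ?thesis using det_norm_p_le_q[OF p(1) True \<alpha> \<Lambda>] by simp
  next
    case False
    then show ?thesis using det_norm_q_less_p[OF p(2) _ \<alpha> \<Lambda>] by simp
  qed
  then obtain C where C: "0 < C" "\<And>(H::real^'n \<Rightarrow> complex) b A. annulus_data H b A \<Longrightarrow> b \<le> 1 + \<Lambda> \<Longrightarrow> 0 < A \<Longrightarrow>
    det_norm q p \<alpha> H \<le> ennreal (C * (b - 1) powr ?\<kappa> * A)" by blast
  show ?thesis
  proof (intro exI[of _ C] conjI C(1) allI impI)
    fix H :: "real^'n \<Rightarrow> complex" and a b A
    assume [measurable]: "H \<in> borel_measurable borel" and rad: "radial_ae H" and a: "0 < a" and ab: "a < b" "b \<le> (1 + \<Lambda>) * a"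
      and A: "0 \<le> A" and supp: "\<forall>\<xi>. \<xi> \<notin> annulus a b \<longrightarrow> H \<xi> = 0" and L2: "(\<integral>\<^sup>+\<xi>. ennreal ((cmod (H \<xi>))\<^sup>2) \<partial>lborel) \<le> ennreal (A\<^sup>2)"
    define H1 where "H1 = (\<lambda>\<eta>. H (a *\<^sub>R \<eta>))"
    have [measurable]: "H1 \<in> borel_measurable borel" unfolding H1_def by measurable
    have rad1: "radial_ae H1"
      unfolding radial_ae_def
    proof (intro allI impI)
      fix T :: "real^'n \<Rightarrow> real^'n" assume T: "orthogonal_transformation T"
      have [measurable]: "T \<in> borel \<rightarrow>\<^sub>M borel" by (rule orthogonal_measurable[OF T])
      have "AE \<xi> in lborel. H (T \<xi>) = H \<xi>" using rad T by (simp add: radial_ae_def)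
      then have "AE \<xi> in lborel. H (T (a *\<^sub>R \<xi>)) = H (a *\<^sub>R \<xi>)" by (rule AE_scale) (use a in auto)
      then show "AE \<xi> in lborel. H1 (T \<xi>) = H1 \<xi>"
        using orthogonal_transformation_linear[OF T] by (simp add: H1_def linear_cmul)
    qed
    have L21: "(\<integral>\<^sup>+\<xi>. ennreal ((cmod (H1 \<xi>))\<^sup>2) \<partial>lborel) \<le> ennreal ((a powr (- real ?n / 2) * B)\<^sup>2)" if "A \<le> B" for B
    proof -
      have "(\<integral>\<^sup>+\<xi>. ennreal ((cmod (H \<xi>))\<^sup>2) \<partial>lborel) = ennreal (\<bar>a\<bar> ^ DIM(real^'n)) * (\<integral>\<^sup>+\<xi>. ennreal ((cmod (H1 \<xi>))\<^sup>2) \<partial>lborel)"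
        unfolding H1_def by (rule nn_integral_scale) (use a in auto)
      then have "ennreal (a powr (- real ?n)) * (ennreal (a ^ ?n) * (\<integral>\<^sup>+\<xi>. ennreal ((cmod (H1 \<xi>))\<^sup>2) \<partial>lborel)) \<le> ennreal (a powr (- real ?n)) * ennreal (A\<^sup>2)"
        using L2 a by (intro mult_left_mono) auto
      also have "\<dots> \<le> ennreal (a powr (- real ?n)) * ennreal (B\<^sup>2)"
        using that A by (intro mult_left_mono ennreal_leI power_mono) auto
      also have "\<dots> = ennreal ((a powr (- real ?n / 2) * B)\<^sup>2)"
      proof -
        have "(a powr (- real ?n / 2))\<^sup>2 = a powr (- real ?n)" using a by (simp add: power2_eq_square powr_add[symmetric])
        then show ?thesis by (simp add: ennreal_mult[symmetric] power_mult_distrib)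
      qed
      also have "ennreal (a powr (- real ?n)) * (ennreal (a ^ ?n) * (\<integral>\<^sup>+\<xi>. ennreal ((cmod (H1 \<xi>))\<^sup>2) \<partial>lborel)) = (\<integral>\<^sup>+\<xi>. ennreal ((cmod (H1 \<xi>))\<^sup>2) \<partial>lborel)"
      proof -
        have "a powr (- real ?n) * a ^ ?n = 1" using a by (simp add: powr_minus powr_realpow)
        then have "ennreal (a powr (- real ?n)) * ennreal (a ^ ?n) = 1" using a by (simp add: ennreal_mult[symmetric])
        then show ?thesis by (simp add: mult.assoc[symmetric])
      qed
      finally show ?thesis .
    qed
    let ?e = "real ?n / 2 - 1 / q - real ?n / p - \<alpha>"
    have key: "det_norm q p \<alpha> H \<le> ennreal (C * a powr ?e * ((b - a) / a) powr ?\<kappa> * B)" if B: "A \<le> B" "0 < B" for B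
    proof -
      have "annulus_data H1 (b / a) (a powr (- real ?n / 2) * B)"
      proof
        show "H1 \<xi> = 0" if "\<xi> \<notin> annulus 1 (b / a)" for \<xi>
          using that supp[rule_format, of "a *\<^sub>R \<xi>"] a by (auto simp: H1_def annulus_def field_simps)
      qed (use rad1 L21[OF B(1)] B a ab in auto)
      then have "det_norm q p \<alpha> H1 \<le> ennreal (C * (b / a - 1) powr ?\<kappa> * (a powr (- real ?n / 2) * B))"
        using a B ab by (intro C) (auto simp: pos_divide_le_eq)
      then have "det_norm q p \<alpha> H \<le> ennreal (a powr (real ?n - \<alpha> - real ?n / p - 1 / q)) * ennreal (C * (b / a - 1) powr ?\<kappa> * (a powr (- real ?n / 2) * B))"
        using a p det_norm_scale[of H a p q \<alpha>] unfolding H1_def by (simp add: mult_left_mono)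
      also have "\<dots> = ennreal (C * (a powr (real ?n - \<alpha> - real ?n / p - 1 / q) * a powr (- real ?n / 2)) * (b / a - 1) powr ?\<kappa> * B)"
        using C(1) B by (simp add: ennreal_mult[symmetric] mult_ac)
      also have "a powr (real ?n - \<alpha> - real ?n / p - 1 / q) * a powr (- real ?n / 2) = a powr ?e"
      proof -
        have "(real ?n - \<alpha> - real ?n / p - 1 / q) + (- real ?n / 2) = ?e" by linarith
        then show ?thesis by (simp only: powr_add[symmetric])
      qed
      also have "b / a - 1 = (b - a) / a" using a by (simp add: diff_divide_distrib)
      finally show ?thesis .
    qed
    \<comment> \<open>The normalised estimates require a positive bound. When \<open>A = 0\<close>
      the estimate holds with every positive \<open>B\<close> in its place, which forces the norm to
      vanish.\<close>
    show "det_norm q p \<alpha> H \<le> ennreal (C * a powr ?e * ((b - a) / a) powr ?\<kappa> * A)"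
    proof (cases "A = 0")
      case True
      have "det_norm q p \<alpha> H = 0"
        by (rule ennreal_le_0_of_mult[where K="C * a powr ?e * ((b - a) / a) powr ?\<kappa>"]) (use key True C(1) in auto)
      then show ?thesis by simp
    next
      case False
      then show ?thesis using key[of A] A by simp
    qed
  qed
qed

lemma det_norm_le_suminf:
  fixes H :: "real^'n::finite \<Rightarrow> complex" and G :: "nat \<Rightarrow> real^'n \<Rightarrow> complex"
  assumes [measurable]: "H \<in> borel_measurable borel" "\<And>j. G j \<in> borel_measurable borel"
    and le: "\<And>t x. ennreal (cmod (wave H t x)) \<le> (\<Sum>j. ennreal (cmod (wave (G j) t x)))" and pq: "1 \<le> p" "1 \<le> q"
  shows "det_norm q p \<alpha> H \<le> (\<Sum>j. det_norm q p \<alpha> (G j))"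
proof -
  have "Lp_norm p lborel (\<lambda>x. ennreal (norm x powr \<alpha> * cmod (wave H t x))) \<le> (\<Sum>j. Lp_norm p lborel (\<lambda>x. ennreal (norm x powr \<alpha> * cmod (wave (G j) t x))))" for t
  proof -
    have "Lp_norm p lborel (\<lambda>x. ennreal (norm x powr \<alpha> * cmod (wave H t x))) \<le> Lp_norm p lborel (\<lambda>x. \<Sum>j. ennreal (norm x powr \<alpha> * cmod (wave (G j) t x)))"
    proof (rule Lp_norm_mono)
      fix x
      have "ennreal (norm x powr \<alpha> * cmod (wave H t x)) \<le> ennreal (norm x powr \<alpha>) * (\<Sum>j. ennreal (cmod (wave (G j) t x)))"
        using le[of t x] by (simp add: ennreal_mult mult_left_mono)
      then show "ennreal (norm x powr \<alpha> * cmod (wave H t x)) \<le> (\<Sum>j. ennreal (norm x powr \<alpha> * cmod (wave (G j) t x)))"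
        by (simp add: ennreal_mult)
    qed (use pq in simp)
    also have "\<dots> \<le> (\<Sum>j. Lp_norm p lborel (\<lambda>x. ennreal (norm x powr \<alpha> * cmod (wave (G j) t x))))"
      by (rule Lp_norm_suminf[OF sigma_finite_lborel _ pq(1)]) measurable
    finally show ?thesis .
  qed
  then have "det_norm q p \<alpha> H \<le> Lp_norm q lborel (\<lambda>t. \<Sum>j. Lp_norm p lborel (\<lambda>x. ennreal (norm x powr \<alpha> * cmod (wave (G j) t x))))"
    unfolding det_norm_def by (intro Lp_norm_mono) (use pq in auto)
  also have "\<dots> \<le> (\<Sum>j. Lp_norm q lborel (\<lambda>t. Lp_norm p lborel (\<lambda>x. ennreal (norm x powr \<alpha> * cmod (wave (G j) t x)))))"
    by (rule Lp_norm_suminf[OF sigma_finite_lborel _ pq(2)]) measurable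
  finally show ?thesis by (simp add: det_norm_def)
qed

lemma radial_ae_mult:
  assumes "radial_ae H"
  shows "radial_ae (\<lambda>\<xi>. m (norm \<xi>) * H \<xi>)"
  unfolding radial_ae_def
proof (intro allI impI)
  fix T :: "'a \<Rightarrow> 'a" assume T: "orthogonal_transformation T"
  then have "AE \<xi> in lborel. H (T \<xi>) = H \<xi>" using assms by (simp add: radial_ae_def)
  then show "AE \<xi> in lborel. m (norm (T \<xi>)) * H (T \<xi>) = m (norm \<xi>) * H \<xi>"
    using T by (auto elim!: eventually_mono simp: orthogonal_transformation_norm)
qed

lemma integrable_of_square:
  fixes H :: "'a::euclidean_space \<Rightarrow> complex"
  assumes [measurable]: "H \<in> borel_measurable borel" and "(\<integral>\<^sup>+\<xi>. ennreal ((cmod (H \<xi>))\<^sup>2) \<partial>lborel) < \<top>"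
    and supp: "\<And>\<xi>. R < norm \<xi> \<Longrightarrow> H \<xi> = 0"
  shows "integrable lborel H"
proof (rule integrableI_bounded)
  have "(\<integral>\<^sup>+\<xi>. ennreal (cmod (H \<xi>)) \<partial>lborel) \<le> (\<integral>\<^sup>+\<xi>. ennreal ((cmod (H \<xi>))\<^sup>2) + indicator (cball 0 R) \<xi> \<partial>lborel)"
  proof (intro nn_integral_mono)
    fix \<xi>
    show "ennreal (cmod (H \<xi>)) \<le> ennreal ((cmod (H \<xi>))\<^sup>2) + indicator (cball 0 R) \<xi>"
    proof (cases "norm \<xi> \<le> R")
      case True
      have "0 \<le> (cmod (H \<xi>) - 1)\<^sup>2" by simp
      then have "cmod (H \<xi>) \<le> (cmod (H \<xi>))\<^sup>2 + 1" by (simp add: power2_diff) (smt (verit) norm_ge_zero zero_le_power2)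
      then have "ennreal (cmod (H \<xi>)) \<le> ennreal ((cmod (H \<xi>))\<^sup>2 + 1)" by (rule ennreal_leI)
      then show ?thesis using True by simp
    qed (use supp in \<open>auto simp: not_le\<close>)
  qed
  also have "\<dots> = (\<integral>\<^sup>+\<xi>. ennreal ((cmod (H \<xi>))\<^sup>2) \<partial>lborel) + emeasure lborel (cball (0::'a) R)"
    by (subst nn_integral_add) auto
  also have "\<dots> < \<infinity>" using assms(2) emeasure_lborel_cball_finite[of "0::'a" R] by simp
  finally show "(\<integral>\<^sup>+\<xi>. ennreal (cmod (H \<xi>)) \<partial>lborel) < \<infinity>" .
qed simp

section \<open>Low frequencies by dyadic decomposition\<close>

lemma det_norm_low:
  fixes p q \<alpha> :: real
  assumes p: "2 \<le> p" "2 \<le> q" and \<alpha>: "- real CARD('n::finite) / p < \<alpha>" "\<alpha> < (real CARD('n) - 1) * (1 / 2 - 1 / p) - 1 / q"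
  shows "\<exists>C>0. \<forall>(H::real^'n \<Rightarrow> complex) A. H \<in> borel_measurable borel \<longrightarrow> radial_ae H \<longrightarrow> 0 \<le> A \<longrightarrow>
    (\<forall>\<xi>. 1 \<le> norm \<xi> \<longrightarrow> H \<xi> = 0) \<longrightarrow> (\<integral>\<^sup>+\<xi>. ennreal ((cmod (H \<xi>))\<^sup>2) \<partial>lborel) \<le> ennreal (A\<^sup>2) \<longrightarrow>
    det_norm q p \<alpha> H \<le> ennreal (C * A)"
proof -
  let ?n = "CARD('n)"
  let ?e = "real ?n / 2 - 1 / q - real ?n / p - \<alpha>"
  obtain C where C: "0 < C" "\<And>(H::real^'n \<Rightarrow> complex) a b A. H \<in> borel_measurable borel \<Longrightarrow> radial_ae H \<Longrightarrow> 0 < a \<Longrightarrow> a < b \<Longrightarrow> b \<le> (1 + 1) * a \<Longrightarrow> 0 \<le> A \<Longrightarrow>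
    (\<forall>\<xi>. \<xi> \<notin> annulus a b \<longrightarrow> H \<xi> = 0) \<Longrightarrow> (\<integral>\<^sup>+\<xi>. ennreal ((cmod (H \<xi>))\<^sup>2) \<partial>lborel) \<le> ennreal (A\<^sup>2) \<Longrightarrow>
    det_norm q p \<alpha> H \<le> ennreal (C * a powr ?e * ((b - a) / a) powr (1 / 2 - 1 / min p q) * A)"
    using det_norm_annulus[OF p \<alpha>, of 1] by (auto 0 3)
  \<comment> \<open>By the upper bound on \<open>\<alpha>\<close>, this exponent exceeds
    \<open>1 / 2 - 1 / p\<close>, which is nonnegative because \<open>2 \<le> p\<close>.\<close>
  have e: "0 < ?e"
  proof -
    have "(real ?n - 1) * (1 / 2 - 1 / p) = real ?n / 2 - real ?n / p - (1 / 2 - 1 / p)"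
      using p by (simp add: field_simps)
    moreover have "1 / p \<le> 1 / 2" using p by (simp add: field_simps)
    ultimately show ?thesis using \<alpha>(2) by linarith
  qed
  define x where "x = (1 / 2) powr ?e"
  have x: "0 < x" "x < 1" using e powr_less_mono'[of "1/2" 0 ?e] by (auto simp: x_def)
  define \<Sigma> where "\<Sigma> = (\<Sum>j. x ^ Suc j)"
  have sm: "summable (\<lambda>j. x ^ Suc j)" using x by (subst summable_Suc_iff) (simp add: summable_geometric)
  have \<Sigma>0: "0 < \<Sigma>" unfolding \<Sigma>_def using x by (intro suminf_pos sm) auto
  show ?thesis
  proof (intro exI[of _ "C * \<Sigma>"] conjI mult_pos_pos C(1) \<Sigma>0 allI impI)
    fix H :: "real^'n \<Rightarrow> complex" and A
    assume [measurable]: "H \<in> borel_measurable borel" and rad: "radial_ae H" and A: "0 \<le> A"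
      and supp: "\<forall>\<xi>. 1 \<le> norm \<xi> \<longrightarrow> H \<xi> = 0" and L2: "(\<integral>\<^sup>+\<xi>. ennreal ((cmod (H \<xi>))\<^sup>2) \<partial>lborel) \<le> ennreal (A\<^sup>2)"
    have Hi: "integrable lborel H"
      by (rule integrable_of_square[where R=1]) (use L2 supp in \<open>auto intro: le_less_trans\<close>)
    define I where "I j = {(1/2) ^ Suc j ..< (1/2::real) ^ j}" for j :: nat
    have [measurable]: "I j \<in> sets borel" for j by (simp add: I_def)
    define G where "G j \<xi> = indicator (I j) (norm \<xi>) * H \<xi>" for j and \<xi> :: "real^'n"
    have G_meas [measurable]: "G j \<in> borel_measurable borel" for j unfolding G_def by measurable
    have Idisj: "i = j" if "r \<in> I i" "r \<in> I j" for i j r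
    proof (rule ccontr)
      assume "i \<noteq> j"
      have *: False if "i < j" "r \<in> I i" "r \<in> I j" for i j
      proof -
        have "(1/2::real) ^ j \<le> (1/2) ^ Suc i" using that(1) by (intro power_decreasing) auto
        then show False using that(2,3) by (auto simp: I_def)
      qed
      show False using * \<open>i \<noteq> j\<close> that by (metis linorder_neqE_nat)
    qed
    have Iex: "\<exists>j. r \<in> I j" if r: "0 < r" "r < 1" for r
    proof -
      obtain k where "(1/2::real) ^ k < r" using real_arch_pow_inv[OF r(1), of "1/2"] by auto
      then have "\<exists>k. (1/2::real) ^ k \<le> r" by (meson less_imp_le)
      define k where "k = (LEAST k. (1/2::real) ^ k \<le> r)"
      have k: "(1/2::real) ^ k \<le> r" unfolding k_def by (rule LeastI_ex) fact
      have "k \<noteq> 0" using k r by (intro notI) simp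
      then obtain j where j: "k = Suc j" by (cases k) auto
      have "\<not> (1/2::real) ^ j \<le> r" using not_less_Least[of j "\<lambda>k. (1/2::real) ^ k \<le> r"] j by (simp add: k_def[symmetric])
      then show ?thesis using k j by (auto simp: I_def not_le)
    qed
    have Gle: "cmod (G j \<xi>) \<le> cmod (H \<xi>)" for j \<xi> by (auto simp: G_def indicator_def)
    have Gd: "G i \<xi> = (if i = j then H \<xi> else 0)" if "norm \<xi> \<in> I j" for i j \<xi>
    proof (cases "i = j")
      case True
      then show ?thesis using that by (simp add: G_def)
    next
      case False
      then have "norm \<xi> \<notin> I i" using Idisj that by blast
      then show ?thesis using False by (simp add: G_def)
    qed
    have Gi: "integrable lborel (G j)" for j
      by (rule Bochner_Integration.integrable_bound[OF Hi]) (use Gle in auto)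
    \<comment> \<open>The dyadic shells cover the punctured unit ball; the origin is missed but is a
      null set. At each frequency the partial sums are eventually constant.\<close>
    have GH: "(\<lambda>N. \<Sum>j<N. G j \<xi>) \<longlonglongrightarrow> H \<xi>" if "\<xi> \<noteq> 0" for \<xi>
    proof (cases "norm \<xi> < 1")
      case True
      have "\<exists>j. norm \<xi> \<in> I j" using True that by (intro Iex) auto
      then obtain j where j: "norm \<xi> \<in> I j" ..
      have "(\<Sum>i<N. G i \<xi>) = H \<xi>" if "j < N" for N
      proof -
        have "(\<Sum>i<N. G i \<xi>) = (\<Sum>i<N. if i = j then H \<xi> else 0)"
          by (intro sum.cong refl Gd[OF j])
        then show ?thesis using that by simp
      qed
      then have "eventually (\<lambda>N. (\<Sum>i<N. G i \<xi>) = H \<xi>) sequentially"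
        unfolding eventually_sequentially by (intro exI[of _ "Suc j"]) auto
      then show ?thesis by (rule tendsto_eventually)
    next
      case False
      then show ?thesis using supp by (simp add: G_def)
    qed
    have Gsum: "cmod (\<Sum>j<N. G j \<xi>) \<le> cmod (H \<xi>)" for N \<xi>
    proof (cases "\<exists>j<N. norm \<xi> \<in> I j")
      case True
      then obtain j where j: "j < N" "norm \<xi> \<in> I j" by auto
      have "(\<Sum>i<N. G i \<xi>) = (\<Sum>i<N. if i = j then H \<xi> else 0)"
        by (intro sum.cong refl Gd[OF j(2)])
      then show ?thesis using j by simp
    next
      case False
      then have "(\<Sum>j<N. G j \<xi>) = 0" by (intro sum.neutral) (auto simp: G_def)
      then show ?thesis by simp
    qed
    have le: "ennreal (cmod (wave H t x)) \<le> (\<Sum>j. ennreal (cmod (wave (G j) t x)))" for t x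
    proof -
      have ws: "wave (\<lambda>\<xi>. \<Sum>j<N. G j \<xi>) t x = (\<Sum>j<N. wave (G j) t x)" for N
        unfolding wave_def ft_def sum_distrib_left
        by (subst Bochner_Integration.integral_sum) (auto intro!: integrable_cis_mult Gi)
      have "(\<lambda>N. wave (\<lambda>\<xi>. \<Sum>j<N. G j \<xi>) t x) \<longlonglongrightarrow> wave H t x"
        unfolding wave_def ft_def
      proof (rule integral_dominated_convergence[where w="\<lambda>\<xi>. cmod (H \<xi>)"])
        have "AE \<xi> in lborel. \<xi> \<noteq> (0::real^'n)" by (rule AE_lborel_singleton)
        then show "AE \<xi> in lborel. (\<lambda>N. cis (x \<bullet> \<xi>) * (cis (t * norm \<xi>) * (\<Sum>j<N. G j \<xi>))) \<longlonglongrightarrow> cis (x \<bullet> \<xi>) * (cis (t * norm \<xi>) * H \<xi>)"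
          by eventually_elim (intro tendsto_mult tendsto_const GH)
        show "AE \<xi> in lborel. norm (cis (x \<bullet> \<xi>) * (cis (t * norm \<xi>) * (\<Sum>j<N. G j \<xi>))) \<le> cmod (H \<xi>)" for N
          using Gsum by (auto simp: norm_mult)
      qed (use Hi in auto)
      then have "(\<lambda>N. ennreal (cmod (\<Sum>j<N. wave (G j) t x))) \<longlonglongrightarrow> ennreal (cmod (wave H t x))"
        unfolding ws by (intro tendsto_ennrealI tendsto_norm)
      note lim = this
      have ub: "ennreal (cmod (\<Sum>j<N. wave (G j) t x)) \<le> (\<Sum>j. ennreal (cmod (wave (G j) t x)))" for N
      proof -
        have "ennreal (cmod (\<Sum>j<N. wave (G j) t x)) \<le> (\<Sum>j<N. ennreal (cmod (wave (G j) t x)))"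
          by (subst sum_ennreal) (auto intro: ennreal_leI norm_sum)
        also have "\<dots> \<le> (\<Sum>j. ennreal (cmod (wave (G j) t x)))" by (rule sum_le_suminf) auto
        finally show ?thesis .
      qed
      show ?thesis by (rule LIMSEQ_le_const2[OF lim]) (use ub in blast)
    qed
    have "det_norm q p \<alpha> H \<le> (\<Sum>j. det_norm q p \<alpha> (G j))"
      by (rule det_norm_le_suminf[OF _ _ le]) (use p in auto)
    also have "\<dots> \<le> (\<Sum>j. ennreal (C * A) * ennreal (x ^ Suc j))"
    proof (intro suminf_le summableI)
      fix j
      let ?a = "(1/2::real) ^ Suc j"
      have "det_norm q p \<alpha> (G j) \<le> ennreal (C * ?a powr ?e * (((1/2) ^ j - ?a) / ?a) powr (1 / 2 - 1 / min p q) * A)"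
      proof (rule C(2))
        show "radial_ae (G j)" unfolding G_def by (rule radial_ae_mult[OF rad])
        show "\<forall>\<xi>. \<xi> \<notin> annulus ?a ((1/2) ^ j) \<longrightarrow> G j \<xi> = 0" by (auto simp: G_def I_def annulus_def)
        have "(\<integral>\<^sup>+\<xi>. ennreal ((cmod (G j \<xi>))\<^sup>2) \<partial>lborel) \<le> (\<integral>\<^sup>+\<xi>. ennreal ((cmod (H \<xi>))\<^sup>2) \<partial>lborel)"
          by (intro nn_integral_mono ennreal_leI power_mono Gle) auto
        then show "(\<integral>\<^sup>+\<xi>. ennreal ((cmod (G j \<xi>))\<^sup>2) \<partial>lborel) \<le> ennreal (A\<^sup>2)" using L2 by (rule order_trans)
      qed (use A in auto)
      \<comment> \<open>A dyadic shell has relative width 1, so thinness gives nothing here. The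
        convergence comes from the scaling factor alone, whose powers form a geometric series with
        ratio \<open>x < 1\<close>.\<close>
      also have "((1/2) ^ j - ?a) / ?a = 1" by simp
      also have "?a powr ?e = x ^ Suc j"
        unfolding x_def by (simp only: powr_realpow[symmetric] powr_powr half_gt_zero zero_less_one powr_gt_zero) (simp add: powr_powr mult.commute)
      finally show "det_norm q p \<alpha> (G j) \<le> ennreal (C * A) * ennreal (x ^ Suc j)"
        using C(1) A x by (simp add: ennreal_mult[symmetric] mult_ac)
    qed
    also have "\<dots> = ennreal (C * A) * ennreal \<Sigma>"
      unfolding \<Sigma>_def using x by (subst ennreal_suminf_cmult, subst suminf_ennreal2) (auto intro: sm simp del: power_Suc)
    finally show "det_norm q p \<alpha> H \<le> ennreal (C * \<Sigma> * A)"
      using C(1) A \<Sigma>0 by (simp add: ennreal_mult[symmetric] mult_ac)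
  qed
qed

section \<open>The frequency shells of the randomization\<close>

text \<open>With \<open>y = \<gamma> / k\<close>, the quotient of the two powers is at most
  \<open>exp y\<close>, and \<open>exp y - 1 \<le> y * exp y\<close> where
  \<open>y \<le> \<gamma>\<close>.\<close>

lemma shell_ratio_le:
  fixes \<gamma> :: real
  assumes "0 < \<gamma>" "1 \<le> k"
  shows "((k + 1) powr \<gamma> - k powr \<gamma>) / k powr \<gamma> \<le> \<gamma> * exp \<gamma> / k"
proof -
  define y where "y = \<gamma> / k"
  have y: "0 < y" "y \<le> \<gamma>" using assms mult_left_mono[of 1 k \<gamma>] by (auto simp: y_def pos_divide_le_eq)
  have "(k + 1) powr \<gamma> / k powr \<gamma> = (1 + 1 / k) powr \<gamma>"
    using assms by (simp add: powr_divide[symmetric] add_divide_distrib)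
  also have "\<dots> = exp (\<gamma> * ln (1 + 1 / k))"
  proof -
    have "0 < 1 + 1 / k" using assms by (simp add: add_pos_pos)
    then show ?thesis by (simp add: powr_def)
  qed
  also have "\<dots> \<le> exp y"
    using assms ln_add_one_self_le_self[of "1 / k"] mult_left_mono[of "ln (1 + 1 / k)" "1 / k" \<gamma>] by (simp add: y_def)
  finally have 1: "(k + 1) powr \<gamma> / k powr \<gamma> - 1 \<le> exp y - 1" by simp
  have "exp y - 1 \<le> y * exp y"
  proof -
    have "1 - y \<le> exp (- y)" using exp_ge_add_one_self[of "- y"] by simp
    then have "(1 - y) * exp y \<le> exp (- y) * exp y" by (intro mult_right_mono) auto
    then show ?thesis by (simp add: exp_minus algebra_simps)
  qed
  also have "\<dots> \<le> y * exp \<gamma>" using y by (intro mult_left_mono) auto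
  finally show ?thesis using 1 assms by (simp add: diff_divide_distrib y_def)
qed

text \<open>For \<open>s \<ge> 0\<close> this is monotonicity. For negative \<open>s\<close> the
  comparison \<open>1 + r^2 \<le> (1 + B^2) * a^2\<close> is used; the same factor serves both
  signs.\<close>

lemma japanese_bracket_lower:
  fixes a s r \<gamma> :: real
  assumes "1 \<le> a" "a \<le> r" "r \<le> B * a" "1 \<le> B"
  shows "a powr (2 * s) \<le> (1 + B\<^sup>2) powr \<bar>s\<bar> * (1 + r\<^sup>2) powr s"
proof (cases "0 \<le> s")
  case True
  have "a powr (2 * s) = (a\<^sup>2) powr s" using assms by (simp add: powr_powr flip: powr_numeral)
  also have "\<dots> \<le> (1 + r\<^sup>2) powr s"
    using assms True by (intro powr_mono2) (auto intro: add_increasing power_mono)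
  also have "\<dots> \<le> (1 + B\<^sup>2) powr \<bar>s\<bar> * (1 + r\<^sup>2) powr s"
    using ge_one_powr_ge_zero[of "1 + B\<^sup>2" "\<bar>s\<bar>"] by (simp add: mult_le_cancel_right1)
  finally show ?thesis .
next
  case False
  have r: "1 + r\<^sup>2 \<le> (1 + B\<^sup>2) * a\<^sup>2"
  proof -
    have "r\<^sup>2 \<le> (B * a)\<^sup>2" using assms by (intro power_mono) auto
    moreover have "1 \<le> a\<^sup>2" using assms by simp
    ultimately show ?thesis by (simp add: power_mult_distrib distrib_right)
  qed
  have a: "0 < a" "0 < 1 + r\<^sup>2" "0 < 1 + B\<^sup>2" using assms by (auto simp: add_pos_nonneg)
  have "((1 + B\<^sup>2) * a\<^sup>2) powr s \<le> (1 + r\<^sup>2) powr s" using False a r by (intro powr_mono2') auto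
  moreover have "((1 + B\<^sup>2) * a\<^sup>2) powr s = (1 + B\<^sup>2) powr s * a powr (2 * s)"
    using a by (simp add: powr_mult powr_powr flip: powr_numeral)
  moreover have "(1 + B\<^sup>2) powr \<bar>s\<bar> * (1 + B\<^sup>2) powr s = 1"
    using False a by (simp add: powr_add[symmetric])
  ultimately show ?thesis
    using mult_left_mono[of "(1 + B\<^sup>2) powr s * a powr (2 * s)" "(1 + r\<^sup>2) powr s" "(1 + B\<^sup>2) powr \<bar>s\<bar>"]
    by (simp add: mult.assoc[symmetric])
qed

text \<open>The symbol of the \<open>k\<close>-th summand of the randomization, without its Gaussian
  coefficient.\<close>

definition block :: "real \<Rightarrow> (real^'n::finite \<Rightarrow> complex) \<Rightarrow> nat \<Rightarrow> real^'n \<Rightarrow> complex" where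
  "block \<gamma> v k \<xi> = indicator {real k powr \<gamma>..<real (Suc k) powr \<gamma>} (norm \<xi>) * v \<xi>"

lemma block_measurable [measurable]:
  assumes [measurable]: "v \<in> borel_measurable borel" shows "block \<gamma> v k \<in> borel_measurable borel"
  unfolding block_def by measurable

text \<open>For \<open>k \<ge> 1\<close> let \<open>a = k powr \<gamma>\<close>. The relative width
  is of order \<open>1 / k\<close>, that is \<open>a powr (- 1 / \<gamma>)\<close>, and passing from
  the Sobolev weight to L^2 costs \<open>a powr (- s)\<close>; the hypothesis on \<open>s\<close>
  keeps the product of all powers of \<open>a\<close> bounded. The block \<open>k = 0\<close> is the
  low-frequency ball, where the Sobolev weight is bounded above and below.\<close>

lemma det_norm_block:
  fixes p q \<alpha> \<gamma> s :: real
  assumes \<gamma>: "0 < \<gamma>" and p: "2 \<le> p" "2 \<le> q" and \<alpha>: "- real CARD('n::finite) / p < \<alpha>" "\<alpha> < (real CARD('n) - 1) * (1 / 2 - 1 / p) - 1 / q"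
    and s: "s \<ge> real CARD('n) / 2 - 1 / q - real CARD('n) / p - \<alpha> - (1 / \<gamma>) * (1 / 2 - 1 / min p q)"
  shows "\<exists>C>0. \<forall>(v::real^'n \<Rightarrow> complex) k A. v \<in> borel_measurable borel \<longrightarrow> radial_ae v \<longrightarrow> 0 \<le> A \<longrightarrow>
    (\<integral>\<^sup>+\<xi>. ennreal ((1 + (norm \<xi>)\<^sup>2) powr s * (cmod (block \<gamma> v k \<xi>))\<^sup>2) \<partial>lborel) \<le> ennreal (A\<^sup>2) \<longrightarrow>
    det_norm q p \<alpha> (block \<gamma> v k) \<le> ennreal (C * A)"
proof -
  let ?n = "CARD('n)"
  let ?e = "real ?n / 2 - 1 / q - real ?n / p - \<alpha>"
  let ?\<kappa> = "1 / 2 - 1 / min p q"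
  \<comment> \<open>Chosen so that \<open>(k + 1) powr \<gamma> \<le> (1 + \<Lambda>) * k powr
    \<gamma>\<close> for all \<open>k \<ge> 1\<close>, because
    \<open>k + 1 \<le> 2 * k\<close>.\<close>
  define \<Lambda> where "\<Lambda> = 2 powr \<gamma> - 1"
  have \<Lambda>: "0 \<le> \<Lambda>" using \<gamma> ge_one_powr_ge_zero[of 2 \<gamma>] by (simp add: \<Lambda>_def)
  have \<kappa>: "0 \<le> ?\<kappa>" using p by (simp add: min_def field_simps)
  obtain C where C: "0 < C" "\<And>(H::real^'n \<Rightarrow> complex) a b A. H \<in> borel_measurable borel \<Longrightarrow> radial_ae H \<Longrightarrow> 0 < a \<Longrightarrow> a < b \<Longrightarrow> b \<le> (1 + \<Lambda>) * a \<Longrightarrow> 0 \<le> A \<Longrightarrow>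
    (\<forall>\<xi>. \<xi> \<notin> annulus a b \<longrightarrow> H \<xi> = 0) \<Longrightarrow> (\<integral>\<^sup>+\<xi>. ennreal ((cmod (H \<xi>))\<^sup>2) \<partial>lborel) \<le> ennreal (A\<^sup>2) \<Longrightarrow>
    det_norm q p \<alpha> H \<le> ennreal (C * a powr ?e * ((b - a) / a) powr ?\<kappa> * A)"
    using det_norm_annulus[OF p \<alpha> \<Lambda>] by (auto 0 3)
  obtain C0 where C0: "0 < C0" "\<And>(H::real^'n \<Rightarrow> complex) A. H \<in> borel_measurable borel \<Longrightarrow> radial_ae H \<Longrightarrow> 0 \<le> A \<Longrightarrow>
    (\<forall>\<xi>. 1 \<le> norm \<xi> \<longrightarrow> H \<xi> = 0) \<Longrightarrow> (\<integral>\<^sup>+\<xi>. ennreal ((cmod (H \<xi>))\<^sup>2) \<partial>lborel) \<le> ennreal (A\<^sup>2) \<Longrightarrow>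
    det_norm q p \<alpha> H \<le> ennreal (C0 * A)"
    using det_norm_low[OF p \<alpha>] by (auto 0 3)
  define L where "L = sqrt ((1 + (2 powr \<gamma>)\<^sup>2) powr \<bar>s\<bar>)"
  have "0 < 1 + (2 powr \<gamma>)\<^sup>2" by (intro add_pos_nonneg) auto
  then have L: "0 < L" by (simp add: L_def)
  define L0 where "L0 = sqrt (2 powr \<bar>s\<bar>)"
  have L0: "0 < L0" by (simp add: L0_def)
  define C1 where "C1 = C * (\<gamma> * exp \<gamma>) powr ?\<kappa> * L"
  have C1: "0 < C1" using C(1) L \<gamma> by (simp add: C1_def)
  have scale: "(\<integral>\<^sup>+\<xi>. ennreal ((cmod (block \<gamma> v k \<xi>))\<^sup>2) \<partial>lborel) \<le> ennreal ((K * A)\<^sup>2)"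
    if [measurable]: "v \<in> borel_measurable borel" and le: "(\<integral>\<^sup>+\<xi>. ennreal ((1 + (norm \<xi>)\<^sup>2) powr s * (cmod (block \<gamma> v k \<xi>))\<^sup>2) \<partial>lborel) \<le> ennreal (A\<^sup>2)"
      and K: "\<And>\<xi>. block \<gamma> v k \<xi> \<noteq> 0 \<Longrightarrow> 1 \<le> K\<^sup>2 * (1 + (norm \<xi>)\<^sup>2) powr s"
    for v :: "real^'n \<Rightarrow> complex" and k K A
  proof -
    have "(\<integral>\<^sup>+\<xi>. ennreal ((cmod (block \<gamma> v k \<xi>))\<^sup>2) \<partial>lborel) \<le> (\<integral>\<^sup>+\<xi>. ennreal (K\<^sup>2) * ennreal ((1 + (norm \<xi>)\<^sup>2) powr s * (cmod (block \<gamma> v k \<xi>))\<^sup>2) \<partial>lborel)"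
    proof (intro nn_integral_mono)
      fix \<xi>
      show "ennreal ((cmod (block \<gamma> v k \<xi>))\<^sup>2) \<le> ennreal (K\<^sup>2) * ennreal ((1 + (norm \<xi>)\<^sup>2) powr s * (cmod (block \<gamma> v k \<xi>))\<^sup>2)"
      proof (cases "block \<gamma> v k \<xi> = 0")
        case False
        then have "(cmod (block \<gamma> v k \<xi>))\<^sup>2 \<le> K\<^sup>2 * ((1 + (norm \<xi>)\<^sup>2) powr s * (cmod (block \<gamma> v k \<xi>))\<^sup>2)"
          using mult_right_mono[OF K[OF False], of "(cmod (block \<gamma> v k \<xi>))\<^sup>2"] by (simp add: mult.assoc)
        then show ?thesis by (simp add: ennreal_mult[symmetric] ennreal_leI)
      qed simp
    qed
    also have "\<dots> = ennreal (K\<^sup>2) * (\<integral>\<^sup>+\<xi>. ennreal ((1 + (norm \<xi>)\<^sup>2) powr s * (cmod (block \<gamma> v k \<xi>))\<^sup>2) \<partial>lborel)"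
      by (rule nn_integral_cmult) measurable
    also have "\<dots> \<le> ennreal (K\<^sup>2) * ennreal (A\<^sup>2)" by (intro mult_left_mono le) auto
    finally show ?thesis by (simp add: ennreal_mult[symmetric] power_mult_distrib)
  qed
  show ?thesis
  proof (intro exI[of _ "C1 + C0 * L0"] conjI allI impI)
    show "0 < C1 + C0 * L0" using C1 C0(1) L0 by (simp add: add_pos_pos)
    fix v :: "real^'n \<Rightarrow> complex" and k A
    assume [measurable]: "v \<in> borel_measurable borel" and rad: "radial_ae v" and A: "0 \<le> A"
      and le: "(\<integral>\<^sup>+\<xi>. ennreal ((1 + (norm \<xi>)\<^sup>2) powr s * (cmod (block \<gamma> v k \<xi>))\<^sup>2) \<partial>lborel) \<le> ennreal (A\<^sup>2)"
    have radb: "radial_ae (block \<gamma> v k)" unfolding block_def[abs_def] by (rule radial_ae_mult[OF rad])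
    show "det_norm q p \<alpha> (block \<gamma> v k) \<le> ennreal ((C1 + C0 * L0) * A)"
    proof (cases "k = 0")
      case True
      have b0: "block \<gamma> v k \<xi> = 0" if "1 \<le> norm \<xi>" for \<xi>
        using True that by (simp add: block_def)
      have "det_norm q p \<alpha> (block \<gamma> v k) \<le> ennreal (C0 * (L0 * A))"
      proof (rule C0(2)[OF _ radb])
        show "(\<integral>\<^sup>+\<xi>. ennreal ((cmod (block \<gamma> v k \<xi>))\<^sup>2) \<partial>lborel) \<le> ennreal ((L0 * A)\<^sup>2)"
        proof (rule scale[OF _ le])
          fix \<xi> assume "block \<gamma> v k \<xi> \<noteq> 0"
          then have n1: "norm \<xi> < 1" using b0 by (meson not_le)
          have "(norm \<xi>)\<^sup>2 \<le> 1\<^sup>2" using n1 by (intro power_mono) auto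
          then have r: "1 + (norm \<xi>)\<^sup>2 \<le> 2" "1 \<le> 1 + (norm \<xi>)\<^sup>2" by auto
          have "1 = 2 powr \<bar>s\<bar> * 2 powr (- \<bar>s\<bar>)" by (simp add: powr_add[symmetric])
          also have "2 powr (- \<bar>s\<bar>) \<le> (1 + (norm \<xi>)\<^sup>2) powr (- \<bar>s\<bar>)"
          proof -
            have "0 < 1 + (norm \<xi>)\<^sup>2" using r(2) by linarith
            then show ?thesis by (rule powr_mono2'[OF _ _ r(1), rotated]) simp
          qed
          also have "\<dots> \<le> (1 + (norm \<xi>)\<^sup>2) powr s" using r by (intro powr_mono) auto
          finally show "1 \<le> L0\<^sup>2 * (1 + (norm \<xi>)\<^sup>2) powr s" by (simp add: L0_def)
        qed measurable
      qed (use b0 A L0 in auto)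
      also have "\<dots> \<le> ennreal ((C1 + C0 * L0) * A)"
        using C1 A by (intro ennreal_leI) (simp add: distrib_right)
      finally show ?thesis .
    next
      case False
      then have k1: "1 \<le> real k" by simp
      define a where "a = real k powr \<gamma>"
      define b where "b = real (Suc k) powr \<gamma>"
      have a1: "1 \<le> a" using k1 \<gamma> by (simp add: a_def ge_one_powr_ge_zero)
      have ab: "a < b" using k1 \<gamma> by (simp add: a_def b_def powr_less_mono2)
      have b2: "b \<le> (1 + \<Lambda>) * a"
      proof -
        have "b \<le> (2 * real k) powr \<gamma>" unfolding b_def using k1 \<gamma> by (intro powr_mono2) auto
        then show ?thesis using k1 by (simp add: \<Lambda>_def a_def powr_mult)
      qed
      have supp: "\<xi> \<in> annulus a b" if "block \<gamma> v k \<xi> \<noteq> 0" for \<xi>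
        using that by (auto simp: block_def annulus_def a_def b_def indicator_def split: if_splits)
      have "det_norm q p \<alpha> (block \<gamma> v k) \<le> ennreal (C * a powr ?e * ((b - a) / a) powr ?\<kappa> * (L * a powr (- s) * A))"
      proof (rule C(2)[OF _ radb])
        show "\<forall>\<xi>. \<xi> \<notin> annulus a b \<longrightarrow> block \<gamma> v k \<xi> = 0" using supp by blast
        show "(\<integral>\<^sup>+\<xi>. ennreal ((cmod (block \<gamma> v k \<xi>))\<^sup>2) \<partial>lborel) \<le> ennreal ((L * a powr (- s) * A)\<^sup>2)"
        proof (rule scale[OF _ le])
          fix \<xi> assume "block \<gamma> v k \<xi> \<noteq> 0"
          then have "a \<le> norm \<xi>" "norm \<xi> < b" using supp by (auto simp: annulus_def)
          then have "a powr (2 * s) \<le> (1 + (2 powr \<gamma>)\<^sup>2) powr \<bar>s\<bar> * (1 + (norm \<xi>)\<^sup>2) powr s"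
            using a1 b2 \<Lambda> by (intro japanese_bracket_lower) (auto simp: \<Lambda>_def)
          then have "a powr (- (2 * s)) * a powr (2 * s) \<le> a powr (- (2 * s)) * ((1 + (2 powr \<gamma>)\<^sup>2) powr \<bar>s\<bar> * (1 + (norm \<xi>)\<^sup>2) powr s)"
            by (intro mult_left_mono) auto
          moreover have "a powr (- (2 * s)) * a powr (2 * s) = 1" using a1 by (simp add: powr_add[symmetric])
          moreover have "(L * a powr (- s))\<^sup>2 = (1 + (2 powr \<gamma>)\<^sup>2) powr \<bar>s\<bar> * a powr (- (2 * s))"
          proof -
            have "L\<^sup>2 = (1 + (2 powr \<gamma>)\<^sup>2) powr \<bar>s\<bar>" unfolding L_def by (rule real_sqrt_pow2) simp
            moreover have "(a powr (- s))\<^sup>2 = a powr (- (2 * s))" by (simp add: power2_eq_square powr_add[symmetric])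
            ultimately show ?thesis by (simp only: power_mult_distrib)
          qed
          ultimately show "1 \<le> (L * a powr (- s))\<^sup>2 * (1 + (norm \<xi>)\<^sup>2) powr s" by (simp add: mult_ac)
        qed measurable
      qed (use a1 ab b2 A L in auto)
      also have "\<dots> \<le> ennreal (C1 * A)"
      proof (rule ennreal_leI)
        have "(b - a) / a \<le> \<gamma> * exp \<gamma> / real k"
          using shell_ratio_le[OF \<gamma> k1] by (simp add: a_def b_def add.commute)
        then have "((b - a) / a) powr ?\<kappa> \<le> (\<gamma> * exp \<gamma> / real k) powr ?\<kappa>"
          using ab a1 \<kappa> by (intro powr_mono2) auto
        also have "\<dots> = (\<gamma> * exp \<gamma>) powr ?\<kappa> * a powr (- (1 / \<gamma> * ?\<kappa>))"
          using \<gamma> k1 by (simp add: powr_divide a_def powr_powr powr_minus_divide)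
        finally have 1: "((b - a) / a) powr ?\<kappa> \<le> (\<gamma> * exp \<gamma>) powr ?\<kappa> * a powr (- (1 / \<gamma> * ?\<kappa>))" .
        have "C * a powr ?e * ((b - a) / a) powr ?\<kappa> * (L * a powr (- s) * A) \<le> C * a powr ?e * ((\<gamma> * exp \<gamma>) powr ?\<kappa> * a powr (- (1 / \<gamma> * ?\<kappa>))) * (L * a powr (- s) * A)"
          using C(1) L A by (intro mult_right_mono mult_left_mono 1) auto
        also have "\<dots> = C1 * A * (a powr ?e * a powr (- (1 / \<gamma> * ?\<kappa>)) * a powr (- s))"
          by (simp add: C1_def mult_ac)
        also have "a powr ?e * a powr (- (1 / \<gamma> * ?\<kappa>)) * a powr (- s) = a powr (?e - 1 / \<gamma> * ?\<kappa> - s)"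
          by (simp add: powr_add[symmetric])
        \<comment> \<open>The hypothesis on \<open>s\<close> says exactly that this exponent is not
          positive, and \<open>a \<ge> 1\<close>.\<close>
        also have "a powr (?e - 1 / \<gamma> * ?\<kappa> - s) \<le> a powr 0"
          using a1 s by (intro powr_mono) auto
        finally show "C * a powr ?e * ((b - a) / a) powr ?\<kappa> * (L * a powr (- s) * A) \<le> C1 * A"
          using a1 C1 A by (simp add: mult_left_mono)
      qed
      also have "\<dots> \<le> ennreal ((C1 + C0 * L0) * A)"
        using C0(1) L0 A by (intro ennreal_leI) (simp add: distrib_right)
      finally show ?thesis .
    qed
  qed
qed

section \<open>Gaussian sums\<close>

text \<open>The left side is the moment of order \<open>2 * m\<close> of a standard Gaussian. Its
  root of order \<open>2 * m\<close> is therefore at most \<open>sqrt (2 * m)\<close>, the origin of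
  the factor \<open>sqrt \<sigma>\<close> in the theorem.\<close>

lemma fact_double_le: "fact (2 * m) / (2 ^ m * fact m) \<le> (real (2 * m)) ^ m"
proof -
  have "fact (2 * m) div fact (2 * m - m) \<le> (2 * m) ^ m"
    by (rule fact_div_fact_le_pow) simp
  then have "fact (2 * m) div fact m \<le> (2 * m) ^ m" by simp
  moreover have "(fact m :: nat) dvd fact (2 * m)" by (rule fact_dvd) simp
  ultimately have "fact (2 * m) \<le> (2 * m) ^ m * (fact m :: nat)"
    by (metis div_le_mono dvd_div_mult_self mult_le_mono1)
  then have "real (fact (2 * m)) \<le> real ((2 * m) ^ m * fact m)" by (simp only: of_nat_le_iff)
  then have "fact (2 * m) \<le> (real (2 * m)) ^ m * fact m" by simp
  also have "\<dots> \<le> (real (2 * m)) ^ m * (2 ^ m * fact m)"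
    by (intro mult_left_mono) (auto simp: mult_le_cancel_right1)
  finally show ?thesis by (simp add: pos_divide_le_eq)
qed

lemma gaussian_sum_moment:
  fixes c :: "nat \<Rightarrow> real"
  assumes g: "iid_std_gaussians M g" and I: "finite I" and m: "0 < m"
  shows "(\<integral>\<^sup>+\<omega>. ennreal ((\<Sum>k\<in>I. c k * g k \<omega>) ^ (2 * m)) \<partial>M) \<le> ennreal ((real (2 * m) * (\<Sum>k\<in>I. (c k)\<^sup>2)) ^ m)"
proof -
  interpret prob_space M using g by (simp add: iid_std_gaussians_def)
  have ind: "indep_vars (\<lambda>_. borel) g UNIV" and dis: "\<And>k. distributed M lborel (g k) std_normal_density"
    using g by (auto simp: iid_std_gaussians_def)
  \<comment> \<open>A combination of independent Gaussians is Gaussian, with variance the sum of the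
    squared coefficients. Zero coefficients are dropped because a normal density needs positive
    standard deviation.\<close>
  define J where "J = {k\<in>I. c k \<noteq> 0}"
  have J: "finite J" "J \<subseteq> I" using I by (auto simp: J_def)
  have sJ: "(\<Sum>k\<in>I. c k * g k \<omega>) = (\<Sum>k\<in>J. c k * g k \<omega>)" for \<omega>
    by (rule sum.mono_neutral_right) (use I in \<open>auto simp: J_def\<close>)
  have cJ: "(\<Sum>k\<in>I. (c k)\<^sup>2) = (\<Sum>k\<in>J. (c k)\<^sup>2)"
    by (rule sum.mono_neutral_right) (use I in \<open>auto simp: J_def\<close>)
  show ?thesis
  proof (cases "J = {}")
    case True
    then show ?thesis using m by (simp add: sJ cJ zero_power)
  next
    case False
    define \<sigma> where "\<sigma> = sqrt (\<Sum>k\<in>J. \<bar>c k\<bar>\<^sup>2)"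
    have sp: "0 < (\<Sum>k\<in>J. \<bar>c k\<bar>\<^sup>2)" using J False by (intro sum_pos) (auto simp: J_def)
    have \<sigma>: "0 < \<sigma>" using sp by (simp add: \<sigma>_def)
    have "indep_vars (\<lambda>_. borel) (\<lambda>k. (\<lambda>x. c k * x) \<circ> g k) J"
      by (rule indep_vars_compose[OF indep_vars_subset[OF ind]]) auto
    then have iv: "indep_vars (\<lambda>_. borel) (\<lambda>k \<omega>. c k * g k \<omega>) J" by (simp add: comp_def)
    have dd: "distributed M lborel (\<lambda>\<omega>. c k * g k \<omega>) (normal_density 0 \<bar>c k\<bar>)" if "k \<in> J" for k
      using normal_density_affine[OF dis[of k], of "c k" 0] that by (simp add: J_def)
    have D: "distributed M lborel (\<lambda>\<omega>. \<Sum>k\<in>J. c k * g k \<omega>) (normal_density 0 \<sigma>)"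
      using sum_indep_normal[OF J(1) False iv, of "\<lambda>k. \<bar>c k\<bar>" "\<lambda>_. 0"] dd by (simp add: J_def \<sigma>_def)
    have "(\<integral>\<^sup>+\<omega>. ennreal ((\<Sum>k\<in>I. c k * g k \<omega>) ^ (2 * m)) \<partial>M) = (\<integral>\<^sup>+x. ennreal (normal_density 0 \<sigma> x) * ennreal (x ^ (2 * m)) \<partial>lborel)"
      unfolding sJ by (subst distributed_nn_integral[OF D]) auto
    also have "\<dots> = (\<integral>\<^sup>+x. ennreal (normal_density 0 \<sigma> x * (x - 0) ^ (2 * m)) \<partial>lborel)"
      by (intro nn_integral_cong) (simp add: ennreal_mult normal_density_nonneg)
    also have "\<dots> = ennreal (fact (2 * m) / ((2 / \<sigma>\<^sup>2) ^ m * fact m))"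
      using normal_moment_even[OF \<sigma>, of 0 m]
      by (subst nn_integral_eq_integral) (auto simp: has_bochner_integral_iff normal_density_nonneg)
    also have "\<dots> \<le> ennreal ((real (2 * m) * (\<Sum>k\<in>I. (c k)\<^sup>2)) ^ m)"
    proof (rule ennreal_leI)
      have "fact (2 * m) / ((2 / \<sigma>\<^sup>2) ^ m * fact m) = fact (2 * m) / (2 ^ m * fact m) * (\<sigma>\<^sup>2) ^ m"
        using \<sigma> by (simp add: power_divide)
      also have "\<dots> \<le> real (2 * m) ^ m * (\<sigma>\<^sup>2) ^ m" by (intro mult_right_mono fact_double_le) auto
      also have "\<dots> = (real (2 * m) * (\<Sum>k\<in>I. (c k)\<^sup>2)) ^ m"
      proof -
        have "\<sigma>\<^sup>2 = (\<Sum>k\<in>I. (c k)\<^sup>2)" using sp by (simp add: \<sigma>_def cJ)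
        then show ?thesis by (simp only: power_mult_distrib)
      qed
      finally show "fact (2 * m) / ((2 / \<sigma>\<^sup>2) ^ m * fact m) \<le> (real (2 * m) * (\<Sum>k\<in>I. (c k)\<^sup>2)) ^ m" .
    qed
    finally show ?thesis .
  qed
qed

lemma iid_measurable:
  assumes "iid_std_gaussians M g" shows "g k \<in> borel_measurable M"
proof -
  have "distributed M lborel (g k) std_normal_density" using assms by (simp add: iid_std_gaussians_def)
  from distributed_measurable[OF this] show ?thesis by simp
qed

text \<open>The squares divided by \<open>(1 + k)^2\<close> have a finite expected sum, so almost
  surely the sum is finite and bounds every term. Linear growth is crude, but the rapid decay of
  test functions absorbs it.\<close>

lemma gaussian_growth:
  assumes g: "iid_std_gaussians M g"
  shows "AE \<omega> in M. \<exists>G. \<forall>k. \<bar>g k \<omega>\<bar> \<le> G * (1 + real k)"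
proof -
  have [measurable]: "g k \<in> borel_measurable M" for k by (rule iid_measurable[OF g])
  have m2: "(\<integral>\<^sup>+\<omega>. ennreal ((g k \<omega>)\<^sup>2) \<partial>M) \<le> 2" for k
    using gaussian_sum_moment[OF g, of "{k}" 1 "\<lambda>_. 1"] by simp
  have sm: "summable (\<lambda>k. 1 / (1 + real k)\<^sup>2)"
    using inverse_power_summable[of 2, where 'a=real] summable_Suc_iff[of "\<lambda>n. inverse (real n ^ 2)"] by (simp add: inverse_eq_divide)
  have "(\<integral>\<^sup>+\<omega>. (\<Sum>k. ennreal ((g k \<omega>)\<^sup>2) * ennreal (1 / (1 + real k)\<^sup>2)) \<partial>M) = (\<Sum>k. (\<integral>\<^sup>+\<omega>. ennreal ((g k \<omega>)\<^sup>2) \<partial>M) * ennreal (1 / (1 + real k)\<^sup>2))"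
    by (subst nn_integral_suminf) (auto simp: nn_integral_multc)
  also have "\<dots> \<le> (\<Sum>k. 2 * ennreal (1 / (1 + real k)\<^sup>2))"
    by (intro suminf_le mult_right_mono m2 summableI) auto
  also have "\<dots> = 2 * ennreal (\<Sum>k. 1 / (1 + real k)\<^sup>2)"
    by (subst ennreal_suminf_cmult, subst suminf_ennreal2) (auto intro: sm)
  also have "\<dots> < \<infinity>" by (simp add: ennreal_mult_less_top)
  finally have "AE \<omega> in M. (\<Sum>k. ennreal ((g k \<omega>)\<^sup>2) * ennreal (1 / (1 + real k)\<^sup>2)) \<noteq> \<infinity>"
    by (intro nn_integral_noteq_infinite) auto
  then show ?thesis
  proof eventually_elim
    case (elim \<omega>)
    then obtain S where S: "(\<Sum>k. ennreal ((g k \<omega>)\<^sup>2) * ennreal (1 / (1 + real k)\<^sup>2)) = ennreal S" "0 \<le> S"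
      by (cases "\<Sum>k. ennreal ((g k \<omega>)\<^sup>2) * ennreal (1 / (1 + real k)\<^sup>2)") auto
    have "\<bar>g k \<omega>\<bar> \<le> sqrt S * (1 + real k)" for k
    proof -
      have "ennreal ((g k \<omega>)\<^sup>2) * ennreal (1 / (1 + real k)\<^sup>2) \<le> ennreal S"
        unfolding S(1)[symmetric] using sum_le_suminf[of "\<lambda>k. ennreal ((g k \<omega>)\<^sup>2) * ennreal (1 / (1 + real k)\<^sup>2)" "{k}"] by simp
      then have "(g k \<omega>)\<^sup>2 / (1 + real k)\<^sup>2 \<le> S" using S(2) by (simp add: ennreal_mult[symmetric])
      then have "(g k \<omega>)\<^sup>2 \<le> S * (1 + real k)\<^sup>2" by (simp add: pos_divide_le_eq)
      then have "sqrt ((g k \<omega>)\<^sup>2) \<le> sqrt (S * (1 + real k)\<^sup>2)" by (rule real_sqrt_le_mono)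
      then show ?thesis by (simp only: real_sqrt_mult real_sqrt_abs abs_of_nonneg[of "1 + real k"])
    qed
    then show ?case by blast
  qed
qed

text \<open>For an even exponent the moments of real Gaussian sums are explicit. Real and imaginary
  parts are treated separately; the power of a sum and the doubling of the bound each cost at most
  \<open>2 ^ m\<close>, which turns \<open>2 * m\<close> into \<open>8 * m\<close>.\<close>

lemma gaussian_Khintchine:
  fixes u :: "nat \<Rightarrow> complex"
  assumes g: "iid_std_gaussians M g" and I: "finite I" and m: "0 < m"
  shows "Lp_norm (real (2 * m)) M (\<lambda>\<omega>. ennreal (cmod (\<Sum>k\<in>I. complex_of_real (g k \<omega>) * u k)))
    \<le> ennreal (sqrt (real (8 * m))) * Lp_norm 2 (count_space I) (\<lambda>k. ennreal (cmod (u k)))"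
proof -
  have [measurable]: "g k \<in> borel_measurable M" for k by (rule iid_measurable[OF g])
  define S where "S = (\<Sum>k\<in>I. (cmod (u k))\<^sup>2)"
  have S: "0 \<le> S" by (auto simp: S_def sum_nonneg)
  have rhs: "Lp_norm 2 (count_space I) (\<lambda>k. ennreal (cmod (u k))) = ennreal (sqrt S)"
  proof -
    have "(\<integral>\<^sup>+k. ennreal_powr (ennreal (cmod (u k))) 2 \<partial>count_space I) = ennreal S"
      using I by (simp add: nn_integral_count_space_finite ennreal_powr_ennreal S_def sum_ennreal)
    then show ?thesis using S by (simp add: Lp_norm_def ennreal_powr_ennreal powr_half_sqrt)
  qed
  define X where "X \<omega> = (\<Sum>k\<in>I. Re (u k) * g k \<omega>)" for \<omega>
  define Y where "Y \<omega> = (\<Sum>k\<in>I. Im (u k) * g k \<omega>)" for \<omega>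
  have XY: "(cmod (\<Sum>k\<in>I. complex_of_real (g k \<omega>) * u k))\<^sup>2 = (X \<omega>)\<^sup>2 + (Y \<omega>)\<^sup>2" for \<omega>
    unfolding cmod_power2 X_def Y_def by (simp add: mult.commute)
  have pw: "(x + y) ^ m \<le> 2 ^ m * (x ^ m + y ^ m)" if "0 \<le> x" "0 \<le> y" for x y :: real
  proof -
    have "(x + y) ^ m \<le> (2 * max x y) ^ m" using that by (intro power_mono) auto
    also have "\<dots> = 2 ^ m * (max x y) ^ m" by (simp add: power_mult_distrib)
    also have "(max x y) ^ m \<le> x ^ m + y ^ m" using that by (cases "x \<le> y") (auto simp: max_def)
    finally show ?thesis by simp
  qed
  have "(\<integral>\<^sup>+\<omega>. ennreal_powr (ennreal (cmod (\<Sum>k\<in>I. complex_of_real (g k \<omega>) * u k))) (real (2 * m)) \<partial>M)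
    \<le> (\<integral>\<^sup>+\<omega>. ennreal (2 ^ m) * (ennreal ((X \<omega>) ^ (2 * m)) + ennreal ((Y \<omega>) ^ (2 * m))) \<partial>M)"
  proof (intro nn_integral_mono)
    fix \<omega>
    let ?z = "cmod (\<Sum>k\<in>I. complex_of_real (g k \<omega>) * u k)"
    have "?z powr real (2 * m) = (?z\<^sup>2) ^ m"
    proof (cases "?z = 0")
      case True
      then show ?thesis using m by simp
    next
      case False
      then have "0 < ?z" by simp
      then show ?thesis by (simp only: powr_realpow power_mult)
    qed
    also have "\<dots> \<le> 2 ^ m * (((X \<omega>)\<^sup>2) ^ m + ((Y \<omega>)\<^sup>2) ^ m)" unfolding XY by (rule pw) auto
    finally have "?z powr real (2 * m) \<le> 2 ^ m * ((X \<omega>) ^ (2 * m) + (Y \<omega>) ^ (2 * m))"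
      by (simp only: power_mult)
    then have "ennreal (?z powr real (2 * m)) \<le> ennreal (2 ^ m * ((X \<omega>) ^ (2 * m) + (Y \<omega>) ^ (2 * m)))" by (rule ennreal_leI)
    also have "\<dots> = ennreal (2 ^ m) * (ennreal ((X \<omega>) ^ (2 * m)) + ennreal ((Y \<omega>) ^ (2 * m)))"
      by (subst ennreal_mult) (auto simp: zero_le_even_power)
    finally show "ennreal_powr (ennreal ?z) (real (2 * m)) \<le> ennreal (2 ^ m) * (ennreal ((X \<omega>) ^ (2 * m)) + ennreal ((Y \<omega>) ^ (2 * m)))"
      by (simp only: ennreal_powr_ennreal norm_ge_zero)
  qed
  also have "\<dots> = ennreal (2 ^ m) * ((\<integral>\<^sup>+\<omega>. ennreal ((X \<omega>) ^ (2 * m)) \<partial>M) + (\<integral>\<^sup>+\<omega>. ennreal ((Y \<omega>) ^ (2 * m)) \<partial>M))"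
    unfolding X_def Y_def by (subst nn_integral_cmult, measurable, subst nn_integral_add) auto
  also have "\<dots> \<le> ennreal (2 ^ m) * (ennreal ((real (2 * m) * S) ^ m) + ennreal ((real (2 * m) * S) ^ m))"
  proof (intro mult_left_mono add_mono)
    have *: "(\<integral>\<^sup>+\<omega>. ennreal ((\<Sum>k\<in>I. c k * g k \<omega>) ^ (2 * m)) \<partial>M) \<le> ennreal ((real (2 * m) * S) ^ m)" if "\<And>k. \<bar>c k\<bar> \<le> cmod (u k)" for c
    proof -
      have "(\<Sum>k\<in>I. (c k)\<^sup>2) \<le> S" unfolding S_def
        using that by (intro sum_mono) (metis abs_ge_zero power2_abs power_mono)
      then have "(real (2 * m) * (\<Sum>k\<in>I. (c k)\<^sup>2)) ^ m \<le> (real (2 * m) * S) ^ m"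
        by (intro power_mono mult_left_mono) (auto intro!: mult_nonneg_nonneg sum_nonneg)
      then show ?thesis using gaussian_sum_moment[OF g I m, of c] by (meson ennreal_leI order_trans)
    qed
    show "(\<integral>\<^sup>+\<omega>. ennreal ((X \<omega>) ^ (2 * m)) \<partial>M) \<le> ennreal ((real (2 * m) * S) ^ m)"
      unfolding X_def by (rule *) (rule abs_Re_le_cmod)
    show "(\<integral>\<^sup>+\<omega>. ennreal ((Y \<omega>) ^ (2 * m)) \<partial>M) \<le> ennreal ((real (2 * m) * S) ^ m)"
      unfolding Y_def by (rule *) (rule abs_Im_le_cmod)
  qed auto
  also have "\<dots> \<le> ennreal ((real (8 * m) * S) ^ m)"
  proof -
    have e: "real (4 * m) * S = 2 * (real (2 * m) * S)" by simp
    have "2 ^ m * (X ^ m + X ^ m) = 2 * (2 * X) ^ m" for X :: real by (simp add: power_mult_distrib)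
    then have "2 ^ m * ((real (2 * m) * S) ^ m + (real (2 * m) * S) ^ m) = 2 * (real (4 * m) * S) ^ m"
      unfolding e .
    also have "\<dots> \<le> 2 ^ m * (real (4 * m) * S) ^ m"
      using m S self_le_power[of "2::real" m] by (intro mult_right_mono) auto
    also have "\<dots> = (2 * (real (4 * m) * S)) ^ m" by (simp only: power_mult_distrib mult.assoc)
    also have "2 * (real (4 * m) * S) = real (8 * m) * S" by simp
    finally have "ennreal (2 ^ m * ((real (2 * m) * S) ^ m + (real (2 * m) * S) ^ m)) \<le> ennreal ((real (8 * m) * S) ^ m)"
      by (rule ennreal_leI)
    moreover have "ennreal (2 ^ m) * (ennreal Z + ennreal Z) = ennreal (2 ^ m * (Z + Z))" if "0 \<le> Z" for Z
      using that by (simp only: ennreal_plus ennreal_mult add_nonneg_nonneg zero_le_power zero_le_numeral)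
    ultimately show ?thesis using S by (simp only: zero_le_power mult_nonneg_nonneg of_nat_0_le_iff)
  qed
  also have "\<dots> = ennreal_powr (ennreal (sqrt (real (8 * m))) * ennreal (sqrt S)) (real (2 * m))"
  proof -
    have "(real (8 * m) * S) ^ m = sqrt (real (8 * m) * S) ^ (2 * m)" using S by (simp add: power_mult)
    also have "\<dots> = sqrt (real (8 * m) * S) powr real (2 * m)"
    proof (cases "S = 0")
      case True
      then show ?thesis using m by simp
    next
      case False
      then show ?thesis using S m by (subst powr_realpow) auto
    qed
    finally show ?thesis using S by (simp only: ennreal_powr_ennreal ennreal_mult[symmetric] real_sqrt_ge_zero of_nat_0_le_iff real_sqrt_mult mult_nonneg_nonneg)
  qed
  finally show ?thesis unfolding rhs using m by (subst Lp_norm_le_iff) auto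
qed

lemma measurable_pair_count_space [measurable (raw)]:
  assumes "countable I" "\<And>k. k \<in> I \<Longrightarrow> F k \<in> borel_measurable M"
  shows "(\<lambda>(x, k). F k x) \<in> borel_measurable (M \<Otimes>\<^sub>M count_space I)"
proof -
  have "(\<lambda>(k, x). F k x) \<in> borel_measurable (count_space I \<Otimes>\<^sub>M M)"
    by (rule measurable_pair_measure_countable1) (use assms in auto)
  from measurable_pair_swap[OF this] show ?thesis by (simp add: case_prod_unfold)
qed

lemma Lp_norm_swap_count_space:
  assumes "sigma_finite_measure M" "countable I" and F: "\<And>k. k \<in> I \<Longrightarrow> F k \<in> borel_measurable M" and "0 < p" "p \<le> r"
  shows "Lp_norm r M (\<lambda>x. Lp_norm p (count_space I) (\<lambda>k. F k x)) \<le> Lp_norm p (count_space I) (\<lambda>k. Lp_norm r M (F k))"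
  by (rule Lp_norm_swap[OF assms(1) sigma_finite_measure_count_space_countable[OF assms(2)]
        measurable_pair_count_space[OF assms(2) F] assms(4,5)])

lemma measurable_Lp_norm_count_space:
  assumes "countable I" "\<And>k. k \<in> I \<Longrightarrow> F k \<in> borel_measurable M"
  shows "(\<lambda>x. Lp_norm r (count_space I) (\<lambda>k. F k x)) \<in> borel_measurable M"
  by (rule measurable_Lp_norm[OF sigma_finite_measure_count_space_countable[OF assms(1)] measurable_pair_count_space[OF assms]])

text \<open>The probabilistic norm moves inside those in \<open>t\<close> and \<open>x\<close> since
  its exponent is at least \<open>q\<close> and \<open>p\<close>. Khintchine's inequality is applied
  at each point, and the square function then moves outside both norms since
  \<open>2 \<le> p\<close> and \<open>2 \<le> q\<close>.\<close>

lemma mixed_Khintchine: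
  fixes u :: "nat \<Rightarrow> real \<Rightarrow> 'a::euclidean_space \<Rightarrow> complex" and w :: "'a \<Rightarrow> real"
  assumes g: "iid_std_gaussians M g" and I: "finite I" and m: "0 < m"
    and u: "\<And>k. (\<lambda>(t, x). u k t x) \<in> borel_measurable (borel \<Otimes>\<^sub>M borel)"
    and w [measurable]: "w \<in> borel_measurable borel" and w0: "\<And>x. 0 \<le> w x"
    and pq: "2 \<le> p" "2 \<le> q" "p \<le> real (2 * m)" "q \<le> real (2 * m)"
  shows "Lp_norm (real (2 * m)) M (\<lambda>\<omega>. Lp_norm q lborel (\<lambda>t. Lp_norm p lborel (\<lambda>x.
      ennreal (w x * cmod (\<Sum>k\<in>I. complex_of_real (g k \<omega>) * u k t x)))))
    \<le> ennreal (sqrt (real (8 * m))) * Lp_norm 2 (count_space I) (\<lambda>k. Lp_norm q lborel (\<lambda>t. Lp_norm p lborel (\<lambda>x.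
      ennreal (w x * cmod (u k t x)))))"
proof -
  interpret prob_space M using g by (simp add: iid_std_gaussians_def)
  have sM: "sigma_finite_measure M" by (rule sigma_finite_measure_axioms)
  note sL = lborel.sigma_finite_measure_axioms
  have cI: "countable I" using I by (rule countable_finite)
  define r where "r = real (2 * m)"
  have r: "0 < r" "p \<le> r" "q \<le> r" and pq0: "0 < p" "0 < q" using m pq by (auto simp: r_def)
  define K where "K = ennreal (sqrt (real (8 * m)))"
  have [measurable]: "g k \<in> borel_measurable M" for k by (rule iid_measurable[OF g])
  note u [measurable]
  define F where "F \<omega> t x = ennreal (w x * cmod (\<Sum>k\<in>I. complex_of_real (g k \<omega>) * u k t x))" for \<omega> t x
  define a where "a k t x = ennreal (w x * cmod (u k t x))" for k t x
  have ut [measurable]: "(\<lambda>x. u k t x) \<in> borel_measurable borel" for k t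
    by measurable
  have am: "(\<lambda>(t, x). a k t x) \<in> borel_measurable (borel \<Otimes>\<^sub>M borel)" for k unfolding a_def by measurable
  have at [measurable]: "a k t \<in> borel_measurable lborel" for k t
    unfolding a_def by simp
  have Fm: "(\<lambda>z. F (fst (fst z)) (snd (fst z)) (snd z)) \<in> borel_measurable ((M \<Otimes>\<^sub>M borel) \<Otimes>\<^sub>M borel)"
    unfolding F_def by measurable
  have Ftx: "(\<lambda>(\<omega>, x). F \<omega> t x) \<in> borel_measurable (M \<Otimes>\<^sub>M lborel)" for t
    unfolding F_def by measurable
  have Fp: "(\<lambda>(\<omega>, t). Lp_norm p lborel (F \<omega> t)) \<in> borel_measurable (M \<Otimes>\<^sub>M lborel)"
  proof -
    have "(\<lambda>z. Lp_norm p lborel (\<lambda>x. F (fst z) (snd z) x)) \<in> borel_measurable (M \<Otimes>\<^sub>M lborel)"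
      by (rule measurable_Lp_norm[OF sL]) (use Fm in \<open>simp add: case_prod_unfold cong: measurable_cong_sets\<close>)
    then show ?thesis by (simp add: case_prod_unfold)
  qed
  have pt: "Lp_norm r M (\<lambda>\<omega>. F \<omega> t x) \<le> K * Lp_norm 2 (count_space I) (\<lambda>k. a k t x)" for t x
  proof -
    have "Lp_norm r M (\<lambda>\<omega>. F \<omega> t x) = ennreal (w x) * Lp_norm r M (\<lambda>\<omega>. ennreal (cmod (\<Sum>k\<in>I. complex_of_real (g k \<omega>) * u k t x)))"
      unfolding F_def ennreal_mult[OF w0 norm_ge_zero] by (rule Lp_norm_cmult[OF _ r(1)]) measurable
    also have "\<dots> \<le> ennreal (w x) * (K * Lp_norm 2 (count_space I) (\<lambda>k. ennreal (cmod (u k t x))))"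
      unfolding r_def K_def by (intro mult_left_mono gaussian_Khintchine[OF g I m]) auto
    also have "\<dots> = K * (ennreal (w x) * Lp_norm 2 (count_space I) (\<lambda>k. ennreal (cmod (u k t x))))"
      by (simp only: mult_ac)
    also have "ennreal (w x) * Lp_norm 2 (count_space I) (\<lambda>k. ennreal (cmod (u k t x))) = Lp_norm 2 (count_space I) (\<lambda>k. a k t x)"
      unfolding a_def ennreal_mult[OF w0 norm_ge_zero] by (rule Lp_norm_cmult[symmetric]) auto
    finally show ?thesis .
  qed
  have l2m: "(\<lambda>x. Lp_norm 2 (count_space I) (\<lambda>k. a k t x)) \<in> borel_measurable lborel" for t
    by (rule measurable_Lp_norm_count_space[OF cI at])
  have apm: "(\<lambda>t. Lp_norm p lborel (a k t)) \<in> borel_measurable lborel" for k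
    by (rule measurable_Lp_norm[OF sL]) (use am[of k] in \<open>simp cong: measurable_cong_sets\<close>)
  have pt2: "Lp_norm r M (\<lambda>\<omega>. Lp_norm p lborel (F \<omega> t)) \<le> K * Lp_norm 2 (count_space I) (\<lambda>k. Lp_norm p lborel (a k t))" for t
  proof -
    have "Lp_norm r M (\<lambda>\<omega>. Lp_norm p lborel (F \<omega> t)) \<le> Lp_norm p lborel (\<lambda>x. Lp_norm r M (\<lambda>\<omega>. F \<omega> t x))"
      by (rule Lp_norm_swap[where F="\<lambda>\<omega>. F \<omega> t", OF sM sL Ftx pq0(1) r(2)])
    also have "\<dots> \<le> Lp_norm p lborel (\<lambda>x. K * Lp_norm 2 (count_space I) (\<lambda>k. a k t x))"
      by (rule Lp_norm_mono[OF pq0(1) pt])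
    also have "\<dots> = K * Lp_norm p lborel (\<lambda>x. Lp_norm 2 (count_space I) (\<lambda>k. a k t x))"
      by (rule Lp_norm_cmult[OF l2m pq0(1)])
    also have "\<dots> \<le> K * Lp_norm 2 (count_space I) (\<lambda>k. Lp_norm p lborel (a k t))"
      by (intro mult_left_mono Lp_norm_swap_count_space[OF sL cI at _ pq(1)]) auto
    finally show ?thesis .
  qed
  have "Lp_norm r M (\<lambda>\<omega>. Lp_norm q lborel (\<lambda>t. Lp_norm p lborel (F \<omega> t))) \<le> Lp_norm q lborel (\<lambda>t. Lp_norm r M (\<lambda>\<omega>. Lp_norm p lborel (F \<omega> t)))"
    by (rule Lp_norm_swap[OF sM sL Fp pq0(2) r(3)])
  also have "\<dots> \<le> Lp_norm q lborel (\<lambda>t. K * Lp_norm 2 (count_space I) (\<lambda>k. Lp_norm p lborel (a k t)))"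
    by (rule Lp_norm_mono[OF pq0(2) pt2])
  also have "\<dots> = K * Lp_norm q lborel (\<lambda>t. Lp_norm 2 (count_space I) (\<lambda>k. Lp_norm p lborel (a k t)))"
    by (rule Lp_norm_cmult[OF measurable_Lp_norm_count_space[OF cI apm] pq0(2)])
  also have "\<dots> \<le> K * Lp_norm 2 (count_space I) (\<lambda>k. Lp_norm q lborel (\<lambda>t. Lp_norm p lborel (a k t)))"
    by (intro mult_left_mono Lp_norm_swap_count_space[OF sL cI apm _ pq(2)]) auto
  finally show ?thesis by (simp only: F_def[abs_def] a_def[abs_def] r_def K_def)
qed

text \<open>Summable energies \<open>a k\<close> need not have summable square roots. Grouping them
  so that the energy of group \<open>j\<close> is at most \<open>T / 4 ^ j\<close> makes the norms
  of the groups decay like \<open>(1 / 2) ^ j\<close>.\<close>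

lemma lacunary_subsequence:
  fixes a :: "nat \<Rightarrow> real"
  assumes a0: "\<And>k. 0 \<le> a k" and T: "\<And>n. (\<Sum>k<n. a k) \<le> T"
  obtains N :: "nat \<Rightarrow> nat" where "N 0 = 0" "strict_mono N" "\<And>j. (\<Sum>k\<in>{N j..<N (Suc j)}. a k) \<le> T / 4 ^ j"
proof -
  have sm: "summable a" by (rule summableI_nonneg_bounded[OF a0 T])
  have T0: "0 \<le> T" using T[of 0] by simp
  \<comment> \<open>\<open>T = 0\<close> is separate because the Cauchy criterion needs a positive
    threshold; all energies vanish then.\<close>
  have ex: "\<exists>n0. \<forall>m\<ge>n0. \<forall>n. sum a {m..<n} \<le> T / 4 ^ j" for j
  proof (cases "T = 0")
    case True
    have "a k = 0" for k
    proof -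
      have "a k \<le> (\<Sum>i<Suc k. a i)" by (rule member_le_sum) (auto intro: a0)
      then show ?thesis using T[of "Suc k"] a0[of k] True by simp
    qed
    then show ?thesis using True by simp
  next
    case False
    then have "0 < T / 4 ^ j" using T0 by simp
    then obtain n0 where "\<And>m n. n0 \<le> m \<Longrightarrow> norm (sum a {m..<n}) < T / 4 ^ j"
      using sm unfolding summable_Cauchy by blast
    then have "\<forall>m\<ge>n0. \<forall>n. sum a {m..<n} \<le> T / 4 ^ j"
      by (smt (verit) real_norm_def)
    then show ?thesis ..
  qed
  then obtain n0 where n0: "\<And>j m n. n0 j \<le> m \<Longrightarrow> sum a {m..<n} \<le> T / 4 ^ j" by metis
  \<comment> \<open>The maximum with \<open>Suc n\<close> forces strict increase. Group 0 may start
    at 0, since its bound is the total \<open>T\<close>.\<close>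
  define N where "N = rec_nat 0 (\<lambda>j n. max (Suc n) (n0 (Suc j)))"
  have N: "N 0 = 0" "N (Suc j) = max (Suc (N j)) (n0 (Suc j))" for j by (simp_all add: N_def)
  have "(\<Sum>k\<in>{N j..<N (Suc j)}. a k) \<le> T / 4 ^ j" for j
  proof (cases j)
    case 0
    then show ?thesis using T[of "N 1"] N(1) by (simp add: lessThan_atLeast0)
  next
    case (Suc i)
    then show ?thesis using N(2)[of i] by (intro n0) simp
  qed
  moreover have "strict_mono N" unfolding strict_mono_Suc_iff using N(2) by (simp add: less_max_iff_disj)
  ultimately show ?thesis using N(1) that by blast
qed

section \<open>The randomized symbol\<close>

text \<open>\<open>fourier_fun f\<close> is an arbitrary choice among the representing functions,
  but agrees almost everywhere with the one whose weighted square is integrable by the definition of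
  \<open>sobolev\<close>.\<close>

lemma sobolev_symbol:
  fixes f :: "'n::finite distr"
  assumes "f \<in> sobolev s"
  shows "represents (fourier_fun f) (fourier_distr f)" "fourier_fun f \<in> borel_measurable borel"
    "integrable lborel (\<lambda>\<xi>. (1 + (norm \<xi>)\<^sup>2) powr s * (cmod (fourier_fun f \<xi>))\<^sup>2)"
proof -
  obtain v where v: "represents v (fourier_distr f)" "integrable lborel (\<lambda>\<xi>. (1 + (norm \<xi>)\<^sup>2) powr s * (cmod (v \<xi>))\<^sup>2)"
    using assms by (auto simp: sobolev_def)
  show r: "represents (fourier_fun f) (fourier_distr f)"
    unfolding fourier_fun_def by (rule someI[of "\<lambda>v. represents v (fourier_distr f)", OF v(1)])
  then show m [measurable]: "fourier_fun f \<in> borel_measurable borel" by (simp add: represents_def)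
  have "AE \<xi> in lborel. v \<xi> = fourier_fun f \<xi>" by (rule represents_unique[OF v(1) r])
  then have "AE \<xi> in lborel. (1 + (norm \<xi>)\<^sup>2) powr s * (cmod (v \<xi>))\<^sup>2 = (1 + (norm \<xi>)\<^sup>2) powr s * (cmod (fourier_fun f \<xi>))\<^sup>2"
    by (auto elim!: eventually_mono)
  then show "integrable lborel (\<lambda>\<xi>. (1 + (norm \<xi>)\<^sup>2) powr s * (cmod (fourier_fun f \<xi>))\<^sup>2)"
    by (rule integrable_cong_AE_imp[OF v(2), rotated]) measurable
qed

definition block_index :: "real \<Rightarrow> 'a::real_normed_vector \<Rightarrow> nat" where
  "block_index \<gamma> \<xi> = nat \<lfloor>norm \<xi> powr (1 / \<gamma>)\<rfloor>"

text \<open>The shells partition frequency space, so at each frequency the randomized series of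
  symbols has a single term, carrying the coefficient of the shell that contains the
  frequency.\<close>

definition rand_symbol :: "(nat \<Rightarrow> real) \<Rightarrow> real \<Rightarrow> (real^'n::finite \<Rightarrow> complex) \<Rightarrow> real^'n \<Rightarrow> complex" where
  "rand_symbol c \<gamma> v \<xi> = complex_of_real (c (block_index \<gamma> \<xi>)) * v \<xi>"

lemma block_index_iff:
  fixes \<xi> :: "'a::real_normed_vector"
  assumes "0 < \<gamma>" shows "norm \<xi> \<in> {real k powr \<gamma>..<real (Suc k) powr \<gamma>} \<longleftrightarrow> block_index \<gamma> \<xi> = k"
proof -
  have e: "(norm \<xi> powr (1 / \<gamma>)) powr \<gamma> = norm \<xi>" using assms by (simp add: powr_powr)
  have 1: "real k powr \<gamma> \<le> norm \<xi> \<longleftrightarrow> real k \<le> norm \<xi> powr (1 / \<gamma>)"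
    using powr_mono2[of \<gamma> "real k" "norm \<xi> powr (1 / \<gamma>)"] powr_less_mono2[of \<gamma> "norm \<xi> powr (1 / \<gamma>)" "real k"] assms
    unfolding e by (auto simp: not_le[symmetric])
  have 2: "norm \<xi> < real (Suc k) powr \<gamma> \<longleftrightarrow> norm \<xi> powr (1 / \<gamma>) < real (Suc k)"
    using powr_mono2[of \<gamma> "real (Suc k)" "norm \<xi> powr (1 / \<gamma>)"] powr_less_mono2[of \<gamma> "norm \<xi> powr (1 / \<gamma>)" "real (Suc k)"] assms
    unfolding e by (meson less_imp_le not_le of_nat_0_le_iff powr_ge_zero)
  have "real k \<le> z \<and> z < real (Suc k) \<longleftrightarrow> nat \<lfloor>z\<rfloor> = k" if "0 \<le> z" for z
  proof -
    have "0 \<le> \<lfloor>z\<rfloor>" using that by simp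
    then have "nat \<lfloor>z\<rfloor> = k \<longleftrightarrow> \<lfloor>z\<rfloor> = int k" by auto
    then show ?thesis by (simp add: floor_eq_iff add.commute)
  qed
  from this[of "norm \<xi> powr (1 / \<gamma>)"] show ?thesis
    unfolding atLeastLessThan_iff 1 2 block_index_def by simp
qed

lemma block_eq:
  assumes "0 < \<gamma>" shows "block \<gamma> v k \<xi> = (if block_index \<gamma> \<xi> = k then v \<xi> else 0)"
  using block_index_iff[OF assms, of \<xi> k] by (auto simp: block_def)

lemma block_index_measurable [measurable]:
  "block_index \<gamma> \<in> measurable borel (count_space (UNIV :: nat set))"
  unfolding block_index_def[abs_def] by measurable

lemma rand_symbol_measurable [measurable]:
  assumes [measurable]: "v \<in> borel_measurable borel" shows "rand_symbol c \<gamma> v \<in> borel_measurable borel"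
  unfolding rand_symbol_def[abs_def] by measurable

lemma block_index_le:
  assumes "0 < \<gamma>" shows "1 + real (block_index \<gamma> \<xi>) \<le> 2 * (1 + norm \<xi>) ^ nat \<lceil>1 / \<gamma>\<rceil>"
proof -
  have "real (block_index \<gamma> \<xi>) \<le> norm \<xi> powr (1 / \<gamma>)" unfolding block_index_def by (simp add: of_nat_floor)
  also have "\<dots> \<le> (1 + norm \<xi>) powr (1 / \<gamma>)" using assms by (intro powr_mono2) auto
  also have "\<dots> \<le> (1 + norm \<xi>) powr (real (nat \<lceil>1 / \<gamma>\<rceil>))" by (intro powr_mono) (auto simp: real_nat_ceiling_ge)
  also have "\<dots> = (1 + norm \<xi>) ^ nat \<lceil>1 / \<gamma>\<rceil>" by (intro powr_realpow) (simp add: add_pos_nonneg)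
  finally have "real (block_index \<gamma> \<xi>) \<le> (1 + norm \<xi>) ^ nat \<lceil>1 / \<gamma>\<rceil>" .
  moreover have "1 \<le> (1 + norm \<xi>) ^ nat \<lceil>1 / \<gamma>\<rceil>" by (rule one_le_power) simp
  ultimately show ?thesis by linarith
qed

text \<open>The product is split by the arithmetic-geometric mean inequality after distributing the
  Sobolev weight \<open>j\<close> to \<open>v\<close> and its inverse to \<open>y\<close>. Since
  \<open>1 / j\<close> grows at most polynomially, the decay of \<open>y\<close> absorbs it.\<close>

lemma weighted_integrable:
  fixes v y :: "real^'n::finite \<Rightarrow> complex"
  assumes [measurable]: "v \<in> borel_measurable borel" "y \<in> borel_measurable borel"
    and v: "integrable lborel (\<lambda>\<xi>. (1 + (norm \<xi>)\<^sup>2) powr s * (cmod (v \<xi>))\<^sup>2)"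
    and y: "\<And>N. \<exists>C. \<forall>\<xi>. (1 + norm \<xi>) ^ N * cmod (y \<xi>) \<le> C"
  shows "integrable lborel (\<lambda>\<xi>. (1 + norm \<xi>) ^ N * (cmod (v \<xi>) * cmod (y \<xi>)))"
proof -
  let ?n = "CARD('n)"
  define K where "K = nat \<lceil>\<bar>s\<bar>\<rceil>"
  have K: "\<bar>s\<bar> \<le> real K" by (simp add: K_def real_nat_ceiling_ge)
  \<comment> \<open>Of the powers of decay, \<open>N\<close> compensate the prescribed weight and
    \<open>K\<close> the inverse Sobolev weight; the remaining \<open>?n\<close> become
    \<open>2 * ?n\<close> after squaring, which is integrable.\<close>
  obtain C where C: "\<And>\<xi>. (1 + norm \<xi>) ^ (?n + N + K) * cmod (y \<xi>) \<le> C" using y by blast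
  have "integrable lborel (\<lambda>\<xi>::real^'n. (1 + (norm \<xi>)\<^sup>2) powr s * (cmod (v \<xi>))\<^sup>2 + C\<^sup>2 * (1 / (1 + norm \<xi>) ^ (2 * ?n)))"
    using poly_decay_integrable[where 'a="real^'n"] by (intro Bochner_Integration.integrable_add integrable_mult_right v) auto
  then show ?thesis
  proof (rule Bochner_Integration.integrable_bound)
    show "(\<lambda>\<xi>. (1 + norm \<xi>) ^ N * (cmod (v \<xi>) * cmod (y \<xi>))) \<in> borel_measurable lborel" by measurable
    show "AE \<xi> in lborel. norm ((1 + norm \<xi>) ^ N * (cmod (v \<xi>) * cmod (y \<xi>))) \<le> norm ((1 + (norm \<xi>)\<^sup>2) powr s * (cmod (v \<xi>))\<^sup>2 + C\<^sup>2 * (1 / (1 + norm \<xi>) ^ (2 * ?n)))"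
    proof (intro AE_I2)
      fix \<xi> :: "real^'n"
      define b where "b = 1 + norm \<xi>"
      have b: "1 \<le> b" by (simp add: b_def)
      define j where "j = sqrt ((1 + (norm \<xi>)\<^sup>2) powr s)"
      have base: "1 \<le> 1 + (norm \<xi>)\<^sup>2" "1 + (norm \<xi>)\<^sup>2 \<le> b\<^sup>2" by (auto simp: b_def power2_sum)
      have pos: "0 < 1 + (norm \<xi>)\<^sup>2" using base(1) by linarith
      have j: "0 < j" using pos by (simp add: j_def)
      have inv: "1 / j \<le> b ^ K"
      proof -
        have "(1 / j)\<^sup>2 = (1 + (norm \<xi>)\<^sup>2) powr (- s)" using pos by (simp add: j_def power_divide powr_minus inverse_eq_divide)
        also have "\<dots> \<le> (1 + (norm \<xi>)\<^sup>2) powr (real K)" using base(1) K by (intro powr_mono) auto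
        also have "\<dots> = (1 + (norm \<xi>)\<^sup>2) ^ K" using pos by (rule powr_realpow)
        also have "\<dots> \<le> (b\<^sup>2) ^ K" using base by (intro power_mono) auto
        also have "\<dots> = (b ^ K)\<^sup>2" by (simp add: power_mult[symmetric] mult.commute)
        finally show ?thesis by (rule power2_le_imp_le) (use b in simp)
      qed
      have yb: "b ^ N * cmod (y \<xi>) * b ^ K \<le> C / b ^ ?n"
        using C[of \<xi>] b by (simp add: b_def[symmetric] pos_le_divide_eq power_add mult_ac)
      have "b ^ N * cmod (y \<xi>) / j \<le> b ^ N * cmod (y \<xi>) * b ^ K"
        using mult_left_mono[OF inv, of "b ^ N * cmod (y \<xi>)"] b by simp
      then have z: "b ^ N * cmod (y \<xi>) / j \<le> C / b ^ ?n" using yb by linarith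
      define X where "X = b ^ N * cmod (y \<xi>) / j"
      have X: "0 \<le> X" "X\<^sup>2 \<le> (C / b ^ ?n)\<^sup>2" using b j z by (auto simp: X_def intro!: power_mono)
      have "b ^ N * (cmod (v \<xi>) * cmod (y \<xi>)) = (j * cmod (v \<xi>)) * X" using j by (simp add: X_def)
      also have "\<dots> \<le> (j * cmod (v \<xi>))\<^sup>2 + X\<^sup>2"
      proof -
        have "0 \<le> (j * cmod (v \<xi>)) * X" using X j by simp
        then show ?thesis using sum_squares_bound[of "j * cmod (v \<xi>)" X] by linarith
      qed
      also have "\<dots> \<le> (1 + (norm \<xi>)\<^sup>2) powr s * (cmod (v \<xi>))\<^sup>2 + (C / b ^ ?n)\<^sup>2"
        using X(2) by (simp add: j_def power_mult_distrib)
      also have "(C / b ^ ?n)\<^sup>2 = C\<^sup>2 * (1 / b ^ (2 * ?n))" by (simp add: power_divide power_mult[symmetric] mult.commute)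
      finally show "norm ((1 + norm \<xi>) ^ N * (cmod (v \<xi>) * cmod (y \<xi>))) \<le> norm ((1 + (norm \<xi>)\<^sup>2) powr s * (cmod (v \<xi>))\<^sup>2 + C\<^sup>2 * (1 / (1 + norm \<xi>) ^ (2 * ?n)))"
        using b by (simp add: b_def[symmetric])
    qed
  qed
qed

text \<open>Linear growth of \<open>c\<close> in the shell index is polynomial growth in the
  frequency, so \<open>D\<close> is an integrable majorant. Partial sums are restrictions to the
  first shells and become constant at each frequency. The test function \<open>y\<close> is merely
  measurable with rapid decay, because it is also applied to \<open>inv_fourier \<phi>\<close> times
  a phase in \<open>norm \<xi>\<close>, which in general is not smooth at the origin.\<close>

lemma rand_symbol_pairing:
  fixes v y :: "real^'n::finite \<Rightarrow> complex"
  assumes \<gamma>: "0 < \<gamma>" and v [measurable]: "v \<in> borel_measurable borel" and y [measurable]: "y \<in> borel_measurable borel"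
    and vs: "integrable lborel (\<lambda>\<xi>. (1 + (norm \<xi>)\<^sup>2) powr s * (cmod (v \<xi>))\<^sup>2)"
    and yd: "\<And>N. \<exists>C. \<forall>\<xi>. (1 + norm \<xi>) ^ N * cmod (y \<xi>) \<le> C"
    and c: "\<And>k. \<bar>c k\<bar> \<le> G * (1 + real k)"
  shows "integrable lborel (\<lambda>\<xi>. rand_symbol c \<gamma> v \<xi> * y \<xi>)" (is ?i)
    and "integrable lborel (\<lambda>\<xi>. block \<gamma> v k \<xi> * y \<xi>)" (is ?j)
    and "(\<lambda>k. complex_of_real (c k) * (LINT \<xi>|lborel. block \<gamma> v k \<xi> * y \<xi>)) sums (LINT \<xi>|lborel. rand_symbol c \<gamma> v \<xi> * y \<xi>)" (is ?s)
proof -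
  have G: "0 \<le> G" using c[of 0] by simp
  define D where "D \<xi> = 2 * G * ((1 + norm \<xi>) ^ nat \<lceil>1 / \<gamma>\<rceil> * (cmod (v \<xi>) * cmod (y \<xi>)))" for \<xi>
  have D: "integrable lborel D" unfolding D_def[abs_def]
    by (intro integrable_mult_right weighted_integrable[OF v y vs yd])
  have le: "cmod (rand_symbol c \<gamma> v \<xi> * y \<xi>) \<le> D \<xi>" for \<xi>
  proof -
    have "\<bar>c (block_index \<gamma> \<xi>)\<bar> \<le> G * (2 * (1 + norm \<xi>) ^ nat \<lceil>1 / \<gamma>\<rceil>)"
      using c[of "block_index \<gamma> \<xi>"] mult_left_mono[OF block_index_le[OF \<gamma>, of \<xi>] G] by linarith
    then have "\<bar>c (block_index \<gamma> \<xi>)\<bar> * (cmod (v \<xi>) * cmod (y \<xi>)) \<le> G * (2 * (1 + norm \<xi>) ^ nat \<lceil>1 / \<gamma>\<rceil>) * (cmod (v \<xi>) * cmod (y \<xi>))"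
      by (intro mult_right_mono) auto
    then show ?thesis by (simp add: rand_symbol_def D_def norm_mult mult_ac)
  qed
  show ?i by (rule Bochner_Integration.integrable_bound[OF D]) (use le in \<open>auto intro!: AE_I2 order_trans[OF le]\<close>)
  have bi: "integrable lborel (\<lambda>\<xi>. block \<gamma> v k \<xi> * y \<xi>)" for k
  proof (rule Bochner_Integration.integrable_bound[OF weighted_integrable[OF v y vs yd, of 0]])
    show "AE \<xi> in lborel. norm (block \<gamma> v k \<xi> * y \<xi>) \<le> norm ((1 + norm \<xi>) ^ 0 * (cmod (v \<xi>) * cmod (y \<xi>)))"
      by (auto simp: block_eq[OF \<gamma>] norm_mult)
  qed measurable
  then show ?j .
  define P where "P n \<xi> = (if block_index \<gamma> \<xi> < n then rand_symbol c \<gamma> v \<xi> * y \<xi> else 0)" for n \<xi>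
  have P: "(\<Sum>k<n. complex_of_real (c k) * (block \<gamma> v k \<xi> * y \<xi>)) = P n \<xi>" for n \<xi>
  proof -
    have "(\<Sum>k<n. complex_of_real (c k) * (block \<gamma> v k \<xi> * y \<xi>)) = (\<Sum>k<n. if k = block_index \<gamma> \<xi> then complex_of_real (c k) * (v \<xi> * y \<xi>) else 0)"
      by (intro sum.cong) (auto simp: block_eq[OF \<gamma>])
    then show ?thesis by (simp add: P_def rand_symbol_def)
  qed
  have s: "(\<Sum>k<n. complex_of_real (c k) * (LINT \<xi>|lborel. block \<gamma> v k \<xi> * y \<xi>)) = (LINT \<xi>|lborel. P n \<xi>)" for n
    unfolding P[symmetric] using bi by simp
  have "(\<lambda>n. LINT \<xi>|lborel. P n \<xi>) \<longlonglongrightarrow> (LINT \<xi>|lborel. rand_symbol c \<gamma> v \<xi> * y \<xi>)"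
  proof (rule integral_dominated_convergence[OF _ _ D])
    show "AE \<xi> in lborel. (\<lambda>n. P n \<xi>) \<longlonglongrightarrow> rand_symbol c \<gamma> v \<xi> * y \<xi>"
    proof (intro AE_I2)
      fix \<xi> :: "real^'n"
      have "\<forall>\<^sub>F n in sequentially. P n \<xi> = rand_symbol c \<gamma> v \<xi> * y \<xi>"
        using eventually_gt_at_top[of "block_index \<gamma> \<xi>"] by eventually_elim (simp add: P_def)
      then show "(\<lambda>n. P n \<xi>) \<longlonglongrightarrow> rand_symbol c \<gamma> v \<xi> * y \<xi>" by (rule tendsto_eventually)
    qed
    show "AE \<xi> in lborel. norm (P n \<xi>) \<le> D \<xi>" for n
      using le order_trans[OF norm_ge_zero le] by (auto simp: P_def)
    show "(\<lambda>\<xi>. rand_symbol c \<gamma> v \<xi> * y \<xi>) \<in> borel_measurable lborel" by measurable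
    show "P n \<in> borel_measurable lborel" for n unfolding P_def[abs_def] by measurable
  qed
  then show ?s unfolding sums_def s .
qed

lemma block_integrable:
  fixes v :: "real^'n::finite \<Rightarrow> complex"
  assumes \<gamma>: "0 < \<gamma>" and v [measurable]: "v \<in> borel_measurable borel"
    and vs: "integrable lborel (\<lambda>\<xi>. (1 + (norm \<xi>)\<^sup>2) powr s * (cmod (v \<xi>))\<^sup>2)"
  shows "integrable lborel (block \<gamma> v k)"
proof -
  define b where "b = real (Suc k) powr \<gamma>"
  \<comment> \<open>The indicator of a ball containing the shell decays rapidly in the required
    sense, and multiplying the block by it changes nothing.\<close>
  define y :: "real^'n \<Rightarrow> complex" where "y \<xi> = indicator {..<b} (norm \<xi>)" for \<xi>
  have [measurable]: "y \<in> borel_measurable borel" unfolding y_def[abs_def] by measurable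
  have "\<exists>C. \<forall>\<xi>. (1 + norm \<xi>) ^ N * cmod (y \<xi>) \<le> C" for N
  proof (intro exI allI)
    fix \<xi>
    show "(1 + norm \<xi>) ^ N * cmod (y \<xi>) \<le> (1 + b) ^ N"
      by (cases "norm \<xi> < b") (auto simp: y_def b_def intro!: power_mono)
  qed
  from rand_symbol_pairing(2)[OF \<gamma> v _ vs this, of "\<lambda>_. 0" 0 k]
  have "integrable lborel (\<lambda>\<xi>. block \<gamma> v k \<xi> * y \<xi>)" by simp
  moreover have "block \<gamma> v k \<xi> * y \<xi> = block \<gamma> v k \<xi>" for \<xi>
    by (auto simp: block_def y_def b_def indicator_def)
  ultimately show ?thesis by simp
qed

lemma schwartz_rapid: "\<phi> \<in> schwartz \<Longrightarrow> \<exists>C. \<forall>\<xi>. (1 + norm \<xi>) ^ N * cmod (\<phi> \<xi>) \<le> C"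
  by (rule schwartz_bound[of \<phi> N]) auto

lemma inv_fourier_rapid:
  fixes \<phi> :: "real^'n::finite \<Rightarrow> complex"
  assumes "\<phi> \<in> schwartz" shows "\<exists>C. \<forall>\<xi>. (1 + norm \<xi>) ^ N * cmod (inv_fourier \<phi> \<xi>) \<le> C"
proof -
  obtain C where C: "\<And>\<xi>. (1 + norm \<xi>) ^ N * cmod (ft \<phi> \<xi>) \<le> C" by (rule ft_schwartz_decay[OF assms]) (rule that; assumption)
  define c where "c = (2 * pi) powr (- real CARD('n) / 2)"
  have "(1 + norm \<xi>) ^ N * cmod (inv_fourier \<phi> \<xi>) \<le> c * C" for \<xi>
  proof -
    have "cmod (inv_fourier \<phi> \<xi>) = c * cmod (ft \<phi> \<xi>)"
      unfolding inv_fourier_eq_ft c_def[symmetric] by (simp add: norm_mult c_def)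
    then show ?thesis using mult_left_mono[OF C[of \<xi>], of c] by (simp add: c_def mult_ac)
  qed
  then show ?thesis by blast
qed

lemma inv_fourier_measurable:
  fixes \<phi> :: "real^'n::finite \<Rightarrow> complex"
  assumes "\<phi> \<in> schwartz" shows "inv_fourier \<phi> \<in> borel_measurable borel"
proof -
  have [measurable]: "\<phi> \<in> borel_measurable borel" by (rule schwartz_measurable[OF assms])
  show ?thesis unfolding inv_fourier_eq_ft[abs_def] by measurable
qed

text \<open>Testing against \<open>fourier \<phi>\<close> meets the inverse transform built into
  \<open>annulus_proj\<close>; Fourier inversion cancels the two, and what is left is the termwise
  pairing with \<open>\<phi>\<close>.\<close>

lemma represents_rand_symbol:
  fixes f :: "'n::finite distr"
  assumes \<gamma>: "0 < \<gamma>" and f: "f \<in> sobolev s" and c: "\<And>k. \<bar>g k \<omega>\<bar> \<le> G * (1 + real k)"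
  shows "represents (rand_symbol (\<lambda>k. g k \<omega>) \<gamma> (fourier_fun f)) (fourier_distr (radial_randomization g \<gamma> f \<omega>))"
  unfolding represents_def
proof (intro conjI ballI)
  note v = sobolev_symbol[OF f]
  show "rand_symbol (\<lambda>k. g k \<omega>) \<gamma> (fourier_fun f) \<in> borel_measurable lborel" using v(2) by simp
  fix \<phi> :: "real^'n \<Rightarrow> complex" assume \<phi>: "\<phi> \<in> schwartz"
  note p = rand_symbol_pairing[OF \<gamma> v(2) schwartz_measurable[OF \<phi>] v(3) schwartz_rapid[OF \<phi>], of "\<lambda>k. g k \<omega>", OF c]
  show "integrable lborel (\<lambda>x. rand_symbol (\<lambda>k. g k \<omega>) \<gamma> (fourier_fun f) x * \<phi> x)" by (rule p(1))
  have "annulus_proj (real k powr \<gamma>) (real (Suc k) powr \<gamma>) f (fourier \<phi>) = (LINT \<xi>|lborel. block \<gamma> (fourier_fun f) k \<xi> * \<phi> \<xi>)" for k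
    by (simp add: annulus_proj_def fourier_multiplier_def inv_fourier_distr_def inv_fourier_fourier[OF \<phi>] block_def)
  then show "fourier_distr (radial_randomization g \<gamma> f \<omega>) \<phi> = (LINT x|lborel. rand_symbol (\<lambda>k. g k \<omega>) \<gamma> (fourier_fun f) x * \<phi> x)"
    using sums_unique[OF p(3)] by (simp add: fourier_distr_def radial_randomization_def)
qed

text \<open>The power of \<open>2 * pi\<close> restores the unitary normalisation missing in
  \<open>wave\<close>; the sign of propagation is absorbed into time.\<close>

definition wave_block :: "real \<Rightarrow> real \<Rightarrow> (real^'n::finite \<Rightarrow> complex) \<Rightarrow> nat \<Rightarrow> real \<Rightarrow> real^'n \<Rightarrow> complex" where
  "wave_block \<epsilon> \<gamma> v k t x = complex_of_real ((2 * pi) powr (- real CARD('n) / 2)) * wave (block \<gamma> v k) (\<epsilon> * t) x"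

lemma wave_block_measurable:
  assumes [measurable]: "v \<in> borel_measurable borel"
  shows "(\<lambda>(t, x). wave_block \<epsilon> \<gamma> v k t x) \<in> borel_measurable (borel \<Otimes>\<^sub>M borel)"
  unfolding wave_block_def by measurable

lemma wave_block_pairing:
  fixes v \<phi> :: "real^'n::finite \<Rightarrow> complex"
  assumes H: "integrable lborel (block \<gamma> v k)" and \<phi>: "\<phi> \<in> schwartz"
  shows "integrable lborel (\<lambda>x. wave_block \<epsilon> \<gamma> v k t x * \<phi> x)"
    and "(LINT x|lborel. wave_block \<epsilon> \<gamma> v k t x * \<phi> x) = (LINT \<xi>|lborel. block \<gamma> v k \<xi> * (cis (\<epsilon> * t * norm \<xi>) * inv_fourier \<phi> \<xi>))"
proof -
  define c where "c = complex_of_real ((2 * pi) powr (- real CARD('n) / 2))"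
  define h where "h \<xi> = cis (\<epsilon> * t * norm \<xi>) * block \<gamma> v k \<xi>" for \<xi>
  have hi: "integrable lborel h" unfolding h_def[abs_def] by (rule integrable_cis_mult[OF H]) measurable
  have \<phi>i: "integrable lborel \<phi>" by (rule schwartz_integrable[OF \<phi>])
  have J: "integrable (lborel \<Otimes>\<^sub>M lborel) (\<lambda>(x, \<xi>). cis (x \<bullet> \<xi>) * (\<phi> x * h \<xi>))"
    by (rule integrable_pair_mult_bounded[OF lborel.sigma_finite_measure_axioms lborel.sigma_finite_measure_axioms \<phi>i hi]) auto
  have e: "wave_block \<epsilon> \<gamma> v k t x * \<phi> x = c * (LINT \<xi>|lborel. cis (x \<bullet> \<xi>) * (\<phi> x * h \<xi>))" for x
  proof -
    have "(LINT \<xi>|lborel. cis (x \<bullet> \<xi>) * (\<phi> x * h \<xi>)) = (LINT \<xi>|lborel. \<phi> x * (cis (x \<bullet> \<xi>) * h \<xi>))"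
      by (simp only: mult_ac)
    also have "\<dots> = \<phi> x * (LINT \<xi>|lborel. cis (x \<bullet> \<xi>) * h \<xi>)" by (rule integral_mult_right_zero)
    finally show ?thesis by (simp add: wave_block_def wave_def ft_def h_def c_def)
  qed
  show "integrable lborel (\<lambda>x. wave_block \<epsilon> \<gamma> v k t x * \<phi> x)"
    unfolding e using lborel_pair.integrable_fst'[OF J] by (intro integrable_mult_right) simp
  have "(LINT x|lborel. wave_block \<epsilon> \<gamma> v k t x * \<phi> x) = c * (LINT x|lborel. LINT \<xi>|lborel. cis (x \<bullet> \<xi>) * (\<phi> x * h \<xi>))"
    unfolding e by (rule integral_mult_right_zero)
  also have "(LINT x|lborel. LINT \<xi>|lborel. cis (x \<bullet> \<xi>) * (\<phi> x * h \<xi>)) = (LINT \<xi>|lborel. LINT x|lborel. cis (x \<bullet> \<xi>) * (\<phi> x * h \<xi>))"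
    using lborel_pair.Fubini_integral[OF J] by simp
  also have "c * \<dots> = (LINT \<xi>|lborel. c * (LINT x|lborel. cis (x \<bullet> \<xi>) * (\<phi> x * h \<xi>)))"
    by (rule integral_mult_right_zero[symmetric])
  also have "\<dots> = (LINT \<xi>|lborel. block \<gamma> v k \<xi> * (cis (\<epsilon> * t * norm \<xi>) * inv_fourier \<phi> \<xi>))"
  proof (intro Bochner_Integration.integral_cong refl)
    fix \<xi>
    have "(LINT x|lborel. cis (x \<bullet> \<xi>) * (\<phi> x * h \<xi>)) = (LINT x|lborel. (cis (\<xi> \<bullet> x) * \<phi> x) * h \<xi>)"
      by (simp only: mult_ac inner_commute)
    also have "\<dots> = (LINT x|lborel. cis (\<xi> \<bullet> x) * \<phi> x) * h \<xi>" by (rule integral_mult_left_zero)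
    finally show "c * (LINT x|lborel. cis (x \<bullet> \<xi>) * (\<phi> x * h \<xi>)) = block \<gamma> v k \<xi> * (cis (\<epsilon> * t * norm \<xi>) * inv_fourier \<phi> \<xi>)"
      by (simp add: inv_fourier_def c_def h_def mult_ac)
  qed
  finally show "(LINT x|lborel. wave_block \<epsilon> \<gamma> v k t x * \<phi> x) = (LINT \<xi>|lborel. block \<gamma> v k \<xi> * (cis (\<epsilon> * t * norm \<xi>) * inv_fourier \<phi> \<xi>))" .
qed

text \<open>\<open>half_wave\<close> acts on the symbol chosen by \<open>fourier_fun\<close>, which
  agrees with the randomized symbol almost everywhere. The phase has modulus 1, so it can be moved
  onto the test side without affecting the decay.\<close>

lemma half_wave_sums:
  fixes f :: "'n::finite distr"
  assumes \<gamma>: "0 < \<gamma>" and f: "f \<in> sobolev s" and c: "\<And>k. \<bar>g k \<omega>\<bar> \<le> G * (1 + real k)" and \<phi>: "\<phi> \<in> schwartz"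
  shows "(\<lambda>k. complex_of_real (g k \<omega>) * (LINT x|lborel. wave_block \<epsilon> \<gamma> (fourier_fun f) k t x * \<phi> x))
    sums half_wave \<epsilon> t (radial_randomization g \<gamma> f \<omega>) \<phi>"
proof -
  note v = sobolev_symbol[OF f]
  define y where "y \<xi> = cis (\<epsilon> * t * norm \<xi>) * inv_fourier \<phi> \<xi>" for \<xi>
  define V where "V = rand_symbol (\<lambda>k. g k \<omega>) \<gamma> (fourier_fun f)"
  define F where "F = radial_randomization g \<gamma> f \<omega>"
  have rV: "represents V (fourier_distr F)" unfolding V_def F_def by (rule represents_rand_symbol[where g=g and \<omega>=\<omega>, OF \<gamma> f c])
  then have rF: "represents (fourier_fun F) (fourier_distr F)"
    unfolding fourier_fun_def by (rule someI[of "\<lambda>v. represents v (fourier_distr F)"])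
  have [measurable]: "inv_fourier \<phi> \<in> borel_measurable borel" by (rule inv_fourier_measurable[OF \<phi>])
  have ym [measurable]: "y \<in> borel_measurable borel" unfolding y_def[abs_def] by measurable
  have [measurable]: "V \<in> borel_measurable borel" "fourier_fun F \<in> borel_measurable borel"
    using rV rF by (simp_all add: represents_def)
  have yd: "\<exists>C. \<forall>\<xi>. (1 + norm \<xi>) ^ N * cmod (y \<xi>) \<le> C" for N
    using inv_fourier_rapid[OF \<phi>, of N] by (simp add: y_def norm_mult)
  note p = rand_symbol_pairing(3)[OF \<gamma> v(2) ym v(3) yd, of "\<lambda>k. g k \<omega>", OF c]
  have "half_wave \<epsilon> t F \<phi> = (LINT \<xi>|lborel. cis (\<epsilon> * t * norm \<xi>) * fourier_fun F \<xi> * inv_fourier \<phi> \<xi>)"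
    by (simp add: half_wave_def fourier_multiplier_def inv_fourier_distr_def)
  also have "\<dots> = (LINT \<xi>|lborel. V \<xi> * y \<xi>)"
  proof (rule integral_cong_AE)
    show "AE \<xi> in lborel. cis (\<epsilon> * t * norm \<xi>) * fourier_fun F \<xi> * inv_fourier \<phi> \<xi> = V \<xi> * y \<xi>"
      using represents_unique[OF rV rF] by eventually_elim (simp add: y_def mult_ac)
  qed measurable
  finally have "half_wave \<epsilon> t F \<phi> = (LINT \<xi>|lborel. V \<xi> * y \<xi>)" .
  then show ?thesis
    using p unfolding wave_block_pairing(2)[OF block_integrable[OF \<gamma> v(2,3)] \<phi>] F_def V_def y_def by simp
qed

section \<open>Convergence of the randomized series\<close>

text \<open>Compare \<open>b\<close> with the power \<open>p - 1\<close> of \<open>a\<close>: in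
  either case one term dominates the product. Constants are irrelevant, as only finiteness of a
  pairing is deduced from it.\<close>

lemma ennreal_Young:
  fixes a b :: ennreal
  assumes "1 < p" shows "a * b \<le> ennreal_powr a p + ennreal_powr b (p / (p - 1))"
proof (cases "b \<le> ennreal_powr a (p - 1)")
  case True
  then have "a * b \<le> ennreal_powr a 1 * ennreal_powr a (p - 1)" by (simp add: mult_left_mono)
  also have "\<dots> = ennreal_powr a p" unfolding ennreal_powr_add[symmetric] by simp
  finally show ?thesis by (simp add: add_increasing2)
next
  case False
  have "ennreal_powr (ennreal_powr a (p - 1)) (1 / (p - 1)) \<le> ennreal_powr b (1 / (p - 1))"
    by (rule ennreal_powr_mono) (use False assms in auto)
  then have "a \<le> ennreal_powr b (1 / (p - 1))" using assms by (simp add: ennreal_powr_powr)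
  then have "a * b \<le> ennreal_powr b (1 / (p - 1)) * ennreal_powr b 1" by (simp add: mult_right_mono)
  also have "\<dots> = ennreal_powr b (p / (p - 1))"
  proof -
    have "1 / (p - 1) + 1 = p / (p - 1)" using assms by (simp add: field_simps)
    then show ?thesis by (simp only: ennreal_powr_add[symmetric])
  qed
  finally show ?thesis by (simp add: add_increasing)
qed

text \<open>The dual side of the weighted norm, with conjugate exponent \<open>p / (p - 1)\<close>.
  The condition on \<open>\<alpha>\<close> gives integrability at the origin; at infinity
  \<open>K\<close> powers of decay of \<open>\<phi>\<close> outweigh any weight.\<close>

lemma weighted_schwartz_finite:
  fixes \<phi> :: "real^'n::finite \<Rightarrow> complex"
  assumes \<phi>: "\<phi> \<in> schwartz" and p: "1 < p" and \<alpha>: "\<alpha> < real CARD('n) * (1 - 1 / p)"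
  shows "(\<integral>\<^sup>+x. ennreal_powr (ennreal (norm x powr (- \<alpha>) * cmod (\<phi> x))) (p / (p - 1)) \<partial>lborel) < \<top>"
proof -
  let ?n = "CARD('n)"
  define p' where "p' = p / (p - 1)"
  have p': "1 \<le> p'" using p by (simp add: p'_def)
  define K where "K = nat \<lceil>real ?n + 1 + \<bar>\<alpha>\<bar>\<rceil>"
  have K: "real ?n + 1 + \<bar>\<alpha>\<bar> \<le> real K" unfolding K_def by (rule real_nat_ceiling_ge)
  obtain C where C: "0 \<le> C" "\<And>x. (1 + norm x) ^ K * cmod (\<phi> x) \<le> C" by (rule schwartz_bound[OF \<phi>]) (rule that; assumption)
  have \<beta>1: "- real DIM(real^'n) < - \<alpha> * p'"
  proof -
    have "\<alpha> * p' < real ?n * (1 - 1 / p) * p'" using \<alpha> p' by (intro mult_strict_right_mono) auto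
    also have "\<dots> = real ?n" using p by (simp add: p'_def field_simps)
    finally show ?thesis by simp
  qed
  have \<beta>2: "(- \<alpha> - real K) * p' < - real DIM(real^'n)"
  proof -
    have "real ?n + 1 \<le> \<alpha> + real K" using K by linarith
    then have "(real ?n + 1) * 1 \<le> (\<alpha> + real K) * p'" using p' by (intro mult_mono) auto
    moreover have "(- \<alpha> - real K) * p' = - ((\<alpha> + real K) * p')" by (simp add: algebra_simps)
    ultimately show ?thesis by simp
  qed
  have pt: "ennreal_powr (ennreal (norm x powr (- \<alpha>) * cmod (\<phi> x))) p' \<le> ennreal (C powr p') *
     (ennreal (norm x powr (- \<alpha> * p')) * indicator (ball 0 1) x + ennreal (norm x powr ((- \<alpha> - real K) * p')) * indicator (- ball 0 1) x)" for x
  proof (cases "norm x < 1")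
    case True
    have "1 * cmod (\<phi> x) \<le> (1 + norm x) ^ K * cmod (\<phi> x)" by (intro mult_right_mono one_le_power) auto
    then have "cmod (\<phi> x) \<le> C" using C(2)[of x] by linarith
    then have "(norm x powr (- \<alpha>) * cmod (\<phi> x)) powr p' \<le> (norm x powr (- \<alpha>) * C) powr p'"
      using p' by (intro powr_mono2 mult_left_mono) auto
    also have "\<dots> = C powr p' * norm x powr (- \<alpha> * p')" using C(1) by (simp add: powr_mult powr_powr mult.commute)
    finally show ?thesis using True C(1) by (simp add: ennreal_powr_ennreal ennreal_mult[symmetric] ennreal_leI)
  next
    case False
    then have x: "1 \<le> norm x" by simp
    have "norm x ^ K * cmod (\<phi> x) \<le> (1 + norm x) ^ K * cmod (\<phi> x)" by (intro mult_right_mono power_mono) auto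
    then have "norm x ^ K * cmod (\<phi> x) \<le> C" using C(2)[of x] by linarith
    moreover have "0 < norm x ^ K" using x by (intro zero_less_power) linarith
    ultimately have "cmod (\<phi> x) \<le> C / norm x ^ K" by (simp add: pos_le_divide_eq mult.commute)
    also have "\<dots> = C * norm x powr (- real K)"
    proof -
      have "0 < norm x" using x by linarith
      from powr_realpow[OF this, of K] show ?thesis by (simp add: powr_minus divide_inverse)
    qed
    finally have "(norm x powr (- \<alpha>) * cmod (\<phi> x)) powr p' \<le> (norm x powr (- \<alpha>) * (C * norm x powr (- real K))) powr p'"
      using p' by (intro powr_mono2 mult_left_mono) auto
    also have "norm x powr (- \<alpha>) * (C * norm x powr (- real K)) = C * norm x powr (- \<alpha> - real K)"
      by (simp add: powr_diff powr_minus divide_inverse)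
    also have "\<dots> powr p' = C powr p' * norm x powr ((- \<alpha> - real K) * p')" using C(1) by (simp add: powr_mult powr_powr)
    finally show ?thesis using False C(1) by (simp add: ennreal_powr_ennreal ennreal_mult[symmetric] ennreal_leI)
  qed
  have "(\<integral>\<^sup>+x. ennreal_powr (ennreal (norm x powr (- \<alpha>) * cmod (\<phi> x))) p' \<partial>lborel)
    \<le> (\<integral>\<^sup>+x. ennreal (C powr p') * (ennreal (norm x powr (- \<alpha> * p')) * indicator (ball 0 1) x + ennreal (norm x powr ((- \<alpha> - real
      K) * p')) * indicator (- ball 0 1) x) \<partial>(lborel :: (real^'n) measure))"
    by (intro nn_integral_mono pt)
  also have "\<dots> = ennreal (C powr p') * ((\<integral>\<^sup>+x. ennreal (norm x powr (- \<alpha> * p')) * indicator (ball 0 1) x \<partial>(lborel :: (real^'n) measure))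
      + (\<integral>\<^sup>+x. ennreal (norm x powr ((- \<alpha> - real K) * p')) * indicator (- ball 0 1) x \<partial>(lborel :: (real^'n) measure)))"
  proof -
    have b: "ball 0 1 \<in> sets (lborel :: (real^'n) measure)" "- ball 0 1 \<in> sets (lborel :: (real^'n) measure)"
      by simp_all
    have m: "(\<lambda>x. ennreal (norm x powr \<beta>)) \<in> borel_measurable (lborel :: (real^'n) measure)" for \<beta> by measurable
    have m1: "(\<lambda>x. ennreal (norm x powr \<beta>) * indicator (ball 0 1) x) \<in> borel_measurable (lborel :: (real^'n) measure)"
      "(\<lambda>x. ennreal (norm x powr \<beta>) * indicator (- ball 0 1) x) \<in> borel_measurable (lborel :: (real^'n) measure)" for \<beta>
      by (rule borel_measurable_times_ennreal[OF m borel_measurable_indicator[OF b(1)]],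
          rule borel_measurable_times_ennreal[OF m borel_measurable_indicator[OF b(2)]])
    show ?thesis
      by (simp only: nn_integral_cmult[OF borel_measurable_add[OF m1(1) m1(2)]] nn_integral_add[OF m1(1) m1(2)])
  qed
  also have "\<dots> < \<top>"
    using nn_integral_radial_powr_near[OF \<beta>1] nn_integral_radial_powr_far[OF \<beta>2]
    by (intro ennreal_mult_less_top[THEN iffD2] conjI) (auto simp: ennreal_mult_less_top)
  finally show ?thesis by (simp only: p'_def)
qed

text \<open>The weighted sum of the moduli lies in the space of exponent \<open>p\<close>, and
  \<open>\<phi>\<close> divided by the weight in the dual one, so the sum of the moduli of
  \<open>D j x * \<phi> x\<close> is integrable. Hence sum and integral may be exchanged, and the
  limit assumed for the pairings identifies the distribution.\<close>

lemma represents_series: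
  fixes D :: "nat \<Rightarrow> real^'n::finite \<Rightarrow> complex" and u :: "'n distr"
  assumes D [measurable]: "\<And>j. D j \<in> borel_measurable borel" and p: "1 < p" and \<alpha>: "\<alpha> < real CARD('n) * (1 - 1 / p)"
    and fin: "Lp_norm p lborel (\<lambda>x. \<Sum>j. ennreal (norm x powr \<alpha> * cmod (D j x))) \<noteq> \<top>"
    and Di: "\<And>\<phi> j. \<phi> \<in> schwartz \<Longrightarrow> integrable lborel (\<lambda>x. D j x * \<phi> x)"
    and conv: "\<And>\<phi>. \<phi> \<in> schwartz \<Longrightarrow> (\<lambda>J. \<Sum>j<J. LINT x|lborel. D j x * \<phi> x) \<longlonglongrightarrow> u \<phi>"
  shows "represents (\<lambda>x. \<Sum>j. D j x) u"
  unfolding represents_def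
proof (intro conjI ballI)
  show "(\<lambda>x. \<Sum>j. D j x) \<in> borel_measurable lborel" by measurable
  fix \<phi> :: "real^'n \<Rightarrow> complex" assume \<phi>: "\<phi> \<in> schwartz"
  have [measurable]: "\<phi> \<in> borel_measurable borel" by (rule schwartz_measurable[OF \<phi>])
  define B where "B x = (\<Sum>j. ennreal (norm x powr \<alpha> * cmod (D j x)))" for x
  define b where "b x = ennreal (norm x powr (- \<alpha>) * cmod (\<phi> x))" for x
  have [measurable]: "B \<in> borel_measurable borel" "b \<in> borel_measurable borel" unfolding B_def b_def by measurable
  define Q where "Q x = (\<Sum>j. ennreal (cmod (D j x * \<phi> x)))" for x
  have [measurable]: "Q \<in> borel_measurable borel" unfolding Q_def by measurable
  have QB: "Q x = B x * b x" if "x \<noteq> 0" for x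
  proof -
    have nn: "0 < norm x" using that by simp
    have "ennreal (cmod (D j x * \<phi> x)) = ennreal (norm x powr \<alpha> * cmod (D j x)) * b x" for j
    proof -
      have "norm x powr \<alpha> * norm x powr (- \<alpha>) = 1" using nn by (simp add: powr_add[symmetric])
      then have "cmod (D j x * \<phi> x) = (norm x powr \<alpha> * cmod (D j x)) * (norm x powr (- \<alpha>) * cmod (\<phi> x))"
        by (metis (no_types, opaque_lifting) mult.assoc mult.commute mult.left_neutral norm_mult)
      then show ?thesis unfolding b_def by (simp only: ennreal_mult mult_nonneg_nonneg powr_ge_zero norm_ge_zero)
    qed
    then show ?thesis by (simp add: Q_def B_def)
  qed
  have "(\<integral>\<^sup>+x. Q x \<partial>lborel) \<le> (\<integral>\<^sup>+x. ennreal_powr (B x) p + ennreal_powr (b x) (p / (p - 1)) \<partial>lborel)"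
  proof (intro nn_integral_mono_AE)
    have "AE x in lborel. x \<noteq> (0::real^'n)" by (rule AE_lborel_singleton)
    then show "AE x in lborel. Q x \<le> ennreal_powr (B x) p + ennreal_powr (b x) (p / (p - 1))"
      by eventually_elim (simp add: QB ennreal_Young[OF p])
  qed
  also have "\<dots> = (\<integral>\<^sup>+x. ennreal_powr (B x) p \<partial>lborel) + (\<integral>\<^sup>+x. ennreal_powr (b x) (p / (p - 1)) \<partial>lborel)"
    by (rule nn_integral_add) measurable
  also have "\<dots> < \<top>"
  proof -
    have "(\<integral>\<^sup>+x. ennreal_powr (B x) p \<partial>lborel) \<noteq> \<top>"
      using fin unfolding Lp_norm_def B_def[symmetric] by simp
    moreover have "(\<integral>\<^sup>+x. ennreal_powr (b x) (p / (p - 1)) \<partial>lborel) < \<top>"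
      unfolding b_def by (rule weighted_schwartz_finite[OF \<phi> p \<alpha>])
    ultimately show ?thesis by (simp add: less_top[symmetric])
  qed
  finally have Qf: "(\<integral>\<^sup>+x. Q x \<partial>lborel) \<noteq> \<top>" by simp
  have sN: "AE x in lborel. summable (\<lambda>j. norm (D j x * \<phi> x))"
  proof -
    have "AE x in lborel. Q x \<noteq> \<infinity>" by (rule nn_integral_noteq_infinite) (use Qf in auto)
    then show ?thesis
      by eventually_elim (rule summable_suminf_not_top, simp, simp add: Q_def)
  qed
  have sI: "summable (\<lambda>j. LINT x|lborel. norm (D j x * \<phi> x))"
  proof (rule summable_suminf_not_top)
    have "(\<Sum>j. ennreal (LINT x|lborel. norm (D j x * \<phi> x))) = (\<Sum>j. \<integral>\<^sup>+x. ennreal (norm (D j x * \<phi> x)) \<partial>lborel)"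
      by (intro suminf_cong nn_integral_eq_integral[symmetric] integrable_norm Di[OF \<phi>]) auto
    also have "\<dots> = (\<integral>\<^sup>+x. Q x \<partial>lborel)" unfolding Q_def by (rule nn_integral_suminf[symmetric]) measurable
    finally show "(\<Sum>j. ennreal (LINT x|lborel. norm (D j x * \<phi> x))) \<noteq> \<top>" using Qf by simp
  qed simp
  have AEs: "AE x in lborel. (\<Sum>j. D j x * \<phi> x) = (\<Sum>j. D j x) * \<phi> x"
    using sN
  proof eventually_elim
    case (elim x)
    then have "summable (\<lambda>j. D j x * \<phi> x)" by (rule summable_norm_cancel)
    then have s: "summable (\<lambda>j. \<phi> x * D j x)" by (simp only: mult.commute)
    \<comment> \<open>Where \<open>\<phi> x = 0\<close> the series of \<open>D j x\<close> itself
      may diverge, but both sides are 0.\<close>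
    show ?case
    proof (cases "\<phi> x = 0")
      case False
      then have "summable (\<lambda>j. D j x)" using s by (simp add: summable_cmult_iff)
      then show ?thesis by (rule suminf_mult2[symmetric])
    qed simp
  qed
  have i1: "integrable lborel (\<lambda>x. \<Sum>j. D j x * \<phi> x)" by (rule integrable_suminf[OF Di[OF \<phi>] sN sI])
  show "integrable lborel (\<lambda>x. (\<Sum>j. D j x) * \<phi> x)"
    by (rule integrable_cong_AE_imp[OF i1 _ AEs]) measurable
  have "(\<lambda>j. LINT x|lborel. D j x * \<phi> x) sums (LINT x|lborel. (\<Sum>j. D j x * \<phi> x))"
    by (rule sums_integral[OF Di[OF \<phi>] sN sI])
  then have "u \<phi> = (LINT x|lborel. (\<Sum>j. D j x * \<phi> x))"
    unfolding sums_def by (rule LIMSEQ_unique[OF conv[OF \<phi>]])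
  also have "\<dots> = (LINT x|lborel. (\<Sum>j. D j x) * \<phi> x)"
    by (rule integral_cong_AE[OF _ _ AEs]) measurable
  finally show "u \<phi> = (LINT x|lborel. (\<Sum>j. D j x) * \<phi> x)" .
qed

section \<open>Assembling the random mixed norm\<close>

lemma mixed_norm_measurable:
  fixes F :: "'w \<Rightarrow> real \<Rightarrow> 'a::euclidean_space \<Rightarrow> ennreal"
  assumes F: "(\<lambda>(\<omega>, t, x). F \<omega> t x) \<in> borel_measurable (M \<Otimes>\<^sub>M lborel \<Otimes>\<^sub>M lborel)"
  shows "\<omega> \<in> space M \<Longrightarrow> F \<omega> t \<in> borel_measurable lborel"
    and "\<omega> \<in> space M \<Longrightarrow> (\<lambda>t. Lp_norm p lborel (F \<omega> t)) \<in> borel_measurable lborel"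
    and "(\<lambda>\<omega>. Lp_norm q lborel (\<lambda>t. Lp_norm p lborel (F \<omega> t))) \<in> borel_measurable M"
proof -
  note sL = lborel.sigma_finite_measure_axioms
  show "F \<omega> t \<in> borel_measurable lborel" if [measurable]: "\<omega> \<in> space M"
  proof -
    have "(\<lambda>x. (\<omega>, t, x)) \<in> measurable lborel (M \<Otimes>\<^sub>M lborel \<Otimes>\<^sub>M lborel)"
      using that by (intro measurable_Pair measurable_const) auto
    from measurable_compose[OF this F] show ?thesis by simp
  qed
  show "(\<lambda>t. Lp_norm p lborel (F \<omega> t)) \<in> borel_measurable lborel" if "\<omega> \<in> space M"
  proof (rule measurable_Lp_norm[OF sL])
    have "(\<lambda>z. (\<omega>, z)) \<in> measurable (lborel \<Otimes>\<^sub>M lborel) (M \<Otimes>\<^sub>M lborel \<Otimes>\<^sub>M lborel)"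
      using that by (rule measurable_Pair1')
    from measurable_compose[OF this F] show "(\<lambda>(t, x). F \<omega> t x) \<in> borel_measurable (lborel \<Otimes>\<^sub>M lborel)" by simp
  qed
  have "(\<lambda>z. (fst (fst z), snd (fst z), snd z)) \<in> measurable ((M \<Otimes>\<^sub>M lborel) \<Otimes>\<^sub>M lborel) (M \<Otimes>\<^sub>M lborel \<Otimes>\<^sub>M lborel)"
    by measurable
  from measurable_compose[OF this F] have "(\<lambda>(y, x). F (fst y) (snd y) x) \<in> borel_measurable ((M \<Otimes>\<^sub>M lborel) \<Otimes>\<^sub>M lborel)"
    by (simp add: case_prod_unfold)
  from measurable_Lp_norm[OF sL this, of p]
  have "(\<lambda>(\<omega>, t). Lp_norm p lborel (F \<omega> t)) \<in> borel_measurable (M \<Otimes>\<^sub>M lborel)"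
    by (simp add: case_prod_unfold)
  then show "(\<lambda>\<omega>. Lp_norm q lborel (\<lambda>t. Lp_norm p lborel (F \<omega> t))) \<in> borel_measurable M"
    by (rule measurable_Lp_norm[OF sL])
qed

lemma mixed_norm_suminf:
  fixes F :: "nat \<Rightarrow> 'w \<Rightarrow> real \<Rightarrow> 'a::euclidean_space \<Rightarrow> ennreal"
  assumes M: "sigma_finite_measure M" and F: "\<And>j. (\<lambda>(\<omega>, t, x). F j \<omega> t x) \<in> borel_measurable (M \<Otimes>\<^sub>M lborel \<Otimes>\<^sub>M lborel)"
    and pqr: "1 \<le> p" "1 \<le> q" "1 \<le> r"
  shows "Lp_norm r M (\<lambda>\<omega>. Lp_norm q lborel (\<lambda>t. Lp_norm p lborel (\<lambda>x. \<Sum>j. F j \<omega> t x)))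
    \<le> (\<Sum>j. Lp_norm r M (\<lambda>\<omega>. Lp_norm q lborel (\<lambda>t. Lp_norm p lborel (F j \<omega> t))))"
proof -
  note sL = lborel.sigma_finite_measure_axioms
  note mm = mixed_norm_measurable[OF F]
  have "Lp_norm r M (\<lambda>\<omega>. Lp_norm q lborel (\<lambda>t. Lp_norm p lborel (\<lambda>x. \<Sum>j. F j \<omega> t x)))
    \<le> Lp_norm r M (\<lambda>\<omega>. \<Sum>j. Lp_norm q lborel (\<lambda>t. Lp_norm p lborel (F j \<omega> t)))"
  proof (rule Lp_norm_mono)
    fix \<omega> assume \<omega>: "\<omega> \<in> space M"
    have "Lp_norm q lborel (\<lambda>t. Lp_norm p lborel (\<lambda>x. \<Sum>j. F j \<omega> t x)) \<le> Lp_norm q lborel (\<lambda>t. \<Sum>j. Lp_norm p lborel (F j \<omega> t))"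
      by (rule Lp_norm_mono) (use pqr in \<open>auto intro!: Lp_norm_suminf[OF sL mm(1)[OF \<omega>]]\<close>)
    also have "\<dots> \<le> (\<Sum>j. Lp_norm q lborel (\<lambda>t. Lp_norm p lborel (F j \<omega> t)))"
      by (rule Lp_norm_suminf[OF sL mm(2)[OF \<omega>] pqr(2)])
    finally show "Lp_norm q lborel (\<lambda>t. Lp_norm p lborel (\<lambda>x. \<Sum>j. F j \<omega> t x)) \<le> (\<Sum>j. Lp_norm q lborel (\<lambda>t. Lp_norm p lborel (F j \<omega> t)))" .
  qed (use pqr in simp)
  also have "\<dots> \<le> (\<Sum>j. Lp_norm r M (\<lambda>\<omega>. Lp_norm q lborel (\<lambda>t. Lp_norm p lborel (F j \<omega> t))))"
    by (rule Lp_norm_suminf[OF M mm(3) pqr(3)])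
  finally show ?thesis .
qed

lemma Lp_norm_2_count_space:
  assumes "finite I" "\<And>k. 0 \<le> x k"
  shows "Lp_norm 2 (count_space I) (\<lambda>k. ennreal (x k)) = ennreal (sqrt (\<Sum>k\<in>I. (x k)\<^sup>2))"
proof -
  have "(\<integral>\<^sup>+k. ennreal_powr (ennreal (x k)) 2 \<partial>count_space I) = ennreal (\<Sum>k\<in>I. (x k)\<^sup>2)"
    using assms by (simp add: nn_integral_count_space_finite ennreal_powr_ennreal sum_ennreal)
  then show ?thesis by (simp add: Lp_norm_def ennreal_powr_ennreal powr_half_sqrt sum_nonneg)
qed

lemma wave_block_norm:
  fixes v :: "real^'n::finite \<Rightarrow> complex"
  assumes [measurable]: "v \<in> borel_measurable borel" and \<epsilon>: "\<epsilon> \<in> {1, -1}" and pq: "0 < p" "0 < q"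
  shows "Lp_norm q lborel (\<lambda>t. Lp_norm p lborel (\<lambda>x. ennreal (norm x powr \<alpha> * cmod (wave_block \<epsilon> \<gamma> v k t x))))
    = ennreal ((2 * pi) powr (- real CARD('n) / 2)) * det_norm q p \<alpha> (block \<gamma> v k)"
proof -
  define c where "c = (2 * pi) powr (- real CARD('n) / 2)"
  have c: "0 \<le> c" by (simp add: c_def)
  define H where "H = block \<gamma> v k"
  have [measurable]: "H \<in> borel_measurable borel" unfolding H_def by measurable
  define N where "N t = Lp_norm p lborel (\<lambda>x. ennreal (norm x powr \<alpha> * cmod (wave H t x)))" for t
  have "(\<lambda>(t, x). ennreal (norm x powr \<alpha> * cmod (wave H t x))) \<in> borel_measurable (borel \<Otimes>\<^sub>M borel)" by measurable
  then have [measurable]: "N \<in> borel_measurable borel"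
    unfolding N_def[abs_def] by (intro measurable_Lp_norm[OF lborel.sigma_finite_measure_axioms]) (simp cong: measurable_cong_sets)
  have e: "Lp_norm p lborel (\<lambda>x. ennreal (norm x powr \<alpha> * cmod (wave_block \<epsilon> \<gamma> v k t x))) = ennreal c * N (\<epsilon> *\<^sub>R t)" for t
  proof -
    have "ennreal (norm x powr \<alpha> * cmod (wave_block \<epsilon> \<gamma> v k t x)) = ennreal c * ennreal (norm x powr \<alpha> * cmod (wave H (\<epsilon> * t) x))" for x
    proof -
      have "norm x powr \<alpha> * cmod (wave_block \<epsilon> \<gamma> v k t x) = c * (norm x powr \<alpha> * cmod (wave H (\<epsilon> * t) x))"
        unfolding wave_block_def c_def[symmetric] H_def[symmetric] norm_mult using c by simp
      then show ?thesis using c by (simp only: ennreal_mult mult_nonneg_nonneg powr_ge_zero norm_ge_zero)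
    qed
    then have "Lp_norm p lborel (\<lambda>x. ennreal (norm x powr \<alpha> * cmod (wave_block \<epsilon> \<gamma> v k t x)))
      = Lp_norm p lborel (\<lambda>x. ennreal c * ennreal (norm x powr \<alpha> * cmod (wave H (\<epsilon> * t) x)))" by simp
    also have "\<dots> = ennreal c * N (\<epsilon> * t)" unfolding N_def by (rule Lp_norm_cmult[OF _ pq(1)]) measurable
    finally show ?thesis by simp
  qed
  have "Lp_norm q lborel (\<lambda>t. ennreal c * N (\<epsilon> *\<^sub>R t)) = ennreal c * Lp_norm q lborel (\<lambda>t. N (\<epsilon> *\<^sub>R t))"
    by (rule Lp_norm_cmult[OF _ pq(2)]) measurable
  also have "Lp_norm q lborel (\<lambda>t. N (\<epsilon> *\<^sub>R t)) = ennreal (\<bar>\<epsilon>\<bar> powr (- real DIM(real) / q)) * Lp_norm q lborel N"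
    by (rule Lp_norm_scale) (use \<epsilon> pq in auto)
  also have "ennreal (\<bar>\<epsilon>\<bar> powr (- real DIM(real) / q)) = 1" using \<epsilon> by auto
  finally show ?thesis by (simp add: e det_norm_def N_def[abs_def] c_def H_def)
qed

lemma block_energy:
  fixes v :: "real^'n::finite \<Rightarrow> complex"
  assumes \<gamma>: "0 < \<gamma>" and [measurable]: "v \<in> borel_measurable borel"
    and vs: "integrable lborel (\<lambda>\<xi>. (1 + (norm \<xi>)\<^sup>2) powr s * (cmod (v \<xi>))\<^sup>2)"
  shows "integrable lborel (\<lambda>\<xi>. (1 + (norm \<xi>)\<^sup>2) powr s * (cmod (block \<gamma> v k \<xi>))\<^sup>2)"
    and "(\<Sum>k<n. LINT \<xi>|lborel. (1 + (norm \<xi>)\<^sup>2) powr s * (cmod (block \<gamma> v k \<xi>))\<^sup>2) \<le> (LINT \<xi>|lborel. (1 + (norm \<xi>)\<^sup>2) powr s * (cmod (v \<xi>))\<^sup>2)"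
proof -
  have i: "integrable lborel (\<lambda>\<xi>. (1 + (norm \<xi>)\<^sup>2) powr s * (cmod (block \<gamma> v k \<xi>))\<^sup>2)" for k
  proof (rule Bochner_Integration.integrable_bound[OF vs])
    show "AE \<xi> in lborel. norm ((1 + (norm \<xi>)\<^sup>2) powr s * (cmod (block \<gamma> v k \<xi>))\<^sup>2) \<le> norm ((1 + (norm \<xi>)\<^sup>2) powr s * (cmod (v \<xi>))\<^sup>2)"
      by (auto simp: block_eq[OF \<gamma>])
  qed measurable
  then show "integrable lborel (\<lambda>\<xi>. (1 + (norm \<xi>)\<^sup>2) powr s * (cmod (block \<gamma> v k \<xi>))\<^sup>2)" .
  have "(\<Sum>k<n. LINT \<xi>|lborel. (1 + (norm \<xi>)\<^sup>2) powr s * (cmod (block \<gamma> v k \<xi>))\<^sup>2) = (LINT \<xi>|lborel. (\<Sum>k<n. (1 + (norm \<xi>)\<^sup>2) powr s * (cmod (block \<gamma> v k \<xi>))\<^sup>2))"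
    by (rule Bochner_Integration.integral_sum[symmetric]) (rule i)
  also have "\<dots> \<le> (LINT \<xi>|lborel. (1 + (norm \<xi>)\<^sup>2) powr s * (cmod (v \<xi>))\<^sup>2)"
  proof (rule integral_mono[OF Bochner_Integration.integrable_sum[OF i] vs])
    fix \<xi> :: "real^'n"
    have "(\<Sum>k<n. (1 + (norm \<xi>)\<^sup>2) powr s * (cmod (block \<gamma> v k \<xi>))\<^sup>2) = (\<Sum>k<n. if k = block_index \<gamma> \<xi> then (1 + (norm \<xi>)\<^sup>2) powr s * (cmod (v \<xi>))\<^sup>2 else 0)"
      by (intro sum.cong) (auto simp: block_eq[OF \<gamma>])
    then show "(\<Sum>k<n. (1 + (norm \<xi>)\<^sup>2) powr s * (cmod (block \<gamma> v k \<xi>))\<^sup>2) \<le> (1 + (norm \<xi>)\<^sup>2) powr s * (cmod (v \<xi>))\<^sup>2"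
      by simp
  qed
  finally show "(\<Sum>k<n. LINT \<xi>|lborel. (1 + (norm \<xi>)\<^sup>2) powr s * (cmod (block \<gamma> v k \<xi>))\<^sup>2) \<le> (LINT \<xi>|lborel. (1 + (norm \<xi>)\<^sup>2) powr s * (cmod (v \<xi>))\<^sup>2)" .
qed

text \<open>A series that does not converge absolutely makes the right side infinite, so the default
  value of \<open>suminf\<close> does no harm.\<close>

lemma ennreal_norm_suminf_le:
  fixes f :: "nat \<Rightarrow> complex"
  shows "ennreal (cmod (\<Sum>j. f j)) \<le> (\<Sum>j. ennreal (cmod (f j)))"
proof (cases "(\<Sum>j. ennreal (cmod (f j))) = \<top>")
  case False
  then have s: "summable (\<lambda>j. cmod (f j))" by (intro summable_suminf_not_top) auto
  have "ennreal (cmod (\<Sum>j. f j)) \<le> ennreal (\<Sum>j. cmod (f j))" by (intro ennreal_leI summable_norm s)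
  also have "\<dots> = (\<Sum>j. ennreal (cmod (f j)))" by (rule suminf_ennreal2[symmetric]) (use s in auto)
  finally show ?thesis .
qed simp

lemma sum_consecutive_blocks:
  fixes a :: "nat \<Rightarrow> complex"
  assumes "N 0 = 0" "strict_mono N"
  shows "(\<Sum>j<J. \<Sum>k\<in>{N j..<N (Suc j)}. a k) = (\<Sum>k<N J. a k)"
proof (induction J)
  case (Suc J)
  have "N J \<le> N (Suc J)" using assms(2) by (simp add: strict_mono_less_eq)
  then show ?case using Suc by (simp add: lessThan_atLeast0 sum.atLeastLessThan_concat)
qed (simp add: assms)

theorem lemma3p4:
  fixes \<gamma> p q \<alpha> s d :: real
  assumes d_def: "d = real CARD('n::finite)"
    and "\<gamma> > 0" and "2 \<le> p" and "2 \<le> q"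
    and "- d / p < \<alpha>" and "\<alpha> < (d - 1) * (1 / 2 - 1 / p) - 1 / q"
    and "s \<ge> d / 2 - 1 / q - d / p - \<alpha> - (1 / \<gamma>) * (1 / 2 - 1 / min p q)"
  shows "\<exists>C>0. \<forall>(M :: 'w measure) g (f :: 'n distr) \<sigma> \<epsilon>.
      iid_std_gaussians M g \<longrightarrow> f \<in> sobolev s \<longrightarrow> radial f \<longrightarrow> 1 \<le> \<sigma> \<longrightarrow> \<epsilon> \<in> {1, -1} \<longrightarrow>
      weighted_mixed_norm M \<sigma> q p \<alpha> (\<lambda>\<omega> t. half_wave \<epsilon> t (radial_randomization g \<gamma> f \<omega>))
        \<le> ennreal (C * sqrt \<sigma> * sobolev_norm s f)"
proof -
  let ?n = "CARD('n)"
  note \<gamma> = assms(2) and p = assms(3) and q = assms(4)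
  obtain C where C: "0 < C" "\<And>(v::real^'n \<Rightarrow> complex) k A. v \<in> borel_measurable borel \<Longrightarrow> radial_ae v \<Longrightarrow> 0 \<le> A \<Longrightarrow>
    (\<integral>\<^sup>+\<xi>. ennreal ((1 + (norm \<xi>)\<^sup>2) powr s * (cmod (block \<gamma> v k \<xi>))\<^sup>2) \<partial>lborel) \<le> ennreal (A\<^sup>2) \<Longrightarrow>
    det_norm q p \<alpha> (block \<gamma> v k) \<le> ennreal (C * A)"
    using det_norm_block[OF assms(2-7)[unfolded d_def]] by auto
  define c0 where "c0 = (2 * pi) powr (- real ?n / 2)"
  have c0: "0 < c0" by (simp add: c0_def)
  \<comment> \<open>The condition under which Schwartz functions pair with the weighted space; it
    follows from the upper bound on \<open>\<alpha>\<close>.\<close>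
  have \<alpha>p: "\<alpha> < real ?n * (1 - 1 / p)"
  proof -
    have "1 \<le> real ?n" by (simp add: Suc_leI)
    then have "(real ?n - 1) * (1 / 2 - 1 / p) \<le> real ?n * (1 - 1 / p)" using p by (intro mult_mono) (auto simp: field_simps)
    moreover have "0 < 1 / q" using q by simp
    ultimately show ?thesis using assms(6) unfolding d_def by linarith
  qed
  \<comment> \<open>The factor 2 is the sum of the geometric series over the groups. The root comes
    from \<open>8 * m \<le> 4 * (p + q + 3) * \<sigma>\<close>, which uses
    \<open>1 \<le> \<sigma>\<close>.\<close>
  define C1 where "C1 = 2 * (c0 * C) * sqrt (4 * (p + q + 3))"
  have C1: "0 < C1" using c0 C(1) p q by (simp add: C1_def)
  show ?thesis
  proof (intro exI[of _ C1] conjI allI impI)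
    show "0 < C1" by fact
    fix M :: "'w measure" and g and f :: "'n distr" and \<sigma> \<epsilon> :: real
    assume g: "iid_std_gaussians M g" and f: "f \<in> sobolev s" and rad: "radial f" and \<sigma>: "1 \<le> \<sigma>" and \<epsilon>: "\<epsilon> \<in> {1, -1}"
    interpret prob_space M using g by (simp add: iid_std_gaussians_def)
    have sM: "sigma_finite_measure M" by (rule sigma_finite_measure_axioms)
    define v where "v = fourier_fun f"
    note v = sobolev_symbol[OF f, folded v_def]
    note v(2) [measurable]
    have vr: "radial_ae v" unfolding radial_ae_def using radial_symbol[OF rad v(1)] by simp
    define T where "T = (LINT \<xi>|lborel. (1 + (norm \<xi>)\<^sup>2) powr s * (cmod (v \<xi>))\<^sup>2)"
    have T0: "0 \<le> T" unfolding T_def by (rule Bochner_Integration.integral_nonneg) simp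
    define a where "a k = (LINT \<xi>|lborel. (1 + (norm \<xi>)\<^sup>2) powr s * (cmod (block \<gamma> v k \<xi>))\<^sup>2)" for k
    have a0: "0 \<le> a k" for k unfolding a_def by (rule Bochner_Integration.integral_nonneg) simp
    have aT: "(\<Sum>k<n. a k) \<le> T" for n unfolding a_def T_def by (rule block_energy(2)[OF \<gamma> v(2,3)])
    obtain N where N: "N 0 = 0" "strict_mono N" "\<And>j. (\<Sum>k\<in>{N j..<N (Suc j)}. a k) \<le> T / 4 ^ j"
      by (rule lacunary_subsequence[of a T, OF a0 aT]) (rule that; assumption)
    \<comment> \<open>\<open>2 * m\<close> must be at least \<open>p\<close>, \<open>q\<close> and
      \<open>\<sigma>\<close>, yet is at most \<open>p + q + \<sigma> + 2\<close>, so that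
      \<open>sqrt (8 * m)\<close> remains of order \<open>sqrt \<sigma>\<close>.\<close>
    define m where "m = nat \<lceil>(p + q + \<sigma>) / 2\<rceil>"
    define r where "r = real (2 * m)"
    have m_lo: "(p + q + \<sigma>) / 2 \<le> real m" unfolding m_def by (rule real_nat_ceiling_ge)
    have m_hi: "real m \<le> (p + q + \<sigma>) / 2 + 1" 
    proof -
      have "real m = of_int \<lceil>(p + q + \<sigma>) / 2\<rceil>" unfolding m_def by (rule of_nat_nat) (use p q \<sigma> in simp)
      then show ?thesis using of_int_ceiling_le_add_one[of "(p + q + \<sigma>) / 2"] by simp
    qed
    have m0: "0 < m" using m_lo p q \<sigma> by (intro gr0I) simp
    have r: "p \<le> r" "q \<le> r" "\<sigma> \<le> r" "1 \<le> r" using m_lo p q \<sigma> by (auto simp: r_def)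
    define w :: "real^'n \<Rightarrow> real" where "w x = norm x powr \<alpha>" for x
    have w0: "0 \<le> w x" for x by (simp add: w_def)
    have wm [measurable]: "w \<in> borel_measurable borel" unfolding w_def by measurable
    define u where "u k t x = wave_block \<epsilon> \<gamma> v k t x" for k t x
    have um [measurable]: "(\<lambda>(t, x). u k t x) \<in> borel_measurable (borel \<Otimes>\<^sub>M borel)" for k
      unfolding u_def by (rule wave_block_measurable) measurable
    have [measurable]: "g k \<in> borel_measurable M" for k by (rule iid_measurable[OF g])
    define D where "D j \<omega> t x = (\<Sum>k\<in>{N j..<N (Suc j)}. complex_of_real (g k \<omega>) * u k t x)" for j \<omega> t x
    define F where "F j \<omega> t x = ennreal (w x * cmod (D j \<omega> t x))" for j \<omega> t x
    \<comment> \<open>\<open>suminf\<close> is total, so \<open>U\<close> is measurable everywhere;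
      that it represents the random distribution is claimed only almost everywhere, in
      \<open>rep\<close>.\<close>
    define U where "U \<omega> t x = (\<Sum>j. D j \<omega> t x)" for \<omega> t x
    have Dm [measurable]: "(\<lambda>(\<omega>, t, x). D j \<omega> t x) \<in> borel_measurable (M \<Otimes>\<^sub>M lborel \<Otimes>\<^sub>M lborel)" for j
      unfolding D_def by measurable
    have Fm [measurable]: "(\<lambda>(\<omega>, t, x). F j \<omega> t x) \<in> borel_measurable (M \<Otimes>\<^sub>M lborel \<Otimes>\<^sub>M lborel)" for j
      unfolding F_def D_def by measurable
    have Um: "(\<lambda>(\<omega>, t, x). U \<omega> t x) \<in> borel_measurable (M \<Otimes>\<^sub>M lborel \<Otimes>\<^sub>M lborel)"
      unfolding U_def D_def by measurable
    have Lm: "(\<lambda>(\<omega>, t, x). \<Sum>j. F j \<omega> t x) \<in> borel_measurable (M \<Otimes>\<^sub>M lborel \<Otimes>\<^sub>M lborel)"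
      unfolding F_def D_def by measurable
    have Dx: "D j \<omega> t \<in> borel_measurable borel" for j \<omega> t
      unfolding D_def[abs_def] by measurable

    have u_norm: "Lp_norm q lborel (\<lambda>t. Lp_norm p lborel (\<lambda>x. ennreal (w x * cmod (u k t x)))) \<le> ennreal (c0 * C * sqrt (a k))" for k
    proof -
      have "(\<integral>\<^sup>+\<xi>. ennreal ((1 + (norm \<xi>)\<^sup>2) powr s * (cmod (block \<gamma> v k \<xi>))\<^sup>2) \<partial>lborel) = ennreal (a k)"
        unfolding a_def by (rule nn_integral_eq_integral[OF block_energy(1)[OF \<gamma> v(2,3)]]) simp
      then have "det_norm q p \<alpha> (block \<gamma> v k) \<le> ennreal (C * sqrt (a k))"
        using a0[of k] by (intro C(2)[OF v(2) vr]) auto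
      moreover have "Lp_norm q lborel (\<lambda>t. Lp_norm p lborel (\<lambda>x. ennreal (w x * cmod (u k t x)))) = ennreal c0 * det_norm q p \<alpha> (block \<gamma> v k)"
        unfolding w_def u_def c0_def by (rule wave_block_norm[OF v(2) \<epsilon>]) (use p q in auto)
      ultimately have "Lp_norm q lborel (\<lambda>t. Lp_norm p lborel (\<lambda>x. ennreal (w x * cmod (u k t x)))) \<le> ennreal c0 * ennreal (C * sqrt (a k))"
        by (simp add: mult_left_mono)
      also have "\<dots> = ennreal (c0 * C * sqrt (a k))" using c0 by (simp add: ennreal_mult' mult.assoc)
      finally show ?thesis .
    qed
    have D_norm: "Lp_norm r M (\<lambda>\<omega>. Lp_norm q lborel (\<lambda>t. Lp_norm p lborel (F j \<omega> t))) \<le> ennreal (sqrt (real (8 * m)) * (c0 * C) * sqrt T * (1 / 2) ^ j)" for j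
    proof -
      let ?I = "{N j..<N (Suc j)}"
      have "Lp_norm r M (\<lambda>\<omega>. Lp_norm q lborel (\<lambda>t. Lp_norm p lborel (F j \<omega> t)))
        \<le> ennreal (sqrt (real (8 * m))) * Lp_norm 2 (count_space ?I) (\<lambda>k. Lp_norm q lborel (\<lambda>t. Lp_norm p lborel (\<lambda>x. ennreal (w x * cmod (u k t x)))))"
        unfolding r_def F_def[abs_def] D_def by (rule mixed_Khintchine[OF g _ m0 um wm w0 p q]) (use r in \<open>auto simp: r_def\<close>)
      also have "\<dots> \<le> ennreal (sqrt (real (8 * m))) * Lp_norm 2 (count_space ?I) (\<lambda>k. ennreal (c0 * C * sqrt (a k)))"
        by (intro mult_left_mono Lp_norm_mono u_norm) auto
      also have "Lp_norm 2 (count_space ?I) (\<lambda>k. ennreal (c0 * C * sqrt (a k))) = ennreal (sqrt (\<Sum>k\<in>?I. (c0 * C * sqrt (a k))\<^sup>2))"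
        using c0 C(1) a0 by (intro Lp_norm_2_count_space) auto
      also have "(\<Sum>k\<in>?I. (c0 * C * sqrt (a k))\<^sup>2) = (c0 * C)\<^sup>2 * (\<Sum>k\<in>?I. a k)"
        unfolding sum_distrib_left by (intro sum.cong refl) (simp add: power_mult_distrib a0)
      \<comment> \<open>The square root turns the energy bound \<open>T / 4 ^ j\<close> of the group
        into the geometric factor \<open>(1 / 2) ^ j\<close>.\<close>
      also have "ennreal (sqrt ((c0 * C)\<^sup>2 * (\<Sum>k\<in>?I. a k))) \<le> ennreal (c0 * C * sqrt T * (1 / 2) ^ j)"
      proof (rule ennreal_leI)
        have "sqrt ((c0 * C)\<^sup>2 * (\<Sum>k\<in>?I. a k)) \<le> sqrt ((c0 * C)\<^sup>2 * (T / 4 ^ j))"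
          by (intro real_sqrt_le_mono mult_left_mono N(3)) auto
        also have "(c0 * C)\<^sup>2 * (T / 4 ^ j) = (c0 * C * sqrt T * (1 / 2) ^ j)\<^sup>2"
        proof -
          have "((1 / 2 :: real) ^ j)\<^sup>2 = 1 / 4 ^ j"
            by (simp add: power_divide power_mult[symmetric] mult.commute[of j 2]) (simp add: power_mult)
          then show ?thesis using T0 by (simp add: power_mult_distrib)
        qed
        also have "sqrt ((c0 * C * sqrt T * (1 / 2) ^ j)\<^sup>2) = c0 * C * sqrt T * (1 / 2) ^ j"
          using c0 C(1) T0 by (intro real_sqrt_unique) auto
        finally show "sqrt ((c0 * C)\<^sup>2 * (\<Sum>k\<in>?I. a k)) \<le> c0 * C * sqrt T * (1 / 2) ^ j" .
      qed
      finally show ?thesis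
        using c0 C(1) T0 by (simp add: ennreal_mult[symmetric] mult.assoc mult_left_mono)
    qed
    define E where "E = sqrt (real (8 * m)) * (c0 * C) * sqrt T"
    have E0: "0 \<le> E" using c0 C(1) T0 by (simp add: E_def)
    have L_norm: "Lp_norm r M (\<lambda>\<omega>. Lp_norm q lborel (\<lambda>t. Lp_norm p lborel (\<lambda>x. \<Sum>j. F j \<omega> t x))) \<le> ennreal (2 * E)"
    proof -
      have "Lp_norm r M (\<lambda>\<omega>. Lp_norm q lborel (\<lambda>t. Lp_norm p lborel (\<lambda>x. \<Sum>j. F j \<omega> t x)))
        \<le> (\<Sum>j. Lp_norm r M (\<lambda>\<omega>. Lp_norm q lborel (\<lambda>t. Lp_norm p lborel (F j \<omega> t))))"
        by (rule mixed_norm_suminf[OF sM Fm]) (use p q r in auto)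
      also have "\<dots> \<le> (\<Sum>j. ennreal (E * (1 / 2) ^ j))"
        by (intro suminf_le summableI) (use D_norm in \<open>simp only: E_def\<close>)
      also have "\<dots> = ennreal (\<Sum>j. E * (1 / 2) ^ j)"
        by (rule suminf_ennreal2) (use E0 in \<open>auto intro!: summable_mult summable_geometric\<close>)
      also have "(\<Sum>j. E * (1 / 2) ^ j) = 2 * E"
        using suminf_mult[of "\<lambda>j. (1 / 2 :: real) ^ j" E] suminf_geometric[of "1 / 2 :: real"] by simp
      finally show ?thesis .
    qed
    have E_le: "2 * E \<le> C1 * sqrt \<sigma> * sobolev_norm s f"
    proof -
      have "8 * real m \<le> 8 * ((p + q + \<sigma>) / 2 + 1)" using m_hi by (rule mult_left_mono) simp
      then have "real (8 * m) \<le> 4 * (p + q + \<sigma> + 2)" by (simp add: field_simps)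
      also have "\<dots> \<le> 4 * (p + q + 3) * \<sigma>"
        using mult_left_mono[OF \<sigma>, of "p + q + 2"] p q by (simp add: algebra_simps)
      finally have "sqrt (real (8 * m)) \<le> sqrt (4 * (p + q + 3)) * sqrt \<sigma>"
        unfolding real_sqrt_mult[symmetric] by (rule real_sqrt_le_mono)
      then have "sqrt (real (8 * m)) * (2 * (c0 * C) * sqrt T) \<le> sqrt (4 * (p + q + 3)) * sqrt \<sigma> * (2 * (c0 * C) * sqrt T)"
        using c0 C(1) T0 by (intro mult_right_mono) auto
      moreover have "sobolev_norm s f = sqrt T" by (simp add: sobolev_norm_def T_def v_def)
      ultimately show ?thesis by (simp only: E_def C1_def mult_ac)
    qed
    have rep: "AE \<omega> in M. AE t in lborel. represents (U \<omega> t) (half_wave \<epsilon> t (radial_randomization g \<gamma> f \<omega>))"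
    proof -
      have "AE \<omega> in M. Lp_norm q lborel (\<lambda>t. Lp_norm p lborel (\<lambda>x. \<Sum>j. F j \<omega> t x)) \<noteq> \<top>"
      proof (rule Lp_norm_finite_AE)
        show "Lp_norm r M (\<lambda>\<omega>. Lp_norm q lborel (\<lambda>t. Lp_norm p lborel (\<lambda>x. \<Sum>j. F j \<omega> t x))) \<noteq> \<top>"
          using L_norm by (rule neq_top_trans[rotated]) simp
      qed (use r mixed_norm_measurable(3)[OF Lm] in auto)
      then show ?thesis using gaussian_growth[OF g] AE_space
      proof eventually_elim
        case (elim \<omega>)
        then obtain G where G: "\<And>k. \<bar>g k \<omega>\<bar> \<le> G * (1 + real k)" by blast
        have "AE t in lborel. Lp_norm p lborel (\<lambda>x. \<Sum>j. F j \<omega> t x) \<noteq> \<top>"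
          by (rule Lp_norm_finite_AE[OF elim(1) _ mixed_norm_measurable(2)[OF Lm elim(3)]]) (use q in simp)
        then show ?case
        proof eventually_elim
          case (elim t)
          show ?case unfolding U_def[abs_def]
          proof (rule represents_series[OF Dx _ \<alpha>p])
            show "1 < p" using p by simp
            show "Lp_norm p lborel (\<lambda>x. \<Sum>j. ennreal (norm x powr \<alpha> * cmod (D j \<omega> t x))) \<noteq> \<top>"
              using elim by (simp add: F_def w_def)
            fix \<phi> :: "real^'n \<Rightarrow> complex" assume \<phi>: "\<phi> \<in> schwartz"
            have ui: "integrable lborel (\<lambda>x. u k t x * \<phi> x)" for k
              unfolding u_def by (rule wave_block_pairing(1)[OF block_integrable[OF \<gamma> v(2,3)] \<phi>])
            have De: "D j \<omega> t x * \<phi> x = (\<Sum>k\<in>{N j..<N (Suc j)}. complex_of_real (g k \<omega>) * (u k t x * \<phi> x))" for j x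
              by (simp add: D_def sum_distrib_right mult.assoc)
            show "integrable lborel (\<lambda>x. D j \<omega> t x * \<phi> x)" for j
              unfolding De by (intro Bochner_Integration.integrable_sum integrable_mult_right ui)
            have "(LINT x|lborel. D j \<omega> t x * \<phi> x) = (\<Sum>k\<in>{N j..<N (Suc j)}. complex_of_real (g k \<omega>) * (LINT x|lborel. u k t x * \<phi> x))" for j
              unfolding De by (subst Bochner_Integration.integral_sum) (auto intro!: integrable_mult_right ui)
            then have "(\<Sum>j<J. LINT x|lborel. D j \<omega> t x * \<phi> x) = (\<Sum>k<N J. complex_of_real (g k \<omega>) * (LINT x|lborel. u k t x * \<phi> x))" for J
              by (simp add: sum_consecutive_blocks[OF N(1,2)])
            moreover have "(\<lambda>n. \<Sum>k<n. complex_of_real (g k \<omega>) * (LINT x|lborel. u k t x * \<phi> x)) \<longlonglongrightarrow> half_wave \<epsilon> t (radial_randomization g \<gamma> f \<omega>) \<phi>"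
              using half_wave_sums[where g=g and \<omega>=\<omega>, OF \<gamma> f G \<phi>] unfolding sums_def u_def v_def .
            \<comment> \<open>Sums over groups are partial sums of the randomized series along
              \<open>N\<close>, and those converge to the distribution.\<close>
            ultimately show "(\<lambda>J. \<Sum>j<J. LINT x|lborel. D j \<omega> t x * \<phi> x) \<longlonglongrightarrow> half_wave \<epsilon> t (radial_randomization g \<gamma> f \<omega>) \<phi>"
              using LIMSEQ_subseq_LIMSEQ[OF _ N(2)] by (simp add: comp_def)
          qed
        qed
      qed
    qed
    have "weighted_mixed_norm M \<sigma> q p \<alpha> (\<lambda>\<omega> t. half_wave \<epsilon> t (radial_randomization g \<gamma> f \<omega>))
      \<le> Lp_norm \<sigma> M (\<lambda>\<omega>. Lp_norm q lborel (\<lambda>t. Lp_norm p lborel (\<lambda>x. ennreal (norm x powr \<alpha> * cmod (U \<omega> t x)))))"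
      unfolding weighted_mixed_norm_def by (rule Inf_lower) (use Um rep in blast)
    also have "\<dots> \<le> Lp_norm \<sigma> M (\<lambda>\<omega>. Lp_norm q lborel (\<lambda>t. Lp_norm p lborel (\<lambda>x. \<Sum>j. F j \<omega> t x)))"
    proof -
      have "ennreal (norm x powr \<alpha> * cmod (U \<omega> t x)) \<le> (\<Sum>j. F j \<omega> t x)" for \<omega> t x
      proof -
        have "ennreal (w x) * ennreal (cmod (U \<omega> t x)) \<le> ennreal (w x) * (\<Sum>j. ennreal (cmod (D j \<omega> t x)))"
          unfolding U_def by (intro mult_left_mono ennreal_norm_suminf_le) simp
        then show ?thesis by (simp add: F_def ennreal_mult w0 w_def[symmetric])
      qed
      then show ?thesis using p q \<sigma> by (intro Lp_norm_mono) auto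
    qed
    \<comment> \<open>On a probability space the exponent may be raised from \<open>\<sigma>\<close>
      to \<open>r\<close>, where Khintchine and Minkowski are available.\<close>
    also have "\<dots> \<le> Lp_norm r M (\<lambda>\<omega>. Lp_norm q lborel (\<lambda>t. Lp_norm p lborel (\<lambda>x. \<Sum>j. F j \<omega> t x)))"
      by (rule Lp_norm_mono_exponent[OF prob_space_axioms mixed_norm_measurable(3)[OF Lm]]) (use \<sigma> r in auto)
    also have "\<dots> \<le> ennreal (2 * E)" by (rule L_norm)
    also have "\<dots> \<le> ennreal (C1 * sqrt \<sigma> * sobolev_norm s f)" by (rule ennreal_leI[OF E_le])
    finally show "weighted_mixed_norm M \<sigma> q p \<alpha> (\<lambda>\<omega> t. half_wave \<epsilon> t (radial_randomization g \<gamma> f \<omega>)) \<le> ennreal (C1 * sqrt \<sigma> * sobolev_norm s f)" .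
  qed
qed

end
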